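(* Suppose $\bar\Lambda$ is the skew-gentle algebra associated with a gentle algebra $\Lambda$. Then their Krull–Gabriel dimensions are equal: $\mathrm{KG}(\bar\Lambda)=\mathrm{KG}(\Lambda)$.
   Context: $K$ is an algebraically closed field with $\mathrm{char}\,K\neq2$; all algebras are finite-dimensional; modules are finitely generated right modules. Gentle algebras. For a finite quiver $Q$ and an ideal $I$ of $KQ$ generated by paths of length two, $KQ/I$ is gentle if it is finite-dimensional, at every vertex at most two arrows start and at most two arrows end, and for every arrow $\alpha$ there is at most one arrow $\beta$ with $\alpha\beta$ a path not in $I$, at most one arrow $\gamma$ with $\gamma\alpha$ a path not in $I$, at most one arrow $\beta'$ with $\alpha\beta'$ a path in $I$, and at most one arrow $\gamma'$ with $\gamma'\alpha$ a path in $I$. Skew-gentle algebras. Let $Q$ be a finite quiver, $I$ a set of paths of length two, and $Sp\subseteq Q_0$ a set of special vertices. Let $Q'$ be obtained from $Q$ by adding a loop $\varepsilon_i$ at each $i\in Sp$, and suppose $KQ'/\langle I\cup\{\varepsilon_i^2: i\in Sp\}\rangle$ is gentle. The skew-gentle algebra of $(Q,I,Sp)$ is $\bar\Lambda=KQ'/\langle I\cup\{\varepsilon_i^2-\varepsilon_i: i\in Sp\}\rangle$ (considered up to Morita equivalence). Associated gentle algebra. The gentle algebra $\Lambda$ associated with $(Q,I,Sp)$ has quiver with one vertex $i$ for each $i\in Sp$, two vertices $i^+,i^-$ for each $i\in Q_0\setminus Sp$, and two arrows $\alpha^+,\alpha^-$ for each arrow $\alpha$ of $Q$, where $\alpha^\pm$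 goes from $s(\alpha)^\pm$ to $t(\alpha)^\pm$ (with $i^\pm:=i$ if $i\in Sp$); its relations are $\alpha^+\beta^+=0$ and $\alpha^-\beta^-=0$ for every $\alpha\beta\in I$, together with no other relations. The group $\mathbb{Z}_2$ acts on $\Lambda$ by exchanging the signs $+$ and $-$, and the skew group algebra $\Lambda\mathbb{Z}_2$ (the space $\Lambda\otimes_K K\mathbb{Z}_2$ with product $(\lambda\otimes g)(\mu\otimes h)=\lambda\, g(\mu)\otimes gh$) is Morita equivalent to $\bar\Lambda$. Krull–Gabriel dimension. $\mathcal{F}(\Lambda)$ is the abelian category of finitely presented contravariant $K$-linear functors from $\mathrm{mod}\text{-}\Lambda$ to finite-dimensional $K$-vector spaces. Put $\mathcal{F}(\Lambda)_{-1}=0$; let $\mathcal{F}(\Lambda)_{\alpha+1}$ be the Serre subcategory of functors having finite length in $\mathcal{F}(\Lambda)/\mathcal{F}(\Lambda)_\alpha$; and $\mathcal{F}(\Lambda)_\beta=\bigcup_{\alpha<\beta}\mathcal{F}(\Lambda)_\alpha$ for limit ordinals $\beta$. $\mathrm{KG}(\Lambda)$ is the smallest ordinal $\alpha$ with $\mathcal{F}(\Lambda)_\alpha=\mathcal{F}(\Lambda)$, and $\infty$ if none exists. *)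

theory Defs
  imports
    "HOL-Algebra.QuotRing"
    "HOL-Algebra.Module"
    "HOL-Computational_Algebra.Polynomial"
    "HOL-Library.Poly_Mapping"
    "HOL-Library.Extended"
    "Graph_Theory.Arc_Walk"
begin

section \<open>Ordinals\<close>

text \<open>The ordinals of cardinality at most \<open>|'w|\<close>: isomorphism types of well-orders on subsets
  of \<^typ>\<open>'w\<close>.\<close>

quotient_type 'w ordinal = "'w rel" / partial: "\<lambda>r s. (r, s) \<in> ordIso"
proof (rule part_equivpI)
  have "({} :: 'w rel, {} :: 'w rel) \<in> ordIso"
    by (rule ordIso_reflexive)
      (simp add: well_order_on_def linear_order_on_def partial_order_on_def preorder_on_def
        refl_on_def trans_def antisym_def total_on_def)
  then show "\<exists>r :: 'w rel. (r, r) \<in> ordIso" by blast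
  show "symp (\<lambda>r s :: 'w rel. (r, s) \<in> ordIso)"
    by (rule sympI) (rule ordIso_symmetric)
  show "transp (\<lambda>r s :: 'w rel. (r, s) \<in> ordIso)"
    by (rule transpI) (rule ordIso_transitive)
qed

instantiation ordinal :: (type) linorder
begin

lift_definition less_eq_ordinal :: "'a ordinal \<Rightarrow> 'a ordinal \<Rightarrow> bool"
  is "\<lambda>r s. (r, s) \<in> ordLeq"
  by (meson ordIso_ordLeq_trans ordIso_symmetric ordLeq_ordIso_trans)

lift_definition less_ordinal :: "'a ordinal \<Rightarrow> 'a ordinal \<Rightarrow> bool"
  is "\<lambda>r s. (r, s) \<in> ordLess"
  by (meson ordIso_ordLess_trans ordIso_symmetric ordLess_ordIso_trans)

instance
proof
  fix x y z :: "'a ordinal"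
  have wo: "Well_order r" if "(r, r) \<in> ordIso" for r :: "'a rel"
    using that by (simp add: ordIso_def)
  show "x < y \<longleftrightarrow> x \<le> y \<and> \<not> y \<le> x"
    by transfer (metis wo not_ordLeq_iff_ordLess ordLess_imp_ordLeq)
  show "x \<le> x"
    by transfer (metis wo ordLeq_reflexive)
  show "x \<le> z" if "x \<le> y" "y \<le> z" using that
    by transfer (rule ordLeq_transitive)
  show "x = y" if "x \<le> y" "y \<le> x" using that
    by transfer (simp add: ordIso_iff_ordLeq)
  show "x \<le> y \<or> y \<le> x"
    by transfer (metis wo ordLeq_total)
qed

end

instance ordinal :: (type) wellorder
proof (rule wf_wellorderI)
  have "(rep_ordinal x, rep_ordinal y) \<in> ordLess" if "x < y" for x y :: "'a ordinal"
    using that by (simp add: less_ordinal_def)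
  then have "{(x, y :: 'a ordinal). x < y} \<subseteq> inv_image ordLess rep_ordinal"
    by auto
  then show "wf {(x, y :: 'a ordinal). x < y}"
    using wf_inv_image[OF wf_ordLess] wf_subset by blast
qed intro_classes


section \<open>Categories\<close>

text \<open>Hom-sets need not be disjoint, so composition receives the three objects involved:
  for \<open>f : X \<rightarrow> Y\<close> and \<open>g : Y \<rightarrow> Z\<close>, the composite \<open>g \<circ> f\<close> is \<open>Comp C X Y Z g f\<close>.\<close>

record ('o, 'm) category =
  Ob :: "'o set"
  Hom :: "'o \<Rightarrow> 'o \<Rightarrow> 'm set"
  Comp :: "'o \<Rightarrow> 'o \<Rightarrow> 'o \<Rightarrow> 'm \<Rightarrow> 'm \<Rightarrow> 'm"
  Id :: "'o \<Rightarrow> 'm"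

definition zero_object :: "('o, 'm) category \<Rightarrow> 'o \<Rightarrow> bool" where
  "zero_object C Z \<longleftrightarrow> Z \<in> Ob C \<and>
     (\<forall>X\<in>Ob C. (\<exists>!f. f \<in> Hom C Z X) \<and> (\<exists>!f. f \<in> Hom C X Z))"

definition zero_morphism :: "('o, 'm) category \<Rightarrow> 'o \<Rightarrow> 'o \<Rightarrow> 'm \<Rightarrow> bool" where
  "zero_morphism C X Y f \<longleftrightarrow>
     (\<exists>Z g h. zero_object C Z \<and> g \<in> Hom C X Z \<and> h \<in> Hom C Z Y \<and> f = Comp C X Z Y h g)"

definition monomorphism :: "('o, 'm) category \<Rightarrow> 'o \<Rightarrow> 'o \<Rightarrow> 'm \<Rightarrow> bool" where
  "monomorphism C X Y f \<longleftrightarrow> f \<in> Hom C X Y \<and>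
     (\<forall>T\<in>Ob C. \<forall>g\<in>Hom C T X. \<forall>h\<in>Hom C T X. Comp C T X Y f g = Comp C T X Y f h \<longrightarrow> g = h)"

definition isomorphism :: "('o, 'm) category \<Rightarrow> 'o \<Rightarrow> 'o \<Rightarrow> 'm \<Rightarrow> bool" where
  "isomorphism C X Y f \<longleftrightarrow> f \<in> Hom C X Y \<and>
     (\<exists>g\<in>Hom C Y X. Comp C X Y X g f = Id C X \<and> Comp C Y X Y f g = Id C Y)"

definition is_kernel :: "('o, 'm) category \<Rightarrow> 'o \<Rightarrow> 'o \<Rightarrow> 'm \<Rightarrow> 'o \<Rightarrow> 'm \<Rightarrow> bool" where
  "is_kernel C X Y f N k \<longleftrightarrow> N \<in> Ob C \<and> k \<in> Hom C N X \<and>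
     zero_morphism C N Y (Comp C N X Y f k) \<and>
     (\<forall>T\<in>Ob C. \<forall>t\<in>Hom C T X. zero_morphism C T Y (Comp C T X Y f t) \<longrightarrow>
        (\<exists>!u. u \<in> Hom C T N \<and> Comp C T N X k u = t))"

definition is_cokernel :: "('o, 'm) category \<Rightarrow> 'o \<Rightarrow> 'o \<Rightarrow> 'm \<Rightarrow> 'o \<Rightarrow> 'm \<Rightarrow> bool" where
  "is_cokernel C X Y f N c \<longleftrightarrow> N \<in> Ob C \<and> c \<in> Hom C Y N \<and>
     zero_morphism C X N (Comp C X Y N c f) \<and>
     (\<forall>T\<in>Ob C. \<forall>t\<in>Hom C Y T. zero_morphism C X T (Comp C X Y T t f) \<longrightarrow>
        (\<exists>!u. u \<in> Hom C N T \<and> Comp C Y N T u c = t))"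

definition simple_object :: "('o, 'm) category \<Rightarrow> 'o \<Rightarrow> bool" where
  "simple_object C X \<longleftrightarrow> X \<in> Ob C \<and> \<not> zero_object C X \<and>
     (\<forall>Y\<in>Ob C. \<forall>m. monomorphism C Y X m \<longrightarrow> zero_object C Y \<or> isomorphism C Y X m)"

text \<open>Existence of a composition series \<open>0 = X\<^sub>0 \<hookrightarrow> \<dots> \<hookrightarrow> X\<^sub>n = X\<close> with simple quotients.\<close>

inductive finite_length :: "('o, 'm) category \<Rightarrow> 'o \<Rightarrow> bool" for C where
  zero: "zero_object C X \<Longrightarrow> finite_length C X"
| step: "finite_length C Y \<Longrightarrow> X \<in> Ob C \<Longrightarrow> monomorphism C Y X m \<Longrightarrow>
    is_cokernel C Y X m S c \<Longrightarrow> simple_object C S \<Longrightarrow> finite_length C X"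


section \<open>Serre quotients\<close>

text \<open>For a Serre subcategory (given by its set of objects \<open>S\<close>) of an abelian category \<open>C\<close>, the
  quotient \<open>C/S\<close> is the localisation of \<open>C\<close> at the morphisms whose kernel and cokernel lie
  in \<open>S\<close>. These admit a calculus of right fractions: a morphism \<open>X \<rightarrow> Y\<close> of \<open>C/S\<close> is an
  equivalence class of roofs \<open>(Z, s, f)\<close>, that is \<open>X \<leftarrow>s\<midarrow> Z \<midarrow>f\<rightarrow> Y\<close>, standing for
  \<open>f \<circ> s\<^sup>-\<^sup>1\<close>.\<close>

definition serre_iso :: "('o, 'm) category \<Rightarrow> 'o set \<Rightarrow> 'o \<Rightarrow> 'o \<Rightarrow> 'm \<Rightarrow> bool" where
  "serre_iso C S X Y s \<longleftrightarrow> s \<in> Hom C X Y \<and>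
     (\<exists>N k. is_kernel C X Y s N k \<and> N \<in> S) \<and> (\<exists>N c. is_cokernel C X Y s N c \<and> N \<in> S)"

definition roofs :: "('o, 'm) category \<Rightarrow> 'o set \<Rightarrow> 'o \<Rightarrow> 'o \<Rightarrow> ('o \<times> 'm \<times> 'm) set" where
  "roofs C S X Y = {(Z, s, f). Z \<in> Ob C \<and> serre_iso C S Z X s \<and> f \<in> Hom C Z Y}"

definition roof_rel ::
  "('o, 'm) category \<Rightarrow> 'o set \<Rightarrow> 'o \<Rightarrow> 'o \<Rightarrow> (('o \<times> 'm \<times> 'm) \<times> ('o \<times> 'm \<times> 'm)) set" where
  "roof_rel C S X Y = {((Z, s, f), (Z', s', f')).
     (Z, s, f) \<in> roofs C S X Y \<and> (Z', s', f') \<in> roofs C S X Y \<and>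
     (\<exists>W\<in>Ob C. \<exists>u\<in>Hom C W Z. \<exists>v\<in>Hom C W Z'.
        serre_iso C S W X (Comp C W Z X s u) \<and>
        Comp C W Z X s u = Comp C W Z' X s' v \<and>
        Comp C W Z Y f u = Comp C W Z' Y f' v)}"

text \<open>\<open>(W, t, g) \<circ> (Z, s, f)\<close> is represented by \<open>(V, s \<circ> t', g \<circ> f')\<close> for any commutative
  square \<open>f \<circ> t' = t \<circ> f'\<close> with \<open>t' : V \<rightarrow> Z\<close> again among the inverted morphisms.\<close>

definition serre_quotient ::
  "('o, 'm) category \<Rightarrow> 'o set \<Rightarrow> ('o, ('o \<times> 'm \<times> 'm) set) category" where
  "serre_quotient C S = \<lparr>
     Ob = Ob C,
     Hom = (\<lambda>X Y. roofs C S X Y // roof_rel C S X Y),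
     Comp = (\<lambda>X Y T d c. \<Union>{roof_rel C S X T `` {(V, Comp C V Z X s t', Comp C V W T g f')}
       | V Z s f W t g t' f'.
         (Z, s, f) \<in> c \<and> (W, t, g) \<in> d \<and> V \<in> Ob C \<and> serre_iso C S V Z t' \<and>
         f' \<in> Hom C V W \<and> Comp C V Z Y f t' = Comp C V W Y t f'}),
     Id = (\<lambda>X. roof_rel C S X X `` {(X, Id C X, Id C X)})\<rparr>"


section \<open>Krull--Gabriel filtration\<close>

text \<open>The indices range over a well-ordered type; \<open>\<alpha>\<close> is the successor of \<open>\<beta>\<close> iff \<open>\<beta>\<close> is the
  greatest element below \<open>\<alpha>\<close>. The bottom index \<open>0\<close> is the successor of the index \<open>-1\<close>,
  whose term is the class of zero objects.\<close>

definition is_pred :: "'i::wellorder \<Rightarrow> 'i \<Rightarrow> bool" where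
  "is_pred \<beta> \<alpha> \<longleftrightarrow> \<beta> < \<alpha> \<and> (\<forall>\<gamma><\<alpha>. \<gamma> \<le> \<beta>)"

definition finite_length_mod :: "('o, 'm) category \<Rightarrow> 'o set \<Rightarrow> 'o set" where
  "finite_length_mod C S = {X \<in> Ob C. finite_length (serre_quotient C S) X}"

function KG_filtration :: "('o, 'm) category \<Rightarrow> 'i::wellorder \<Rightarrow> 'o set" where
  "KG_filtration C \<alpha> =
    (if \<forall>\<beta>. \<alpha> \<le> \<beta> then finite_length_mod C {X. zero_object C X}
     else if \<exists>\<beta>. is_pred \<beta> \<alpha> then finite_length_mod C (KG_filtration C (THE \<beta>. is_pred \<beta> \<alpha>))
     else (\<Union>\<beta>\<in>{\<beta>. \<beta> < \<alpha>}. KG_filtration C \<beta>))"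
  by pat_completeness auto
termination
proof (relation "inv_image {(x, y). x < y} snd")
  show "wf (inv_image {(x, y :: 'i::wellorder). x < y} (snd :: ('o, 'm) category \<times> 'i \<Rightarrow> 'i))"
    by (intro wf_inv_image wf)
next
  fix C :: "('o, 'm) category" and \<alpha> :: "'i::wellorder"
  assume "\<exists>\<beta>. is_pred \<beta> \<alpha>"
  then obtain \<beta> where "is_pred \<beta> \<alpha>" by blast
  moreover from this have "(THE \<beta>. is_pred \<beta> \<alpha>) = \<beta>"
    by (intro the_equality) (auto simp: is_pred_def intro: antisym)
  ultimately show "((C, THE \<beta>. is_pred \<beta> \<alpha>), C, \<alpha>) \<in> inv_image {(x, y). x < y} snd"
    by (simp add: is_pred_def)
qed simp

declare KG_filtration.simps [simp del]

definition KG_dim_category :: "('o, 'm) category \<Rightarrow> 'i::wellorder extended" where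
  "KG_dim_category C =
    (if \<exists>\<alpha>::'i. KG_filtration C \<alpha> = Ob C then Fin (LEAST \<alpha>. KG_filtration C \<alpha> = Ob C) else Pinf)"


section \<open>Finite-dimensional vector spaces, algebras and modules\<close>

definition scale :: "'k::field \<Rightarrow> ('x \<Rightarrow>\<^sub>0 'k) \<Rightarrow> ('x \<Rightarrow>\<^sub>0 'k)" where
  "scale c = Poly_Mapping.map ((*) c)"

lemma lookup_scale [simp]: "Poly_Mapping.lookup (scale c x) i = c * Poly_Mapping.lookup x i"
  by (simp add: scale_def Poly_Mapping.map.rep_eq when_def)

text \<open>Vector spaces and modules are taken with underlying space a subspace of the
  countably-dimensional space \<open>nat \<Rightarrow>\<^sub>0 'k\<close>. Every finite-dimensional vector space or module
  is isomorphic to such a one, so the categories below are small and equivalent to the categories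
  of all finite-dimensional vector spaces and modules.\<close>

type_synonym 'k vec = "nat \<Rightarrow>\<^sub>0 'k"

global_interpretation kvs: vector_space "scale :: 'k::field \<Rightarrow> 'k vec \<Rightarrow> 'k vec"
  by unfold_locales
    (auto intro!: poly_mapping_eqI simp: lookup_add algebra_simps)

definition fd_space :: "'k::field vec set \<Rightarrow> bool" where
  "fd_space U \<longleftrightarrow> (\<exists>B. finite B \<and> U = kvs.span B)"

definition linear_maps :: "'k::field vec set \<Rightarrow> 'k vec set \<Rightarrow> ('k vec \<Rightarrow> 'k vec) set" where
  "linear_maps U W = {f \<in> U \<rightarrow>\<^sub>E W.
     (\<forall>x\<in>U. \<forall>y\<in>U. f (x + y) = f x + f y) \<and> (\<forall>c. \<forall>x\<in>U. f (scale c x) = scale c (f x))}"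

text \<open>A \<open>K\<close>-algebra is a ring together with scalars acting through \<open>smult\<close>, represented by the
  record \<^typ>\<open>('k, 'a) module\<close>.\<close>

definition fd_algebra :: "('k::field, 'a) module \<Rightarrow> bool" where
  "fd_algebra A \<longleftrightarrow> (\<exists>B. finite B \<and> B \<subseteq> carrier A \<and>
     carrier A = {\<Oplus>\<^bsub>A\<^esub>b\<in>B. c b \<odot>\<^bsub>A\<^esub> b | c. True})"

text \<open>A module is a pair of its underlying space and the right action \<open>u \<mapsto> u \<cdot> a\<close>.\<close>

type_synonym ('k, 'a) rmod = "'k vec set \<times> ('k vec \<Rightarrow> 'a \<Rightarrow> 'k vec)"

definition right_module :: "('k::field, 'a) module \<Rightarrow> ('k, 'a) rmod \<Rightarrow> bool" where
  "right_module A = (\<lambda>(U, act).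
     kvs.subspace U \<and>
     (\<forall>u\<in>U. \<forall>a\<in>carrier A. act u a \<in> U) \<and>
     (\<forall>u\<in>U. \<forall>v\<in>U. \<forall>a\<in>carrier A. act (u + v) a = act u a + act v a) \<and>
     (\<forall>u\<in>U. \<forall>a\<in>carrier A. \<forall>b\<in>carrier A. act u (a \<oplus>\<^bsub>A\<^esub> b) = act u a + act u b) \<and>
     (\<forall>u\<in>U. \<forall>a\<in>carrier A. \<forall>b\<in>carrier A. act u (a \<otimes>\<^bsub>A\<^esub> b) = act (act u a) b) \<and>
     (\<forall>u\<in>U. act u \<one>\<^bsub>A\<^esub> = u) \<and>
     (\<forall>u\<in>U. \<forall>a\<in>carrier A. \<forall>c. act (scale c u) a = scale c (act u a) \<and>
        act u (c \<odot>\<^bsub>A\<^esub> a) = scale c (act u a)))"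

definition fin_gen :: "('k::field, 'a) module \<Rightarrow> ('k, 'a) rmod \<Rightarrow> bool" where
  "fin_gen A = (\<lambda>(U, act). \<exists>B. finite B \<and> B \<subseteq> U \<and>
     (\<forall>u\<in>U. \<exists>a. (\<forall>b\<in>B. a b \<in> carrier A) \<and> u = (\<Sum>b\<in>B. act b (a b))))"

definition mod_cat :: "('k::field, 'a) module \<Rightarrow> (('k, 'a) rmod, 'k vec \<Rightarrow> 'k vec) category" where
  "mod_cat A = \<lparr>
     Ob = {M. right_module A M \<and> fin_gen A M},
     Hom = (\<lambda>(U, act) (W, act').
       {f \<in> linear_maps U W. \<forall>u\<in>U. \<forall>a\<in>carrier A. f (act u a) = act' (f u) a}),
     Comp = (\<lambda>X Y Z g f. compose (fst X) g f),
     Id = (\<lambda>X. \<lambda>u\<in>fst X. u)\<rparr>"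


section \<open>Finitely presented functors\<close>

record (overloaded) ('k, 'a) mod_functor =
  Fob :: "('k, 'a) rmod \<Rightarrow> 'k vec set"
  Fmap :: "('k, 'a) rmod \<Rightarrow> ('k, 'a) rmod \<Rightarrow> ('k vec \<Rightarrow> 'k vec) \<Rightarrow> 'k vec \<Rightarrow> 'k vec"

text \<open>For \<open>f : M \<rightarrow> N\<close>, the induced map is \<open>Fmap F M N f : F N \<rightarrow> F M\<close>.\<close>

definition linear_functor :: "('k::field, 'a) module \<Rightarrow> ('k, 'a) mod_functor \<Rightarrow> bool" where
  "linear_functor A F \<longleftrightarrow>
     (\<forall>M\<in>Ob (mod_cat A). fd_space (Fob F M)) \<and>
     (\<forall>M\<in>Ob (mod_cat A). \<forall>N\<in>Ob (mod_cat A). \<forall>f\<in>Hom (mod_cat A) M N.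
        Fmap F M N f \<in> linear_maps (Fob F N) (Fob F M)) \<and>
     (\<forall>M\<in>Ob (mod_cat A). Fmap F M M (Id (mod_cat A) M) = (\<lambda>x\<in>Fob F M. x)) \<and>
     (\<forall>L\<in>Ob (mod_cat A). \<forall>M\<in>Ob (mod_cat A). \<forall>N\<in>Ob (mod_cat A).
        \<forall>f\<in>Hom (mod_cat A) L M. \<forall>g\<in>Hom (mod_cat A) M N.
        Fmap F L N (Comp (mod_cat A) L M N g f) = compose (Fob F N) (Fmap F L M f) (Fmap F M N g)) \<and>
     (\<forall>M\<in>Ob (mod_cat A). \<forall>N\<in>Ob (mod_cat A). \<forall>f\<in>Hom (mod_cat A) M N. \<forall>x\<in>Fob F N.
        (\<forall>g\<in>Hom (mod_cat A) M N.
           Fmap F M N (\<lambda>u\<in>fst M. f u + g u) x = Fmap F M N f x + Fmap F M N g x) \<and>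
        (\<forall>c. Fmap F M N (\<lambda>u\<in>fst M. scale c (f u)) x = scale c (Fmap F M N f x)))"

text \<open>There are \<open>f : M \<rightarrow> N\<close> and a natural transformation \<open>\<pi> : Hom(-, N) \<rightarrow> F\<close> such that
  \<open>Hom(-, M) \<rightarrow> Hom(-, N) \<rightarrow> F \<rightarrow> 0\<close> is exact.\<close>

definition fin_presented :: "('k::field, 'a) module \<Rightarrow> ('k, 'a) mod_functor \<Rightarrow> bool" where
  "fin_presented A F \<longleftrightarrow>
     (\<exists>M\<in>Ob (mod_cat A). \<exists>N\<in>Ob (mod_cat A). \<exists>f\<in>Hom (mod_cat A) M N. \<exists>\<pi>.
        (\<forall>X\<in>Ob (mod_cat A). \<forall>g\<in>Hom (mod_cat A) X N. \<forall>h\<in>Hom (mod_cat A) X N.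
           \<pi> X (\<lambda>u\<in>fst X. g u + h u) = \<pi> X g + \<pi> X h) \<and>
        (\<forall>X\<in>Ob (mod_cat A). \<forall>g\<in>Hom (mod_cat A) X N. \<forall>c.
           \<pi> X (\<lambda>u\<in>fst X. scale c (g u)) = scale c (\<pi> X g)) \<and>
        (\<forall>X\<in>Ob (mod_cat A). \<forall>Y\<in>Ob (mod_cat A). \<forall>h\<in>Hom (mod_cat A) X Y. \<forall>g\<in>Hom (mod_cat A) Y N.
           \<pi> X (Comp (mod_cat A) X Y N g h) = Fmap F X Y h (\<pi> Y g)) \<and>
        (\<forall>X\<in>Ob (mod_cat A). \<pi> X ` Hom (mod_cat A) X N = Fob F X) \<and>
        (\<forall>X\<in>Ob (mod_cat A). {g \<in> Hom (mod_cat A) X N. \<pi> X g = 0} =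
           (\<lambda>h. Comp (mod_cat A) X M N f h) ` Hom (mod_cat A) X M))"

text \<open>The category \<open>\<F>(A)\<close>; morphisms are natural transformations.\<close>

definition fp_functor_cat :: "('k::field, 'a) module \<Rightarrow>
    (('k, 'a) mod_functor, ('k, 'a) rmod \<Rightarrow> 'k vec \<Rightarrow> 'k vec) category" where
  "fp_functor_cat A = \<lparr>
     Ob = {F. linear_functor A F \<and> fin_presented A F},
     Hom = (\<lambda>F G. {\<eta> \<in> (\<Pi>\<^sub>E M\<in>Ob (mod_cat A). linear_maps (Fob F M) (Fob G M)).
       \<forall>M\<in>Ob (mod_cat A). \<forall>N\<in>Ob (mod_cat A). \<forall>f\<in>Hom (mod_cat A) M N. \<forall>x\<in>Fob F N.
         \<eta> M (Fmap F M N f x) = Fmap G M N f (\<eta> N x)}),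
     Comp = (\<lambda>F G H \<theta> \<eta>. \<lambda>M\<in>Ob (mod_cat A). compose (Fob F M) (\<theta> M) (\<eta> M)),
     Id = (\<lambda>F. \<lambda>M\<in>Ob (mod_cat A). \<lambda>x\<in>Fob F M. x)\<rparr>"

text \<open>The type \<^typ>\<open>'w\<close> only bounds the ordinals available as values. Since \<open>\<F>(A)\<close> has at most
  \<open>|K|\<close> isomorphism classes when \<open>A\<close> is finite-dimensional over the infinite field \<open>K\<close>,
  and the filtration is strictly increasing until it stabilises, the choice \<open>'w = 'k\<close> (or any larger
  type) yields the Krull--Gabriel dimension without truncation.\<close>

definition KG :: "('k::field, 'a) module \<Rightarrow> 'w ordinal extended" where
  "KG A = KG_dim_category (fp_functor_cat A)"


section \<open>Path algebras and their quotients\<close>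

text \<open>A quiver is a \<^const>\<open>fin_digraph\<close>. A path is a pair of its starting vertex and its list of
  arrows; the product \<open>p q\<close> means first \<open>p\<close>, then \<open>q\<close>.\<close>

definition quiver_paths :: "('v, 'a) pre_digraph \<Rightarrow> ('v \<times> 'a list) set" where
  "quiver_paths Q = {(v, p). \<exists>w. pre_digraph.awalk Q v p w}"

definition path_algebra :: "('v, 'a) pre_digraph \<Rightarrow> ('k::field, 'v \<times> 'a list \<Rightarrow>\<^sub>0 'k) module" where
  "path_algebra Q = \<lparr>
     carrier = {x. Poly_Mapping.keys x \<subseteq> quiver_paths Q},
     monoid.mult = (\<lambda>x y. \<Sum>(v, p)\<in>Poly_Mapping.keys x. \<Sum>(w, q)\<in>Poly_Mapping.keys y.
       if last (pre_digraph.awalk_verts Q v p) = w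
       then Poly_Mapping.single (v, p @ q) (Poly_Mapping.lookup x (v, p) * Poly_Mapping.lookup y (w, q))
       else 0),
     one = (\<Sum>v\<in>verts Q. Poly_Mapping.single (v, []) 1),
     zero = 0,
     add = (+),
     module.smult = scale\<rparr>"

definition quotient_algebra :: "('k::field, 'a) module \<Rightarrow> 'a set \<Rightarrow> ('k, 'a set) module" where
  "quotient_algebra A J = \<lparr>
     carrier = carrier (A Quot J),
     monoid.mult = (\<lambda>X Y. X \<otimes>\<^bsub>A Quot J\<^esub> Y),
     one = \<one>\<^bsub>A Quot J\<^esub>,
     zero = \<zero>\<^bsub>A Quot J\<^esub>,
     add = (\<lambda>X Y. X \<oplus>\<^bsub>A Quot J\<^esub> Y),
     module.smult = (\<lambda>c X. \<Union>x\<in>X. J +>\<^bsub>A\<^esub> (c \<odot>\<^bsub>A\<^esub> x))\<rparr>"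

definition paths2 :: "('v, 'a) pre_digraph \<Rightarrow> ('a \<times> 'a) set" where
  "paths2 Q = {(a, b). a \<in> arcs Q \<and> b \<in> arcs Q \<and> head Q a = tail Q b}"

definition path2_elem :: "('v, 'a) pre_digraph \<Rightarrow> 'a \<times> 'a \<Rightarrow> ('v \<times> 'a list \<Rightarrow>\<^sub>0 'k::field)" where
  "path2_elem Q = (\<lambda>(a, b). Poly_Mapping.single (tail Q a, [a, b]) 1)"

definition arrow_elem :: "('v, 'a) pre_digraph \<Rightarrow> 'a \<Rightarrow> ('v \<times> 'a list \<Rightarrow>\<^sub>0 'k::field)" where
  "arrow_elem Q a = Poly_Mapping.single (tail Q a, [a]) 1"


section \<open>Gentle and skew-gentle algebras\<close>

definition gentle :: "('v, 'a) pre_digraph \<Rightarrow> ('v \<times> 'a list \<Rightarrow>\<^sub>0 'k::field) set \<Rightarrow> bool" where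
  "gentle Q J \<longleftrightarrow>
     fin_digraph Q \<and>
     (\<exists>R\<subseteq>paths2 Q. J = genideal (path_algebra Q) (path2_elem Q ` R)) \<and>
     fd_algebra (quotient_algebra (path_algebra Q) J) \<and>
     (\<forall>v\<in>verts Q. card {a \<in> arcs Q. tail Q a = v} \<le> 2 \<and> card {a \<in> arcs Q. head Q a = v} \<le> 2) \<and>
     (\<forall>a\<in>arcs Q.
        (\<exists>\<^sub>\<le>\<^sub>1 b. (a, b) \<in> paths2 Q \<and> path2_elem Q (a, b) \<notin> J) \<and>
        (\<exists>\<^sub>\<le>\<^sub>1 c. (c, a) \<in> paths2 Q \<and> path2_elem Q (c, a) \<notin> J) \<and>
        (\<exists>\<^sub>\<le>\<^sub>1 b. (a, b) \<in> paths2 Q \<and> path2_elem Q (a, b) \<in> J) \<and>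
        (\<exists>\<^sub>\<le>\<^sub>1 c. (c, a) \<in> paths2 Q \<and> path2_elem Q (c, a) \<in> J))"

text \<open>The quiver with a loop added at each special vertex: old arrows are \<open>Inl \<alpha>\<close>, the special loop at \<open>i\<close> is \<open>Inr i\<close>.\<close>

definition add_loops :: "('v, 'a) pre_digraph \<Rightarrow> 'v set \<Rightarrow> ('v, 'a + 'v) pre_digraph" where
  "add_loops Q Sp = \<lparr>
     verts = verts Q,
     arcs = Inl ` arcs Q \<union> Inr ` Sp,
     tail = case_sum (tail Q) id,
     head = case_sum (head Q) id\<rparr>"

definition skew_gentle_triple ::
  "'k::field itself \<Rightarrow> ('v, 'a) pre_digraph \<Rightarrow> ('a \<times> 'a) set \<Rightarrow> 'v set \<Rightarrow> bool" where
  "skew_gentle_triple _ Q I Sp \<longleftrightarrow>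
     fin_digraph Q \<and> I \<subseteq> paths2 Q \<and> Sp \<subseteq> verts Q \<and>
     gentle (add_loops Q Sp)
       (genideal (path_algebra (add_loops Q Sp))
         (path2_elem (add_loops Q Sp) `
           ((\<lambda>(a, b). (Inl a, Inl b)) ` I \<union> (\<lambda>i. (Inr i, Inr i)) ` Sp))
        :: ('v \<times> ('a + 'v) list \<Rightarrow>\<^sub>0 'k) set)"

definition skew_gentle_algebra :: "('v, 'a) pre_digraph \<Rightarrow> ('a \<times> 'a) set \<Rightarrow> 'v set \<Rightarrow>
    ('k::field, ('v \<times> ('a + 'v) list \<Rightarrow>\<^sub>0 'k) set) module" where
  "skew_gentle_algebra Q I Sp =
     quotient_algebra (path_algebra (add_loops Q Sp))
       (genideal (path_algebra (add_loops Q Sp))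
         (path2_elem (add_loops Q Sp) ` (\<lambda>(a, b). (Inl a, Inl b)) ` I \<union>
          (\<lambda>i. path2_elem (add_loops Q Sp) (Inr i, Inr i) - arrow_elem (add_loops Q Sp) (Inr i)) ` Sp))"

datatype sign = Plus | Minus

datatype 'v signed_vertex = Special 'v | Signed 'v sign

definition sign_vertex :: "'v set \<Rightarrow> 'v \<Rightarrow> sign \<Rightarrow> 'v signed_vertex" where
  "sign_vertex Sp i s = (if i \<in> Sp then Special i else Signed i s)"

definition signed_quiver ::
  "('v, 'a) pre_digraph \<Rightarrow> 'v set \<Rightarrow> ('v signed_vertex, 'a \<times> sign) pre_digraph" where
  "signed_quiver Q Sp = \<lparr>
     verts = {sign_vertex Sp i s | i s. i \<in> verts Q},
     arcs = arcs Q \<times> UNIV,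
     tail = (\<lambda>(a, s). sign_vertex Sp (tail Q a) s),
     head = (\<lambda>(a, s). sign_vertex Sp (head Q a) s)\<rparr>"

definition associated_gentle_algebra :: "('v, 'a) pre_digraph \<Rightarrow> ('a \<times> 'a) set \<Rightarrow> 'v set \<Rightarrow>
    ('k::field, ('v signed_vertex \<times> ('a \<times> sign) list \<Rightarrow>\<^sub>0 'k) set) module" where
  "associated_gentle_algebra Q I Sp =
     quotient_algebra (path_algebra (signed_quiver Q Sp))
       (genideal (path_algebra (signed_quiver Q Sp))
         (path2_elem (signed_quiver Q Sp) ` {((a, s), (b, s)) | a b s. (a, b) \<in> I}))"

end

theory Submission
  imports Defs
begin

text \<open>There are functors \<open>F\<close> and \<open>H\<close> between the module categories of the gentle and the
  skew-gentle algebra (induction to and restriction from the skew group algebra, up to Morita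
  equivalence) which are right adjoint to each other. Since \<open>2\<close> is invertible, every module is
  a direct summand of \<open>F (H N)\<close> or of \<open>H (F M)\<close>, respectively. Precomposition with such a functor
  preserves finitely presented functors because of the right adjoint, it is exact because exactness
  is tested pointwise, and it is faithful because of the summands. An exact faithful functor
  reflects the terms of the Krull--Gabriel filtration: by transfinite induction on the
  terms, the length modulo the previous term does not decrease under it. Hence the two
  filtrations exhaust their categories at the same ordinals.\<close>

section \<open>Abelian categories with exact families of underlying groups\<close>

text \<open>The quotients \<open>C/S\<close> are never shown to be abelian. What is needed of them
  is translated into conditions on \<open>C\<close>: kernels and cokernels become statements about
  elements, and finite length in \<open>C/S\<close> becomes \<open>len\<close>, a recursion over
  subobjects in \<open>C\<close> with "zero" weakened to "in \<open>S\<close>". Such a recursion can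
  be compared along an exact functor without touching fractions, and the comparison asks only that
  the functor reflects membership in the two classes; the induction over the filtration supplies
  this. F and H are written directly on quiver representations, so that the skew group algebra and
  the Morita equivalence stay implicit. The link is the involution 1 - 2\<epsilon> belonging to an
  idempotent loop \<epsilon>: it plays the action of Z_2 at a special vertex, where the two signed
  copies of the vertex coincide. The characteristic enters through 1/2, in \<epsilon> = (1 - tau)/2
  and in the splitting of F (H N) onto N. Finite dimension of the algebras enters when finitely
  generated modules are identified with finite-dimensional ones; it is extracted from the gentle
  algebra on the quiver with loops by counting paths that avoid the relations.\<close>

text \<open>\<open>E X i\<close> is the underlying group of \<open>X\<close> at the index \<open>i\<close>; for a category of functors
  the indices are the objects of the source category.\<close>

locale concrete_abelian =
  fixes C :: "('o, 'i \<Rightarrow> 'e \<Rightarrow> 'e::ab_group_add) category"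
    and J :: "'i set"
    and E :: "'o \<Rightarrow> 'i \<Rightarrow> 'e set"
  assumes zero_mem: "X \<in> Ob C \<Longrightarrow> i \<in> J \<Longrightarrow> 0 \<in> E X i"
    and diff_mem: "X \<in> Ob C \<Longrightarrow> i \<in> J \<Longrightarrow> x \<in> E X i \<Longrightarrow> y \<in> E X i \<Longrightarrow> x - y \<in> E X i"
    and hom_mem: "X \<in> Ob C \<Longrightarrow> Y \<in> Ob C \<Longrightarrow> f \<in> Hom C X Y \<Longrightarrow> i \<in> J \<Longrightarrow> x \<in> E X i \<Longrightarrow> f i x \<in> E Y i"
    and hom_diff: "X \<in> Ob C \<Longrightarrow> Y \<in> Ob C \<Longrightarrow> f \<in> Hom C X Y \<Longrightarrow> i \<in> J \<Longrightarrow> x \<in> E X i \<Longrightarrow> y \<in> E X i \<Longrightarrow>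
      f i (x - y) = f i x - f i y"
    and hom_eqI: "X \<in> Ob C \<Longrightarrow> Y \<in> Ob C \<Longrightarrow> f \<in> Hom C X Y \<Longrightarrow> g \<in> Hom C X Y \<Longrightarrow>
      (\<And>i x. i \<in> J \<Longrightarrow> x \<in> E X i \<Longrightarrow> f i x = g i x) \<Longrightarrow> f = g"
    and comp_hom: "X \<in> Ob C \<Longrightarrow> Y \<in> Ob C \<Longrightarrow> Z \<in> Ob C \<Longrightarrow> f \<in> Hom C X Y \<Longrightarrow> g \<in> Hom C Y Z \<Longrightarrow>
      Comp C X Y Z g f \<in> Hom C X Z"
    and comp_app [simp]: "i \<in> J \<Longrightarrow> x \<in> E X i \<Longrightarrow> Comp C X Y Z g f i x = g i (f i x)"
    and id_hom: "X \<in> Ob C \<Longrightarrow> Id C X \<in> Hom C X X"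
    and id_app [simp]: "i \<in> J \<Longrightarrow> x \<in> E X i \<Longrightarrow> Id C X i x = x"
    and zero_ex: "\<exists>Z\<in>Ob C. \<forall>i\<in>J. E Z i = {0}"
    and zero_hom_ex: "X \<in> Ob C \<Longrightarrow> Y \<in> Ob C \<Longrightarrow> \<exists>f\<in>Hom C X Y. \<forall>i\<in>J. \<forall>x\<in>E X i. f i x = 0"
    and diff_hom_ex: "X \<in> Ob C \<Longrightarrow> Y \<in> Ob C \<Longrightarrow> f \<in> Hom C X Y \<Longrightarrow> g \<in> Hom C X Y \<Longrightarrow>
      \<exists>h\<in>Hom C X Y. \<forall>i\<in>J. \<forall>x\<in>E X i. h i x = f i x - g i x"
    and kernel_ex: "X \<in> Ob C \<Longrightarrow> Y \<in> Ob C \<Longrightarrow> f \<in> Hom C X Y \<Longrightarrow>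
      \<exists>N\<in>Ob C. \<exists>k\<in>Hom C N X. \<forall>i\<in>J. inj_on (k i) (E N i) \<and> k i ` E N i = {x \<in> E X i. f i x = 0}"
    and cokernel_ex: "X \<in> Ob C \<Longrightarrow> Y \<in> Ob C \<Longrightarrow> f \<in> Hom C X Y \<Longrightarrow>
      \<exists>N\<in>Ob C. \<exists>c\<in>Hom C Y N. \<forall>i\<in>J. c i ` E Y i = E N i \<and> {y \<in> E Y i. c i y = 0} = f i ` E X i"
    and lift_ex: "N \<in> Ob C \<Longrightarrow> X \<in> Ob C \<Longrightarrow> T \<in> Ob C \<Longrightarrow> k \<in> Hom C N X \<Longrightarrow> t \<in> Hom C T X \<Longrightarrow>
      (\<And>i. i \<in> J \<Longrightarrow> inj_on (k i) (E N i) \<and> t i ` E T i \<subseteq> k i ` E N i) \<Longrightarrow>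
      \<exists>u\<in>Hom C T N. \<forall>i\<in>J. \<forall>x\<in>E T i. k i (u i x) = t i x"
    and descend_ex: "N \<in> Ob C \<Longrightarrow> Y \<in> Ob C \<Longrightarrow> T \<in> Ob C \<Longrightarrow> c \<in> Hom C Y N \<Longrightarrow> t \<in> Hom C Y T \<Longrightarrow>
      (\<And>i. i \<in> J \<Longrightarrow> c i ` E Y i = E N i) \<Longrightarrow>
      (\<And>i y. i \<in> J \<Longrightarrow> y \<in> E Y i \<Longrightarrow> c i y = 0 \<Longrightarrow> t i y = 0) \<Longrightarrow>
      \<exists>u\<in>Hom C N T. \<forall>i\<in>J. \<forall>y\<in>E Y i. u i (c i y) = t i y"
    and product_ex: "X \<in> Ob C \<Longrightarrow> Y \<in> Ob C \<Longrightarrow>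
      \<exists>P\<in>Ob C. \<exists>p\<in>Hom C P X. \<exists>q\<in>Hom C P Y. \<forall>i\<in>J. bij_betw (\<lambda>z. (p i z, q i z)) (E P i) (E X i \<times> E Y i)"
begin

section \<open>Elementwise kernels, cokernels, images and fibre products\<close>

definition ar :: "'o \<Rightarrow> 'o \<Rightarrow> ('i \<Rightarrow> 'e \<Rightarrow> 'e) \<Rightarrow> bool" where
  "ar X Y f \<longleftrightarrow> X \<in> Ob C \<and> Y \<in> Ob C \<and> f \<in> Hom C X Y"

definition inj :: "'o \<Rightarrow> ('i \<Rightarrow> 'e \<Rightarrow> 'e) \<Rightarrow> bool" where
  "inj X f \<longleftrightarrow> (\<forall>i\<in>J. \<forall>x\<in>E X i. f i x = 0 \<longrightarrow> x = 0)"

definition sur :: "'o \<Rightarrow> 'o \<Rightarrow> ('i \<Rightarrow> 'e \<Rightarrow> 'e) \<Rightarrow> bool" where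
  "sur X Y f \<longleftrightarrow> (\<forall>i\<in>J. \<forall>y\<in>E Y i. \<exists>x\<in>E X i. f i x = y)"

definition exact :: "'o \<Rightarrow> 'o \<Rightarrow> ('i \<Rightarrow> 'e \<Rightarrow> 'e) \<Rightarrow> ('i \<Rightarrow> 'e \<Rightarrow> 'e) \<Rightarrow> bool" where
  "exact X Y f g \<longleftrightarrow> (\<forall>i\<in>J. \<forall>y\<in>E Y i. g i y = 0 \<longleftrightarrow> (\<exists>x\<in>E X i. f i x = y))"

definition ker :: "'o \<Rightarrow> 'o \<Rightarrow> ('i \<Rightarrow> 'e \<Rightarrow> 'e) \<Rightarrow> 'o \<Rightarrow> ('i \<Rightarrow> 'e \<Rightarrow> 'e) \<Rightarrow> bool" where
  "ker X Y f N k \<longleftrightarrow> ar N X k \<and> inj N k \<and> exact N X k f"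

definition cok :: "'o \<Rightarrow> 'o \<Rightarrow> ('i \<Rightarrow> 'e \<Rightarrow> 'e) \<Rightarrow> 'o \<Rightarrow> ('i \<Rightarrow> 'e \<Rightarrow> 'e) \<Rightarrow> bool" where
  "cok X Y f N c \<longleftrightarrow> ar Y N c \<and> sur Y N c \<and> exact X Y f c"

definition zob :: "'o \<Rightarrow> bool" where
  "zob Z \<longleftrightarrow> Z \<in> Ob C \<and> (\<forall>i\<in>J. E Z i = {0})"

lemma ar_Ob: "ar X Y f \<Longrightarrow> X \<in> Ob C" "ar X Y f \<Longrightarrow> Y \<in> Ob C" "ar X Y f \<Longrightarrow> f \<in> Hom C X Y"
  by (auto simp: ar_def)

lemma ar_mem: "ar X Y f \<Longrightarrow> i \<in> J \<Longrightarrow> x \<in> E X i \<Longrightarrow> f i x \<in> E Y i"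
  unfolding ar_def by (blast intro: hom_mem)

lemma ar_diff: "ar X Y f \<Longrightarrow> i \<in> J \<Longrightarrow> x \<in> E X i \<Longrightarrow> y \<in> E X i \<Longrightarrow> f i (x - y) = f i x - f i y"
  unfolding ar_def by (blast intro: hom_diff)

lemma ar_zero: "ar X Y f \<Longrightarrow> i \<in> J \<Longrightarrow> f i 0 = 0"
  using ar_diff[of X Y f i 0 0] zero_mem[of X i] by (simp add: ar_def)

lemma ar_comp: "ar X Y f \<Longrightarrow> ar Y Z g \<Longrightarrow> ar X Z (Comp C X Y Z g f)"
  by (simp add: ar_def comp_hom)

lemma ar_id: "X \<in> Ob C \<Longrightarrow> ar X X (Id C X)"
  by (simp add: ar_def id_hom)

lemma ar_eqI: "ar X Y f \<Longrightarrow> ar X Y g \<Longrightarrow> (\<And>i x. i \<in> J \<Longrightarrow> x \<in> E X i \<Longrightarrow> f i x = g i x) \<Longrightarrow> f = g"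
  unfolding ar_def by (rule hom_eqI) auto

lemma injD: "ar X Y f \<Longrightarrow> inj X f \<Longrightarrow> i \<in> J \<Longrightarrow> x \<in> E X i \<Longrightarrow> y \<in> E X i \<Longrightarrow> f i x = f i y \<Longrightarrow> x = y"
  using ar_diff[of X Y f i x y] diff_mem[of X i x y] ar_Ob(1)[of X Y f]
  by (metis inj_def eq_iff_diff_eq_0)

lemma inj_on_inj: "ar X Y f \<Longrightarrow> (\<forall>i\<in>J. inj_on (f i) (E X i)) \<longleftrightarrow> inj X f"
proof
  assume "ar X Y f" "\<forall>i\<in>J. inj_on (f i) (E X i)"
  then show "inj X f" unfolding inj_def
    by (metis ar_zero ar_Ob(1) inj_onD zero_mem)
next
  assume "ar X Y f" "inj X f"
  then show "\<forall>i\<in>J. inj_on (f i) (E X i)" by (meson injD inj_onI)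
qed

lemma zob_ex: obtains Z where "zob Z"
  using zero_ex by (auto simp: zob_def)

lemma zero_ar:
  assumes "X \<in> Ob C" "Y \<in> Ob C"
  obtains z where "ar X Y z" "\<And>i x. i \<in> J \<Longrightarrow> x \<in> E X i \<Longrightarrow> z i x = 0"
  using zero_hom_ex[OF assms] assms by (auto simp: ar_def)

lemma diff_ar:
  assumes "ar X Y f" "ar X Y g"
  obtains h where "ar X Y h" "\<And>i x. i \<in> J \<Longrightarrow> x \<in> E X i \<Longrightarrow> h i x = f i x - g i x"
  using diff_hom_ex[of X Y f g] assms by (auto simp: ar_def)

lemma ker_ex:
  assumes "ar X Y f" obtains N k where "ker X Y f N k"
proof -
  obtain N k where "N \<in> Ob C" "k \<in> Hom C N X"
      and *: "\<forall>i\<in>J. inj_on (k i) (E N i) \<and> k i ` E N i = {x \<in> E X i. f i x = 0}"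
    using kernel_ex[of X Y f] assms by (auto simp: ar_def)
  then have k: "ar N X k" using assms by (auto simp: ar_def)
  moreover have "inj N k" using * inj_on_inj[OF k] by blast
  moreover have "exact N X k f" unfolding exact_def
  proof (intro ballI)
    fix i x assume "i \<in> J" "x \<in> E X i"
    then have "f i x = 0 \<longleftrightarrow> x \<in> k i ` E N i" using * by simp
    then show "f i x = 0 \<longleftrightarrow> (\<exists>n\<in>E N i. k i n = x)" by blast
  qed
  ultimately show ?thesis using that by (auto simp: ker_def)
qed

lemma cok_ex:
  assumes "ar X Y f" obtains N c where "cok X Y f N c"
proof -
  obtain N c where "N \<in> Ob C" "c \<in> Hom C Y N"
      and *: "\<forall>i\<in>J. c i ` E Y i = E N i \<and> {y \<in> E Y i. c i y = 0} = f i ` E X i"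
    using cokernel_ex[of X Y f] assms by (auto simp: ar_def)
  then have "ar Y N c" using assms by (auto simp: ar_def)
  moreover have "sur Y N c" unfolding sur_def
  proof (intro ballI)
    fix i n assume "i \<in> J" "n \<in> E N i"
    then have "n \<in> c i ` E Y i" using * by simp
    then show "\<exists>y\<in>E Y i. c i y = n" by blast
  qed
  moreover have "exact X Y f c" unfolding exact_def
  proof (intro ballI)
    fix i y assume "i \<in> J" "y \<in> E Y i"
    then have "c i y = 0 \<longleftrightarrow> y \<in> f i ` E X i" using * by blast
    then show "c i y = 0 \<longleftrightarrow> (\<exists>x\<in>E X i. f i x = y)" by blast
  qed
  ultimately show ?thesis using that by (auto simp: cok_def)
qed

lemma ar_lift:
  assumes "ar N X k" "inj N k" "ar T X t"
    and "\<And>i x. i \<in> J \<Longrightarrow> x \<in> E T i \<Longrightarrow> \<exists>n\<in>E N i. k i n = t i x"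
  obtains u where "ar T N u" "\<And>i x. i \<in> J \<Longrightarrow> x \<in> E T i \<Longrightarrow> k i (u i x) = t i x"
proof -
  have "\<exists>u\<in>Hom C T N. \<forall>i\<in>J. \<forall>x\<in>E T i. k i (u i x) = t i x"
  proof (rule lift_ex[of N X])
    fix i assume "i \<in> J"
    then show "inj_on (k i) (E N i) \<and> t i ` E T i \<subseteq> k i ` E N i"
      using assms(4)[of i] inj_on_inj[OF assms(1)] assms(2) by (auto simp: image_iff) metis
  qed (use assms in \<open>auto simp: ar_def\<close>)
  then show ?thesis using that assms by (auto simp: ar_def)
qed

lemma ar_descend:
  assumes "ar Y N c" "sur Y N c" "ar Y T t"
    and "\<And>i y. i \<in> J \<Longrightarrow> y \<in> E Y i \<Longrightarrow> c i y = 0 \<Longrightarrow> t i y = 0"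
  obtains u where "ar N T u" "\<And>i y. i \<in> J \<Longrightarrow> y \<in> E Y i \<Longrightarrow> u i (c i y) = t i y"
proof -
  have "\<exists>u\<in>Hom C N T. \<forall>i\<in>J. \<forall>y\<in>E Y i. u i (c i y) = t i y"
  proof (rule descend_ex)
    fix i assume "i \<in> J"
    then show "c i ` E Y i = E N i"
      using assms(1,2) ar_mem by (fastforce simp: sur_def image_iff)
  qed (use assms in \<open>auto simp: ar_def\<close>)
  then show ?thesis using that assms by (auto simp: ar_def)
qed

text \<open>The fibre product is the kernel of the difference of the two maps on the product. The
  last two properties say on elements that it consists of the pairs on which \<open>f\<close> and
  \<open>t\<close> agree, each pair once; later diagram chases use this form instead of a universal
  property.\<close>

lemma pullback_ex:
  assumes "ar X Y f" "ar W Y t"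
  obtains V p q where "ar V X p" "ar V W q" "\<And>i v. i \<in> J \<Longrightarrow> v \<in> E V i \<Longrightarrow> f i (p i v) = t i (q i v)"
    "\<And>i x w. i \<in> J \<Longrightarrow> x \<in> E X i \<Longrightarrow> w \<in> E W i \<Longrightarrow> f i x = t i w \<Longrightarrow> \<exists>v\<in>E V i. p i v = x \<and> q i v = w"
    "\<And>i v. i \<in> J \<Longrightarrow> v \<in> E V i \<Longrightarrow> p i v = 0 \<Longrightarrow> q i v = 0 \<Longrightarrow> v = 0"
proof -
  obtain P p q where P: "P \<in> Ob C" "p \<in> Hom C P X" "q \<in> Hom C P W"
      and bij: "\<forall>i\<in>J. bij_betw (\<lambda>z. (p i z, q i z)) (E P i) (E X i \<times> E W i)"
    using product_ex[of X W] assms by (auto simp: ar_def)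
  have p: "ar P X p" and q: "ar P W q" using P assms by (auto simp: ar_def)
  obtain h where h: "ar P Y h" "\<And>i x. i \<in> J \<Longrightarrow> x \<in> E P i \<Longrightarrow> h i x = f i (p i x) - t i (q i x)"
    by (rule diff_ar[OF ar_comp[OF p assms(1)] ar_comp[OF q assms(2)]]) simp
  obtain V k where "ker P Y h V k" using ker_ex[OF h(1)] .
  then have k: "ar V P k" "inj V k" "exact V P k h" by (auto simp: ker_def)
  show ?thesis
  proof
    show "ar V X (Comp C V P X p k)" "ar V W (Comp C V P W q k)" using k(1) p q ar_comp by blast+
  next
    fix i v assume i: "i \<in> J" and v: "v \<in> E V i"
    have kv: "k i v \<in> E P i" using k i v ar_mem by blast
    then have "h i (k i v) = 0" using k(3) i v by (auto simp: exact_def)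
    then show "f i (Comp C V P X p k i v) = t i (Comp C V P W q k i v)" using h(2)[OF i kv] i v by simp
    assume "Comp C V P X p k i v = 0" "Comp C V P W q k i v = 0"
    then have "p i (k i v) = p i 0 \<and> q i (k i v) = q i 0" using i v ar_zero[OF p i] ar_zero[OF q i] by simp
    moreover have "inj_on (\<lambda>z. (p i z, q i z)) (E P i)" using bij i bij_betw_def by blast
    ultimately have "k i v = 0" using kv zero_mem[OF P(1) i] by (auto dest: inj_onD)
    then show "v = 0" using k(2) i v by (auto simp: inj_def)
  next
    fix i x w assume i: "i \<in> J" and x: "x \<in> E X i" "w \<in> E W i" "f i x = t i w"
    have "(x, w) \<in> (\<lambda>z. (p i z, q i z)) ` E P i" using bij i x by (simp add: bij_betw_def)
    then obtain z where z: "z \<in> E P i" "p i z = x" "q i z = w" by auto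
    then have "h i z = 0" using h(2) i x by simp
    then obtain v where "v \<in> E V i" "k i v = z" using k(3) i z by (auto simp: exact_def)
    then show "\<exists>v\<in>E V i. Comp C V P X p k i v = x \<and> Comp C V P W q k i v = w" using z i by auto
  qed
qed

lemma ker_zero: "ker X Y f N k \<Longrightarrow> i \<in> J \<Longrightarrow> n \<in> E N i \<Longrightarrow> f i (k i n) = 0"
  by (auto simp: ker_def exact_def dest: ar_mem)

lemma cok_zero: "cok X Y f N c \<Longrightarrow> ar X Y f \<Longrightarrow> i \<in> J \<Longrightarrow> x \<in> E X i \<Longrightarrow> c i (f i x) = 0"
  using ar_mem[of X Y f i x] by (auto simp: cok_def exact_def)

lemma ker_lift:
  assumes "ker X Y f N k" "ar T X t" "\<And>i x. i \<in> J \<Longrightarrow> x \<in> E T i \<Longrightarrow> f i (t i x) = 0"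
  obtains u where "ar T N u" "\<And>i x. i \<in> J \<Longrightarrow> x \<in> E T i \<Longrightarrow> k i (u i x) = t i x"
proof (rule ar_lift[of N X k T t])
  fix i x assume "i \<in> J" "x \<in> E T i"
  then show "\<exists>n\<in>E N i. k i n = t i x"
    using assms ar_mem[OF assms(2)] by (auto simp: ker_def exact_def)
qed (use assms that in \<open>auto simp: ker_def\<close>)

lemma cok_descend:
  assumes "cok X Y f N c" "ar Y T t" "\<And>i x. i \<in> J \<Longrightarrow> x \<in> E X i \<Longrightarrow> t i (f i x) = 0"
  obtains u where "ar N T u" "\<And>i y. i \<in> J \<Longrightarrow> y \<in> E Y i \<Longrightarrow> u i (c i y) = t i y"
proof (rule ar_descend[of Y N c T t])
  fix i y assume "i \<in> J" "y \<in> E Y i" "c i y = 0"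
  then show "t i y = 0" using assms by (auto simp: cok_def exact_def)
qed (use assms that in \<open>auto simp: cok_def\<close>)

text \<open>The image is the kernel of the cokernel; exactness at \<open>Y\<close> makes the
  corestriction surjective.\<close>

lemma image_factor:
  assumes f: "ar X Y f"
  obtains N k e where "ar N Y k" "inj N k" "ar X N e" "sur X N e" "\<And>i x. i \<in> J \<Longrightarrow> x \<in> E X i \<Longrightarrow> k i (e i x) = f i x"
proof -
  obtain Q c where c: "cok X Y f Q c" using cok_ex[OF f] .
  then have c': "ar Y Q c" by (simp add: cok_def)
  obtain N k where k: "ker Y Q c N k" using ker_ex[OF c'] .
  obtain e where e: "ar X N e" "\<And>i x. i \<in> J \<Longrightarrow> x \<in> E X i \<Longrightarrow> k i (e i x) = f i x"
    using ker_lift[OF k f] cok_zero[OF c f] by blast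
  have "sur X N e" unfolding sur_def
  proof (intro ballI)
    fix i n assume i: "i \<in> J" and n: "n \<in> E N i"
    have k': "ar N Y k" "inj N k" using k by (auto simp: ker_def)
    have "c i (k i n) = 0" using ker_zero[OF k] i n by blast
    then obtain x where "x \<in> E X i" "f i x = k i n"
      using c i ar_mem[OF k'(1) i n] by (auto simp: cok_def exact_def)
    then show "\<exists>x\<in>E X i. e i x = n"
      using e(2)[OF i] injD[OF k' i _ n] ar_mem[OF e(1) i] by metis
  qed
  then show ?thesis using that e k by (auto simp: ker_def)
qed

section \<open>Categorical notions in terms of elements\<close>

lemma zero_object_iff: "zero_object C Z \<longleftrightarrow> zob Z"
proof
  assume Z: "zero_object C Z"
  then have ZO: "Z \<in> Ob C" by (simp add: zero_object_def)
  then obtain z where z: "ar Z Z z" "\<And>i x. i \<in> J \<Longrightarrow> x \<in> E Z i \<Longrightarrow> z i x = 0" using zero_ar by blast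
  \<comment> \<open>A zero object has a single endomorphism, so the zero map is the identity and
    every element is 0.\<close>
  have "z = Id C Z" using Z ZO z(1) id_hom[OF ZO] unfolding zero_object_def ar_def by blast
  then have "\<And>i x. i \<in> J \<Longrightarrow> x \<in> E Z i \<Longrightarrow> x = 0" using z(2) by (metis id_app)
  then show "zob Z" using ZO zero_mem[OF ZO] by (auto simp: zob_def)
next
  assume Z: "zob Z"
  then have ZO: "Z \<in> Ob C" by (simp add: zob_def)
  show "zero_object C Z" unfolding zero_object_def
  proof (intro conjI ballI ZO)
    fix X assume X: "X \<in> Ob C"
    obtain z where z: "ar Z X z" "\<And>i x. i \<in> J \<Longrightarrow> x \<in> E Z i \<Longrightarrow> z i x = 0" using zero_ar[OF ZO X] by metis
    show "\<exists>!f. f \<in> Hom C Z X"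
    proof (rule ex1I[of _ z])
      show "z \<in> Hom C Z X" using z by (simp add: ar_def)
      fix f assume "f \<in> Hom C Z X"
      then have f: "ar Z X f" using ZO X by (simp add: ar_def)
      show "f = z" using Z ar_zero[OF f] ar_zero[OF z(1)] by (intro ar_eqI[OF f z(1)]) (auto simp: zob_def)
    qed
    obtain w where w: "ar X Z w" "\<And>i x. i \<in> J \<Longrightarrow> x \<in> E X i \<Longrightarrow> w i x = 0" using zero_ar[OF X ZO] by metis
    show "\<exists>!f. f \<in> Hom C X Z"
    proof (rule ex1I[of _ w])
      show "w \<in> Hom C X Z" using w by (simp add: ar_def)
      fix f assume "f \<in> Hom C X Z"
      then have f: "ar X Z f" using ZO X by (simp add: ar_def)
      show "f = w" using Z ar_mem[OF f] ar_mem[OF w(1)] by (intro ar_eqI[OF f w(1)]) (auto simp: zob_def)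
    qed
  qed
qed

lemma zero_morphism_iff:
  assumes "X \<in> Ob C" "Y \<in> Ob C"
  shows "zero_morphism C X Y f \<longleftrightarrow> f \<in> Hom C X Y \<and> (\<forall>i\<in>J. \<forall>x\<in>E X i. f i x = 0)"
proof
  assume "zero_morphism C X Y f"
  then obtain Z g h where Z: "zob Z" "g \<in> Hom C X Z" "h \<in> Hom C Z Y" "f = Comp C X Z Y h g"
    unfolding zero_morphism_def zero_object_iff by blast
  then have g: "ar X Z g" and h: "ar Z Y h" using assms by (auto simp: ar_def zob_def)
  show "f \<in> Hom C X Y \<and> (\<forall>i\<in>J. \<forall>x\<in>E X i. f i x = 0)"
    using ar_comp[OF g h] Z ar_mem[OF g] ar_zero[OF h] by (auto simp: ar_def zob_def)
next
  assume f: "f \<in> Hom C X Y \<and> (\<forall>i\<in>J. \<forall>x\<in>E X i. f i x = 0)"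
  obtain Z where Z: "zob Z" using zob_ex .
  then have ZO: "Z \<in> Ob C" by (simp add: zob_def)
  obtain g where g: "ar X Z g" "\<And>i x. i \<in> J \<Longrightarrow> x \<in> E X i \<Longrightarrow> g i x = 0" using zero_ar[OF assms(1) ZO] by metis
  obtain h where h: "ar Z Y h" "\<And>i x. i \<in> J \<Longrightarrow> x \<in> E Z i \<Longrightarrow> h i x = 0" using zero_ar[OF ZO assms(2)] by metis
  have f': "ar X Y f" using f assms by (simp add: ar_def)
  have "f = Comp C X Z Y h g"
    using f h(2) ar_mem[OF g(1)] by (intro ar_eqI[OF f' ar_comp[OF g(1) h(1)]]) auto
  then show "zero_morphism C X Y f" unfolding zero_morphism_def zero_object_iff
    using Z g h by (auto simp: ar_def)
qed

text \<open>An elementwise kernel is universal by \<open>ker_lift\<close>. Conversely a universal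
  arrow is compared with an elementwise kernel \<open>j\<close>; the comparison splits, which
  carries injectivity and exactness over from \<open>j\<close>.\<close>

lemma is_kernel_iff:
  assumes f: "ar X Y f"
  shows "is_kernel C X Y f N k \<longleftrightarrow> ker X Y f N k"
proof
  assume k: "ker X Y f N k"
  then have k': "ar N X k" "inj N k" by (auto simp: ker_def)
  show "is_kernel C X Y f N k" unfolding is_kernel_def
  proof (intro conjI ballI impI)
    show "N \<in> Ob C" "k \<in> Hom C N X" using k' by (auto simp: ar_def)
    show "zero_morphism C N Y (Comp C N X Y f k)"
      using ar_comp[OF k'(1) f] ker_zero[OF k] by (subst zero_morphism_iff) (auto simp: ar_def)
    fix T t assume T: "T \<in> Ob C" "t \<in> Hom C T X" "zero_morphism C T Y (Comp C T X Y f t)"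
    then have t: "ar T X t" using f by (simp add: ar_def)
    have "f i (t i x) = 0" if "i \<in> J" "x \<in> E T i" for i x
      using T(3) that f T(1) by (subst (asm) zero_morphism_iff) (auto simp: ar_def)
    then obtain u where u: "ar T N u" "\<And>i x. i \<in> J \<Longrightarrow> x \<in> E T i \<Longrightarrow> k i (u i x) = t i x"
      using ker_lift[OF k t] by blast
    show "\<exists>!u. u \<in> Hom C T N \<and> Comp C T N X k u = t"
    proof (rule ex1I[of _ u], intro conjI)
      show "u \<in> Hom C T N" using u by (simp add: ar_def)
      show "Comp C T N X k u = t" using u(2) by (intro ar_eqI[OF ar_comp[OF u(1) k'(1)] t]) simp
      fix v assume v: "v \<in> Hom C T N \<and> Comp C T N X k v = t"
      then have v': "ar T N v" using u by (simp add: ar_def)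
      show "v = u"
      proof (rule ar_eqI[OF v' u(1)])
        fix i x assume i: "i \<in> J" "x \<in> E T i"
        have "k i (v i x) = k i (u i x)" using v u(2)[OF i] comp_app[OF i] by metis
        then show "v i x = u i x" using injD[OF k'] i ar_mem[OF v'] ar_mem[OF u(1)] by blast
      qed
    qed
  qed
next
  assume "is_kernel C X Y f N k"
  then have NO: "N \<in> Ob C" "k \<in> Hom C N X" and z: "zero_morphism C N Y (Comp C N X Y f k)"
    and un: "\<And>T t. T \<in> Ob C \<Longrightarrow> t \<in> Hom C T X \<Longrightarrow> zero_morphism C T Y (Comp C T X Y f t) \<Longrightarrow>
        \<exists>!u. u \<in> Hom C T N \<and> Comp C T N X k u = t" unfolding is_kernel_def by blast+
  have XY: "X \<in> Ob C" "Y \<in> Ob C" using f by (auto simp: ar_def)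
  have k: "ar N X k" using NO XY by (simp add: ar_def)
  have fk: "f i (k i x) = 0" if "i \<in> J" "x \<in> E N i" for i x
    using z that NO XY by (subst (asm) zero_morphism_iff) auto
  obtain K j where j: "ker X Y f K j" using ker_ex[OF f] .
  then have j': "ar K X j" "inj K j" by (auto simp: ker_def)
  have "zero_morphism C K Y (Comp C K X Y f j)"
      using ar_comp[OF j'(1) f] ker_zero[OF j] by (subst zero_morphism_iff) (auto simp: ar_def)
  then obtain v where v: "v \<in> Hom C K N" "Comp C K N X k v = j" using un[of K j] j' by (auto simp: ar_def)
  have v': "ar K N v" using v j' k by (simp add: ar_def)
  obtain u where u: "ar N K u" "\<And>i x. i \<in> J \<Longrightarrow> x \<in> E N i \<Longrightarrow> j i (u i x) = k i x"
    using ker_lift[OF j k fk] by blast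
  have e: "k i (v i x) = j i x" if "i \<in> J" "x \<in> E K i" for i x using v(2) that comp_app by metis
  \<comment> \<open>Both morphisms factor \<open>k\<close> through itself, and such a factorisation
    is unique.\<close>
  have "Comp C N K N v u = Id C N"
  proof -
    have "Comp C N N X k (Comp C N K N v u) = k"
      using e u(2) ar_mem[OF u(1)]
      by (intro ar_eqI[OF ar_comp[OF ar_comp[OF u(1) v'] k] k]) auto
    moreover have "Comp C N N X k (Id C N) = k"
      by (intro ar_eqI[OF ar_comp[OF ar_id k] k]) (auto simp: NO)
    ultimately show ?thesis using un[OF NO z] ar_comp[OF u(1) v'] id_hom[OF NO(1)] unfolding ar_def by blast
  qed
  then have vu: "v i (u i x) = x" if "i \<in> J" "x \<in> E N i" for i x using that by (metis comp_app id_app)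
  have "inj N k" unfolding inj_def
  proof (intro ballI impI)
    fix i x assume i: "i \<in> J" "x \<in> E N i" "k i x = 0"
    then have "j i (u i x) = 0" using u(2) by simp
    then have "u i x = 0" using j'(2) ar_mem[OF u(1)] i by (auto simp: inj_def)
    then show "x = 0" using vu[OF i(1,2)] ar_zero[OF v'] i by simp
  qed
  moreover have "exact N X k f" unfolding exact_def
  proof (intro ballI iffI)
    fix i x assume i: "i \<in> J" "x \<in> E X i" "f i x = 0"
    then obtain y where "y \<in> E K i" "j i y = x" using j by (auto simp: ker_def exact_def)
    then show "\<exists>n\<in>E N i. k i n = x" using e i ar_mem[OF v'] by blast
  qed (use fk in auto)
  ultimately show "ker X Y f N k" using k by (simp add: ker_def)
qed

text \<open>Dual to \<open>is_kernel_iff\<close>: surjectivity and exactness are carried over from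
  an elementwise cokernel \<open>j\<close> along the split comparison.\<close>

lemma is_cokernel_iff:
  assumes f: "ar X Y f"
  shows "is_cokernel C X Y f N c \<longleftrightarrow> cok X Y f N c"
proof
  assume c: "cok X Y f N c"
  then have c': "ar Y N c" "sur Y N c" by (auto simp: cok_def)
  show "is_cokernel C X Y f N c" unfolding is_cokernel_def
  proof (intro conjI ballI impI)
    show "N \<in> Ob C" "c \<in> Hom C Y N" using c' by (auto simp: ar_def)
    show "zero_morphism C X N (Comp C X Y N c f)"
      using ar_comp[OF f c'(1)] cok_zero[OF c f] by (subst zero_morphism_iff) (auto simp: ar_def)
    fix T t assume T: "T \<in> Ob C" "t \<in> Hom C Y T" "zero_morphism C X T (Comp C X Y T t f)"
    then have t: "ar Y T t" using f by (simp add: ar_def)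
    have "t i (f i x) = 0" if "i \<in> J" "x \<in> E X i" for i x
      using T(3) that f T(1) by (subst (asm) zero_morphism_iff) (auto simp: ar_def)
    then obtain u where u: "ar N T u" "\<And>i x. i \<in> J \<Longrightarrow> x \<in> E Y i \<Longrightarrow> u i (c i x) = t i x"
      using cok_descend[OF c t] by blast
    show "\<exists>!u. u \<in> Hom C N T \<and> Comp C Y N T u c = t"
    proof (rule ex1I[of _ u], intro conjI)
      show "u \<in> Hom C N T" using u by (simp add: ar_def)
      show "Comp C Y N T u c = t" using u(2) by (intro ar_eqI[OF ar_comp[OF c'(1) u(1)] t]) simp
      fix v assume v: "v \<in> Hom C N T \<and> Comp C Y N T v c = t"
      then have v': "ar N T v" using u by (simp add: ar_def)
      show "v = u"
      proof (rule ar_eqI[OF v' u(1)])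
        fix i x assume i: "i \<in> J" "x \<in> E N i"
        then obtain y where y: "y \<in> E Y i" "c i y = x" using c'(2) by (auto simp: sur_def)
        have "v i (c i y) = u i (c i y)" using v u(2)[OF i(1) y(1)] comp_app[OF i(1) y(1)] by metis
        then show "v i x = u i x" using y by simp
      qed
    qed
  qed
next
  assume "is_cokernel C X Y f N c"
  then have NO: "N \<in> Ob C" "c \<in> Hom C Y N" and z: "zero_morphism C X N (Comp C X Y N c f)"
    and un: "\<And>T t. T \<in> Ob C \<Longrightarrow> t \<in> Hom C Y T \<Longrightarrow> zero_morphism C X T (Comp C X Y T t f) \<Longrightarrow>
        \<exists>!u. u \<in> Hom C N T \<and> Comp C Y N T u c = t" unfolding is_cokernel_def by blast+
  have XY: "X \<in> Ob C" "Y \<in> Ob C" using f by (auto simp: ar_def)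
  have c: "ar Y N c" using NO XY by (simp add: ar_def)
  have cf: "c i (f i x) = 0" if "i \<in> J" "x \<in> E X i" for i x
    using z that NO XY by (subst (asm) zero_morphism_iff) auto
  obtain K j where j: "cok X Y f K j" using cok_ex[OF f] .
  then have j': "ar Y K j" "sur Y K j" by (auto simp: cok_def)
  have "zero_morphism C X K (Comp C X Y K j f)"
      using ar_comp[OF f j'(1)] cok_zero[OF j f] by (subst zero_morphism_iff) (auto simp: ar_def)
  then obtain v where v: "v \<in> Hom C N K" "Comp C Y N K v c = j" using un[of K j] j' by (auto simp: ar_def)
  have v': "ar N K v" using v j' c by (simp add: ar_def)
  obtain u where u: "ar K N u" "\<And>i x. i \<in> J \<Longrightarrow> x \<in> E Y i \<Longrightarrow> u i (j i x) = c i x"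
    using cok_descend[OF j c cf] by blast
  have e: "v i (c i x) = j i x" if "i \<in> J" "x \<in> E Y i" for i x using v(2) that comp_app by metis
  have "Comp C N K N u v = Id C N"
  proof -
    have "Comp C Y N N (Comp C N K N u v) c = c"
      using e u(2) ar_mem[OF c]
      by (intro ar_eqI[OF ar_comp[OF c ar_comp[OF v' u(1)]] c]) auto
    moreover have "Comp C Y N N (Id C N) c = c"
      using ar_mem[OF c] by (intro ar_eqI[OF ar_comp[OF c ar_id] c]) (auto simp: NO)
    ultimately show ?thesis using un[OF NO z] ar_comp[OF v' u(1)] id_hom[OF NO(1)] unfolding ar_def by blast
  qed
  then have uv: "u i (v i x) = x" if "i \<in> J" "x \<in> E N i" for i x using that by (metis comp_app id_app)
  have "sur Y N c" unfolding sur_def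
  proof (intro ballI)
    fix i n assume i: "i \<in> J" "n \<in> E N i"
    then obtain y where "y \<in> E Y i" "j i y = v i n" using j'(2) ar_mem[OF v'] by (metis sur_def)
    then show "\<exists>y\<in>E Y i. c i y = n" using uv[OF i] u(2)[OF i(1)] by metis
  qed
  moreover have "exact X Y f c" unfolding exact_def
  proof (intro ballI iffI)
    fix i y assume i: "i \<in> J" "y \<in> E Y i" "c i y = 0"
    then have "j i y = 0" using e ar_zero[OF v'] by metis
    then show "\<exists>x\<in>E X i. f i x = y" using j i by (auto simp: cok_def exact_def)
  qed (use cf in auto)
  ultimately show "cok X Y f N c" using c by (simp add: cok_def)
qed

end

section \<open>Serre quotients\<close>

text \<open>\<open>S_mid\<close> asks that the image of \<open>f\<close> contains the kernel of
  \<open>g\<close>, and neither g f = 0 nor injectivity or surjectivity. With a zero object as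
  \<open>X\<close> or \<open>Z\<close> it yields closure under subobjects and quotients, otherwise
  under extensions, so that one axiom expresses the Serre condition and fits every snake-like
  sequence below.\<close>

locale serre_class = concrete_abelian C J E
  for C :: "('o, 'i \<Rightarrow> 'e \<Rightarrow> 'e::ab_group_add) category" and J E +
  fixes S :: "'o set"
  assumes S_Ob: "S \<subseteq> Ob C"
    and S_zero: "zob Z \<Longrightarrow> Z \<in> S"
    and S_mid: "ar X Y f \<Longrightarrow> ar Y Z g \<Longrightarrow>
      (\<And>i y. i \<in> J \<Longrightarrow> y \<in> E Y i \<Longrightarrow> g i y = 0 \<Longrightarrow> \<exists>x\<in>E X i. f i x = y) \<Longrightarrow> X \<in> S \<Longrightarrow> Z \<in> S \<Longrightarrow> Y \<in> S"
begin

section \<open>Morphisms with kernel and cokernel in the Serre class\<close>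

definition kerS :: "'o \<Rightarrow> 'o \<Rightarrow> ('i \<Rightarrow> 'e \<Rightarrow> 'e) \<Rightarrow> bool" where
  "kerS X Y f \<longleftrightarrow> (\<forall>N k. ker X Y f N k \<longrightarrow> N \<in> S)"

definition cokS :: "'o \<Rightarrow> 'o \<Rightarrow> ('i \<Rightarrow> 'e \<Rightarrow> 'e) \<Rightarrow> bool" where
  "cokS X Y f \<longleftrightarrow> (\<forall>N c. cok X Y f N c \<longrightarrow> N \<in> S)"

definition qi :: "'o \<Rightarrow> 'o \<Rightarrow> ('i \<Rightarrow> 'e \<Rightarrow> 'e) \<Rightarrow> bool" where
  "qi X Y f \<longleftrightarrow> ar X Y f \<and> kerS X Y f \<and> cokS X Y f"

lemma qi_ar: "qi X Y f \<Longrightarrow> ar X Y f" by (simp add: qi_def)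

lemma S_sub:
  assumes m: "ar Y X m" and i: "inj Y m" and X: "X \<in> S" shows "Y \<in> S"
proof -
  obtain Z where Z: "zob Z" using zob_ex .
  obtain z where z: "ar Z Y z" using zero_ar[of Z Y] Z m by (metis zob_def ar_Ob(1))
  show ?thesis
  proof (rule S_mid[OF z m _ S_zero[OF Z] X])
    fix i y assume *: "i \<in> J" "y \<in> E Y i" "m i y = 0"
    then have "y = 0" using i by (auto simp: inj_def)
    then show "\<exists>x\<in>E Z i. z i x = y" using Z *(1) ar_zero[OF z *(1)] by (auto simp: zob_def)
  qed
qed

lemma S_quot:
  assumes m: "ar X Y c" and i: "sur X Y c" and X: "X \<in> S" shows "Y \<in> S"
proof -
  obtain Z where Z: "zob Z" using zob_ex .
  obtain z where z: "ar Y Z z" using zero_ar[of Y Z] Z m by (metis zob_def ar_Ob(2))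
  show ?thesis
    by (rule S_mid[OF m z _ X S_zero[OF Z]]) (use i in \<open>auto simp: sur_def\<close>)
qed

text \<open>\<open>kerS\<close> and \<open>cokS\<close> quantify over all kernels and cokernels, so
  that none has to be chosen. A single kernel in \<open>S\<close> suffices because every other
  kernel embeds into it.\<close>

lemma kerSI:
  assumes f: "ar X Y f" and k: "ker X Y f N k" and N: "N \<in> S" shows "kerS X Y f"
  unfolding kerS_def
proof (intro allI impI)
  fix M j assume j: "ker X Y f M j"
  then have j': "ar M X j" "inj M j" by (auto simp: ker_def)
  obtain u where u: "ar M N u" "\<And>i x. i \<in> J \<Longrightarrow> x \<in> E M i \<Longrightarrow> k i (u i x) = j i x"
    using ker_lift[OF k j'(1)] ker_zero[OF j] by blast
  have "inj M u" unfolding inj_def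
    using u(2) j'(2) k ar_zero[of N X k] by (auto simp: inj_def ker_def) (metis zero_mem ar_Ob(1))
  then show "M \<in> S" using S_sub[OF u(1) _ N] by blast
qed

lemma cokSI:
  assumes f: "ar X Y f" and c: "cok X Y f N c" and N: "N \<in> S" shows "cokS X Y f"
  unfolding cokS_def
proof (intro allI impI)
  fix M d assume d: "cok X Y f M d"
  then have d': "ar Y M d" "sur Y M d" by (auto simp: cok_def)
  obtain u where u: "ar N M u" "\<And>i x. i \<in> J \<Longrightarrow> x \<in> E Y i \<Longrightarrow> u i (c i x) = d i x"
    using cok_descend[OF c d'(1)] cok_zero[OF d f] by blast
  have "ar Y N c" using c by (simp add: cok_def)
  then have "sur N M u" using u(2) d'(2) unfolding sur_def by (metis ar_mem)
  then show "M \<in> S" using S_quot[OF u(1) _ N] by blast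
qed

lemma serre_iso_iff:
  assumes "X \<in> Ob C" "Y \<in> Ob C" shows "serre_iso C S X Y s \<longleftrightarrow> qi X Y s"
proof (cases "ar X Y s")
  case True
  show ?thesis unfolding serre_iso_def qi_def is_kernel_iff[OF True] is_cokernel_iff[OF True]
    using True kerSI[OF True] cokSI[OF True] ker_ex[OF True] cok_ex[OF True]
    unfolding kerS_def cokS_def by (metis ar_def)
next
  case False
  then show ?thesis using assms by (auto simp: serre_iso_def qi_def ar_def)
qed

text \<open>On the kernel of \<open>g\<close> the map \<open>m\<close> is injective and lands in the
  kernel of \<open>f\<close>, so the former is a subobject of the latter.\<close>

lemma kerS_sub:
  assumes f: "ar X Y f" "kerS X Y f" and g: "ar T Z g" and m: "ar T X m"
    and *: "\<And>i x. i \<in> J \<Longrightarrow> x \<in> E T i \<Longrightarrow> g i x = 0 \<Longrightarrow> f i (m i x) = 0 \<and> (m i x = 0 \<longrightarrow> x = 0)"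
  shows "kerS T Z g"
proof -
  obtain A a where a: "ker T Z g A a" using ker_ex[OF g] .
  then have a': "ar A T a" "inj A a" by (auto simp: ker_def)
  obtain B b where b: "ker X Y f B b" using ker_ex[OF f(1)] .
  then have b': "ar B X b" "B \<in> S" using f by (auto simp: ker_def kerS_def)
  have z: "f i (Comp C A T X m a i x) = 0" if "i \<in> J" "x \<in> E A i" for i x
    using *[OF that(1) ar_mem[OF a'(1) that]] ker_zero[OF a that] that by simp
  obtain u where u: "ar A B u" "\<And>i x. i \<in> J \<Longrightarrow> x \<in> E A i \<Longrightarrow> b i (u i x) = m i (a i x)"
    using ker_lift[OF b ar_comp[OF a'(1) m] z] comp_app by metis
  have "inj A u" unfolding inj_def
  proof (intro ballI impI)
    fix i x assume i: "i \<in> J" "x \<in> E A i" "u i x = 0"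
    then have "m i (a i x) = 0" using u(2)[OF i(1,2)] ar_zero[OF b'(1)] by simp
    then have "a i x = 0" using *[OF i(1) ar_mem[OF a'(1) i(1,2)]] ker_zero[OF a i(1,2)] by blast
    then show "x = 0" using a'(2) i by (auto simp: inj_def)
  qed
  then show ?thesis using S_sub[OF u(1)] b'(2) kerSI[OF g a] by blast
qed

text \<open>Since \<open>c\<close> maps the image of \<open>f\<close> into the image of
  \<open>g\<close>, it induces a surjection from the cokernel of \<open>f\<close> onto that of
  \<open>g\<close>.\<close>

lemma cokS_quot:
  assumes f: "ar X Y f" "cokS X Y f" and c: "ar Y Y' c" "sur Y Y' c" and g: "ar T Y' g"
    and *: "\<And>i x. i \<in> J \<Longrightarrow> x \<in> E X i \<Longrightarrow> \<exists>y\<in>E T i. g i y = c i (f i x)"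
  shows "cokS T Y' g"
proof -
  obtain P p where p: "cok X Y f P p" using cok_ex[OF f(1)] .
  then have p': "ar Y P p" "P \<in> S" using f by (auto simp: cok_def cokS_def)
  obtain Q q where q: "cok T Y' g Q q" using cok_ex[OF g] .
  then have q': "ar Y' Q q" "sur Y' Q q" by (auto simp: cok_def)
  have z: "Comp C Y Y' Q q c i (f i x) = 0" if "i \<in> J" "x \<in> E X i" for i x
    using *[OF that] cok_zero[OF q g that(1)] comp_app[OF that(1) ar_mem[OF f(1) that]] by metis
  obtain u where u: "ar P Q u" "\<And>i x. i \<in> J \<Longrightarrow> x \<in> E Y i \<Longrightarrow> u i (p i x) = q i (c i x)"
    using cok_descend[OF p ar_comp[OF c(1) q'(1)] z] comp_app by metis
  have "sur P Q u" unfolding sur_def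
  proof (intro ballI)
    fix i y assume i: "i \<in> J" "y \<in> E Q i"
    then obtain x where x: "x \<in> E Y i" "q i (c i x) = y"
      using q'(2) c(2) ar_mem[OF c(1)] unfolding sur_def by metis
    then show "\<exists>x\<in>E P i. u i x = y" using u(2)[OF i(1) x(1)] ar_mem[OF p'(1) i(1) x(1)] by metis
  qed
  then show ?thesis using S_quot[OF u(1)] p'(2) cokSI[OF g q] by blast
qed

lemma kerS_inj:
  assumes f: "ar X Y f" "inj X f" shows "kerS X Y f"
proof -
  obtain N k where k: "ker X Y f N k" using ker_ex[OF f(1)] .
  then have k': "ar N X k" "inj N k" by (auto simp: ker_def)
  have "x = 0" if "i \<in> J" "x \<in> E N i" for i x
    using ker_zero[OF k that] ar_mem[OF k'(1) that] f(2) k'(2) that by (auto simp: inj_def)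
  then have "zob N" using k'(1) zero_mem[of N] by (auto simp: zob_def ar_def)
  then show ?thesis using S_zero kerSI[OF f(1) k] by blast
qed

lemma cokS_sur:
  assumes f: "ar X Y f" "sur X Y f" shows "cokS X Y f"
proof -
  obtain N c where c: "cok X Y f N c" using cok_ex[OF f(1)] .
  then have c': "ar Y N c" "sur Y N c" by (auto simp: cok_def)
  have "x = 0" if "i \<in> J" "x \<in> E N i" for i x
    using cok_zero[OF c f(1)] c'(2) f(2) that unfolding sur_def by metis
  then have "zob N" using c'(1) zero_mem[of N] by (auto simp: zob_def ar_def)
  then show ?thesis using S_zero cokSI[OF f(1) c] by blast
qed

lemma qi_bij: "ar X Y f \<Longrightarrow> inj X f \<Longrightarrow> sur X Y f \<Longrightarrow> qi X Y f"
  by (simp add: qi_def kerS_inj cokS_sur)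

lemma qi_id: "X \<in> Ob C \<Longrightarrow> qi X X (Id C X)"
  by (rule qi_bij) (auto simp: ar_id inj_def sur_def)

text \<open>The sequence ker s -> ker (t s) -> ker t is exact in the middle.\<close>

lemma kerS_comp:
  assumes s: "ar X Y s" "kerS X Y s" and t: "ar Y Z t" "kerS Y Z t"
  shows "kerS X Z (Comp C X Y Z t s)"
proof -
  let ?g = "Comp C X Y Z t s"
  have g: "ar X Z ?g" using ar_comp[OF s(1) t(1)] .
  obtain N k where k: "ker X Z ?g N k" using ker_ex[OF g] .
  then have k': "ar N X k" "inj N k" by (auto simp: ker_def)
  obtain A a where a: "ker X Y s A a" using ker_ex[OF s(1)] .
  then have a': "ar A X a" "inj A a" "A \<in> S" using s by (auto simp: ker_def kerS_def)
  obtain B b where b: "ker Y Z t B b" using ker_ex[OF t(1)] .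
  then have b': "ar B Y b" "inj B b" "B \<in> S" using t by (auto simp: ker_def kerS_def)
  have "?g i (a i x) = 0" if "i \<in> J" "x \<in> E A i" for i x
    using ar_mem[OF a'(1) that] ker_zero[OF a that] ar_zero[OF t(1)] that by simp
  then obtain u where u: "ar A N u" "\<And>i x. i \<in> J \<Longrightarrow> x \<in> E A i \<Longrightarrow> k i (u i x) = a i x"
    using ker_lift[OF k a'(1)] by metis
  have "t i (Comp C N X Y s k i x) = 0" if "i \<in> J" "x \<in> E N i" for i x
    using ar_mem[OF k'(1) that] ker_zero[OF k that] that by simp
  then obtain v where v: "ar N B v" "\<And>i x. i \<in> J \<Longrightarrow> x \<in> E N i \<Longrightarrow> b i (v i x) = s i (k i x)"
    using ker_lift[OF b ar_comp[OF k'(1) s(1)]] comp_app by metis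
  have "N \<in> S"
  proof (rule S_mid[OF u(1) v(1) _ a'(3) b'(3)])
    fix i y assume i: "i \<in> J" "y \<in> E N i" "v i y = 0"
    then have "s i (k i y) = 0" using v(2) ar_zero[OF b'(1)] by metis
    then obtain x where x: "x \<in> E A i" "a i x = k i y"
      using a ar_mem[OF k'(1)] i by (auto simp: ker_def exact_def)
    then have "u i x = y" using u(2) injD[OF k'] i ar_mem[OF u(1)] by metis
    then show "\<exists>x\<in>E A i. u i x = y" using x by blast
  qed
  then show ?thesis using kerSI[OF g k] by blast
qed

text \<open>The sequence coker s -> coker (t s) -> coker t is exact in the middle.\<close>

lemma cokS_comp:
  assumes s: "ar X Y s" "cokS X Y s" and t: "ar Y Z t" "cokS Y Z t"
  shows "cokS X Z (Comp C X Y Z t s)"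
proof -
  let ?g = "Comp C X Y Z t s"
  have g: "ar X Z ?g" using ar_comp[OF s(1) t(1)] .
  obtain R r where r: "cok X Z ?g R r" using cok_ex[OF g] .
  then have r': "ar Z R r" "sur Z R r" by (auto simp: cok_def)
  obtain P p where p: "cok X Y s P p" using cok_ex[OF s(1)] .
  then have p': "ar Y P p" "sur Y P p" "P \<in> S" using s by (auto simp: cok_def cokS_def)
  obtain Q q where q: "cok Y Z t Q q" using cok_ex[OF t(1)] .
  then have q': "ar Z Q q" "sur Z Q q" "Q \<in> S" using t by (auto simp: cok_def cokS_def)
  have "Comp C Y Z R r t i (s i x) = 0" if "i \<in> J" "x \<in> E X i" for i x
    using ar_mem[OF s(1) that] cok_zero[OF r g that] that by simp
  then obtain u where u: "ar P R u" "\<And>i x. i \<in> J \<Longrightarrow> x \<in> E Y i \<Longrightarrow> u i (p i x) = r i (t i x)"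
    using cok_descend[OF p ar_comp[OF t(1) r'(1)]] comp_app by metis
  have "q i (?g i x) = 0" if "i \<in> J" "x \<in> E X i" for i x
    using ar_mem[OF s(1) that] cok_zero[OF q t(1)] that by simp
  then obtain v where v: "ar R Q v" "\<And>i x. i \<in> J \<Longrightarrow> x \<in> E Z i \<Longrightarrow> v i (r i x) = q i x"
    using cok_descend[OF r q'(1)] by metis
  have "R \<in> S"
  proof (rule S_mid[OF u(1) v(1) _ p'(3) q'(3)])
    fix i y assume i: "i \<in> J" "y \<in> E R i" "v i y = 0"
    then obtain z where z: "z \<in> E Z i" "r i z = y" using r'(2) by (auto simp: sur_def)
    then have "q i z = 0" using v(2) i by metis
    then obtain x where x: "x \<in> E Y i" "t i x = z"
      using q z i by (auto simp: cok_def exact_def)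
    then have "u i (p i x) = y" using u(2) i z by metis
    then show "\<exists>x\<in>E P i. u i x = y" using ar_mem[OF p'(1) i(1) x(1)] by blast
  qed
  then show ?thesis using cokSI[OF g r] by blast
qed

lemma qi_comp: "qi X Y s \<Longrightarrow> qi Y Z t \<Longrightarrow> qi X Z (Comp C X Y Z t s)"
  by (simp add: qi_def kerS_comp cokS_comp ar_comp)

text \<open>The composite is passed as \<open>g\<close> to avoid rewriting composites into syntactic form.\<close>

lemma qi_cancel_left:
  assumes s: "ar X Y s" and t: "qi Y Z t" and g: "qi X Z g"
    and e: "\<And>i x. i \<in> J \<Longrightarrow> x \<in> E X i \<Longrightarrow> g i x = t i (s i x)"
  shows "qi X Y s"
proof -
  have t': "ar Y Z t" and g': "ar X Z g" using t g by (auto simp: qi_def)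
  have "kerS X Y s"
    by (rule kerS_sub[of X Z g, OF g' _ s ar_id]) (use g e s ar_zero[OF t'] in \<open>auto simp: qi_def ar_def\<close>)
  moreover have "cokS X Y s"
  proof -
    obtain R r where r: "cok X Z g R r" using cok_ex[OF g'] .
    then have r': "ar Z R r" "R \<in> S" using g by (auto simp: cok_def qi_def cokS_def)
    obtain P p where p: "cok X Y s P p" using cok_ex[OF s] .
    then have p': "ar Y P p" "sur Y P p" by (auto simp: cok_def)
    obtain B b where b: "ker Y Z t B b" using ker_ex[OF t'] .
    then have b': "ar B Y b" "B \<in> S" using t by (auto simp: ker_def kerS_def qi_def)
    have "Comp C Y Z R r t i (s i x) = 0" if "i \<in> J" "x \<in> E X i" for i x
      using ar_mem[OF s that] cok_zero[OF r g' that] e that by simp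
    then obtain u where u: "ar P R u" "\<And>i x. i \<in> J \<Longrightarrow> x \<in> E Y i \<Longrightarrow> u i (p i x) = r i (t i x)"
      using cok_descend[OF p ar_comp[OF t' r'(1)]] comp_app by metis
    \<comment> \<open>Part of the snake sequence: ker t -> coker s -> coker (t s) is exact in the
      middle.\<close>
    have "P \<in> S"
    proof (rule S_mid[OF ar_comp[OF b'(1) p'(1)] u(1) _ b'(2) r'(2)])
      fix i y assume i: "i \<in> J" "y \<in> E P i" "u i y = 0"
      then obtain z where z: "z \<in> E Y i" "p i z = y" using p'(2) by (auto simp: sur_def)
      then have "r i (t i z) = 0" using u(2) i by metis
      then obtain x where x: "x \<in> E X i" "g i x = t i z"
        using r z i ar_mem[OF t'] by (auto simp: cok_def exact_def)
      have sx: "s i x \<in> E Y i" using ar_mem[OF s] i x by blast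
      have "t i (z - s i x) = 0" using ar_diff[OF t' i(1) z(1) sx] x e[OF i(1)] by simp
      then obtain w where w: "w \<in> E B i" "b i w = z - s i x"
        using b i diff_mem[OF ar_Ob(1)[OF t'] i(1) z(1) sx] by (auto simp: ker_def exact_def)
      have "p i (b i w) = y" using w z ar_diff[OF p'(1) i(1) z(1) sx] cok_zero[OF p s i(1) x(1)] by simp
      then show "\<exists>x\<in>E B i. Comp C B Y P p b i x = y" using w(1) i(1) by (intro bexI[of _ w]) simp_all
    qed
    then show ?thesis using cokSI[OF s p] by blast
  qed
  ultimately show ?thesis using s by (simp add: qi_def)
qed

text \<open>Inverted morphisms are stable under pullback: the kernel of \<open>p\<close> embeds into
  the kernel of \<open>t\<close>, and the cokernel of \<open>p\<close> into the cokernel of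
  \<open>t\<close>. The elementwise description of the square is kept for \<open>Q_epi\<close> and
  \<open>Q_cokernel\<close>, where a mere commutative square would not do.\<close>

lemma ore_pullback:
  assumes f: "ar X Y f" and t: "qi W Y t"
  obtains V p q where "qi V X p" "ar V W q" "\<And>i v. i \<in> J \<Longrightarrow> v \<in> E V i \<Longrightarrow> f i (p i v) = t i (q i v)"
    "\<And>i x w. i \<in> J \<Longrightarrow> x \<in> E X i \<Longrightarrow> w \<in> E W i \<Longrightarrow> f i x = t i w \<Longrightarrow> \<exists>v\<in>E V i. p i v = x \<and> q i v = w"
    "\<And>i v. i \<in> J \<Longrightarrow> v \<in> E V i \<Longrightarrow> p i v = 0 \<Longrightarrow> q i v = 0 \<Longrightarrow> v = 0"
proof (rule pullback_ex[OF f qi_ar[OF t]])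
  have t': "ar W Y t" using t by (simp add: qi_def)
  fix V p q assume p: "ar V X p" and q: "ar V W q" and sq: "\<And>i v. i \<in> J \<Longrightarrow> v \<in> E V i \<Longrightarrow> f i (p i v) = t i (q i v)"
    and su: "\<And>i x w. i \<in> J \<Longrightarrow> x \<in> E X i \<Longrightarrow> w \<in> E W i \<Longrightarrow> f i x = t i w \<Longrightarrow> \<exists>v\<in>E V i. p i v = x \<and> q i v = w"
    and ji: "\<And>i v. i \<in> J \<Longrightarrow> v \<in> E V i \<Longrightarrow> p i v = 0 \<Longrightarrow> q i v = 0 \<Longrightarrow> v = 0"
  have "kerS V X p"
  proof (rule kerS_sub[of W Y t, OF t' _ p q])
    show "kerS W Y t" using t by (simp add: qi_def)
    fix i x assume i: "i \<in> J" "x \<in> E V i" "p i x = 0"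
    then show "t i (q i x) = 0 \<and> (q i x = 0 \<longrightarrow> x = 0)" using sq[OF i(1,2)] ji ar_zero[OF f] by metis
  qed
  moreover have "cokS V X p"
  proof -
    obtain P c where c: "cok V X p P c" using cok_ex[OF p] .
    then have c': "ar X P c" "sur X P c" by (auto simp: cok_def)
    obtain Q d where d: "cok W Y t Q d" using cok_ex[OF t'] .
    then have d': "ar Y Q d" "Q \<in> S" using t by (auto simp: cok_def qi_def cokS_def)
    have "Comp C X Y Q d f i (p i x) = 0" if "i \<in> J" "x \<in> E V i" for i x
      using ar_mem[OF p that] sq[OF that] cok_zero[OF d t' that(1) ar_mem[OF q that]] that by simp
    then obtain u where u: "ar P Q u" "\<And>i x. i \<in> J \<Longrightarrow> x \<in> E X i \<Longrightarrow> u i (c i x) = d i (f i x)"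
      using cok_descend[OF c ar_comp[OF f d'(1)]] comp_app by metis
    have "inj P u" unfolding inj_def
    proof (intro ballI impI)
      fix i y assume i: "i \<in> J" "y \<in> E P i" "u i y = 0"
      then obtain x where x: "x \<in> E X i" "c i x = y" using c'(2) by (auto simp: sur_def)
      then have "d i (f i x) = 0" using u(2) i by metis
      then obtain w where "w \<in> E W i" "t i w = f i x"
        using d ar_mem[OF f] x i by (auto simp: cok_def exact_def)
      then obtain v where "v \<in> E V i" "p i v = x" using su[OF i(1) x(1)] by metis
      then show "y = 0" using cok_zero[OF c p i(1)] x by auto
    qed
    then show ?thesis using S_sub[OF u(1)] d'(2) cokSI[OF p c] by blast
  qed
  ultimately have "qi V X p" using p by (simp add: qi_def)
  then show ?thesis by (rule that[OF _ q sq su ji])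
qed

lemma ore:
  assumes f: "ar X Y f" and t: "qi W Y t"
  obtains V p q where "qi V X p" "ar V W q" "\<forall>i\<in>J. \<forall>v\<in>E V i. f i (p i v) = t i (q i v)"
proof (rule ore_pullback[OF assms])
  fix V p q assume "qi V X p" "ar V W q" "\<And>i v. i \<in> J \<Longrightarrow> v \<in> E V i \<Longrightarrow> f i (p i v) = t i (q i v)"
  then show thesis using that by blast
qed

text \<open>The second half of the calculus of fractions. \<open>s\<close> is the kernel of f - g;
  its cokernel embeds into the kernel of \<open>t\<close>, because f - g takes values there.\<close>

lemma qi_equalize:
  assumes f: "ar X Y f" and g: "ar X Y g" and t: "qi Y Z t"
    and e: "\<And>i x. i \<in> J \<Longrightarrow> x \<in> E X i \<Longrightarrow> t i (f i x) = t i (g i x)"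
  obtains V s where "qi V X s" "\<And>i v. i \<in> J \<Longrightarrow> v \<in> E V i \<Longrightarrow> f i (s i v) = g i (s i v)"
proof -
  have t': "ar Y Z t" using t by (simp add: qi_def)
  obtain h where h: "ar X Y h" "\<And>i x. i \<in> J \<Longrightarrow> x \<in> E X i \<Longrightarrow> h i x = f i x - g i x"
    using diff_ar[OF f g] by metis
  obtain V s where s: "ker X Y h V s" using ker_ex[OF h(1)] .
  then have s': "ar V X s" "inj V s" by (auto simp: ker_def)
  have "cokS V X s"
  proof -
    obtain P c where c: "cok V X s P c" using cok_ex[OF s'(1)] .
    then have c': "ar X P c" "sur X P c" by (auto simp: cok_def)
    obtain B b where b: "ker Y Z t B b" using ker_ex[OF t'] .
    then have b': "ar B Y b" "B \<in> S" using t by (auto simp: ker_def kerS_def qi_def)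
    have "t i (h i x) = 0" if "i \<in> J" "x \<in> E X i" for i x
      using that h(2) e ar_diff[OF t'] ar_mem[OF f] ar_mem[OF g] by simp
    then obtain h' where h': "ar X B h'" "\<And>i x. i \<in> J \<Longrightarrow> x \<in> E X i \<Longrightarrow> b i (h' i x) = h i x"
      using ker_lift[OF b h(1)] by metis
    have hs: "h' i (s i x) = 0" if "i \<in> J" "x \<in> E V i" for i x
    proof -
      have "b i (h' i (s i x)) = 0" using h'(2) ker_zero[OF s] ar_mem[OF s'(1)] that by simp
      then show ?thesis using b ar_mem[OF h'(1)] ar_mem[OF s'(1)] that by (auto simp: ker_def inj_def)
    qed
    obtain u where u: "ar P B u" "\<And>i x. i \<in> J \<Longrightarrow> x \<in> E X i \<Longrightarrow> u i (c i x) = h' i x"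
      using cok_descend[OF c h'(1) hs] by metis
    have "inj P u" unfolding inj_def
    proof (intro ballI impI)
      fix i y assume i: "i \<in> J" "y \<in> E P i" "u i y = 0"
      then obtain x where x: "x \<in> E X i" "c i x = y" using c'(2) by (auto simp: sur_def)
      then have "h i x = 0" using u(2) h'(2) ar_zero[OF b'(1)] i by metis
      then obtain v where "v \<in> E V i" "s i v = x" using s x i by (auto simp: ker_def exact_def)
      then show "y = 0" using cok_zero[OF c s'(1) i(1)] x by auto
    qed
    then show ?thesis using S_sub[OF u(1)] b'(2) cokSI[OF s'(1) c] by blast
  qed
  then have "qi V X s" using s' kerS_inj by (simp add: qi_def)
  moreover have "f i (s i v) = g i (s i v)" if "i \<in> J" "v \<in> E V i" for i v
    using ker_zero[OF s that] h(2)[OF that(1) ar_mem[OF s'(1) that]] by simp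
  ultimately show ?thesis using that by blast
qed

section \<open>Morphisms of the quotient as classes of roofs\<close>

abbreviation "RR \<equiv> roof_rel C S"
abbreviation "D \<equiv> serre_quotient C S"

definition cls :: "'o \<Rightarrow> 'o \<Rightarrow> 'o \<Rightarrow> ('i \<Rightarrow> 'e \<Rightarrow> 'e) \<Rightarrow> ('i \<Rightarrow> 'e \<Rightarrow> 'e) \<Rightarrow> ('o \<times> ('i \<Rightarrow> 'e \<Rightarrow> 'e) \<times> ('i \<Rightarrow> 'e \<Rightarrow> 'e)) set" where
  "cls X Y Z s f = RR X Y `` {(Z, s, f)}"

lemma roofs_iff:
  assumes "X \<in> Ob C" "Y \<in> Ob C"
  shows "(Z, s, f) \<in> roofs C S X Y \<longleftrightarrow> qi Z X s \<and> ar Z Y f"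
  using assms by (auto simp: roofs_def serre_iso_iff ar_def)

lemma roof_relI:
  assumes s: "qi Z X s" and f: "ar Z Y f" and s': "qi Z' X s'" and f': "ar Z' Y f'"
    and u: "qi W Z u" and v: "ar W Z' v"
    and e: "\<And>i w. i \<in> J \<Longrightarrow> w \<in> E W i \<Longrightarrow> s i (u i w) = s' i (v i w)"
    and e': "\<And>i w. i \<in> J \<Longrightarrow> w \<in> E W i \<Longrightarrow> f i (u i w) = f' i (v i w)"
  shows "((Z, s, f), (Z', s', f')) \<in> RR X Y"
proof -
  have O: "X \<in> Ob C" "Y \<in> Ob C" "W \<in> Ob C" using s f u by (auto simp: qi_def ar_def)
  have as: "ar Z X s" "ar Z' X s'" "ar W Z u" using s s' u by (auto simp: qi_def)
  have "Comp C W Z X s u = Comp C W Z' X s' v"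
    by (rule ar_eqI[OF ar_comp[OF as(3,1)] ar_comp[OF v as(2)]]) (simp add: e)
  moreover have "Comp C W Z Y f u = Comp C W Z' Y f' v"
    by (rule ar_eqI[OF ar_comp[OF as(3) f] ar_comp[OF v f']]) (simp add: e')
  moreover have "serre_iso C S W X (Comp C W Z X s u)"
    using qi_comp[OF u s] O by (simp add: serre_iso_iff)
  moreover have "u \<in> Hom C W Z" "v \<in> Hom C W Z'" using as v by (auto simp: ar_def)
  ultimately have "\<exists>W\<in>Ob C. \<exists>u\<in>Hom C W Z. \<exists>v\<in>Hom C W Z'. serre_iso C S W X (Comp C W Z X s u) \<and>
      Comp C W Z X s u = Comp C W Z' X s' v \<and> Comp C W Z Y f u = Comp C W Z' Y f' v"
    using O(3) by blast
  then show ?thesis unfolding roof_rel_def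
    using O s f s' f' by (simp add: roofs_iff del: bex_simps)
qed

text \<open>The relation demands only that the common composite W -> X is inverted. Cancelling the
  denominators \<open>s\<close> and \<open>s'\<close> shows that both refinements \<open>u\<close>
  and \<open>v\<close> are inverted themselves.\<close>

lemma roof_relE:
  assumes r: "((Z, s, f), (Z', s', f')) \<in> RR X Y" and O: "X \<in> Ob C" "Y \<in> Ob C"
  obtains W u v where "qi W Z u" "qi W Z' v"
    "\<And>i w. i \<in> J \<Longrightarrow> w \<in> E W i \<Longrightarrow> s i (u i w) = s' i (v i w)"
    "\<And>i w. i \<in> J \<Longrightarrow> w \<in> E W i \<Longrightarrow> f i (u i w) = f' i (v i w)"
proof -
  have sf: "qi Z X s" "ar Z Y f" "qi Z' X s'" "ar Z' Y f'" using r O by (auto simp: roof_rel_def roofs_iff)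
  obtain W u v where W: "W \<in> Ob C" "u \<in> Hom C W Z" "v \<in> Hom C W Z'" "serre_iso C S W X (Comp C W Z X s u)"
    "Comp C W Z X s u = Comp C W Z' X s' v" "Comp C W Z Y f u = Comp C W Z' Y f' v"
    using r unfolding roof_rel_def by blast
  have uv: "ar W Z u" "ar W Z' v" using W sf by (auto simp: ar_def)
  have q: "qi W X (Comp C W Z X s u)" using W O by (simp add: serre_iso_iff)
  have e: "s i (u i w) = s' i (v i w)" "f i (u i w) = f' i (v i w)" if "i \<in> J" "w \<in> E W i" for i w
    using W(5,6) that by (metis comp_app)+
  have "qi W Z u" by (rule qi_cancel_left[OF uv(1) sf(1) q]) simp
  moreover have "qi W Z' v" by (rule qi_cancel_left[OF uv(2) sf(3) q]) (simp add: e)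
  ultimately show ?thesis using that e by blast
qed

lemma roof_rel_equiv:
  assumes O: "X \<in> Ob C" "Y \<in> Ob C"
  shows "equiv (roofs C S X Y) (RR X Y)"
proof (rule equivI)
  show "RR X Y \<subseteq> roofs C S X Y \<times> roofs C S X Y" by (auto simp: roof_rel_def)
  show "refl_on (roofs C S X Y) (RR X Y)"
  proof (rule refl_onI)
    fix r assume "r \<in> roofs C S X Y"
    moreover obtain Z s f where r: "r = (Z, s, f)" by (cases r)
    ultimately have sf: "qi Z X s" "ar Z Y f" using O by (auto simp: roofs_iff)
    then have Z: "Z \<in> Ob C" by (simp add: ar_def)
    show "(r, r) \<in> RR X Y" unfolding r
      by (rule roof_relI[OF sf sf qi_id[OF Z] ar_id[OF Z]]) auto
  qed
  show "sym (RR X Y)"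
  proof (rule symI)
    fix a b assume ab: "(a, b) \<in> RR X Y"
    obtain Z s f Z' s' f' where eq: "a = (Z, s, f)" "b = (Z', s', f')" by (cases a, cases b)
    have sf: "qi Z X s" "ar Z Y f" "qi Z' X s'" "ar Z' Y f'" using ab eq O by (auto simp: roof_rel_def roofs_iff)
    show "(b, a) \<in> RR X Y" using ab unfolding eq
    proof (rule roof_relE[OF _ O])
      fix W u v assume "qi W Z u" "qi W Z' v" and e: "\<And>i w. i \<in> J \<Longrightarrow> w \<in> E W i \<Longrightarrow> s i (u i w) = s' i (v i w)"
        "\<And>i w. i \<in> J \<Longrightarrow> w \<in> E W i \<Longrightarrow> f i (u i w) = f' i (v i w)"
      then show "((Z', s', f'), (Z, s, f)) \<in> RR X Y"
        by (intro roof_relI[OF sf(3,4,1,2)]) (auto simp: qi_def)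
    qed
  qed
  show "trans (RR X Y)"
  proof (rule transI)
    fix a b c assume ab: "(a, b) \<in> RR X Y" and bc: "(b, c) \<in> RR X Y"
    obtain Z1 s1 f1 Z2 s2 f2 Z3 s3 f3 where eq: "a = (Z1, s1, f1)" "b = (Z2, s2, f2)" "c = (Z3, s3, f3)"
      by (cases a, cases b, cases c)
    have sf: "qi Z1 X s1" "ar Z1 Y f1" "qi Z3 X s3" "ar Z3 Y f3" using ab bc eq O by (auto simp: roof_rel_def roofs_iff)
    show "(a, c) \<in> RR X Y" unfolding eq
      using ab[unfolded eq]
    proof (rule roof_relE[OF _ O])
      fix W u v assume u: "qi W Z1 u" "qi W Z2 v" and e: "\<And>i w. i \<in> J \<Longrightarrow> w \<in> E W i \<Longrightarrow> s1 i (u i w) = s2 i (v i w)"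
        "\<And>i w. i \<in> J \<Longrightarrow> w \<in> E W i \<Longrightarrow> f1 i (u i w) = f2 i (v i w)"
      show "((Z1, s1, f1), (Z3, s3, f3)) \<in> RR X Y" using bc[unfolded eq]
      proof (rule roof_relE[OF _ O])
        fix W' u' v' assume u': "qi W' Z2 u'" "qi W' Z3 v'" and e': "\<And>i w. i \<in> J \<Longrightarrow> w \<in> E W' i \<Longrightarrow> s2 i (u' i w) = s3 i (v' i w)"
          "\<And>i w. i \<in> J \<Longrightarrow> w \<in> E W' i \<Longrightarrow> f2 i (u' i w) = f3 i (v' i w)"
        \<comment> \<open>Transitivity: the two refinements meet in the middle roof and are
          completed there to an Ore square.\<close>
        obtain V p q where p: "qi V W p" and q: "ar V W' q" and sq: "\<forall>i\<in>J. \<forall>x\<in>E V i. v i (p i x) = u' i (q i x)"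
          using ore[OF qi_ar[OF u(2)] u'(1)] by metis
        have m: "p i x \<in> E W i" "q i x \<in> E W' i" if "i \<in> J" "x \<in> E V i" for i x
          using ar_mem[OF qi_ar[OF p] that] ar_mem[OF q that] by auto
        show ?thesis
          by (rule roof_relI[OF sf qi_comp[OF p u(1)] ar_comp[OF q qi_ar[OF u'(2)]]])
            (simp_all add: e e' m sq)
      qed
    qed
  qed
qed

lemma cls_eq_iff:
  assumes "qi Z X s" "ar Z Y f" "qi Z' X s'" "ar Z' Y f'"
  shows "cls X Y Z s f = cls X Y Z' s' f' \<longleftrightarrow> ((Z, s, f), (Z', s', f')) \<in> RR X Y"
proof -
  have O: "X \<in> Ob C" "Y \<in> Ob C" using assms by (auto simp: qi_def ar_def)
  show ?thesis unfolding cls_def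
    by (rule eq_equiv_class_iff[OF roof_rel_equiv[OF O]]) (use assms O in \<open>auto simp: roofs_iff\<close>)
qed

lemma clsI:
  assumes "qi Z X s" "ar Z Y f" "qi Z' X s'" "ar Z' Y f'" "qi W Z u" "ar W Z' v"
    "\<And>i w. i \<in> J \<Longrightarrow> w \<in> E W i \<Longrightarrow> s i (u i w) = s' i (v i w)"
    "\<And>i w. i \<in> J \<Longrightarrow> w \<in> E W i \<Longrightarrow> f i (u i w) = f' i (v i w)"
  shows "cls X Y Z s f = cls X Y Z' s' f'"
  using cls_eq_iff[OF assms(1-4)] roof_relI[OF assms] by blast

lemma clsE:
  assumes "cls X Y Z s f = cls X Y Z' s' f'" "qi Z X s" "ar Z Y f" "qi Z' X s'" "ar Z' Y f'"
  obtains W u v where "qi W Z u" "qi W Z' v"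
    "\<And>i w. i \<in> J \<Longrightarrow> w \<in> E W i \<Longrightarrow> s i (u i w) = s' i (v i w)"
    "\<And>i w. i \<in> J \<Longrightarrow> w \<in> E W i \<Longrightarrow> f i (u i w) = f' i (v i w)"
proof -
  have "((Z, s, f), (Z', s', f')) \<in> RR X Y" using cls_eq_iff[OF assms(2-)] assms(1) by blast
  moreover have "X \<in> Ob C" "Y \<in> Ob C" using assms by (auto simp: qi_def ar_def)
  ultimately show ?thesis by (rule roof_relE) (rule that)
qed

lemma Ob_D [simp]: "Ob D = Ob C" by (simp add: serre_quotient_def)

lemma Hom_D:
  assumes "X \<in> Ob C" "Y \<in> Ob C"
  shows "Hom D X Y = {cls X Y Z s f | Z s f. qi Z X s \<and> ar Z Y f}"
proof -
  have "Hom D X Y = {RR X Y `` {r} | r. r \<in> roofs C S X Y}"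
    by (auto simp: serre_quotient_def quotient_def)
  then show ?thesis unfolding cls_def using roofs_iff[OF assms] by auto
qed

lemma Hom_DI: "qi Z X s \<Longrightarrow> ar Z Y f \<Longrightarrow> cls X Y Z s f \<in> Hom D X Y"
  by (subst Hom_D) (auto simp: qi_def ar_def)

lemma Hom_DE:
  assumes "c \<in> Hom D X Y" "X \<in> Ob C" "Y \<in> Ob C"
  obtains Z s f where "c = cls X Y Z s f" "qi Z X s" "ar Z Y f"
  using assms by (auto simp: Hom_D)

lemma cls_mem:
  assumes "qi Z X s" "ar Z Y f"
  shows "(Z', s', f') \<in> cls X Y Z s f \<longleftrightarrow> qi Z' X s' \<and> ar Z' Y f' \<and> cls X Y Z' s' f' = cls X Y Z s f"
proof -
  have O: "X \<in> Ob C" "Y \<in> Ob C" using assms by (auto simp: qi_def ar_def)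
  have "(Z', s', f') \<in> cls X Y Z s f \<longleftrightarrow> ((Z, s, f), (Z', s', f')) \<in> RR X Y" by (simp add: cls_def)
  also have "\<dots> \<longleftrightarrow> qi Z' X s' \<and> ar Z' Y f' \<and> ((Z, s, f), (Z', s', f')) \<in> RR X Y"
    using O by (auto simp: roof_rel_def roofs_iff)
  finally show ?thesis using cls_eq_iff[OF assms] by metis
qed

text \<open>For fixed representatives the composite does not depend on the square that completes
  them: two completions are refined to a common one over \<open>Z\<close>.\<close>

lemma comp_half:
  assumes s: "qi Z X s" and f: "ar Z Y f" and t: "qi W Y t" and g: "ar W T g"
    and a: "qi V Z a" and b: "ar V W b" and ab: "\<And>i x. i \<in> J \<Longrightarrow> x \<in> E V i \<Longrightarrow> f i (a i x) = t i (b i x)"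
    and u: "qi P Z u" and v: "ar P W v" and uv: "\<And>i x. i \<in> J \<Longrightarrow> x \<in> E P i \<Longrightarrow> f i (u i x) = t i (v i x)"
  shows "cls X T V (Comp C V Z X s a) (Comp C V W T g b) = cls X T P (Comp C P Z X s u) (Comp C P W T g v)"
proof -
  obtain R p q where p: "qi R V p" and q: "ar R P q" and pq: "\<forall>i\<in>J. \<forall>x\<in>E R i. a i (p i x) = u i (q i x)"
    using ore[OF qi_ar[OF a] u] by metis
  have mp: "p i x \<in> E V i" "q i x \<in> E P i" if "i \<in> J" "x \<in> E R i" for i x
    using ar_mem[OF qi_ar[OF p] that] ar_mem[OF q that] by auto
  have "t i (Comp C R V W b p i x) = t i (Comp C R P W v q i x)" if "i \<in> J" "x \<in> E R i" for i x
    using that mp[OF that] ab uv pq by (metis comp_app)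
  \<comment> \<open>So far the two legs into \<open>W\<close> agree only after \<open>t\<close>; a
    further refinement makes them equal.\<close>
  then obtain R' r where r: "qi R' R r" and rr: "\<And>i x. i \<in> J \<Longrightarrow> x \<in> E R' i \<Longrightarrow>
      Comp C R V W b p i (r i x) = Comp C R P W v q i (r i x)"
    using qi_equalize[OF ar_comp[OF qi_ar[OF p] b] ar_comp[OF q v] t] by metis
  have mr: "r i x \<in> E R i" if "i \<in> J" "x \<in> E R' i" for i x using ar_mem[OF qi_ar[OF r] that] .
  show ?thesis
  proof (rule clsI[OF qi_comp[OF a s] ar_comp[OF b g] qi_comp[OF u s] ar_comp[OF v g]
        qi_comp[OF r p] ar_comp[OF qi_ar[OF r] q]])
    fix i w assume i: "i \<in> J" "w \<in> E R' i"
    note m = mr[OF i] mp[OF i(1) mr[OF i]]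
    show "Comp C V Z X s a i (Comp C R' R V p r i w) = Comp C P Z X s u i (Comp C R' R P q r i w)"
      using i m pq by simp
    show "Comp C V W T g b i (Comp C R' R V p r i w) = Comp C P W T g v i (Comp C R' R P q r i w)"
      using i m rr[OF i] by simp
  qed
qed

text \<open>Both roofs are replaced by common refinements \<open>U\<close> and \<open>Q\<close>, and
  one Ore square \<open>P\<close> over these completes either pair of representatives. By
  \<open>comp_half\<close> each composite equals the one computed with \<open>P\<close>, and there
  the two coincide.\<close>

lemma comp_welldef:
  assumes s1: "qi Z1 X s1" and f1: "ar Z1 Y f1" and t1: "qi W1 Y t1" and g1: "ar W1 T g1"
    and a1: "qi V1 Z1 a1" and b1: "ar V1 W1 b1" and ab1: "\<And>i x. i \<in> J \<Longrightarrow> x \<in> E V1 i \<Longrightarrow> f1 i (a1 i x) = t1 i (b1 i x)"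
    and s2: "qi Z2 X s2" and f2: "ar Z2 Y f2" and t2: "qi W2 Y t2" and g2: "ar W2 T g2"
    and a2: "qi V2 Z2 a2" and b2: "ar V2 W2 b2" and ab2: "\<And>i x. i \<in> J \<Longrightarrow> x \<in> E V2 i \<Longrightarrow> f2 i (a2 i x) = t2 i (b2 i x)"
    and e1: "cls X Y Z1 s1 f1 = cls X Y Z2 s2 f2" and e2: "cls Y T W1 t1 g1 = cls Y T W2 t2 g2"
  shows "cls X T V1 (Comp C V1 Z1 X s1 a1) (Comp C V1 W1 T g1 b1) = cls X T V2 (Comp C V2 Z2 X s2 a2) (Comp C V2 W2 T g2 b2)"
proof (rule clsE[OF e1 s1 f1 s2 f2])
  fix U u1 u2 assume u: "qi U Z1 u1" "qi U Z2 u2" and ue: "\<And>i x. i \<in> J \<Longrightarrow> x \<in> E U i \<Longrightarrow> s1 i (u1 i x) = s2 i (u2 i x)"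
    "\<And>i x. i \<in> J \<Longrightarrow> x \<in> E U i \<Longrightarrow> f1 i (u1 i x) = f2 i (u2 i x)"
  show ?thesis
  proof (rule clsE[OF e2 t1 g1 t2 g2])
    fix Q v1 v2 assume v: "qi Q W1 v1" "qi Q W2 v2" and ve: "\<And>i x. i \<in> J \<Longrightarrow> x \<in> E Q i \<Longrightarrow> t1 i (v1 i x) = t2 i (v2 i x)"
      "\<And>i x. i \<in> J \<Longrightarrow> x \<in> E Q i \<Longrightarrow> g1 i (v1 i x) = g2 i (v2 i x)"
    obtain P p q where p: "qi P U p" and q: "ar P Q q" and pq: "\<forall>i\<in>J. \<forall>x\<in>E P i. Comp C U Z1 Y f1 u1 i (p i x) = Comp C Q W1 Y t1 v1 i (q i x)"
      using ore[OF ar_comp[OF qi_ar[OF u(1)] f1] qi_comp[OF v(1) t1]] by metis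
    have m: "p i x \<in> E U i" "q i x \<in> E Q i" if "i \<in> J" "x \<in> E P i" for i x
      using ar_mem[OF qi_ar[OF p] that] ar_mem[OF q that] by auto
    have pq': "f1 i (u1 i (p i x)) = t1 i (v1 i (q i x))" if "i \<in> J" "x \<in> E P i" for i x
      using pq m[OF that] that by (metis comp_app)
    have h1: "cls X T V1 (Comp C V1 Z1 X s1 a1) (Comp C V1 W1 T g1 b1) =
        cls X T P (Comp C P Z1 X s1 (Comp C P U Z1 u1 p)) (Comp C P W1 T g1 (Comp C P Q W1 v1 q))"
      by (rule comp_half[OF s1 f1 t1 g1 a1 b1 ab1 qi_comp[OF p u(1)] ar_comp[OF q qi_ar[OF v(1)]]])
        (auto simp: pq')
    have h2: "cls X T V2 (Comp C V2 Z2 X s2 a2) (Comp C V2 W2 T g2 b2) =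
        cls X T P (Comp C P Z2 X s2 (Comp C P U Z2 u2 p)) (Comp C P W2 T g2 (Comp C P Q W2 v2 q))"
      by (rule comp_half[OF s2 f2 t2 g2 a2 b2 ab2 qi_comp[OF p u(2)] ar_comp[OF q qi_ar[OF v(2)]]])
        (use pq' ue ve m in \<open>auto\<close>)
    have "Comp C P Z1 X s1 (Comp C P U Z1 u1 p) = Comp C P Z2 X s2 (Comp C P U Z2 u2 p)"
      by (rule ar_eqI[OF ar_comp[OF ar_comp[OF qi_ar[OF p] qi_ar[OF u(1)]] qi_ar[OF s1]]
            ar_comp[OF ar_comp[OF qi_ar[OF p] qi_ar[OF u(2)]] qi_ar[OF s2]]]) (simp add: ue m)
    moreover have "Comp C P W1 T g1 (Comp C P Q W1 v1 q) = Comp C P W2 T g2 (Comp C P Q W2 v2 q)"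
      by (rule ar_eqI[OF ar_comp[OF ar_comp[OF q qi_ar[OF v(1)]] g1]
            ar_comp[OF ar_comp[OF q qi_ar[OF v(2)]] g2]]) (simp add: ve m)
    ultimately show ?thesis using h1 h2 by simp
  qed
qed

text \<open>In the definition of composition the union runs over a family with exactly one member:
  all members agree by \<open>comp_welldef\<close>, and the given square provides one.\<close>

lemma Comp_D:
  assumes s: "qi Z X s" and f: "ar Z Y f" and t: "qi W Y t" and g: "ar W T g"
    and a: "qi V Z a" and b: "ar V W b" and ab: "\<forall>i\<in>J. \<forall>x\<in>E V i. f i (a i x) = t i (b i x)"
  shows "Comp D X Y T (cls Y T W t g) (cls X Y Z s f) = cls X T V (Comp C V Z X s a) (Comp C V W T g b)"
    (is "_ = ?R")
proof -
  have O: "X \<in> Ob C" "Y \<in> Ob C" "T \<in> Ob C" using s f g by (auto simp: qi_def ar_def)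

  let ?A = "{RR X T `` {(V, Comp C V Z' X s' t', Comp C V W' T g' f'')}
       | V Z' s' f' W' tt g' t' f''.
         (Z', s', f') \<in> cls X Y Z s f \<and> (W', tt, g') \<in> cls Y T W t g \<and> V \<in> Ob C \<and> serre_iso C S V Z' t' \<and>
         f'' \<in> Hom C V W' \<and> Comp C V Z' Y f' t' = Comp C V W' Y tt f''}"
  have "Comp D X Y T (cls Y T W t g) (cls X Y Z s f) = \<Union>?A" by (simp add: serre_quotient_def)
  moreover have "?A = {?R}"
  proof (intro subset_antisym subsetI)
    fix A assume "A \<in> ?A"
    then obtain V' Z' s' f' W' t' g' a' b' where A: "A = cls X T V' (Comp C V' Z' X s' a') (Comp C V' W' T g' b')"
      and m: "(Z', s', f') \<in> cls X Y Z s f" "(W', t', g') \<in> cls Y T W t g"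
      and h: "V' \<in> Ob C" "serre_iso C S V' Z' a'" "b' \<in> Hom C V' W'" "Comp C V' Z' Y f' a' = Comp C V' W' Y t' b'"
      by (auto simp: cls_def)
    have m1: "qi Z' X s'" "ar Z' Y f'" "cls X Y Z' s' f' = cls X Y Z s f" using m(1) cls_mem[OF s f] by blast+
    have m2: "qi W' Y t'" "ar W' T g'" "cls Y T W' t' g' = cls Y T W t g" using m(2) cls_mem[OF t g] by blast+
    have a': "qi V' Z' a'" using h m1 by (auto simp: serre_iso_iff ar_def)
    have b': "ar V' W' b'" using h m2 by (auto simp: ar_def)
    have e: "f' i (a' i x) = t' i (b' i x)" if "i \<in> J" "x \<in> E V' i" for i x
      using h(4) that comp_app by metis
    show "A \<in> {?R}" unfolding A
      using comp_welldef[OF m1(1,2) m2(1,2) a' b' e s f t g a b ab[rule_format] m1(3) m2(3)] by simp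
  next
    fix A assume "A \<in> {?R}"
    moreover have "(Z, s, f) \<in> cls X Y Z s f" "(W, t, g) \<in> cls Y T W t g"
      using cls_mem[OF s f] cls_mem[OF t g] s f t g by auto
    moreover have "V \<in> Ob C" "serre_iso C S V Z a" "b \<in> Hom C V W" using a b f by (auto simp: serre_iso_iff ar_def)
    moreover have "Comp C V Z Y f a = Comp C V W Y t b"
      by (rule ar_eqI[OF ar_comp[OF qi_ar[OF a] f] ar_comp[OF b qi_ar[OF t]]]) (simp add: ab)
    ultimately show "A \<in> ?A" unfolding cls_def by blast
  qed
  ultimately show ?thesis by simp
qed

lemma Comp_D_hom:
  assumes c: "c \<in> Hom D X Y" and d: "d \<in> Hom D Y T" and O: "X \<in> Ob C" "Y \<in> Ob C" "T \<in> Ob C"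
  shows "Comp D X Y T d c \<in> Hom D X T"
proof -
  obtain Z s f where c: "c = cls X Y Z s f" "qi Z X s" "ar Z Y f" using Hom_DE[OF c O(1,2)] .
  obtain W t g where d: "d = cls Y T W t g" "qi W Y t" "ar W T g" using Hom_DE[OF d O(2,3)] .
  obtain V p q where v: "qi V Z p" "ar V W q" "\<forall>i\<in>J. \<forall>x\<in>E V i. f i (p i x) = t i (q i x)"
    using ore[OF c(3) d(2)] by metis
  show ?thesis unfolding c(1) d(1) Comp_D[OF c(2,3) d(2,3) v]
    by (rule Hom_DI[OF qi_comp[OF v(1) c(2)] ar_comp[OF v(2) d(3)]])
qed

text \<open>Three Ore squares lead to one roof \<open>P\<close> that computes both bracketings; what
  remains is associativity in \<open>C\<close>.\<close>

lemma Comp_D_assoc: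
  assumes c: "c \<in> Hom D X Y" and d: "d \<in> Hom D Y T" and e: "e \<in> Hom D T U"
    and O: "X \<in> Ob C" "Y \<in> Ob C" "T \<in> Ob C" "U \<in> Ob C"
  shows "Comp D X T U e (Comp D X Y T d c) = Comp D X Y U (Comp D Y T U e d) c"
proof -
  obtain Z s f where c: "c = cls X Y Z s f" "qi Z X s" "ar Z Y f" using Hom_DE[OF c O(1,2)] .
  obtain W t g where d: "d = cls Y T W t g" "qi W Y t" "ar W T g" using Hom_DE[OF d O(2,3)] .
  obtain R r h where e: "e = cls T U R r h" "qi R T r" "ar R U h" using Hom_DE[OF e O(3,4)] .
  obtain V p q where v: "qi V Z p" "ar V W q" "\<forall>i\<in>J. \<forall>x\<in>E V i. f i (p i x) = t i (q i x)"
    using ore[OF c(3) d(2)] by metis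
  obtain V' p' q' where v': "qi V' W p'" "ar V' R q'" "\<forall>i\<in>J. \<forall>x\<in>E V' i. g i (p' i x) = r i (q' i x)"
    using ore[OF d(3) e(2)] by metis
  obtain P a b where P: "qi P V a" "ar P V' b" "\<forall>i\<in>J. \<forall>x\<in>E P i. q i (a i x) = p' i (b i x)"
    using ore[OF v(2) v'(1)] by metis
  have m: "a i x \<in> E V i" "b i x \<in> E V' i" if "i \<in> J" "x \<in> E P i" for i x
    using ar_mem[OF qi_ar[OF P(1)] that] ar_mem[OF P(2) that] by auto
  have l: "Comp D X T U e (Comp D X Y T d c) =
      cls X U P (Comp C P V X (Comp C V Z X s p) a) (Comp C P R U h (Comp C P V' R q' b))"
    unfolding c(1) d(1) e(1) Comp_D[OF c(2,3) d(2,3) v]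
    by (rule Comp_D[OF qi_comp[OF v(1) c(2)] ar_comp[OF v(2) d(3)] e(2,3) P(1) ar_comp[OF P(2) v'(2)]])
      (simp add: m P(3) v'(3))
  have r: "Comp D X Y U (Comp D Y T U e d) c =
      cls X U P (Comp C P Z X s (Comp C P V Z p a)) (Comp C P V' U (Comp C V' R U h q') b)"
    unfolding c(1) d(1) e(1) Comp_D[OF d(2,3) e(2,3) v']
    by (rule Comp_D[OF c(2,3) qi_comp[OF v'(1) d(2)] ar_comp[OF v'(2) e(3)] qi_comp[OF P(1) v(1)] P(2)])
      (simp add: m P(3) v(3))
  have "Comp C P V X (Comp C V Z X s p) a = Comp C P Z X s (Comp C P V Z p a)"
    using c(2) v P by (intro ar_eqI[of P X]) (auto intro!: ar_comp[of P V] ar_comp[of P Z] ar_comp[of V Z] simp: qi_def m)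
  moreover have "Comp C P R U h (Comp C P V' R q' b) = Comp C P V' U (Comp C V' R U h q') b"
    using e(3) v' P by (intro ar_eqI[of P U]) (auto intro!: ar_comp[of P V'] ar_comp[of P R] ar_comp[of V' R] simp: qi_def m)
  ultimately show ?thesis unfolding l r by simp
qed

section \<open>The localisation functor, zero objects and zero morphisms\<close>

definition Q :: "'o \<Rightarrow> 'o \<Rightarrow> ('i \<Rightarrow> 'e \<Rightarrow> 'e) \<Rightarrow> ('o \<times> ('i \<Rightarrow> 'e \<Rightarrow> 'e) \<times> ('i \<Rightarrow> 'e \<Rightarrow> 'e)) set" where
  "Q X Y f = cls X Y X (Id C X) f"

lemma Q_hom: "ar X Y f \<Longrightarrow> Q X Y f \<in> Hom D X Y"
  unfolding Q_def by (rule Hom_DI) (auto simp: qi_id ar_def)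

lemma Id_D: "X \<in> Ob C \<Longrightarrow> Id D X = Q X X (Id C X)"
  by (simp add: serre_quotient_def Q_def cls_def)

lemma Comp_Q_left:
  assumes "qi Z X s" "ar Z Y f" "ar Y T g"
  shows "Comp D X Y T (Q Y T g) (cls X Y Z s f) = cls X T Z s (Comp C Z Y T g f)"
proof -
  have O: "Z \<in> Ob C" "Y \<in> Ob C" using assms by (auto simp: ar_def)
  have "Comp D X Y T (Q Y T g) (cls X Y Z s f) = cls X T Z (Comp C Z Z X s (Id C Z)) (Comp C Z Y T g f)"
    unfolding Q_def
    by (rule Comp_D[OF assms(1,2) qi_id[OF O(2)] assms(3) qi_id[OF O(1)] assms(2)])
      (use assms(2) in \<open>auto dest: ar_mem\<close>)
  moreover have "Comp C Z Z X s (Id C Z) = s"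
    by (rule ar_eqI[OF ar_comp[OF ar_id[OF O(1)]] ]) (use assms(1) in \<open>auto simp: qi_def\<close>)
  ultimately show ?thesis by simp
qed

lemma Comp_Q_right:
  assumes "ar X Y f" "qi W Y t" "ar W T g" "qi V X a" "ar V W b" "\<forall>i\<in>J. \<forall>x\<in>E V i. f i (a i x) = t i (b i x)"
  shows "Comp D X Y T (cls Y T W t g) (Q X Y f) = cls X T V a (Comp C V W T g b)"
proof -
  have X: "X \<in> Ob C" using assms by (auto simp: ar_def)
  have "Comp D X Y T (cls Y T W t g) (Q X Y f) = cls X T V (Comp C V X X (Id C X) a) (Comp C V W T g b)"
    unfolding Q_def by (rule Comp_D[OF qi_id[OF X] assms])
  moreover have "Comp C V X X (Id C X) a = a"
    using assms(4) by (intro ar_eqI[OF ar_comp[OF _ ar_id[OF X]]]) (auto simp: qi_def ar_mem)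
  ultimately show ?thesis by simp
qed

lemma Comp_Id_left: "c \<in> Hom D X Y \<Longrightarrow> X \<in> Ob C \<Longrightarrow> Y \<in> Ob C \<Longrightarrow> Comp D X Y Y (Id D Y) c = c"
proof -
  assume c: "c \<in> Hom D X Y" and O: "X \<in> Ob C" "Y \<in> Ob C"
  obtain Z s f where c: "c = cls X Y Z s f" "qi Z X s" "ar Z Y f" using Hom_DE[OF c O] .
  have "Comp C Z Y Y (Id C Y) f = f"
    using c(3) ar_mem[OF c(3)] by (intro ar_eqI[OF ar_comp[OF _ ar_id]]) (auto simp: O)
  then show ?thesis unfolding c(1) Id_D[OF O(2)] Comp_Q_left[OF c(2,3) ar_id[OF O(2)]] by simp
qed

lemma S_dom: "qi X Y s \<Longrightarrow> Y \<in> S \<Longrightarrow> X \<in> S"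
proof -
  assume s: "qi X Y s" and Y: "Y \<in> S"
  obtain N k where k: "ker X Y s N k" using ker_ex[OF qi_ar[OF s]] .
  show ?thesis
    by (rule S_mid[of N X k Y s]) (use k s Y in \<open>auto simp: ker_def exact_def qi_def kerS_def\<close>)
qed

lemma S_cod: "ar X Y s \<Longrightarrow> cokS X Y s \<Longrightarrow> X \<in> S \<Longrightarrow> Y \<in> S"
proof -
  assume s: "ar X Y s" "cokS X Y s" and X: "X \<in> S"
  obtain N c where c: "cok X Y s N c" using cok_ex[OF s(1)] .
  show ?thesis
    by (rule S_mid[of X Y s N c]) (use c s X in \<open>auto simp: cok_def exact_def cokS_def\<close>)
qed

text \<open>The cokernel of \<open>k\<close> is the image of \<open>f\<close>, a subobject of
  \<open>Y\<close>. This provides the refinements along which roofs through objects of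
  \<open>S\<close> become zero.\<close>

lemma qi_ker_into_S:
  assumes f: "ar X Y f" and Y: "Y \<in> S" and k: "ker X Y f N k"
  shows "qi N X k"
proof -
  have k': "ar N X k" "inj N k" using k by (auto simp: ker_def)
  obtain P c where c: "cok N X k P c" using cok_ex[OF k'(1)] .
  then have c': "ar X P c" "sur X P c" by (auto simp: cok_def)
  obtain u where u: "ar P Y u" "\<And>i x. i \<in> J \<Longrightarrow> x \<in> E X i \<Longrightarrow> u i (c i x) = f i x"
    using cok_descend[OF c f ker_zero[OF k]] by metis
  have "inj P u" unfolding inj_def
  proof (intro ballI impI)
    fix i y assume i: "i \<in> J" "y \<in> E P i" "u i y = 0"
    then obtain x where x: "x \<in> E X i" "c i x = y" using c'(2) by (auto simp: sur_def)
    then have "f i x = 0" using u(2) i by metis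
    then obtain n where "n \<in> E N i" "k i n = x" using k x i by (auto simp: ker_def exact_def)
    then show "y = 0" using cok_zero[OF c k'(1) i(1)] x by auto
  qed
  then have "cokS N X k" using S_sub[OF u(1)] Y cokSI[OF k'(1) c] by blast
  then show ?thesis using k' kerS_inj by (simp add: qi_def)
qed

definition zr :: "'o \<Rightarrow> 'o \<Rightarrow> 'i \<Rightarrow> 'e \<Rightarrow> 'e" where
  "zr X Y = (SOME z. ar X Y z \<and> (\<forall>i\<in>J. \<forall>x\<in>E X i. z i x = 0))"

lemma zr: assumes "X \<in> Ob C" "Y \<in> Ob C"
  shows "ar X Y (zr X Y)" "\<And>i x. i \<in> J \<Longrightarrow> x \<in> E X i \<Longrightarrow> zr X Y i x = 0"
proof -
  have "\<exists>z. ar X Y z \<and> (\<forall>i\<in>J. \<forall>x\<in>E X i. z i x = 0)" using zero_ar[OF assms] by metis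
  from someI_ex[OF this]
  show "ar X Y (zr X Y)" "\<And>i x. i \<in> J \<Longrightarrow> x \<in> E X i \<Longrightarrow> zr X Y i x = 0"
    unfolding zr_def by blast+
qed

abbreviation "zc X Y \<equiv> Q X Y (zr X Y)"

lemma cls_zero_iff:
  assumes s: "qi Z X s" and f: "ar Z Y f"
  shows "cls X Y Z s f = zc X Y \<longleftrightarrow> (\<exists>W u. qi W Z u \<and> (\<forall>i\<in>J. \<forall>w\<in>E W i. f i (u i w) = 0))"
proof
  have O: "X \<in> Ob C" "Y \<in> Ob C" using assms by (auto simp: qi_def ar_def)
  have i: "qi X X (Id C X)" using O by (simp add: qi_id)
  {
    assume e: "cls X Y Z s f = zc X Y"
    show "\<exists>W u. qi W Z u \<and> (\<forall>i\<in>J. \<forall>w\<in>E W i. f i (u i w) = 0)"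
    proof (rule clsE[OF e[unfolded Q_def] s f i zr(1)[OF O]])
      fix W u v assume "qi W Z u" and v: "qi W X v" and "\<And>i w. i \<in> J \<Longrightarrow> w \<in> E W i \<Longrightarrow> f i (u i w) = zr X Y i (v i w)"
      then show ?thesis using zr(2)[OF O] ar_mem[OF qi_ar[OF v]] by metis
    qed
  next
    assume "\<exists>W u. qi W Z u \<and> (\<forall>i\<in>J. \<forall>w\<in>E W i. f i (u i w) = 0)"
    then obtain W u where u: "qi W Z u" "\<forall>i\<in>J. \<forall>w\<in>E W i. f i (u i w) = 0" by blast
    show "cls X Y Z s f = zc X Y" unfolding Q_def
      using ar_mem[OF qi_ar[OF s]] ar_mem[OF qi_ar[OF u(1)]]
      by (intro clsI[OF s f i zr(1)[OF O] u(1) ar_comp[OF qi_ar[OF u(1)] qi_ar[OF s]]])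
        (auto simp: u(2) zr(2)[OF O])
  }
qed

lemma zero_object_D:
  assumes X: "X \<in> Ob C" shows "zero_object D X \<longleftrightarrow> X \<in> S"
proof
  assume "zero_object D X"
  moreover have "Q X X (Id C X) \<in> Hom D X X" "zc X X \<in> Hom D X X"
    using Q_hom ar_id zr(1) X by auto
  ultimately have "Q X X (Id C X) = zc X X" using X unfolding zero_object_def by auto
  then obtain W u where u: "qi W X u" "\<forall>i\<in>J. \<forall>w\<in>E W i. Id C X i (u i w) = 0"
    using cls_zero_iff[OF qi_id[OF X] ar_id[OF X]] unfolding Q_def by blast
  have u0: "u i w = 0" if "i \<in> J" "w \<in> E W i" for i w
    using u(2) ar_mem[OF qi_ar[OF u(1)] that] that by (metis id_app)
  \<comment> \<open>The identity of \<open>X\<close> vanishes along an inverted \<open>u\<close>, so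
    u = 0 and \<open>X\<close> is its own cokernel of \<open>u\<close>.\<close>
  have "cok W X u X (Id C X)"
    using u0 ar_id[OF X] zero_mem[of W] u(1) by (auto simp: cok_def sur_def exact_def qi_def ar_def)
  then show "X \<in> S" using u(1) by (auto simp: qi_def cokS_def)
next
  assume XS: "X \<in> S"
  have zz: "c = zc X Y" if Y: "Y \<in> Ob C" and c: "c \<in> Hom D X Y" for Y c
  proof -
    obtain Z s f where c: "c = cls X Y Z s f" "qi Z X s" "ar Z Y f" using Hom_DE[OF c X Y] .
    have Z: "Z \<in> S" using S_dom c XS by blast
    then have ZO: "Z \<in> Ob C" using S_Ob by blast
    \<comment> \<open>The kernel of the identity is a zero object; as \<open>Z\<close> lies in
      \<open>S\<close>, its inclusion is inverted, and it kills any numerator.\<close>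
    obtain N k where k: "ker Z Z (Id C Z) N k" using ker_ex[OF ar_id[OF ZO]] .
    then have k': "ar N Z k" by (simp add: ker_def)
    have "k i w = 0" if "i \<in> J" "w \<in> E N i" for i w
      using ker_zero[OF k that] ar_mem[OF k' that] that by simp
    then have "\<forall>i\<in>J. \<forall>w\<in>E N i. f i (k i w) = 0" using ar_zero[OF c(3)] by simp
    then show ?thesis unfolding c(1) cls_zero_iff[OF c(2,3)]
      using qi_ker_into_S[OF ar_id[OF ZO] Z k] by blast
  qed
  have zz': "c = zc Y X" if Y: "Y \<in> Ob C" and c: "c \<in> Hom D Y X" for Y c
  proof -
    obtain Z s f where c: "c = cls Y X Z s f" "qi Z Y s" "ar Z X f" using Hom_DE[OF c Y X] .
    obtain N k where k: "ker Z X f N k" using ker_ex[OF c(3)] .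
    show ?thesis unfolding c(1) cls_zero_iff[OF c(2,3)]
      using qi_ker_into_S[OF c(3) XS k] ker_zero[OF k] by blast
  qed
  show "zero_object D X" unfolding zero_object_def Ob_D
  proof (intro conjI ballI X)
    fix Y assume Y: "Y \<in> Ob C"
    show "\<exists>!f. f \<in> Hom D X Y" using zz[OF Y] Q_hom[OF zr(1)[OF X Y]] by blast
    show "\<exists>!f. f \<in> Hom D Y X" using zz'[OF Y] Q_hom[OF zr(1)[OF Y X]] by blast
  qed
qed

lemma zero_morphism_D:
  assumes O: "X \<in> Ob C" "Y \<in> Ob C"
  shows "zero_morphism D X Y c \<longleftrightarrow> c = zc X Y"
proof
  assume "zero_morphism D X Y c"
  then obtain Z g h where z: "zero_object D Z" "g \<in> Hom D X Z" "h \<in> Hom D Z Y" "c = Comp D X Z Y h g"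
    unfolding zero_morphism_def by blast
  then have ZO: "Z \<in> Ob C" by (simp add: zero_object_def)
  then have ZS: "Z \<in> S" using z zero_object_D by blast
  obtain V s f where g: "g = cls X Z V s f" "qi V X s" "ar V Z f" using Hom_DE[OF z(2) O(1) ZO] .
  obtain W t k where h: "h = cls Z Y W t k" "qi W Z t" "ar W Y k" using Hom_DE[OF z(3) ZO O(2)] .
  obtain P p q where p: "qi P V p" "ar P W q" "\<forall>i\<in>J. \<forall>x\<in>E P i. f i (p i x) = t i (q i x)"
    using ore[OF g(3) h(2)] by metis
  have c: "c = cls X Y P (Comp C P V X s p) (Comp C P W Y k q)"
    unfolding z(4) g(1) h(1) by (rule Comp_D[OF g(2,3) h(2,3) p])
  have WS: "W \<in> S" using S_dom h ZS by blast
  \<comment> \<open>\<open>W\<close> lies in \<open>S\<close>, so the kernel of \<open>q\<close> is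
    an inverted morphism, and the composite numerator vanishes along it.\<close>
  obtain N l where l: "ker P W q N l" using ker_ex[OF p(2)] .
  have "\<forall>i\<in>J. \<forall>w\<in>E N i. Comp C P W Y k q i (l i w) = 0"
    using ker_zero[OF l] ar_zero[OF h(3)] l ar_mem[of N P l] by (auto simp: ker_def)
  then show "c = zc X Y" unfolding c cls_zero_iff[OF qi_comp[OF p(1) g(2)] ar_comp[OF p(2) h(3)]]
    using qi_ker_into_S[OF p(2) WS l] by blast
next
  assume c: "c = zc X Y"
  obtain Z where Z: "zob Z" using zob_ex .
  then have ZO: "Z \<in> Ob C" by (simp add: zob_def)
  have i: "qi X X (Id C X)" "ar X Z (zr X Z)" using O ZO by (auto simp: qi_id zr)
  have "Comp D X Z Y (zc Z Y) (zc X Z) = cls X Y X (Id C X) (Comp C X Z Y (zr Z Y) (zr X Z))"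
    using Comp_Q_left[OF i zr(1)[OF ZO O(2)]] by (simp add: Q_def)
  also have "Comp C X Z Y (zr Z Y) (zr X Z) = zr X Y"
    using ar_mem[OF i(2)]
    by (intro ar_eqI[OF ar_comp[OF i(2) zr(1)] zr(1)]) (auto simp: zr(2) O ZO)
  finally have "c = Comp D X Z Y (zc Z Y) (zc X Z)" using c by (simp add: Q_def)
  moreover have "zero_object D Z" using S_zero[OF Z] zero_object_D[OF ZO] by blast
  moreover have "zc X Z \<in> Hom D X Z" "zc Z Y \<in> Hom D Z Y" using Q_hom zr(1) O ZO by auto
  ultimately show "zero_morphism D X Y c" unfolding zero_morphism_def by blast
qed

section \<open>Monomorphisms and cokernels in the quotient\<close>

lemma Q_mono:
  assumes m: "ar Y X m" "inj Y m" shows "monomorphism D Y X (Q Y X m)"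
  unfolding monomorphism_def Ob_D
proof (intro conjI ballI impI)
  show "Q Y X m \<in> Hom D Y X" using Q_hom[OF m(1)] .
  have Y: "Y \<in> Ob C" using m by (simp add: ar_def)
  fix T g h assume T: "T \<in> Ob C" and gh: "g \<in> Hom D T Y" "h \<in> Hom D T Y"
    and e: "Comp D T Y X (Q Y X m) g = Comp D T Y X (Q Y X m) h"
  obtain Z s f where g: "g = cls T Y Z s f" "qi Z T s" "ar Z Y f" using Hom_DE[OF gh(1) T Y] .
  obtain Z' s' f' where h: "h = cls T Y Z' s' f'" "qi Z' T s'" "ar Z' Y f'" using Hom_DE[OF gh(2) T Y] .
  have e': "cls T X Z s (Comp C Z Y X m f) = cls T X Z' s' (Comp C Z' Y X m f')"
    using e unfolding g(1) h(1) Comp_Q_left[OF g(2,3) m(1)] Comp_Q_left[OF h(2,3) m(1)] .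
  show "g = h" unfolding g(1) h(1)
  proof (rule clsE[OF e' g(2) ar_comp[OF g(3) m(1)] h(2) ar_comp[OF h(3) m(1)]])
    fix W u v assume u: "qi W Z u" and v: "qi W Z' v"
      and eq: "\<And>i w. i \<in> J \<Longrightarrow> w \<in> E W i \<Longrightarrow> s i (u i w) = s' i (v i w)"
       "\<And>i w. i \<in> J \<Longrightarrow> w \<in> E W i \<Longrightarrow> Comp C Z Y X m f i (u i w) = Comp C Z' Y X m f' i (v i w)"
    show "cls T Y Z s f = cls T Y Z' s' f'"
    proof (rule clsI[OF g(2,3) h(2,3) u qi_ar[OF v] eq(1)])
      fix i w assume i: "i \<in> J" "w \<in> E W i"
      have uv: "u i w \<in> E Z i" "v i w \<in> E Z' i" using ar_mem[OF qi_ar[OF u] i] ar_mem[OF qi_ar[OF v] i] .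
      have "m i (f i (u i w)) = m i (f' i (v i w))" using eq(2)[OF i] uv i by simp
      then show "f i (u i w) = f' i (v i w)"
        using injD[OF m i(1)] ar_mem[OF g(3) i(1) uv(1)] ar_mem[OF h(3) i(1) uv(2)] by blast
    qed
  qed
qed

text \<open>Restricting the roof to the kernel \<open>N\<close> of its numerator gives the zero
  morphism. Since the roof is a monomorphism, s k itself becomes zero in the quotient, that is,
  vanishes along some inverted u : W -> N. Then \<open>W\<close> is in \<open>S\<close>, hence so is
  \<open>N\<close>.\<close>

lemma mono_kerS:
  assumes mono: "monomorphism D Y X (cls Y X Z s f)" and s: "qi Z Y s" and f: "ar Z X f"
  shows "kerS Z X f"
proof -
  have O: "Y \<in> Ob C" "X \<in> Ob C" "Z \<in> Ob C" using s f by (auto simp: qi_def ar_def)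
  obtain N k where k: "ker Z X f N k" using ker_ex[OF f] .
  then have k': "ar N Z k" "inj N k" by (auto simp: ker_def)
  then have N: "N \<in> Ob C" by (simp add: ar_def)
  let ?sk = "Comp C N Z Y s k"
  have sk: "ar N Y ?sk" using ar_comp[OF k'(1) qi_ar[OF s]] .
  have 1: "Comp D N Y X (cls Y X Z s f) (Q N Y ?sk) = cls N X N (Id C N) (Comp C N Z X f k)"
    by (rule Comp_Q_right[OF sk s f qi_id[OF N] k'(1)]) simp
  have 2: "Comp D N Y X (cls Y X Z s f) (zc N Y) = cls N X N (Id C N) (Comp C N Z X f (zr N Z))"
    by (rule Comp_Q_right[OF zr(1)[OF N O(1)] s f qi_id[OF N] zr(1)[OF N O(3)]])
      (simp add: zr N O ar_zero[OF qi_ar[OF s]])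
  have "Comp C N Z X f k = Comp C N Z X f (zr N Z)"
    by (rule ar_eqI[OF ar_comp[OF k'(1) f] ar_comp[OF zr(1)[OF N O(3)] f]])
      (simp add: zr N O ker_zero[OF k] ar_zero[OF f])
  then have "Comp D N Y X (cls Y X Z s f) (Q N Y ?sk) = Comp D N Y X (cls Y X Z s f) (zc N Y)"
    using 1 2 by simp
  then have "Q N Y ?sk = zc N Y"
    using mono Q_hom[OF sk] Q_hom[OF zr(1)[OF N O(1)]] N unfolding monomorphism_def by simp
  then obtain W u where u: "qi W N u" and u0: "\<forall>i\<in>J. \<forall>w\<in>E W i. ?sk i (u i w) = 0"
    using cls_zero_iff[OF qi_id[OF N] sk] by (auto simp: Q_def)
  obtain A a where a: "ker W N u A a" using ker_ex[OF qi_ar[OF u]] .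
  then have a': "ar A W a" "A \<in> S" using u by (auto simp: ker_def qi_def kerS_def)
  obtain B b where b: "ker Z Y s B b" using ker_ex[OF qi_ar[OF s]] .
  then have b': "ar B Z b" "B \<in> S" using s by (auto simp: ker_def qi_def kerS_def)
  have mu: "u i w \<in> E N i" if "i \<in> J" "w \<in> E W i" for i w using ar_mem[OF qi_ar[OF u] that] .
  have "s i (Comp C W N Z k u i w) = 0" if "i \<in> J" "w \<in> E W i" for i w
    using u0 that mu[OF that] by (metis comp_app)
  then obtain v where v: "ar W B v" "\<And>i x. i \<in> J \<Longrightarrow> x \<in> E W i \<Longrightarrow> b i (v i x) = k i (u i x)"
    using ker_lift[OF b ar_comp[OF qi_ar[OF u] k'(1)]] comp_app by metis
  \<comment> \<open>ker u -> W -> ker s is exact in the middle, because \<open>k\<close> is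
    injective.\<close>
  have "W \<in> S"
  proof (rule S_mid[OF a'(1) v(1) _ a'(2) b'(2)])
    fix i y assume i: "i \<in> J" "y \<in> E W i" "v i y = 0"
    then have "k i (u i y) = 0" using v(2) ar_zero[OF b'(1)] by metis
    then have "u i y = 0" using k'(2) i mu by (auto simp: inj_def)
    then show "\<exists>x\<in>E A i. a i x = y" using a i by (auto simp: ker_def exact_def)
  qed
  then have "N \<in> S" using S_cod u by (auto simp: qi_def)
  then show ?thesis using kerSI[OF f k] by blast
qed

text \<open>Surjections remain epimorphisms. From equality after precomposition one has to find a
  refinement over \<open>Z\<close> itself: the fibre product \<open>P\<close> of the two
  denominators is cut down to the part \<open>K\<close> on which the numerators agree, and
  \<open>K\<close> is still large modulo \<open>S\<close> because it covers the image of
  \<open>W\<close> in \<open>Z\<close>.\<close>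

lemma Q_epi:
  assumes q: "ar X Z q" "sur X Z q" and T: "T \<in> Ob C" and uu: "u \<in> Hom D Z T" "u' \<in> Hom D Z T"
    and e: "Comp D X Z T u (Q X Z q) = Comp D X Z T u' (Q X Z q)"
  shows "u = u'"
proof -
  have O: "X \<in> Ob C" "Z \<in> Ob C" using q by (auto simp: ar_def)
  obtain A a f where u: "u = cls Z T A a f" "qi A Z a" "ar A T f" using Hom_DE[OF uu(1) O(2) T] .
  obtain B b g where u': "u' = cls Z T B b g" "qi B Z b" "ar B T g" using Hom_DE[OF uu(2) O(2) T] .
  obtain A' p1 q1 where A: "qi A' X p1" "ar A' A q1" "\<forall>i\<in>J. \<forall>x\<in>E A' i. q i (p1 i x) = a i (q1 i x)"
    using ore[OF q(1) u(2)] by metis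
  obtain B' p2 q2 where B: "qi B' X p2" "ar B' B q2" "\<forall>i\<in>J. \<forall>x\<in>E B' i. q i (p2 i x) = b i (q2 i x)"
    using ore[OF q(1) u'(2)] by metis
  have e: "cls X T A' p1 (Comp C A' A T f q1) = cls X T B' p2 (Comp C B' B T g q2)"
    using e unfolding u(1) u'(1) Comp_Q_right[OF q(1) u(2,3) A] Comp_Q_right[OF q(1) u'(2,3) B] .
  show ?thesis unfolding u(1) u'(1)
  proof (rule clsE[OF e A(1) ar_comp[OF A(2) u(3)] B(1) ar_comp[OF B(2) u'(3)]])
    fix W v w assume v: "qi W A' v" and w: "qi W B' w"
      and e1: "\<And>i x. i \<in> J \<Longrightarrow> x \<in> E W i \<Longrightarrow> p1 i (v i x) = p2 i (w i x)"
      and e2: "\<And>i x. i \<in> J \<Longrightarrow> x \<in> E W i \<Longrightarrow> Comp C A' A T f q1 i (v i x) = Comp C B' B T g q2 i (w i x)"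
    show "cls Z T A a f = cls Z T B b g"
    proof (rule ore_pullback[OF qi_ar[OF u(2)] u'(2)])
      fix P x y assume x: "qi P A x" and y: "ar P B y" and xy: "\<And>i z. i \<in> J \<Longrightarrow> z \<in> E P i \<Longrightarrow> a i (x i z) = b i (y i z)"
        and su: "\<And>i z t. i \<in> J \<Longrightarrow> z \<in> E A i \<Longrightarrow> t \<in> E B i \<Longrightarrow> a i z = b i t \<Longrightarrow> \<exists>v\<in>E P i. x i v = z \<and> y i v = t"
      have fx: "ar P T (Comp C P A T f x)" "ar P T (Comp C P B T g y)"
        using ar_comp[OF qi_ar[OF x] u(3)] ar_comp[OF y u'(3)] .
      obtain h where h: "ar P T h" "\<And>i z. i \<in> J \<Longrightarrow> z \<in> E P i \<Longrightarrow> h i z = f i (x i z) - g i (y i z)"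
        using diff_ar[OF fx] comp_app by metis
      obtain K k where k: "ker P T h K k" using ker_ex[OF h(1)] .
      then have k': "ar K P k" "inj K k" by (auto simp: ker_def)
      let ?xk = "Comp C K P A x k"
      let ?axk = "Comp C K A Z a ?xk"
      have xk: "ar K A ?xk" using ar_comp[OF k'(1) qi_ar[OF x]] .
      have axk: "ar K Z ?axk" using ar_comp[OF xk qi_ar[OF u(2)]] .
      have "kerS K A ?xk" using kerS_comp[OF k'(1) kerS_inj[OF k'] qi_ar[OF x]] x by (simp add: qi_def)
      then have "kerS K Z ?axk" using kerS_comp[OF xk _ qi_ar[OF u(2)]] u(2) by (simp add: qi_def)
      \<comment> \<open>An element of \<open>W\<close> supplies, through \<open>A'\<close> and
        \<open>B'\<close>, a compatible pair in \<open>P\<close> with equal numerators, hence an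
        element of \<open>K\<close> over its image in \<open>Z\<close>.\<close>
      moreover have "cokS K Z ?axk"
      proof (rule cokS_quot[OF _ _ q axk])
        show "ar W X (Comp C W A' X p1 v)" "cokS W X (Comp C W A' X p1 v)"
          using qi_comp[OF v A(1)] by (auto simp: qi_def)
        fix i z assume i: "i \<in> J" "z \<in> E W i"
        have mv: "v i z \<in> E A' i" "w i z \<in> E B' i" using ar_mem[OF qi_ar[OF v] i] ar_mem[OF qi_ar[OF w] i] .
        have mq: "q1 i (v i z) \<in> E A i" "q2 i (w i z) \<in> E B i"
          using ar_mem[OF A(2) i(1) mv(1)] ar_mem[OF B(2) i(1) mv(2)] .
        have ab: "a i (q1 i (v i z)) = q i (p1 i (v i z))" "b i (q2 i (w i z)) = q i (p1 i (v i z))"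
          using A(3)[rule_format, OF i(1) mv(1)] B(3)[rule_format, OF i(1) mv(2)] e1[OF i] by simp_all
        then obtain t where t: "t \<in> E P i" "x i t = q1 i (v i z)" "y i t = q2 i (w i z)"
          using su[OF i(1) mq] by auto
        have "f i (q1 i (v i z)) = g i (q2 i (w i z))" using e2[OF i] mv i by simp
        then have "h i t = 0" using h(2)[OF i(1) t(1)] t by simp
        then obtain n where n: "n \<in> E K i" "k i n = t" using k t i by (auto simp: ker_def exact_def)
        have "?axk i n = q i (Comp C W A' X p1 v i z)" using n t ab i ar_mem[OF k'(1)] by simp
        then show "\<exists>n\<in>E K i. ?axk i n = q i (Comp C W A' X p1 v i z)" using n by blast
      qed
      ultimately have "qi K Z ?axk" using axk by (simp add: qi_def)
      then have xkq: "qi K A ?xk" by (rule qi_cancel_left[OF xk u(2)]) simp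
      show ?thesis
      proof (rule clsI[OF u(2,3) u'(2,3) xkq ar_comp[OF k'(1) y]])
        fix i z assume i: "i \<in> J" "z \<in> E K i"
        show "a i (?xk i z) = b i (Comp C K P B y k i z)" using i xy ar_mem[OF k'(1) i] by simp
        show "f i (?xk i z) = g i (Comp C K P B y k i z)"
          using i ker_zero[OF k i] h(2)[OF i(1) ar_mem[OF k'(1) i]] by simp
      qed
    qed
  qed
qed

text \<open>The denominator \<open>s\<close> becomes invertible, so only the numerator matters, and
  the localisation preserves its cokernel. Uniqueness of the factorisation is
  \<open>Q_epi\<close>.\<close>

lemma Q_cokernel:
  assumes s: "qi A Y s" and f: "ar A X f" and q: "cok A X f Z q"
  shows "is_cokernel D Y X (cls Y X A s f) Z (Q X Z q)"
proof -
  have q': "ar X Z q" "sur X Z q" using q by (auto simp: cok_def)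
  have O: "X \<in> Ob C" "Y \<in> Ob C" "Z \<in> Ob C" "A \<in> Ob C" using s q' f by (auto simp: qi_def ar_def)
  show ?thesis unfolding is_cokernel_def Ob_D
  proof (intro conjI ballI impI)
    show "Z \<in> Ob C" using O by blast
    show "Q X Z q \<in> Hom D X Z" using Q_hom[OF q'(1)] .
    have "\<exists>W u. qi W A u \<and> (\<forall>i\<in>J. \<forall>w\<in>E W i. Comp C A X Z q f i (u i w) = 0)"
      using qi_id[OF O(4)] cok_zero[OF q f] by (intro exI[of _ A] exI[of _ "Id C A"]) simp
    then show "zero_morphism D Y Z (Comp D Y X Z (Q X Z q) (cls Y X A s f))"
      unfolding Comp_Q_left[OF s f q'(1)] zero_morphism_D[OF O(2,3)]
        cls_zero_iff[OF s ar_comp[OF f q'(1)]] .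
    fix T t assume T: "T \<in> Ob C" and tt: "t \<in> Hom D X T" and
      z: "zero_morphism D Y T (Comp D Y X T t (cls Y X A s f))"
    obtain W r h where t: "t = cls X T W r h" "qi W X r" "ar W T h" using Hom_DE[OF tt O(1) T] .
    have "\<exists>u. u \<in> Hom D Z T \<and> Comp D X Z T u (Q X Z q) = t"
    proof (rule ore_pullback[OF f t(2)])
      fix V p p' assume p: "qi V A p" and p': "ar V W p'" and sq: "\<And>i v. i \<in> J \<Longrightarrow> v \<in> E V i \<Longrightarrow> f i (p i v) = r i (p' i v)"
        and su: "\<And>i x w. i \<in> J \<Longrightarrow> x \<in> E A i \<Longrightarrow> w \<in> E W i \<Longrightarrow> f i x = r i w \<Longrightarrow> \<exists>v\<in>E V i. p i v = x \<and> p' i v = w"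
      have "Comp D Y X T t (cls Y X A s f) = cls Y T V (Comp C V A Y s p) (Comp C V W T h p')"
        unfolding t(1) by (rule Comp_D[OF s f t(2,3) p p']) (simp add: sq)
      then obtain V' j where j: "qi V' V j" and j0: "\<forall>i\<in>J. \<forall>w\<in>E V' i. Comp C V W T h p' i (j i w) = 0"
        using z zero_morphism_D[OF O(2) T] cls_zero_iff[OF qi_comp[OF p s] ar_comp[OF p' t(3)]] by auto
      have mj: "j i x \<in> E V i" if "i \<in> J" "x \<in> E V' i" for i x using ar_mem[OF qi_ar[OF j] that] .
      let ?l = "Comp C V' V W p' j"
      have l: "ar V' W ?l" using ar_comp[OF qi_ar[OF j] p'] .
      \<comment> \<open>The numerator \<open>h\<close> need not vanish on the part of
        \<open>W\<close> lying over the image of \<open>f\<close>, only on the image of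
        \<open>V'\<close>. It descends to the quotient \<open>W'\<close>, which serves as the apex
        of the factorising roof once W' -> Z is shown to be inverted.\<close>
      obtain W' c where c: "cok V' W ?l W' c" using cok_ex[OF l] .
      then have c': "ar W W' c" "sur W W' c" by (auto simp: cok_def)
      have "h i (?l i x) = 0" if "i \<in> J" "x \<in> E V' i" for i x using j0 that mj[OF that] by (metis comp_app)
      then obtain h' where h': "ar W' T h'" "\<And>i x. i \<in> J \<Longrightarrow> x \<in> E W i \<Longrightarrow> h' i (c i x) = h i x"
        using cok_descend[OF c t(3)] by metis
      have "Comp C W X Z q r i (?l i x) = 0" if "i \<in> J" "x \<in> E V' i" for i x
      proof -
        have "Comp C W X Z q r i (?l i x) = q i (f i (p i (j i x)))"
          using that mj[OF that] ar_mem[OF p'] sq by simp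
        then show ?thesis using cok_zero[OF q f that(1)] ar_mem[OF qi_ar[OF p] that(1) mj[OF that]] by simp
      qed
      then obtain s' where s': "ar W' Z s'" "\<And>i x. i \<in> J \<Longrightarrow> x \<in> E W i \<Longrightarrow> s' i (c i x) = q i (r i x)"
        using cok_descend[OF c ar_comp[OF qi_ar[OF t(2)] q'(1)]] comp_app by metis
      have "cokS W' Z s'"
      proof (rule cokS_quot[OF qi_ar[OF t(2)] _ q' s'(1)])
        show "cokS W X r" using t(2) by (simp add: qi_def)
        fix i x assume i: "i \<in> J" "x \<in> E W i"
        then show "\<exists>y\<in>E W' i. s' i y = q i (r i x)" using s'(2)[OF i] ar_mem[OF c'(1) i] by blast
      qed
      moreover have "kerS W' Z s'"
      proof -
        obtain N n where n: "ker W' Z s' N n" using ker_ex[OF s'(1)] .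
        then have n': "ar N W' n" "inj N n" by (auto simp: ker_def)
        have "s' i (Comp C V W W' c p' i v) = 0" if "i \<in> J" "v \<in> E V i" for i v
          using that s'(2) ar_mem[OF p' that] sq[OF that, symmetric] cok_zero[OF q f that(1)] ar_mem[OF qi_ar[OF p] that] by simp
        then obtain e where e: "ar V N e" "\<And>i x. i \<in> J \<Longrightarrow> x \<in> E V i \<Longrightarrow> n i (e i x) = c i (p' i x)"
          using ker_lift[OF n ar_comp[OF p' c'(1)]] comp_app by metis
        obtain P d where d: "cok V' V j P d" using cok_ex[OF qi_ar[OF j]] .
        then have d': "ar V P d" "P \<in> S" using j by (auto simp: cok_def qi_def cokS_def)
        have "e i (j i x) = 0" if "i \<in> J" "x \<in> E V' i" for i x
        proof -
          have "n i (e i (j i x)) = 0" using e(2)[OF that(1) mj[OF that]] cok_zero[OF c l that] that by simp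
          then show ?thesis using n'(2) ar_mem[OF e(1) that(1) mj[OF that]] that by (auto simp: inj_def)
        qed
        then obtain e' where e': "ar P N e'" "\<And>i x. i \<in> J \<Longrightarrow> x \<in> E V i \<Longrightarrow> e' i (d i x) = e i x"
          using cok_descend[OF d e(1)] by metis
        \<comment> \<open>The kernel \<open>N\<close> of W' -> Z consists of classes of elements of
          \<open>W\<close> lying over the image of \<open>f\<close>, hence coming from the fibre
          product \<open>V\<close>. As \<open>V'\<close> maps to zero, \<open>N\<close> is a
          quotient of the cokernel of V' -> V.\<close>
        have "sur P N e'" unfolding sur_def
        proof (intro ballI)
          fix i y assume i: "i \<in> J" "y \<in> E N i"
          then obtain w where w: "w \<in> E W i" "c i w = n i y" using c'(2) ar_mem[OF n'(1)] by (metis sur_def)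
          then have "q i (r i w) = 0" using s'(2)[OF i(1) w(1)] ker_zero[OF n i] by simp
          then obtain x where x: "x \<in> E A i" "f i x = r i w"
            using q ar_mem[OF qi_ar[OF t(2)] i(1) w(1)] i by (auto simp: cok_def exact_def)
          then obtain v where v: "v \<in> E V i" "p' i v = w" using su[OF i(1) x(1) w(1)] by auto
          then have "n i (e i v) = n i y" using e(2)[OF i(1) v(1)] w by simp
          then have "e i v = y" using injD[OF n' i(1) ar_mem[OF e(1) i(1) v(1)] i(2)] by blast
          then show "\<exists>x\<in>E P i. e' i x = y" using e'(2)[OF i(1) v(1)] ar_mem[OF d'(1) i(1) v(1)] by blast
        qed
        then show ?thesis using S_quot[OF e'(1)] d'(2) kerSI[OF s'(1) n] by blast
      qed
      ultimately have qs: "qi W' Z s'" using s' by (simp add: qi_def)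
      have "Comp D X Z T (cls Z T W' s' h') (Q X Z q) = cls X T W r (Comp C W W' T h' c)"
        by (rule Comp_Q_right[OF q'(1) qs h'(1) t(2) c'(1)]) (simp add: s')
      also have "Comp C W W' T h' c = h"
        by (rule ar_eqI[OF ar_comp[OF c'(1) h'(1)] t(3)]) (simp add: h')
      finally show ?thesis using Hom_DI[OF qs h'(1)] t(1) by metis
    qed
    then show "\<exists>!u. u \<in> Hom D Z T \<and> Comp D X Z T u (Q X Z q) = t"
      using Q_epi[OF q' T] by blast
  qed
qed

section \<open>Simple objects and length modulo a Serre class\<close>

definition ssim :: "'o \<Rightarrow> bool" where
  "ssim Z \<longleftrightarrow> Z \<in> Ob C \<and> Z \<notin> S \<and> (\<forall>Y m. ar Y Z m \<longrightarrow> inj Y m \<longrightarrow> Y \<in> S \<or> cokS Y Z m)"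

lemma qi_isomorphism:
  assumes s: "qi A Y s" and f: "qi A Z f" shows "isomorphism D Y Z (cls Y Z A s f)"
proof -
  have O: "Y \<in> Ob C" "Z \<in> Ob C" "A \<in> Ob C" using s f by (auto simp: qi_def ar_def)
  have a: "ar A A (Id C A)" "qi A A (Id C A)" using O by (auto simp: ar_id qi_id)
  have *: "Comp D Y' Z' Y' (cls Z' Y' A f' s') (cls Y' Z' A s' f') = Id D Y'"
    if s: "qi A Y' s'" and f: "qi A Z' f'" for Y' Z' s' f'
  proof -
    have O': "Y' \<in> Ob C" "Z' \<in> Ob C" using s f by (auto simp: qi_def ar_def)
    have "Comp D Y' Z' Y' (cls Z' Y' A f' s') (cls Y' Z' A s' f') =
       cls Y' Y' A (Comp C A A Y' s' (Id C A)) (Comp C A A Y' s' (Id C A))"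
      by (rule Comp_D[OF s qi_ar[OF f] f qi_ar[OF s] a(2,1)]) simp
    also have "\<dots> = Q Y' Y' (Id C Y')" unfolding Q_def
      using ar_mem[OF qi_ar[OF s]]
      by (intro clsI[OF qi_comp[OF a(2) s] qi_ar[OF qi_comp[OF a(2) s]] qi_id[OF O'(1)] ar_id[OF O'(1)] a(2) qi_ar[OF s]])
        (auto)
    finally show ?thesis using Id_D[OF O'(1)] by simp
  qed
  show ?thesis unfolding isomorphism_def
    using *[OF s f] *[OF f s] Hom_DI[OF s qi_ar[OF f]] Hom_DI[OF f qi_ar[OF s]] by blast
qed

text \<open>A monomorphism of the quotient comes from a roof whose numerator is injective modulo
  \<open>S\<close>. The image of the numerator is a genuine subobject of \<open>Z\<close>, and the
  dichotomy in \<open>ssim\<close> decides between zero and isomorphism.\<close>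

lemma ssim_simple: assumes Z: "ssim Z" shows "simple_object D Z"
  unfolding simple_object_def Ob_D
proof (intro conjI ballI allI impI)
  show ZO: "Z \<in> Ob C" and "\<not> zero_object D Z" using Z zero_object_D by (auto simp: ssim_def)
  fix Y m assume Y: "Y \<in> Ob C" and m: "monomorphism D Y Z m"
  then obtain A s f where c: "m = cls Y Z A s f" "qi A Y s" "ar A Z f"
    using Hom_DE[OF _ Y ZO] unfolding monomorphism_def by metis
  have kf: "kerS A Z f" using mono_kerS m c by blast
  obtain N k e where k: "ar N Z k" "inj N k" and e: "ar A N e" "sur A N e"
    and ke: "\<And>i x. i \<in> J \<Longrightarrow> x \<in> E A i \<Longrightarrow> k i (e i x) = f i x" using image_factor[OF c(3)] by metis
  have "kerS A N e"
    by (rule kerS_sub[OF c(3) kf e(1) ar_id[OF ar_Ob(1)[OF e(1)]]]) (use ke ar_zero[OF k(1)] in \<open>auto simp flip: ke\<close>)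
  then have qe: "qi A N e" using e cokS_sur by (simp add: qi_def)
  consider "N \<in> S" | "cokS N Z k" using Z k by (auto simp: ssim_def)
  then show "zero_object D Y \<or> isomorphism D Y Z m"
  proof cases
    case 1
    then have "A \<in> S" using S_dom qe by blast
    then have "Y \<in> S" using S_cod c(2) by (auto simp: qi_def)
    then show ?thesis using zero_object_D Y by blast
  next
    case 2
    have "cokS A Z f"
    proof (rule cokS_quot[OF k(1) 2 ar_id[OF ZO] _ c(3)])
      show "sur Z Z (Id C Z)" by (auto simp: sur_def)
      fix i x assume i: "i \<in> J" "x \<in> E N i"
      then obtain a where "a \<in> E A i" "e i a = x" using e(2) by (auto simp: sur_def)
      then show "\<exists>y\<in>E A i. f i y = Id C Z i (k i x)" using ke i ar_mem[OF k(1) i] by (intro bexI[of _ a]) auto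
    qed
    then have "qi A Z f" using kf c by (simp add: qi_def)
    then show ?thesis using qi_isomorphism[OF c(2)] c(1) by blast
  qed
qed

text \<open>Spelled out with roofs, a right inverse says that some inverted \<open>v\<close> into
  \<open>Z\<close> factors through \<open>w\<close>; hence the cokernel of \<open>w\<close> is a
  quotient of that of \<open>v\<close>.\<close>

lemma right_inverse_cokS:
  assumes w: "ar W Z w" and d: "d \<in> Hom D Z W" and e: "Comp D Z W Z (Q W Z w) d = Id D Z"
  shows "cokS W Z w"
proof -
  have O: "W \<in> Ob C" "Z \<in> Ob C" using w by (auto simp: ar_def)
  obtain B t g where d: "d = cls Z W B t g" "qi B Z t" "ar B W g" using Hom_DE[OF d O(2,1)] .
  have e': "cls Z Z B t (Comp C B W Z w g) = cls Z Z Z (Id C Z) (Id C Z)"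
    using e Comp_Q_left[OF d(2,3) w] Id_D[OF O(2)] unfolding d(1) by (simp add: Q_def[of Z Z])
  show ?thesis
  proof (rule clsE[OF e' d(2) ar_comp[OF d(3) w] qi_id[OF O(2)] ar_id[OF O(2)]])
    fix R u v assume u: "qi R B u" and v: "qi R Z v" and
      uv: "\<And>i x. i \<in> J \<Longrightarrow> x \<in> E R i \<Longrightarrow> Comp C B W Z w g i (u i x) = Id C Z i (v i x)"
    show ?thesis
    proof (rule cokS_quot[OF qi_ar[OF v] _ ar_id[OF O(2)] _ w])
      show "cokS R Z v" using v by (simp add: qi_def)
      show "sur Z Z (Id C Z)" by (auto simp: sur_def)
      fix i x assume i: "i \<in> J" "x \<in> E R i"
      have "u i x \<in> E B i" using ar_mem[OF qi_ar[OF u] i] .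
      then show "\<exists>y\<in>E W i. w i y = Id C Z i (v i x)"
        using uv[OF i] i ar_mem[OF d(3)] by (intro bexI[of _ "g i (u i x)"]) auto
    qed
  qed
qed

text \<open>The simple cokernel \<open>T\<close> in a composition series is known only by its
  universal property. It is matched with the cokernel \<open>Z\<close> formed in \<open>C\<close>
  through \<open>a\<close> and \<open>b\<close>; a subobject \<open>w\<close> of \<open>Z\<close>
  then becomes a monomorphism into \<open>T\<close>, and simplicity of \<open>T\<close> is read back
  as a statement in \<open>C\<close>.\<close>

lemma simple_cokernel:
  assumes s: "qi A Y s" and f: "ar A X f" and q: "cok A X f Z q"
    and c: "is_cokernel D Y X (cls Y X A s f) T c" and T: "simple_object D T"
    and w: "ar W Z w" "inj W w"
  shows "W \<in> S \<or> cokS W Z w"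
proof -
  let ?m = "cls Y X A s f"
  have q': "ar X Z q" "sur X Z q" using q by (auto simp: cok_def)
  have O: "X \<in> Ob C" "Y \<in> Ob C" "Z \<in> Ob C" "W \<in> Ob C" using s q' f w by (auto simp: qi_def ar_def)
  have TO: "T \<in> Ob C" using T by (simp add: simple_object_def)
  have q2: "is_cokernel D Y X ?m Z (Q X Z q)" by (rule Q_cokernel[OF s f q])
  have qh: "Q X Z q \<in> Hom D X Z" and qz: "zero_morphism D Y Z (Comp D Y X Z (Q X Z q) ?m)"
    and qu: "\<And>t R. R \<in> Ob C \<Longrightarrow> t \<in> Hom D X R \<Longrightarrow> zero_morphism D Y R (Comp D Y X R t ?m) \<Longrightarrow>
      \<exists>!u. u \<in> Hom D Z R \<and> Comp D X Z R u (Q X Z q) = t"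
    using q2 unfolding is_cokernel_def Ob_D by blast+
  have ch: "c \<in> Hom D X T" and cz: "zero_morphism D Y T (Comp D Y X T c ?m)"
    and cu: "\<And>t R. R \<in> Ob C \<Longrightarrow> t \<in> Hom D X R \<Longrightarrow> zero_morphism D Y R (Comp D Y X R t ?m) \<Longrightarrow>
      \<exists>!u. u \<in> Hom D T R \<and> Comp D X T R u c = t"
    using c unfolding is_cokernel_def Ob_D by blast+
  obtain a where a: "a \<in> Hom D T Z" "Comp D X T Z a c = Q X Z q" using cu[OF O(3) qh qz] by blast
  obtain b where b: "b \<in> Hom D Z T" "Comp D X Z T b (Q X Z q) = c" using qu[OF TO ch cz] by blast
  have ab: "Comp D Z T Z a b = Id D Z"
  proof -
    have "Comp D X Z Z (Comp D Z T Z a b) (Q X Z q) = Q X Z q"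
      using Comp_D_assoc[OF qh b(1) a(1)] O TO a b by simp
    moreover have "Comp D X Z Z (Id D Z) (Q X Z q) = Q X Z q" using Comp_Id_left[OF qh] O by simp
    moreover have "Id D Z \<in> Hom D Z Z" using Q_hom[OF ar_id[OF O(3)]] Id_D[OF O(3)] by simp
    ultimately show ?thesis using qu[OF O(3) qh qz] Comp_D_hom[OF b(1) a(1)] O TO by blast
  qed
  have qw: "Q W Z w \<in> Hom D W Z" using Q_hom[OF w(1)] .
  let ?th = "Comp D W Z T b (Q W Z w)"
  have th: "?th \<in> Hom D W T" using Comp_D_hom[OF qw b(1)] O TO by blast
  have ath: "Comp D W T Z a ?th = Q W Z w"
    using Comp_D_assoc[OF qw b(1) a(1)] O TO ab Comp_Id_left[OF qw] by simp
  have "monomorphism D W T ?th" unfolding monomorphism_def Ob_D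
  proof (intro conjI ballI impI th)
    fix R g h assume R: "R \<in> Ob C" and gh: "g \<in> Hom D R W" "h \<in> Hom D R W" "Comp D R W T ?th g = Comp D R W T ?th h"
    have *: "Comp D R T Z a (Comp D R W T ?th k) = Comp D R W Z (Q W Z w) k" if "k \<in> Hom D R W" for k
      using Comp_D_assoc[OF that th a(1)] O TO R ath by simp
    have "Comp D R W Z (Q W Z w) g = Comp D R W Z (Q W Z w) h" using *[OF gh(1)] *[OF gh(2)] gh(3) by simp
    then show "g = h" using Q_mono[OF w] gh R unfolding monomorphism_def by simp
  qed
  then consider "zero_object D W" | "isomorphism D W T ?th" using T O unfolding simple_object_def by auto
  then show ?thesis
  proof cases
    case 1 then show ?thesis using zero_object_D O by blast
  next
    case 2
    then obtain g where g: "g \<in> Hom D T W" "Comp D T W T ?th g = Id D T" unfolding isomorphism_def by blast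
    have gb: "Comp D Z T W g b \<in> Hom D Z W" using Comp_D_hom[OF b(1) g(1)] O TO by blast
    have "Comp D Z W Z (Q W Z w) (Comp D Z T W g b) = Comp D Z T Z a (Comp D Z W T ?th (Comp D Z T W g b))"
      using Comp_D_assoc[OF gb th a(1)] O TO ath by simp
    also have "Comp D Z W T ?th (Comp D Z T W g b) = b"
      using Comp_D_assoc[OF b(1) g(1) th] O TO g Comp_Id_left[OF b(1)] by simp
    finally show ?thesis using right_inverse_cokS[OF w(1) gb] ab by simp
  qed
qed

text \<open>Length at most \<open>n\<close> in the quotient, expressed in \<open>C\<close> alone: a
  subobject that is proper modulo \<open>S\<close> has length at most n - 1. Thus
  \<open>len 0\<close> means zero in the quotient and \<open>len 1\<close> zero or simple.
  Subobjects replace chains because an exact functor maps them to subobjects.\<close>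

primrec len :: "nat \<Rightarrow> 'o \<Rightarrow> bool" where
  "len 0 X \<longleftrightarrow> X \<in> S"
| "len (Suc n) X \<longleftrightarrow> X \<in> Ob C \<and> (\<forall>Y m. ar Y X m \<longrightarrow> inj Y m \<longrightarrow> cokS Y X m \<or> len n Y)"

lemma inj_comp: "ar W Y j \<Longrightarrow> inj W j \<Longrightarrow> inj Y m \<Longrightarrow> inj W (Comp C W Y X m j)"
  unfolding inj_def by (metis ar_mem comp_app)

text \<open>For subobjects W, Y of X with W contained in Y, the quotient Y/W embeds into
  X/W.\<close>

lemma cokS_restrict:
  assumes j: "ar W Y j" and m: "ar Y X m" "inj Y m" and c: "cokS W X (Comp C W Y X m j)"
  shows "cokS W Y j"
proof -
  let ?g = "Comp C W Y X m j"
  have g: "ar W X ?g" using ar_comp[OF j m(1)] .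
  obtain P p where p: "cok W Y j P p" using cok_ex[OF j] .
  then have p': "ar Y P p" "sur Y P p" by (auto simp: cok_def)
  obtain R r where r: "cok W X ?g R r" using cok_ex[OF g] .
  then have r': "ar X R r" "R \<in> S" using c by (auto simp: cok_def cokS_def)
  have "Comp C Y X R r m i (j i x) = 0" if "i \<in> J" "x \<in> E W i" for i x
    using cok_zero[OF r g that] ar_mem[OF j that] that by simp
  then obtain u where u: "ar P R u" "\<And>i x. i \<in> J \<Longrightarrow> x \<in> E Y i \<Longrightarrow> u i (p i x) = r i (m i x)"
    using cok_descend[OF p ar_comp[OF m(1) r'(1)]] comp_app by metis
  have "inj P u" unfolding inj_def
  proof (intro ballI impI)
    fix i y assume i: "i \<in> J" "y \<in> E P i" "u i y = 0"
    then obtain x where x: "x \<in> E Y i" "p i x = y" using p'(2) by (auto simp: sur_def)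
    then have "r i (m i x) = 0" using u(2) i by metis
    then obtain w where w: "w \<in> E W i" "?g i w = m i x"
      using r ar_mem[OF m(1) i(1) x(1)] i by (auto simp: cok_def exact_def)
    then have "j i w = x" using injD[OF m i(1) ar_mem[OF j i(1) w(1)] x(1)] i by simp
    then show "y = 0" using cok_zero[OF p j i(1) w(1)] x by simp
  qed
  then show ?thesis using S_sub[OF u(1)] r'(2) cokSI[OF j p] by blast
qed

lemma len_sub: "len n X \<Longrightarrow> ar Y X m \<Longrightarrow> inj Y m \<Longrightarrow> len n Y"
proof (cases n)
  case 0
  then show "len n X \<Longrightarrow> ar Y X m \<Longrightarrow> inj Y m \<Longrightarrow> len n Y" using S_sub by simp
next
  case (Suc k)
  assume X: "len n X" and m: "ar Y X m" "inj Y m"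
  show "len n Y" unfolding Suc len.simps
  proof (intro conjI allI impI)
    show "Y \<in> Ob C" using m by (simp add: ar_def)
    fix W j assume j: "ar W Y j" "inj W j"
    have "cokS W X (Comp C W Y X m j) \<or> len k W"
      using X ar_comp[OF j(1) m(1)] inj_comp[OF j m(2)] unfolding Suc len.simps by blast
    then show "cokS W Y j \<or> len k W" using cokS_restrict[OF j(1) m] by blast
  qed
qed

lemma len_Ob: "len n X \<Longrightarrow> X \<in> Ob C" using S_Ob by (cases n) auto

text \<open>\<open>Y1\<close> is the trace of \<open>Y\<close> on \<open>X1\<close> and
  \<open>Y2\<close> its image in \<open>X2\<close>. The cokernels of these three maps form a
  sequence exact in the middle, so \<open>Y\<close> is everything modulo \<open>S\<close> if trace
  and image are.\<close>

lemma cokS_mid: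
  assumes f: "ar X1 X f" and g: "ar X X2 g"
    and ex: "\<And>i x. i \<in> J \<Longrightarrow> x \<in> E X i \<Longrightarrow> g i x = 0 \<Longrightarrow> \<exists>x1\<in>E X1 i. f i x1 = x"
    and m: "ar Y X m" and y1: "ar Y1 X1 y1" "cokS Y1 X1 y1" and y2: "ar Y1 Y y2"
    and sq: "\<And>i v. i \<in> J \<Longrightarrow> v \<in> E Y1 i \<Longrightarrow> f i (y1 i v) = m i (y2 i v)"
    and k: "ar Y2 X2 k" "cokS Y2 X2 k" and e: "ar Y Y2 e" "sur Y Y2 e"
    and ke: "\<And>i x. i \<in> J \<Longrightarrow> x \<in> E Y i \<Longrightarrow> k i (e i x) = g i (m i x)"
  shows "cokS Y X m"
proof -
  obtain C1 p1 where p1: "cok Y1 X1 y1 C1 p1" using cok_ex[OF y1(1)] .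
  then have p1': "ar X1 C1 p1" "C1 \<in> S" using y1 by (auto simp: cok_def cokS_def)
  obtain C0 p where p: "cok Y X m C0 p" using cok_ex[OF m] .
  then have p': "ar X C0 p" "sur X C0 p" by (auto simp: cok_def)
  obtain C2 p2 where p2: "cok Y2 X2 k C2 p2" using cok_ex[OF k(1)] .
  then have p2': "ar X2 C2 p2" "C2 \<in> S" using k by (auto simp: cok_def cokS_def)
  have "Comp C X1 X C0 p f i (y1 i x) = 0" if "i \<in> J" "x \<in> E Y1 i" for i x
    using cok_zero[OF p m that(1) ar_mem[OF y2 that]] sq[OF that] ar_mem[OF y1(1) that] that by simp
  then obtain u where u: "ar C1 C0 u" "\<And>i x. i \<in> J \<Longrightarrow> x \<in> E X1 i \<Longrightarrow> u i (p1 i x) = p i (f i x)"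
    using cok_descend[OF p1 ar_comp[OF f p'(1)]] comp_app by metis
  have "Comp C X X2 C2 p2 g i (m i x) = 0" if "i \<in> J" "x \<in> E Y i" for i x
    using cok_zero[OF p2 k(1) that(1) ar_mem[OF e(1) that]] ke[OF that] ar_mem[OF m that] that by simp
  then obtain v where v: "ar C0 C2 v" "\<And>i x. i \<in> J \<Longrightarrow> x \<in> E X i \<Longrightarrow> v i (p i x) = p2 i (g i x)"
    using cok_descend[OF p ar_comp[OF g p2'(1)]] comp_app by metis
  have "C0 \<in> S"
  proof (rule S_mid[OF u(1) v(1) _ p1'(2) p2'(2)])
    fix i z assume i: "i \<in> J" "z \<in> E C0 i" "v i z = 0"
    then obtain x where x: "x \<in> E X i" "p i x = z" using p'(2) by (auto simp: sur_def)
    then have "p2 i (g i x) = 0" using v(2) i by metis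
    then obtain y' where y': "y' \<in> E Y2 i" "k i y' = g i x"
      using p2 ar_mem[OF g i(1) x(1)] i by (auto simp: cok_def exact_def)
    then obtain y where y: "y \<in> E Y i" "e i y = y'" using e(2) i by (auto simp: sur_def)
    have my: "m i y \<in> E X i" using ar_mem[OF m i(1) y(1)] .
    have "g i (x - m i y) = 0" using ar_diff[OF g i(1) x(1) my] ke[OF i(1) y(1)] y y' by simp
    then obtain x1 where x1: "x1 \<in> E X1 i" "f i x1 = x - m i y"
      using ex[OF i(1)] diff_mem[OF ar_Ob(1)[OF g] i(1) x(1) my] by metis
    have "u i (p1 i x1) = z"
      using u(2)[OF i(1) x1(1)] x1 x ar_diff[OF p'(1) i(1) x(1) my] cok_zero[OF p m i(1) y(1)] by simp
    then show "\<exists>x\<in>E C1 i. u i x = z" using ar_mem[OF p1'(1) i(1) x1(1)] by blast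
  qed
  then show ?thesis using cokSI[OF m p] by blast
qed

text \<open>Length is subadditive. If a subobject \<open>Y\<close> is proper modulo
  \<open>S\<close>, its trace on \<open>X1\<close> or its image in \<open>X2\<close> is proper
  modulo \<open>S\<close> by \<open>cokS_mid\<close>, so one of the two bounds drops while the other
  is kept by \<open>len_sub\<close>; the induction is on their sum.\<close>

lemma len_mid:
  "a + b = n \<Longrightarrow> ar X1 X f \<Longrightarrow> ar X X2 g \<Longrightarrow>
    (\<And>i x. i \<in> J \<Longrightarrow> x \<in> E X i \<Longrightarrow> g i x = 0 \<Longrightarrow> \<exists>x1\<in>E X1 i. f i x1 = x) \<Longrightarrow>
    len a X1 \<Longrightarrow> len b X2 \<Longrightarrow> len n X"
proof (induction n arbitrary: a b X1 X X2 f g)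
  case 0
  then show ?case using S_mid[OF 0(2,3)] by simp
next
  case (Suc n)
  note f = Suc.prems(2) and g = Suc.prems(3) and ex = Suc.prems(4) and la = Suc.prems(5) and lb = Suc.prems(6)
  show ?case unfolding len.simps
  proof (intro conjI allI impI)
    show "X \<in> Ob C" using f by (simp add: ar_def)
    fix Y m assume m: "ar Y X m" "inj Y m"
    obtain Y2 k e where k: "ar Y2 X2 k" "inj Y2 k" and e: "ar Y Y2 e" "sur Y Y2 e"
      and ke: "\<And>i x. i \<in> J \<Longrightarrow> x \<in> E Y i \<Longrightarrow> k i (e i x) = g i (m i x)"
      using image_factor[OF ar_comp[OF m(1) g]] comp_app by metis
    show "cokS Y X m \<or> len n Y"
    proof (rule pullback_ex[OF f m(1)])
      fix Y1 y1 y2 assume y1: "ar Y1 X1 y1" and y2: "ar Y1 Y y2"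
        and sq: "\<And>i v. i \<in> J \<Longrightarrow> v \<in> E Y1 i \<Longrightarrow> f i (y1 i v) = m i (y2 i v)"
        and su: "\<And>i x w. i \<in> J \<Longrightarrow> x \<in> E X1 i \<Longrightarrow> w \<in> E Y i \<Longrightarrow> f i x = m i w \<Longrightarrow> \<exists>v\<in>E Y1 i. y1 i v = x \<and> y2 i v = w"
        and ji: "\<And>i v. i \<in> J \<Longrightarrow> v \<in> E Y1 i \<Longrightarrow> y1 i v = 0 \<Longrightarrow> y2 i v = 0 \<Longrightarrow> v = 0"
      have y1i: "inj Y1 y1" unfolding inj_def
      proof (intro ballI impI)
        fix i v assume i: "i \<in> J" "v \<in> E Y1 i" "y1 i v = 0"
        then have "m i (y2 i v) = 0" using sq[OF i(1,2)] ar_zero[OF f i(1)] by simp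
        then have "y2 i v = 0" using m(2) ar_mem[OF y2] i by (auto simp: inj_def)
        then show "v = 0" using ji i by blast
      qed
      have ex': "\<exists>v\<in>E Y1 i. y2 i v = y" if i: "i \<in> J" and y: "y \<in> E Y i" "e i y = 0" for i y
      proof -
        have "g i (m i y) = 0" using ke[OF i y(1)] y(2) ar_zero[OF k(1) i] by simp
        then obtain x where x: "x \<in> E X1 i" "f i x = m i y" using ex[OF i ar_mem[OF m(1) i y(1)]] by blast
        then show ?thesis using su[OF i x(1) y(1)] by blast
      qed
      consider "cokS Y1 X1 y1" "cokS Y2 X2 k" | "\<not> cokS Y1 X1 y1" | "\<not> cokS Y2 X2 k" by blast
      then show ?thesis
      proof cases
        case 1
        then show ?thesis using cokS_mid[OF f g ex m(1) y1 1(1) y2 sq k(1) 1(2) e ke] by blast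
      next
        case 2
        \<comment> \<open>All cokernels into an object of \<open>S\<close> lie in \<open>S\<close>,
          so a proper trace forces a positive bound.\<close>
        have "a \<noteq> 0"
        proof
          assume "a = 0"
          then have "X1 \<in> S" using la by simp
          then show False using 2 S_quot by (auto simp: cokS_def cok_def)
        qed
        then obtain a' where a': "a = Suc a'" using not0_implies_Suc by blast
        have "len a' Y1" using la[unfolded a' len.simps] y1 y1i 2 by blast
        moreover have "len b Y2" using len_sub[OF lb k] .
        moreover have "a' + b = n" using Suc.prems(1) a' by simp
        ultimately show ?thesis using Suc.IH[OF _ y2 e(1) ex'] by blast
      next
        case 3
        have "b \<noteq> 0"
        proof
          assume "b = 0"
          then have "X2 \<in> S" using lb by simp
          then show False using 3 S_quot by (auto simp: cokS_def cok_def)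
        qed
        then obtain b' where b': "b = Suc b'" using not0_implies_Suc by blast
        have "len b' Y2" using lb[unfolded b' len.simps] k 3 by blast
        moreover have "len a Y1" using len_sub[OF la y1 y1i] .
        moreover have "a + b' = n" using Suc.prems(1) b' by simp
        ultimately show ?thesis using Suc.IH[OF _ y2 e(1) ex'] by blast
      qed
    qed
  qed
qed

text \<open>Produces a maximal proper subobject modulo \<open>S\<close>. A witness \<open>Y\<close>
  against \<open>len n X\<close> works: a proper \<open>Y'\<close> above it has length at most
  \<open>n\<close>, and since \<open>Y\<close> violates the bound n - 1, \<open>Y\<close> must fill
  \<open>Y'\<close> modulo \<open>S\<close>. For n = 0 there is no such bound to violate; then
  \<open>Y\<close> is zero and the alternative \<open>Y'\<close> in \<open>S\<close> is the one that
  holds.\<close>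

lemma len_step:
  assumes X: "len (Suc n) X" and nX: "\<not> len n X"
  obtains Y m where "ar Y X m" "inj Y m" "\<not> cokS Y X m" "len n Y"
    "\<And>Y' j m'. ar Y Y' j \<Longrightarrow> inj Y j \<Longrightarrow> ar Y' X m' \<Longrightarrow> inj Y' m' \<Longrightarrow> \<not> cokS Y' X m' \<Longrightarrow> cokS Y Y' j \<or> Y' \<in> S"
proof (cases n)
  case 0
  have XO: "X \<in> Ob C" using X by simp
  obtain Z where Z: "zob Z" using zob_ex .
  then have ZO: "Z \<in> Ob C" by (simp add: zob_def)
  show ?thesis
  proof
    show z: "ar Z X (zr Z X)" using zr ZO XO by blast
    show "inj Z (zr Z X)" using Z by (auto simp: inj_def zob_def)
    show "\<not> cokS Z X (zr Z X)" using S_cod[OF z] S_zero[OF Z] nX 0 by auto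
    show "len n Z" using S_zero[OF Z] 0 by simp
    fix Y' j m' assume "ar Y' X m'" "inj Y' m'" "\<not> cokS Y' X m'"
    then show "cokS Z Y' j \<or> Y' \<in> S" using X 0 by auto
  qed
next
  case (Suc k)
  then obtain Y m where Y: "ar Y X m" "inj Y m" "\<not> cokS Y X m" "\<not> len k Y"
    using nX len_Ob[OF X] by auto
  show ?thesis
  proof
    show "ar Y X m" "inj Y m" "\<not> cokS Y X m" using Y by blast+
    show "len n Y" using X Y by auto
    fix Y' j m' assume j: "ar Y Y' j" "inj Y j" and m': "ar Y' X m'" "inj Y' m'" "\<not> cokS Y' X m'"
    then have "len n Y'" using X by auto
    then show "cokS Y Y' j \<or> Y' \<in> S" using j Y(4) unfolding Suc by auto
  qed
qed

text \<open>Splits off the quotient by a maximal proper subobject, which is simple modulo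
  \<open>S\<close>, and continues with the subobject.\<close>

lemma len_finite_length: "len n X \<Longrightarrow> finite_length D X"
proof (induction n arbitrary: X)
  case 0
  then show ?case using zero_object_D[of X] S_Ob by (auto intro: finite_length.zero)
next
  case (Suc n)
  show ?case
  proof (cases "len n X")
    case True then show ?thesis using Suc.IH by blast
  next
    case False
    show ?thesis
    proof (rule len_step[OF Suc.prems False])
      fix Y m assume m: "ar Y X m" "inj Y m" "\<not> cokS Y X m" and Y: "len n Y"
        and mx: "\<And>Y' j m'. ar Y Y' j \<Longrightarrow> inj Y j \<Longrightarrow> ar Y' X m' \<Longrightarrow> inj Y' m' \<Longrightarrow> \<not> cokS Y' X m' \<Longrightarrow> cokS Y Y' j \<or> Y' \<in> S"
      have O: "Y \<in> Ob C" "X \<in> Ob C" using m by (auto simp: ar_def)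
      obtain Z q where q: "cok Y X m Z q" using cok_ex[OF m(1)] .
      then have q': "ar X Z q" "sur X Z q" by (auto simp: cok_def)
      have "ssim Z" unfolding ssim_def
      proof (intro conjI allI impI)
        show "Z \<in> Ob C" using q' by (simp add: ar_def)
        show "Z \<notin> S" using m(3) cokSI[OF m(1) q] by blast
        fix W w assume w: "ar W Z w" "inj W w"
        show "W \<in> S \<or> cokS W Z w"
        \<comment> \<open>\<open>Y'\<close> is the preimage of \<open>W\<close> in \<open>X\<close>.
          It contains \<open>Y\<close>, so maximality of \<open>Y\<close> applies to it.\<close>
        proof (rule pullback_ex[OF q'(1) w(1)])
          fix Y' m' e assume m': "ar Y' X m'" and e: "ar Y' W e"
            and sq: "\<And>i v. i \<in> J \<Longrightarrow> v \<in> E Y' i \<Longrightarrow> q i (m' i v) = w i (e i v)"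
            and su: "\<And>i x y. i \<in> J \<Longrightarrow> x \<in> E X i \<Longrightarrow> y \<in> E W i \<Longrightarrow> q i x = w i y \<Longrightarrow> \<exists>v\<in>E Y' i. m' i v = x \<and> e i v = y"
            and ji: "\<And>i v. i \<in> J \<Longrightarrow> v \<in> E Y' i \<Longrightarrow> m' i v = 0 \<Longrightarrow> e i v = 0 \<Longrightarrow> v = 0"
          have mi: "inj Y' m'" unfolding inj_def
          proof (intro ballI impI)
            fix i v assume i: "i \<in> J" "v \<in> E Y' i" "m' i v = 0"
            then have "w i (e i v) = 0" using sq[OF i(1,2)] ar_zero[OF q'(1) i(1)] by simp
            then have "e i v = 0" using w(2) ar_mem[OF e] i by (auto simp: inj_def)
            then show "v = 0" using ji i by blast
          qed
          have se: "\<exists>v\<in>E Y' i. e i v = y" if i: "i \<in> J" and y: "y \<in> E W i" for i y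
          proof -
            obtain x where "x \<in> E X i" "q i x = w i y" using q'(2) ar_mem[OF w(1) i y] i by (metis sur_def)
            then show ?thesis using su i y by blast
          qed
          have lift: "\<exists>v\<in>E Y' i. m' i v = m i y" if i: "i \<in> J" and y: "y \<in> E Y i" for i y
            using su[OF i ar_mem[OF m(1) i y], of 0] zero_mem[OF ar_Ob(1)[OF w(1)] i]
              cok_zero[OF q m(1) i y] ar_zero[OF w(1) i] by auto
          obtain j where j: "ar Y Y' j" and mj: "\<And>i x. i \<in> J \<Longrightarrow> x \<in> E Y i \<Longrightarrow> m' i (j i x) = m i x"
            using ar_lift[OF m' mi m(1) lift] by metis
          have jin: "inj Y j" unfolding inj_def
            using mj m(2) ar_zero[OF m'] by (metis inj_def)
          show ?thesis
          proof (cases "cokS Y' X m'")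
            case True
            have "cokS W Z w"
              by (rule cokS_quot[OF m' True q' w(1)]) (use sq ar_mem[OF e] in metis)
            then show ?thesis by blast
          next
            case False
            then consider "cokS Y Y' j" | "Y' \<in> S" using mx[OF j jin m' mi] by blast
            then have "W \<in> S"
            proof cases
              case 2
              then show ?thesis using S_quot[OF e] se by (auto simp: sur_def)
            next
              case 1
              \<comment> \<open>\<open>e\<close> kills \<open>Y\<close>, so \<open>W\<close> is a
                quotient of the cokernel of \<open>Y\<close> in \<open>Y'\<close>.\<close>
              obtain P p where p: "cok Y Y' j P p" using cok_ex[OF j] .
              then have p': "ar Y' P p" "P \<in> S" using 1 by (auto simp: cok_def cokS_def)
              have "e i (j i x) = 0" if i: "i \<in> J" and x: "x \<in> E Y i" for i x
              proof -
                have "w i (e i (j i x)) = 0"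
                  using sq[OF i ar_mem[OF j i x]] mj[OF i x] cok_zero[OF q m(1) i x] by simp
                then show ?thesis using w(2) ar_mem[OF e i ar_mem[OF j i x]] i by (auto simp: inj_def)
              qed
              then obtain u where u: "ar P W u" "\<And>i x. i \<in> J \<Longrightarrow> x \<in> E Y' i \<Longrightarrow> u i (p i x) = e i x"
                using cok_descend[OF p e] by metis
              have "sur P W u" unfolding sur_def using se u(2) ar_mem[OF p'(1)] by metis
              then show ?thesis using S_quot[OF u(1) _ p'(2)] by blast
            qed
            then show ?thesis by blast
          qed
        qed
      qed
      then have "simple_object D Z" by (rule ssim_simple)
      moreover have "is_cokernel D Y X (Q Y X m) Z (Q X Z q)"
        unfolding Q_def[of Y X] by (rule Q_cokernel[OF qi_id[OF O(1)] m(1) q])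
      moreover have "monomorphism D Y X (Q Y X m)" using Q_mono m by blast
      ultimately show ?thesis using finite_length.step[OF Suc.IH[OF Y]] O by simp
    qed
  qed
qed

text \<open>A step of a composition series in the quotient is represented by a roof from
  \<open>Y\<close> through \<open>A\<close> to \<open>X\<close>. Passing from \<open>Y\<close> to
  \<open>A\<close> costs nothing, passing from \<open>A\<close> to \<open>X\<close> costs one for
  the simple cokernel.\<close>

lemma finite_length_len: "finite_length D X \<Longrightarrow> \<exists>n. len n X"
proof (induction rule: finite_length.induct)
  case (zero X)
  then have "X \<in> S" using zero_object_D[of X] by (auto simp: zero_object_def)
  then have "len 0 X" by simp
  then show ?case by blast
next
  case (step Y X m T c)
  then obtain n where n: "len n Y" by blast
  have XO: "X \<in> Ob C" and YO: "Y \<in> Ob C" using step len_Ob[OF n] by auto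
  obtain A s f where m: "m = cls Y X A s f" "qi A Y s" "ar A X f"
    using Hom_DE[OF _ YO XO] step(3) unfolding monomorphism_def by metis
  obtain Z q where q: "cok A X f Z q" using cok_ex[OF m(3)] .
  then have q': "ar X Z q" by (simp add: cok_def)
  have "len 1 Z"
    using simple_cokernel[OF m(2,3) q step(4)[unfolded m(1)] step(5)] q' by (auto simp: ar_def)
  moreover have "len n A"
  proof -
    \<comment> \<open>The kernel of the denominator has length 0, so the bound for \<open>Y\<close>
      passes to \<open>A\<close> by subadditivity.\<close>
    obtain N k where k: "ker A Y s N k" using ker_ex[OF qi_ar[OF m(2)]] .
    then have "ar N A k" "len 0 N" using m(2) by (auto simp: ker_def qi_def kerS_def)
    then show ?thesis using len_mid[of 0 n n N A k Y s] qi_ar[OF m(2)] n k by (auto simp: ker_def exact_def)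
  qed
  moreover have "\<exists>x\<in>E A i. f i x = y" if "i \<in> J" "y \<in> E X i" "q i y = 0" for i y
    using q that by (auto simp: cok_def exact_def)
  ultimately have "len (n + 1) X" using len_mid[OF refl m(3) q'] by blast
  then show ?case by blast
qed

lemma finite_length_mod_eq: "finite_length_mod C S = {X. \<exists>n. len n X}"
  unfolding finite_length_mod_def using finite_length_len len_finite_length len_Ob by blast

lemma serre_class_finite_length_mod: "serre_class C J E (finite_length_mod C S)"
proof unfold_locales
  show "finite_length_mod C S \<subseteq> Ob C" by (auto simp: finite_length_mod_def)
  fix Z assume "zob Z"
  then have "len 0 Z" using S_zero by simp
  then show "Z \<in> finite_length_mod C S" unfolding finite_length_mod_eq by blast
next
  fix X Y f Z g assume *: "ar X Y f" "ar Y Z g" "\<And>i y. i \<in> J \<Longrightarrow> y \<in> E Y i \<Longrightarrow> g i y = 0 \<Longrightarrow> \<exists>x\<in>E X i. f i x = y"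
    "X \<in> finite_length_mod C S" "Z \<in> finite_length_mod C S"
  then obtain a b where "len a X" "len b Z" unfolding finite_length_mod_eq by blast
  then have "len (a + b) Y" using len_mid[OF refl *(1-3)] by blast
  then show "Y \<in> finite_length_mod C S" unfolding finite_length_mod_eq by blast
qed

lemma finite_length_mod_incr: "S \<subseteq> finite_length_mod C S"
  unfolding finite_length_mod_eq by (metis (mono_tags) len.simps(1) mem_Collect_eq subsetI)

end

section \<open>The Krull-Gabriel filtration by Serre classes\<close>

context concrete_abelian
begin

lemma serre_class_zero: "serre_class C J E {X. zero_object C X}"
proof unfold_locales
  fix X Y f Z g assume *: "ar X Y f" "ar Y Z g" "\<And>i y. i \<in> J \<Longrightarrow> y \<in> E Y i \<Longrightarrow> g i y = 0 \<Longrightarrow> \<exists>x\<in>E X i. f i x = y"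
    "X \<in> {X. zero_object C X}" "Z \<in> {X. zero_object C X}"
  have "y = 0" if i: "i \<in> J" and y: "y \<in> E Y i" for i y
  proof -
    have "g i y = 0" using ar_mem[OF *(2) i y] *(5) i by (auto simp: zero_object_iff zob_def)
    then obtain x where "x \<in> E X i" "f i x = y" using *(3) i y by blast
    then show ?thesis using *(4) i ar_zero[OF *(1) i] by (auto simp: zero_object_iff zob_def)
  qed
  then show "Y \<in> {X. zero_object C X}" using *(1) zero_mem[of Y] by (auto simp: zero_object_iff zob_def ar_def)
qed (auto simp: zero_object_iff zob_def)

lemma KG_filtration_bot: "(\<forall>\<beta>. \<alpha> \<le> \<beta>) \<Longrightarrow> KG_filtration C \<alpha> = finite_length_mod C {X. zero_object C X}"
  by (subst KG_filtration.simps) simp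

lemma KG_filtration_pred: "is_pred \<beta> \<alpha> \<Longrightarrow> KG_filtration C \<alpha> = finite_length_mod C (KG_filtration C \<beta>)"
proof -
  assume p: "is_pred \<beta> \<alpha>"
  then have "(THE \<beta>. is_pred \<beta> \<alpha>) = \<beta>" by (intro the_equality) (auto simp: is_pred_def intro: antisym)
  moreover have "\<not> (\<forall>\<gamma>. \<alpha> \<le> \<gamma>)" using p by (auto simp: is_pred_def not_le)
  ultimately show ?thesis using p by (subst KG_filtration.simps) auto
qed

lemma KG_filtration_lim: "\<not> (\<forall>\<beta>. \<alpha> \<le> \<beta>) \<Longrightarrow> \<nexists>\<beta>. is_pred \<beta> \<alpha> \<Longrightarrow> KG_filtration C \<alpha> = (\<Union>\<beta>\<in>{\<beta>. \<beta> < \<alpha>}. KG_filtration C \<beta>)"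
  by (subst KG_filtration.simps) (simp del: not_all)

text \<open>The Serre property and monotonicity are proved together: at a limit the two outer terms
  of an exact sequence must first be moved into one common stage.\<close>

lemma KG_filtration_serre:
  fixes \<alpha> :: "'w::wellorder"
  shows "serre_class C J E (KG_filtration C \<alpha>) \<and> (\<forall>\<beta>\<le>\<alpha>. KG_filtration C \<beta> \<subseteq> KG_filtration C \<alpha>)"
proof (induction \<alpha> rule: less_induct)
  case (less \<alpha>)
  consider "\<forall>\<beta>. \<alpha> \<le> \<beta>" | \<beta> where "is_pred \<beta> \<alpha>" | "\<not> (\<forall>\<beta>. \<alpha> \<le> \<beta>)" "\<nexists>\<beta>. is_pred \<beta> \<alpha>" by blast
  then show ?case
  proof cases
    case 1
    then have "\<beta> = \<alpha>" if "\<beta> \<le> \<alpha>" for \<beta> using that by (simp add: antisym)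
    then show ?thesis
      using KG_filtration_bot[OF 1] serre_class.serre_class_finite_length_mod[OF serre_class_zero] by auto
  next
    case (2 \<beta>)
    then have b: "\<beta> < \<alpha>" "\<And>\<gamma>. \<gamma> < \<alpha> \<Longrightarrow> \<gamma> \<le> \<beta>" by (auto simp: is_pred_def)
    then have ih: "serre_class C J E (KG_filtration C \<beta>)" "\<forall>\<gamma>\<le>\<beta>. KG_filtration C \<gamma> \<subseteq> KG_filtration C \<beta>"
      using less.IH by blast+
    show ?thesis
    proof (intro conjI allI impI)
      show "serre_class C J E (KG_filtration C \<alpha>)"
        unfolding KG_filtration_pred[OF 2] by (rule serre_class.serre_class_finite_length_mod[OF ih(1)])
      fix \<gamma> assume g: "\<gamma> \<le> \<alpha>"
      show "KG_filtration C \<gamma> \<subseteq> KG_filtration C \<alpha>"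
      proof (cases "\<gamma> = \<alpha>")
        case False
        then have "KG_filtration C \<gamma> \<subseteq> KG_filtration C \<beta>" using g b(2) ih(2) by (simp add: order_less_le)
        also have "\<dots> \<subseteq> KG_filtration C \<alpha>"
          unfolding KG_filtration_pred[OF 2] by (rule serre_class.finite_length_mod_incr[OF ih(1)])
        finally show ?thesis .
      qed simp
    qed
  next
    case 3
    note eq = KG_filtration_lim[OF 3]
    obtain \<beta>0 where b0: "\<beta>0 < \<alpha>" using 3(1) by (auto simp: not_le)
    have mono: "\<exists>\<gamma><\<alpha>. X \<in> KG_filtration C \<gamma> \<and> Z \<in> KG_filtration C \<gamma>"
      if XZ: "X \<in> KG_filtration C \<alpha>" "Z \<in> KG_filtration C \<alpha>" for X Z
    proof -
      obtain x z where xz: "x < \<alpha>" "z < \<alpha>" "X \<in> KG_filtration C x" "Z \<in> KG_filtration C z" using XZ eq by auto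
      show ?thesis
      proof (cases "x \<le> z")
        case True then show ?thesis using xz less.IH[OF xz(2)] by blast
      next
        case False then have "z \<le> x" by simp
        then show ?thesis using xz less.IH[OF xz(1)] by blast
      qed
    qed
    have s: "serre_class C J E (KG_filtration C \<beta>)" if "\<beta> < \<alpha>" for \<beta> using less.IH[OF that] by blast
    show ?thesis
    proof (intro conjI allI impI)
      show "serre_class C J E (KG_filtration C \<alpha>)"
      proof unfold_locales
        show "KG_filtration C \<alpha> \<subseteq> Ob C" unfolding eq using serre_class.S_Ob[OF s] by blast
        show "Z \<in> KG_filtration C \<alpha>" if "zob Z" for Z
          unfolding eq using serre_class.S_zero[OF s[OF b0] that] b0 by blast
        fix X Y f Z g assume *: "ar X Y f" "ar Y Z g" "\<And>i y. i \<in> J \<Longrightarrow> y \<in> E Y i \<Longrightarrow> g i y = 0 \<Longrightarrow> \<exists>x\<in>E X i. f i x = y"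
          "X \<in> KG_filtration C \<alpha>" "Z \<in> KG_filtration C \<alpha>"
        obtain \<gamma> where c: "\<gamma> < \<alpha>" "X \<in> KG_filtration C \<gamma>" "Z \<in> KG_filtration C \<gamma>" using mono[OF *(4,5)] by blast
        have "Y \<in> KG_filtration C \<gamma>" by (rule serre_class.S_mid[OF s[OF c(1)] *(1-3) c(2,3)])
        then show "Y \<in> KG_filtration C \<alpha>" unfolding eq using c by blast
      qed
      fix \<beta> assume "\<beta> \<le> \<alpha>"
      then consider "\<beta> = \<alpha>" | "\<beta> < \<alpha>" by fastforce
      then show "KG_filtration C \<beta> \<subseteq> KG_filtration C \<alpha>"
      proof cases
        case 2 then show ?thesis using eq by blast
      qed simp
    qed
  qed
qed

end

text \<open>An exact faithful functor given on elements by reindexing along \<open>\<phi>\<close>.\<close>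

locale reindexing_functor =
  A: concrete_abelian CA JA EA + B: concrete_abelian CB JB EB
  for CA :: "('oa, 'ia \<Rightarrow> 'e \<Rightarrow> 'e::ab_group_add) category" and JA EA
    and CB :: "('ob, 'ib \<Rightarrow> 'e \<Rightarrow> 'e) category" and JB EB +
  fixes G :: "'ob \<Rightarrow> 'oa" and GM :: "'ob \<Rightarrow> 'ob \<Rightarrow> ('ib \<Rightarrow> 'e \<Rightarrow> 'e) \<Rightarrow> 'ia \<Rightarrow> 'e \<Rightarrow> 'e" and \<phi> :: "'ia \<Rightarrow> 'ib"
  assumes G_Ob: "X \<in> Ob CB \<Longrightarrow> G X \<in> Ob CA"
    and \<phi>_mem: "i \<in> JA \<Longrightarrow> \<phi> i \<in> JB"
    and E_G: "X \<in> Ob CB \<Longrightarrow> i \<in> JA \<Longrightarrow> EA (G X) i = EB X (\<phi> i)"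
    and GM_hom: "X \<in> Ob CB \<Longrightarrow> Y \<in> Ob CB \<Longrightarrow> f \<in> Hom CB X Y \<Longrightarrow> GM X Y f \<in> Hom CA (G X) (G Y)"
    and GM_app: "X \<in> Ob CB \<Longrightarrow> Y \<in> Ob CB \<Longrightarrow> f \<in> Hom CB X Y \<Longrightarrow> i \<in> JA \<Longrightarrow> x \<in> EB X (\<phi> i) \<Longrightarrow> GM X Y f i x = f (\<phi> i) x"
    and faithful: "X \<in> Ob CB \<Longrightarrow> (\<And>i. i \<in> JA \<Longrightarrow> EB X (\<phi> i) = {0}) \<Longrightarrow> j \<in> JB \<Longrightarrow> EB X j = {0}"
begin

lemma GM_ar: "B.ar X Y f \<Longrightarrow> A.ar (G X) (G Y) (GM X Y f)"
  by (simp add: A.ar_def B.ar_def G_Ob GM_hom)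

lemma GM_ar_app: "B.ar X Y f \<Longrightarrow> i \<in> JA \<Longrightarrow> x \<in> EB X (\<phi> i) \<Longrightarrow> GM X Y f i x = f (\<phi> i) x"
  by (simp add: B.ar_def GM_app)

lemma GM_inj: "B.ar X Y f \<Longrightarrow> B.inj X f \<Longrightarrow> A.inj (G X) (GM X Y f)"
  using GM_ar_app[of X Y f] E_G[OF B.ar_Ob(1)[of X Y f]] \<phi>_mem by (auto simp: A.inj_def B.inj_def)

lemma GM_cok: "B.ar X Y f \<Longrightarrow> B.cok X Y f N c \<Longrightarrow> A.cok (G X) (G Y) (GM X Y f) (G N) (GM Y N c)"
proof -
  assume f: "B.ar X Y f" and c: "B.cok X Y f N c"
  then have c': "B.ar Y N c" "B.sur Y N c" "B.exact X Y f c" by (auto simp: B.cok_def)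
  have E: "EA (G X) i = EB X (\<phi> i)" "EA (G Y) i = EB Y (\<phi> i)" "EA (G N) i = EB N (\<phi> i)" if "i \<in> JA" for i
    using E_G that f c' by (auto simp: B.ar_def)
  show ?thesis unfolding A.cok_def
    using GM_ar[OF c'(1)] c'(2,3) GM_ar_app[OF f] GM_ar_app[OF c'(1)] \<phi>_mem
    by (auto simp: A.sur_def A.exact_def E B.sur_def B.exact_def)
qed

text \<open>Subobjects of \<open>X\<close> go to subobjects of \<open>G X\<close>, and a cokernel
  goes to a cokernel, so a length bound for \<open>G X\<close> bounds \<open>X\<close>. At both
  places only reflection of membership from \<open>SA\<close> to \<open>SB\<close> is used.\<close>

lemma len_transfer:
  assumes SA: "serre_class CA JA EA SA" and SB: "serre_class CB JB EB SB"
    and refl: "\<And>X. X \<in> Ob CB \<Longrightarrow> G X \<in> SA \<Longrightarrow> X \<in> SB"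
  shows "X \<in> Ob CB \<Longrightarrow> serre_class.len CA JA EA SA n (G X) \<Longrightarrow> serre_class.len CB JB EB SB n X"
proof (induction n arbitrary: X)
  case 0
  then show ?case using refl by (simp add: serre_class.len.simps[OF SA] serre_class.len.simps[OF SB])
next
  case (Suc n)
  show ?case unfolding serre_class.len.simps[OF SB]
  proof (intro conjI allI impI)
    show "X \<in> Ob CB" using Suc by blast
    fix Y m assume m: "B.ar Y X m" "B.inj Y m"
    then have Y: "Y \<in> Ob CB" by (simp add: B.ar_def)
    have "serre_class.cokS CA JA EA SA (G Y) (G X) (GM Y X m) \<or> serre_class.len CA JA EA SA n (G Y)"
      using Suc.prems(2) GM_ar[OF m(1)] GM_inj[OF m] unfolding serre_class.len.simps[OF SA] by blast
    then show "serre_class.cokS CB JB EB SB Y X m \<or> serre_class.len CB JB EB SB n Y"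
    proof
      assume cs: "serre_class.cokS CA JA EA SA (G Y) (G X) (GM Y X m)"
      have "N \<in> SB" if c: "B.cok Y X m N c" for N c
      proof -
        have "G N \<in> SA" using cs GM_cok[OF m(1) c] unfolding serre_class.cokS_def[OF SA] by blast
        moreover have "N \<in> Ob CB" using c by (simp add: B.cok_def B.ar_def)
        ultimately show ?thesis using refl by blast
      qed
      then show ?thesis unfolding serre_class.cokS_def[OF SB] by blast
    next
      assume "serre_class.len CA JA EA SA n (G Y)"
      then show ?thesis using Suc.IH[OF Y] by blast
    qed
  qed
qed

text \<open>The bottom stage starts with faithfulness, in the form that only zero objects become
  zero. At a successor stage the induction hypothesis is the reflection that
  \<open>len_transfer\<close> asks for.\<close>

lemma KG_filtration_reflect:
  fixes \<alpha> :: "'w::wellorder"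
  shows "X \<in> Ob CB \<Longrightarrow> G X \<in> KG_filtration CA \<alpha> \<Longrightarrow> X \<in> KG_filtration CB \<alpha>"
proof (induction \<alpha> arbitrary: X rule: less_induct)
  case (less \<alpha>)
  have fl: "X \<in> finite_length_mod CB SB"
    if SA: "serre_class CA JA EA SA" and SB: "serre_class CB JB EB SB"
      and refl: "\<And>X. X \<in> Ob CB \<Longrightarrow> G X \<in> SA \<Longrightarrow> X \<in> SB" and GX: "G X \<in> finite_length_mod CA SA" for SA SB
  proof -
    obtain n where "serre_class.len CA JA EA SA n (G X)"
      using GX unfolding serre_class.finite_length_mod_eq[OF SA] by blast
    then show ?thesis
      using len_transfer[OF SA SB refl less.prems(1)] unfolding serre_class.finite_length_mod_eq[OF SB] by blast
  qed
  consider "\<forall>\<beta>. \<alpha> \<le> \<beta>" | \<beta> where "is_pred \<beta> \<alpha>" | "\<not> (\<forall>\<beta>. \<alpha> \<le> \<beta>)" "\<nexists>\<beta>. is_pred \<beta> \<alpha>" by blast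
  then show ?case
  proof cases
    case 1
    have "X \<in> finite_length_mod CB {X. zero_object CB X}"
    proof (rule fl[OF A.serre_class_zero B.serre_class_zero])
      fix X assume X: "X \<in> Ob CB" "G X \<in> {X. zero_object CA X}"
      then have "EB X j = {0}" if "j \<in> JB" for j
        using faithful[OF X(1) _ that] E_G[OF X(1)] by (auto simp: A.zero_object_iff A.zob_def)
      then show "X \<in> {X. zero_object CB X}" using X(1) by (auto simp: B.zero_object_iff B.zob_def)
    qed (use less.prems(2) A.KG_filtration_bot[OF 1] in simp)
    then show ?thesis using B.KG_filtration_bot[OF 1] by simp
  next
    case (2 \<beta>)
    then have b: "\<beta> < \<alpha>" by (simp add: is_pred_def)
    show ?thesis unfolding B.KG_filtration_pred[OF 2]
      by (rule fl[of "KG_filtration CA \<beta>"])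
        (use A.KG_filtration_serre[of \<beta>] B.KG_filtration_serre[of \<beta>] less.IH[OF b] less.prems(2) A.KG_filtration_pred[OF 2] in auto)
  next
    case 3
    then show ?thesis using less unfolding A.KG_filtration_lim[OF 3] B.KG_filtration_lim[OF 3] by auto
  qed
qed

lemma KG_filtration_all:
  fixes \<alpha> :: "'w::wellorder"
  shows "KG_filtration CA \<alpha> = Ob CA \<Longrightarrow> KG_filtration CB \<alpha> = Ob CB"
  using KG_filtration_reflect[of _ \<alpha>] G_Ob serre_class.S_Ob[OF conjunct1[OF B.KG_filtration_serre[of \<alpha>]]] by blast

end

section \<open>Finitely presented functors\<close>

text \<open>Interleaving two finitely supported sequences, at even and odd positions, makes the
  direct sum of two subspaces of the fixed countable-dimensional space a subspace of it
  again.\<close>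

lift_definition pr :: "'k::field vec \<Rightarrow> 'k vec \<Rightarrow> 'k vec" is
  "\<lambda>x y n. if even n then x (n div 2) else y (n div 2)"
proof -
  fix x y :: "nat \<Rightarrow> 'k" assume f: "finite {n. x n \<noteq> 0}" "finite {n. y n \<noteq> 0}"
  have "{n. (if even n then x (n div 2) else y (n div 2)) \<noteq> 0} \<subseteq> (\<lambda>n. 2 * n) ` {n. x n \<noteq> 0} \<union> (\<lambda>n. 2 * n + 1) ` {n. y n \<noteq> 0}"
  proof
    fix n assume "n \<in> {n. (if even n then x (n div 2) else y (n div 2)) \<noteq> 0}"
    then show "n \<in> (\<lambda>n. 2 * n) ` {n. x n \<noteq> 0} \<union> (\<lambda>n. 2 * n + 1) ` {n. y n \<noteq> 0}"
      by (cases "even n") (auto elim!: evenE oddE)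
  qed
  then show "finite {n. (if even n then x (n div 2) else y (n div 2)) \<noteq> 0}"
    by (rule finite_subset) (use f in auto)
qed

lift_definition pr1 :: "'k::field vec \<Rightarrow> 'k vec" is "\<lambda>x n. x (2 * n)"
  using finite_vimageI[of "{n. _ n \<noteq> 0}" "\<lambda>n::nat. 2 * n"] by (auto simp: vimage_def inj_on_def)

lift_definition pr2 :: "'k::field vec \<Rightarrow> 'k vec" is "\<lambda>x n. x (2 * n + 1)"
  using finite_vimageI[of "{n. _ n \<noteq> 0}" "\<lambda>n::nat. 2 * n + 1"] by (auto simp: vimage_def inj_on_def)

lemma pr_simps [simp]: "pr1 (pr x y) = x" "pr2 (pr x y) = y" "pr (pr1 z) (pr2 z) = z"
  by (transfer, simp add: fun_eq_iff)+

lemma pr_eq_iff: "pr x y = pr x' y' \<longleftrightarrow> x = x' \<and> y = y'"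
  by (metis pr_simps(1,2))

lemma pr_add: "pr x y + pr x' y' = pr (x + x') (y + y')"
  by transfer (auto simp: fun_eq_iff)

lemma pr_scale: "scale c (pr x y) = pr (scale c x) (scale c y)"
  by (rule poly_mapping_eqI) (simp add: pr.rep_eq)

lemma pr_zero: "pr 0 0 = 0"
  by transfer (auto simp: fun_eq_iff)

lemma pr_eq_0_iff: "pr x y = 0 \<longleftrightarrow> x = 0 \<and> y = 0"
  using pr_eq_iff[of x y 0 0] by (simp add: pr_zero)

lemma pr12_add: "pr1 (x + y) = pr1 x + pr1 y" "pr2 (x + y) = pr2 x + pr2 y"
  by (transfer, simp add: fun_eq_iff)+

lemma pr12_scale: "pr1 (scale c x) = scale c (pr1 x)" "pr2 (scale c x) = scale c (pr2 x)"
  by (rule poly_mapping_eqI, simp add: pr1.rep_eq pr2.rep_eq)+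

lemma pr12_zero [simp]: "pr1 0 = 0" "pr2 0 = 0"
  by (transfer, simp)+

lemma scale_simps [simp]: "scale c (0 :: 'k::field vec) = 0" "scale 1 (x :: 'k vec) = x" "scale 0 (x :: 'k vec) = 0"
  by (auto simp: kvs.scale_zero_right)

lemma scale_add: "scale c (x + y) = scale c x + scale c (y :: 'k::field vec)"
  by (rule kvs.scale_right_distrib)

lemma scale_diff: "scale c (x - y) = scale c x - scale c (y :: 'k::field vec)"
  by (rule kvs.scale_right_diff_distrib)

definition prodset :: "'k::field vec set \<Rightarrow> 'k vec set \<Rightarrow> 'k vec set" where
  "prodset U W = {pr u w | u w. u \<in> U \<and> w \<in> W}"

lemma prodset_iff: "z \<in> prodset U W \<longleftrightarrow> pr1 z \<in> U \<and> pr2 z \<in> W"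
  unfolding prodset_def by (auto) (metis pr_simps(3))

lemma subspace_prodset: "kvs.subspace U \<Longrightarrow> kvs.subspace W \<Longrightarrow> kvs.subspace (prodset U W)"
  by (auto simp: kvs.subspace_def prodset_iff pr12_add pr12_scale)

lemma fd_space_subspace: "fd_space U \<Longrightarrow> kvs.subspace U"
  by (auto simp: fd_space_def)

lemma fd_space_sub:
  assumes U: "fd_space U" and V: "kvs.subspace V" "V \<subseteq> U" shows "fd_space V"
proof -
  obtain B where B: "finite B" "U = kvs.span B" using U by (auto simp: fd_space_def)
  obtain B' where B': "B' \<subseteq> V" "kvs.independent B'" "V \<subseteq> kvs.span B'" using kvs.maximal_independent_subset by blast
  have "finite B'" using kvs.independent_span_bound[OF B(1) B'(2)] B' V B by blast
  moreover have "V = kvs.span B'" using B' V(1) kvs.span_minimal by blast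
  ultimately show ?thesis by (auto simp: fd_space_def)
qed

lemma linear_maps_iff: "f \<in> linear_maps U W \<longleftrightarrow> f \<in> extensional U \<and> (\<forall>x\<in>U. f x \<in> W) \<and>
     (\<forall>x\<in>U. \<forall>y\<in>U. f (x + y) = f x + f y) \<and> (\<forall>c. \<forall>x\<in>U. f (scale c x) = scale c (f x))"
  by (auto simp: linear_maps_def PiE_iff)

lemma linear_maps_zero: "f \<in> linear_maps U W \<Longrightarrow> kvs.subspace U \<Longrightarrow> f 0 = 0"
  unfolding linear_maps_iff using kvs.subspace_0[of U] by (metis scale_simps(3))

lemma linear_maps_diff: "f \<in> linear_maps U W \<Longrightarrow> kvs.subspace U \<Longrightarrow> x \<in> U \<Longrightarrow> y \<in> U \<Longrightarrow> f (x - y) = f x - f y"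
proof -
  assume f: "f \<in> linear_maps U W" and U: "kvs.subspace U" and x: "x \<in> U" and y: "y \<in> U"
  have "f (x - y + y) = f (x - y) + f y"
    using f kvs.subspace_diff[OF U x y] y unfolding linear_maps_iff by blast
  then show ?thesis by simp
qed

lemma fd_space_image:
  assumes U: "fd_space U" and add: "\<And>x y. x \<in> U \<Longrightarrow> y \<in> U \<Longrightarrow> f (x + y) = f x + f y"
    and sc: "\<And>c x. x \<in> U \<Longrightarrow> f (scale c x) = scale c (f x)"
  shows "fd_space (f ` U)"
proof -
  obtain B where B: "finite B" "U = kvs.span B" using U by (auto simp: fd_space_def)
  have sU: "kvs.subspace U" using U fd_space_subspace by blast
  have f0: "f 0 = 0" using sc[OF kvs.subspace_0[OF sU], of 0] by simp
  have "x \<in> kvs.span B \<and> f x \<in> kvs.span (f ` B)" if "x \<in> kvs.span B" for x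
    using that
  proof (induction rule: kvs.span_induct_alt)
    case base then show ?case by (simp add: f0 kvs.span_zero)
  next
    case (step c x y)
    then show ?case
      using B sU by (auto simp: add sc kvs.span_base kvs.subspace_scale intro!: kvs.span_add kvs.span_scale)
  qed
  then have sub: "f ` U \<subseteq> kvs.span (f ` B)" using B by blast
  have "kvs.subspace (f ` U)"
  proof (rule kvs.subspaceI)
    show "0 \<in> f ` U" using f0 kvs.subspace_0[OF sU] by force
    show "x + y \<in> f ` U" if "x \<in> f ` U" "y \<in> f ` U" for x y
      using that add kvs.subspace_add[OF sU] by (auto simp flip: add)
    show "scale c x \<in> f ` U" if "x \<in> f ` U" for c x
      using that sc kvs.subspace_scale[OF sU] by (auto simp flip: sc)
  qed
  moreover have "fd_space (kvs.span (f ` B))" using B by (auto simp: fd_space_def)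
  ultimately show ?thesis using fd_space_sub sub by blast
qed

lemma fd_space_prodset:
  assumes U: "fd_space U" and W: "fd_space W" shows "fd_space (prodset U W)"
proof -
  obtain B where B: "finite B" "(\<lambda>u. pr u 0) ` U = kvs.span B"
    using fd_space_image[OF U, of "\<lambda>u. pr u 0"] by (auto simp: fd_space_def pr_add pr_scale)
  obtain D where D: "finite D" "(\<lambda>u. pr 0 u) ` W = kvs.span D"
    using fd_space_image[OF W, of "\<lambda>u. pr 0 u"] by (auto simp: fd_space_def pr_add pr_scale)
  have "prodset U W \<subseteq> kvs.span (B \<union> D)"
  proof
    fix z assume z: "z \<in> prodset U W"
    have "pr (pr1 z) 0 \<in> kvs.span B" "pr 0 (pr2 z) \<in> kvs.span D"
      using z by (auto simp: prodset_iff simp flip: B D)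
    then have "pr (pr1 z) 0 + pr 0 (pr2 z) \<in> kvs.span (B \<union> D)"
      by (intro kvs.span_add) (meson Un_upper1 Un_upper2 kvs.span_mono subsetD)+
    then show "z \<in> kvs.span (B \<union> D)" by (simp add: pr_add)
  qed
  moreover have "fd_space (kvs.span (B \<union> D))" using B D by (auto simp: fd_space_def)
  ultimately show ?thesis using fd_space_sub subspace_prodset[OF fd_space_subspace[OF U] fd_space_subspace[OF W]] by blast
qed

lemma fd_space_zero: "fd_space {0}"
  by (auto simp: fd_space_def intro!: exI[of _ "{}"])

interpretation kvsp: vector_space_pair "scale :: 'k::field \<Rightarrow> 'k vec \<Rightarrow> 'k vec" "scale :: 'k::field \<Rightarrow> 'k vec \<Rightarrow> 'k vec"
  by unfold_locales

text \<open>Quotients, too, must live in the fixed space. With a linear projection \<open>g\<close>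
  onto \<open>V\<close>, the endomorphism x - g x has kernel exactly \<open>V\<close> and serves as
  the quotient map.\<close>

lemma linear_with_kernel:
  fixes V :: "'k::field vec set"
  assumes V: "kvs.subspace V"
  shows "\<exists>c :: 'k vec \<Rightarrow> 'k vec. (\<forall>x y. c (x + y) = c x + c y) \<and> (\<forall>r x. c (scale r x) = scale r (c x)) \<and> (\<forall>x. c x = 0 \<longleftrightarrow> x \<in> V)"
proof -
  have "Vector_Spaces.linear scale scale (\<lambda>x :: 'k vec. x)" using kvs.linear_ident by simp
  then obtain g where g: "range g \<subseteq> V" "Vector_Spaces.linear scale scale g" "\<forall>v\<in>V. g v = v"
    using kvsp.linear_exists_left_inverse_on[of "\<lambda>x. x" V] V by (auto simp: inj_on_def)
  have "g (x + y) = g x + g y" "g (scale r x) = scale r (g x)" for x y r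
    using kvsp.linear_add[OF g(2)] kvsp.linear_scale[OF g(2)] by auto
  then show ?thesis
    by (intro exI[of _ "\<lambda>x. x - g x"]) (use g(1,3) in \<open>auto simp: scale_diff range_subsetD\<close>)
qed

section \<open>Modules, fibre products and products\<close>

lemma right_module_iff: "right_module A M \<longleftrightarrow> kvs.subspace (fst M) \<and>
     (\<forall>u\<in>fst M. \<forall>a\<in>carrier A. snd M u a \<in> fst M) \<and>
     (\<forall>u\<in>fst M. \<forall>v\<in>fst M. \<forall>a\<in>carrier A. snd M (u + v) a = snd M u a + snd M v a) \<and>
     (\<forall>u\<in>fst M. \<forall>a\<in>carrier A. \<forall>b\<in>carrier A. snd M u (a \<oplus>\<^bsub>A\<^esub> b) = snd M u a + snd M u b) \<and>
     (\<forall>u\<in>fst M. \<forall>a\<in>carrier A. \<forall>b\<in>carrier A. snd M u (a \<otimes>\<^bsub>A\<^esub> b) = snd M (snd M u a) b) \<and>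
     (\<forall>u\<in>fst M. snd M u \<one>\<^bsub>A\<^esub> = u) \<and>
     (\<forall>u\<in>fst M. \<forall>a\<in>carrier A. \<forall>c. snd M (scale c u) a = scale c (snd M u a) \<and>
        snd M u (c \<odot>\<^bsub>A\<^esub> a) = scale c (snd M u a))"
  by (cases M) (simp add: right_module_def)

text \<open>Isolates what finite dimension of the algebra is used for: kernels and fibre products
  are subspaces, for which finite dimension is inherited at once.\<close>

locale fd_modules =
  fixes A :: "('k::field, 'a) module"
  assumes fin_gen_iff: "right_module A M \<Longrightarrow> fin_gen A M \<longleftrightarrow> fd_space (fst M)"
begin

abbreviation "MO \<equiv> Ob (mod_cat A)"
abbreviation "MH \<equiv> Hom (mod_cat A)"
abbreviation "mc \<equiv> Comp (mod_cat A)"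

lemma MO_iff: "M \<in> MO \<longleftrightarrow> right_module A M \<and> fd_space (fst M)"
  by (auto simp: mod_cat_def fin_gen_iff)

lemma MH_iff: "f \<in> MH M N \<longleftrightarrow> f \<in> linear_maps (fst M) (fst N) \<and> (\<forall>u\<in>fst M. \<forall>a\<in>carrier A. f (snd M u a) = snd N (f u) a)"
  by (cases M, cases N) (simp add: mod_cat_def)

lemma mc_app [simp]: "x \<in> fst L \<Longrightarrow> mc L M N g f x = g (f x)"
  by (simp add: mod_cat_def compose_def)

lemma mid_app [simp]: "x \<in> fst M \<Longrightarrow> Id (mod_cat A) M x = x"
  by (simp add: mod_cat_def)

lemma MO_subspace: "M \<in> MO \<Longrightarrow> kvs.subspace (fst M)"
  using MO_iff fd_space_subspace by blast

lemma MH_mem: "f \<in> MH M N \<Longrightarrow> x \<in> fst M \<Longrightarrow> f x \<in> fst N"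
  by (simp add: MH_iff linear_maps_iff)

lemma MH_eqI: "f \<in> MH M N \<Longrightarrow> g \<in> MH M N \<Longrightarrow> (\<And>x. x \<in> fst M \<Longrightarrow> f x = g x) \<Longrightarrow> f = g"
  unfolding MH_iff linear_maps_iff by (meson extensionalityI)

lemma MH_comp: "f \<in> MH L M \<Longrightarrow> g \<in> MH M N \<Longrightarrow> L \<in> MO \<Longrightarrow> mc L M N g f \<in> MH L N"
  unfolding MH_iff linear_maps_iff
  using kvs.subspace_add[OF MO_subspace[of L]] kvs.subspace_scale[OF MO_subspace[of L]]
  by (auto simp: mod_cat_def compose_def right_module_iff)

lemma MH_id: "M \<in> MO \<Longrightarrow> Id (mod_cat A) M \<in> MH M M"
  unfolding MH_iff linear_maps_iff
  using kvs.subspace_add[OF MO_subspace[of M]] kvs.subspace_scale[OF MO_subspace[of M]]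
  by (auto simp: mod_cat_def right_module_iff)

lemma MH_add: "f \<in> MH M N \<Longrightarrow> g \<in> MH M N \<Longrightarrow> M \<in> MO \<Longrightarrow> N \<in> MO \<Longrightarrow> (\<lambda>u\<in>fst M. f u + g u) \<in> MH M N"
  unfolding MH_iff linear_maps_iff
  using kvs.subspace_add[OF MO_subspace[of M]] kvs.subspace_scale[OF MO_subspace[of M]] kvs.subspace_add[OF MO_subspace[of N]]
  by (auto simp: MO_iff right_module_iff scale_add add_ac)

lemma MH_scale: "f \<in> MH M N \<Longrightarrow> M \<in> MO \<Longrightarrow> N \<in> MO \<Longrightarrow> (\<lambda>u\<in>fst M. scale c (f u)) \<in> MH M N"
  unfolding MH_iff linear_maps_iff
  using kvs.subspace_add[OF MO_subspace[of M]] kvs.subspace_scale[OF MO_subspace[of M]] kvs.subspace_scale[OF MO_subspace[of N]]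
  by (auto simp: MO_iff right_module_iff scale_add mult.commute)

lemma MH_lin: "f \<in> MH M N \<Longrightarrow> x \<in> fst M \<Longrightarrow> y \<in> fst M \<Longrightarrow> f (x + y) = f x + f y"
  "f \<in> MH M N \<Longrightarrow> x \<in> fst M \<Longrightarrow> f (scale c x) = scale c (f x)"
  by (auto simp: MH_iff linear_maps_iff)

lemma MH_diff: "f \<in> MH M N \<Longrightarrow> M \<in> MO \<Longrightarrow> x \<in> fst M \<Longrightarrow> y \<in> fst M \<Longrightarrow> f (x - y) = f x - f y"
  using linear_maps_diff[OF _ MO_subspace] by (metis MH_iff)

lemma MH_restrict:
  assumes "\<And>x. x \<in> fst M \<Longrightarrow> f x \<in> fst N" "\<And>x y. x \<in> fst M \<Longrightarrow> y \<in> fst M \<Longrightarrow> f (x + y) = f x + f y"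
    "\<And>c x. x \<in> fst M \<Longrightarrow> f (scale c x) = scale c (f x)"
    "\<And>x a. x \<in> fst M \<Longrightarrow> a \<in> carrier A \<Longrightarrow> f (snd M x a) = snd N (f x) a"
    and M: "M \<in> MO"
  shows "(\<lambda>x\<in>fst M. f x) \<in> MH M N"
  unfolding MH_iff linear_maps_iff
  using kvs.subspace_add[OF MO_subspace[OF M]] kvs.subspace_scale[OF MO_subspace[OF M]] assms
  by (auto simp: MO_iff right_module_iff)

lemma zero_mod: "({0}, \<lambda>_ _. 0) \<in> MO"
  by (auto simp: MO_iff right_module_iff fd_space_zero kvs.subspace_0 kvs.subspace_def)

lemma act_zero: "M \<in> MO \<Longrightarrow> a \<in> carrier A \<Longrightarrow> snd M 0 a = 0"
proof -
  assume M: "M \<in> MO" and a: "a \<in> carrier A"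
  have "0 \<in> fst M" using kvs.subspace_0[OF MO_subspace[OF M]] .
  then have "snd M (scale 0 0) a = scale 0 (snd M 0 a)" using M a unfolding MO_iff right_module_iff by blast
  then show ?thesis by simp
qed

lemma zero_MH: "M \<in> MO \<Longrightarrow> N \<in> MO \<Longrightarrow> (\<lambda>u\<in>fst M. 0) \<in> MH M N"
  by (rule MH_restrict) (auto simp: act_zero kvs.subspace_0[OF MO_subspace])

text \<open>Lifts are recorded without uniqueness, since presentations of functors ask only whether
  a morphism factors.\<close>

lemma pullback_mod:
  assumes P: "P \<in> MO" and N: "N \<in> MO" and M: "M \<in> MO" and p: "p \<in> MH P N" and f: "f \<in> MH M N"
  obtains V a b where "V \<in> MO" "a \<in> MH V P" "b \<in> MH V M" "\<forall>v\<in>fst V. p (a v) = f (b v)"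
    "\<forall>X\<in>MO. \<forall>g\<in>MH X P. \<forall>h\<in>MH X M. (\<forall>x\<in>fst X. p (g x) = f (h x)) \<longrightarrow>
      (\<exists>l\<in>MH X V. \<forall>x\<in>fst X. a (l x) = g x \<and> b (l x) = h x)"
proof -
  define V where "V = ({z \<in> prodset (fst P) (fst M). p (pr1 z) = f (pr2 z)}, \<lambda>z a. pr (snd P (pr1 z) a) (snd M (pr2 z) a))"
  have fV: "z \<in> fst V \<longleftrightarrow> pr1 z \<in> fst P \<and> pr2 z \<in> fst M \<and> p (pr1 z) = f (pr2 z)" for z
    by (auto simp: V_def prodset_iff)
  have sV: "snd V z a = pr (snd P (pr1 z) a) (snd M (pr2 z) a)" for z a by (simp add: V_def)
  have subsp: "kvs.subspace (fst P)" "kvs.subspace (fst M)" using MO_subspace P M by auto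
  have p0: "p 0 = 0" "f 0 = 0" using p f linear_maps_zero subsp by (auto simp: MH_iff)
  have sub: "kvs.subspace (fst V)"
    by (rule kvs.subspaceI)
      (use subsp MH_lin[OF p] MH_lin[OF f] in \<open>auto simp: fV p0 pr12_add pr12_scale kvs.subspace_def\<close>)
  have "fd_space (fst V)"
    by (rule fd_space_sub[OF fd_space_prodset[of "fst P" "fst M"] sub]) (use P M in \<open>auto simp: MO_iff fV prodset_iff\<close>)
  moreover have "right_module A V"
    unfolding right_module_iff
    using P M p f sub by (auto simp: sV fV MO_iff right_module_iff pr12_add pr12_scale pr_add pr_scale MH_iff)
  ultimately have V: "V \<in> MO" by (simp add: MO_iff)
  show ?thesis
  proof (rule that[of V "\<lambda>z\<in>fst V. pr1 z" "\<lambda>z\<in>fst V. pr2 z"])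
    show "(\<lambda>z\<in>fst V. pr1 z) \<in> MH V P" "(\<lambda>z\<in>fst V. pr2 z) \<in> MH V M"
      by (rule MH_restrict; auto simp: fV sV pr12_add pr12_scale V)+
    show "\<forall>v\<in>fst V. p ((\<lambda>z\<in>fst V. pr1 z) v) = f ((\<lambda>z\<in>fst V. pr2 z) v)" by (auto simp: fV)
    show "\<forall>X\<in>MO. \<forall>g\<in>MH X P. \<forall>h\<in>MH X M. (\<forall>x\<in>fst X. p (g x) = f (h x)) \<longrightarrow>
      (\<exists>l\<in>MH X V. \<forall>x\<in>fst X. (\<lambda>z\<in>fst V. pr1 z) (l x) = g x \<and> (\<lambda>z\<in>fst V. pr2 z) (l x) = h x)"
    proof (intro ballI impI)
      fix X g h assume X: "X \<in> MO" "g \<in> MH X P" "h \<in> MH X M" and e: "\<forall>x\<in>fst X. p (g x) = f (h x)"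
      have "(\<lambda>x\<in>fst X. pr (g x) (h x)) \<in> MH X V"
        by (rule MH_restrict[OF _ _ _ _ X(1)])
          (use X e in \<open>auto simp: fV sV pr_add pr_scale MH_iff linear_maps_iff\<close>)
      then show "\<exists>l\<in>MH X V. \<forall>x\<in>fst X. (\<lambda>z\<in>fst V. pr1 z) (l x) = g x \<and> (\<lambda>z\<in>fst V. pr2 z) (l x) = h x"
        by (rule bexI[rotated]) (use X e in \<open>auto simp: fV MH_mem\<close>)
    qed
  qed (rule V)
qed

lemma product_mod:
  assumes P: "P \<in> MO" and M: "M \<in> MO"
  obtains V a b where "V \<in> MO" "a \<in> MH V P" "b \<in> MH V M"
    "\<forall>X\<in>MO. \<forall>g\<in>MH X P. \<forall>h\<in>MH X M. \<exists>l\<in>MH X V. \<forall>x\<in>fst X. a (l x) = g x \<and> b (l x) = h x"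
    "\<forall>x\<in>fst V. \<forall>y\<in>fst V. a x = a y \<longrightarrow> b x = b y \<longrightarrow> x = y"
proof -
  define V where "V = (prodset (fst P) (fst M), \<lambda>z a. pr (snd P (pr1 z) a) (snd M (pr2 z) a))"
  have fV: "z \<in> fst V \<longleftrightarrow> pr1 z \<in> fst P \<and> pr2 z \<in> fst M" for z
    by (auto simp: V_def prodset_iff)
  have sV: "snd V z a = pr (snd P (pr1 z) a) (snd M (pr2 z) a)" for z a by (simp add: V_def)
  have fd: "fd_space (fst V)" using P M fd_space_prodset by (auto simp: MO_iff V_def)
  then have "right_module A V"
    unfolding right_module_iff
    using P M fd_space_subspace[OF fd] by (auto simp: sV fV MO_iff right_module_iff pr12_add pr12_scale pr_add pr_scale)
  then have V: "V \<in> MO" using fd by (simp add: MO_iff)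
  show ?thesis
  proof (rule that[of V "\<lambda>z\<in>fst V. pr1 z" "\<lambda>z\<in>fst V. pr2 z"])
    show "(\<lambda>z\<in>fst V. pr1 z) \<in> MH V P" "(\<lambda>z\<in>fst V. pr2 z) \<in> MH V M"
      by (rule MH_restrict; auto simp: fV sV pr12_add pr12_scale V)+
    show "\<forall>x\<in>fst V. \<forall>y\<in>fst V. (\<lambda>z\<in>fst V. pr1 z) x = (\<lambda>z\<in>fst V. pr1 z) y \<longrightarrow> (\<lambda>z\<in>fst V. pr2 z) x = (\<lambda>z\<in>fst V. pr2 z) y \<longrightarrow> x = y"
      by (auto) (metis pr_simps(3))
    show "\<forall>X\<in>MO. \<forall>g\<in>MH X P. \<forall>h\<in>MH X M.
      \<exists>l\<in>MH X V. \<forall>x\<in>fst X. (\<lambda>z\<in>fst V. pr1 z) (l x) = g x \<and> (\<lambda>z\<in>fst V. pr2 z) (l x) = h x"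
    proof (intro ballI impI)
      fix X g h assume X: "X \<in> MO" "g \<in> MH X P" "h \<in> MH X M"
      have "(\<lambda>x\<in>fst X. pr (g x) (h x)) \<in> MH X V"
        by (rule MH_restrict[OF _ _ _ _ X(1)])
          (use X in \<open>auto simp: fV sV pr_add pr_scale MH_iff linear_maps_iff\<close>)
      then show "\<exists>l\<in>MH X V. \<forall>x\<in>fst X. (\<lambda>z\<in>fst V. pr1 z) (l x) = g x \<and> (\<lambda>z\<in>fst V. pr2 z) (l x) = h x"
        by (rule bexI[rotated]) (use X in \<open>auto simp: fV MH_mem\<close>)
    qed
  qed (rule V)
qed

section \<open>Linear functors and their presentations\<close>

lemma linear_functorI:
  assumes "\<And>M. M \<in> MO \<Longrightarrow> fd_space (Fob F M)"
    and "\<And>M N f. M \<in> MO \<Longrightarrow> N \<in> MO \<Longrightarrow> f \<in> MH M N \<Longrightarrow> Fmap F M N f \<in> extensional (Fob F N)"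
    and "\<And>M N f y. M \<in> MO \<Longrightarrow> N \<in> MO \<Longrightarrow> f \<in> MH M N \<Longrightarrow> y \<in> Fob F N \<Longrightarrow> Fmap F M N f y \<in> Fob F M"
    and "\<And>M N f x y. M \<in> MO \<Longrightarrow> N \<in> MO \<Longrightarrow> f \<in> MH M N \<Longrightarrow> x \<in> Fob F N \<Longrightarrow> y \<in> Fob F N \<Longrightarrow>
      Fmap F M N f (x + y) = Fmap F M N f x + Fmap F M N f y"
    and "\<And>M N f c y. M \<in> MO \<Longrightarrow> N \<in> MO \<Longrightarrow> f \<in> MH M N \<Longrightarrow> y \<in> Fob F N \<Longrightarrow> Fmap F M N f (scale c y) = scale c (Fmap F M N f y)"
    and "\<And>M y. M \<in> MO \<Longrightarrow> y \<in> Fob F M \<Longrightarrow> Fmap F M M (Id (mod_cat A) M) y = y"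
    and "\<And>L M N f g y. L \<in> MO \<Longrightarrow> M \<in> MO \<Longrightarrow> N \<in> MO \<Longrightarrow> f \<in> MH L M \<Longrightarrow> g \<in> MH M N \<Longrightarrow> y \<in> Fob F N \<Longrightarrow>
      Fmap F L N (mc L M N g f) y = Fmap F L M f (Fmap F M N g y)"
    and "\<And>M N f g y. M \<in> MO \<Longrightarrow> N \<in> MO \<Longrightarrow> f \<in> MH M N \<Longrightarrow> g \<in> MH M N \<Longrightarrow> y \<in> Fob F N \<Longrightarrow>
      Fmap F M N (\<lambda>u\<in>fst M. f u + g u) y = Fmap F M N f y + Fmap F M N g y"
    and "\<And>M N f c y. M \<in> MO \<Longrightarrow> N \<in> MO \<Longrightarrow> f \<in> MH M N \<Longrightarrow> y \<in> Fob F N \<Longrightarrow>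
      Fmap F M N (\<lambda>u\<in>fst M. scale c (f u)) y = scale c (Fmap F M N f y)"
  shows "linear_functor A F"
  unfolding linear_functor_def
proof (intro conjI ballI allI)
  fix M assume M: "M \<in> MO"
  show "fd_space (Fob F M)" using assms(1) M .
  show "Fmap F M M (Id (mod_cat A) M) = (\<lambda>x\<in>Fob F M. x)"
    by (rule extensionalityI[OF assms(2)[OF M M MH_id[OF M]]]) (auto simp: assms(6)[OF M])
  fix N assume N: "N \<in> MO"
  { fix f assume "f \<in> MH M N"
    then show "Fmap F M N f \<in> linear_maps (Fob F N) (Fob F M)"
      using assms(2-5)[OF M N] unfolding linear_maps_iff by blast }
  { fix f x g assume "f \<in> MH M N" "x \<in> Fob F N" "g \<in> MH M N"
    then show "Fmap F M N (\<lambda>u\<in>fst M. f u + g u) x = Fmap F M N f x + Fmap F M N g x" using assms(8)[OF M N] by blast }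
  { fix f x c assume "f \<in> MH M N" "x \<in> Fob F N"
    then show "Fmap F M N (\<lambda>u\<in>fst M. scale c (f u)) x = scale c (Fmap F M N f x)" using assms(9)[OF M N] by blast }
  fix L f g assume L: "L \<in> MO" and fg: "f \<in> MH M N" "g \<in> MH N L"
  show "Fmap F M L (mc M N L g f) = compose (Fob F L) (Fmap F M N f) (Fmap F N L g)"
    by (rule extensionalityI[OF assms(2)[OF M L MH_comp[OF fg M]]])
      (auto simp: compose_def assms(7)[OF M N L fg])
qed

lemma linear_functorD:
  assumes F: "linear_functor A F"
  shows lf_fd: "M \<in> MO \<Longrightarrow> fd_space (Fob F M)"
    and lf_map: "M \<in> MO \<Longrightarrow> N \<in> MO \<Longrightarrow> f \<in> MH M N \<Longrightarrow> y \<in> Fob F N \<Longrightarrow> Fmap F M N f y \<in> Fob F M"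
    and lf_add: "M \<in> MO \<Longrightarrow> N \<in> MO \<Longrightarrow> f \<in> MH M N \<Longrightarrow> x \<in> Fob F N \<Longrightarrow> y \<in> Fob F N \<Longrightarrow>
      Fmap F M N f (x + y) = Fmap F M N f x + Fmap F M N f y"
    and lf_scale: "M \<in> MO \<Longrightarrow> N \<in> MO \<Longrightarrow> f \<in> MH M N \<Longrightarrow> y \<in> Fob F N \<Longrightarrow> Fmap F M N f (scale c y) = scale c (Fmap F M N f y)"
    and lf_id: "M \<in> MO \<Longrightarrow> y \<in> Fob F M \<Longrightarrow> Fmap F M M (Id (mod_cat A) M) y = y"
    and lf_comp: "L \<in> MO \<Longrightarrow> M \<in> MO \<Longrightarrow> N \<in> MO \<Longrightarrow> f \<in> MH L M \<Longrightarrow> g \<in> MH M N \<Longrightarrow> y \<in> Fob F N \<Longrightarrow>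
      Fmap F L N (mc L M N g f) y = Fmap F L M f (Fmap F M N g y)"
    and lf_addf: "M \<in> MO \<Longrightarrow> N \<in> MO \<Longrightarrow> f \<in> MH M N \<Longrightarrow> g \<in> MH M N \<Longrightarrow> y \<in> Fob F N \<Longrightarrow>
      Fmap F M N (\<lambda>u\<in>fst M. f u + g u) y = Fmap F M N f y + Fmap F M N g y"
    and lf_scalef: "M \<in> MO \<Longrightarrow> N \<in> MO \<Longrightarrow> f \<in> MH M N \<Longrightarrow> y \<in> Fob F N \<Longrightarrow>
      Fmap F M N (\<lambda>u\<in>fst M. scale c (f u)) y = scale c (Fmap F M N f y)"
    and lf_sub: "M \<in> MO \<Longrightarrow> kvs.subspace (Fob F M)"
  using F unfolding linear_functor_def linear_maps_iff
  by (simp_all add: compose_def fd_space_subspace)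

lemma lf_zero: "linear_functor A F \<Longrightarrow> M \<in> MO \<Longrightarrow> N \<in> MO \<Longrightarrow> f \<in> MH M N \<Longrightarrow> Fmap F M N f 0 = 0"
  using lf_scale[of F M N f 0 0] kvs.subspace_0[OF lf_sub[of F N]] by simp

text \<open>By Yoneda a natural transformation Hom(-, N) -> F is an element \<open>x\<close> of
  \<open>F N\<close>. The last two clauses say that \<open>x\<close> generates \<open>F\<close> and
  that a morphism kills \<open>x\<close> iff it factors through \<open>f\<close>; this is exactness
  of Hom(-, M) -> Hom(-, N) -> F -> 0 without mentioning a transformation.\<close>

definition fpd :: "('k, 'a) mod_functor \<Rightarrow> ('k, 'a) rmod \<Rightarrow> ('k, 'a) rmod \<Rightarrow> ('k vec \<Rightarrow> 'k vec) \<Rightarrow> 'k vec \<Rightarrow> bool" where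
  "fpd F M N f x \<longleftrightarrow> M \<in> MO \<and> N \<in> MO \<and> f \<in> MH M N \<and> x \<in> Fob F N \<and>
     (\<forall>X\<in>MO. \<forall>y\<in>Fob F X. \<exists>g\<in>MH X N. y = Fmap F X N g x) \<and>
     (\<forall>X\<in>MO. \<forall>g\<in>MH X N. Fmap F X N g x = 0 \<longleftrightarrow> (\<exists>h\<in>MH X M. \<forall>u\<in>fst X. g u = f (h u)))"

lemma factor_iff:
  assumes "X \<in> MO" "M \<in> MO" "N \<in> MO" "f \<in> MH M N" "g \<in> MH X N"
  shows "g \<in> (\<lambda>h. mc X M N f h) ` MH X M \<longleftrightarrow> (\<exists>h\<in>MH X M. \<forall>u\<in>fst X. g u = f (h u))"
proof
  assume "\<exists>h\<in>MH X M. \<forall>u\<in>fst X. g u = f (h u)"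
  then obtain h where h: "h \<in> MH X M" "\<forall>u\<in>fst X. g u = f (h u)" by blast
  have "g = mc X M N f h"
    by (rule MH_eqI[OF assms(5) MH_comp[OF h(1) assms(4,1)]]) (simp add: h)
  then show "g \<in> (\<lambda>h. mc X M N f h) ` MH X M" using h by blast
qed auto

lemma fin_presented_iff:
  assumes F: "linear_functor A F"
  shows "fin_presented A F \<longleftrightarrow> (\<exists>M N f x. fpd F M N f x)"
proof
  assume "fin_presented A F"
  then obtain M N f \<pi> where M: "M \<in> MO" "N \<in> MO" "f \<in> MH M N"
    and nat: "\<forall>X\<in>MO. \<forall>Y\<in>MO. \<forall>h\<in>MH X Y. \<forall>g\<in>MH Y N. \<pi> X (mc X Y N g h) = Fmap F X Y h (\<pi> Y g)"
    and sur: "\<forall>X\<in>MO. \<pi> X ` MH X N = Fob F X"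
    and ker: "\<forall>X\<in>MO. {g \<in> MH X N. \<pi> X g = 0} = (\<lambda>h. mc X M N f h) ` MH X M"
    unfolding fin_presented_def by (elim bexE exE conjE) (rule that)
  \<comment> \<open>The Yoneda element of the given transformation.\<close>
  let ?x = "\<pi> N (Id (mod_cat A) N)"
  have x: "?x \<in> Fob F N" using sur M MH_id by blast
  have px: "\<pi> X g = Fmap F X N g ?x" if "X \<in> MO" "g \<in> MH X N" for X g
  proof -
    have "mc X N N (Id (mod_cat A) N) g = g"
      by (rule MH_eqI[OF MH_comp[OF that(2) MH_id[OF M(2)] that(1)] that(2)]) (simp add: MH_mem[OF that(2)])
    then show ?thesis using nat that M MH_id by metis
  qed
  have "fpd F M N f ?x" unfolding fpd_def
  proof (intro conjI ballI M x)
    fix X assume X: "X \<in> MO"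
    show "\<exists>g\<in>MH X N. y = Fmap F X N g ?x" if "y \<in> Fob F X" for y
    proof -
      have "y \<in> \<pi> X ` MH X N" using that sur X by simp
      then obtain g where "g \<in> MH X N" "y = \<pi> X g" by blast
      then show ?thesis using px[OF X] by blast
    qed
    show "Fmap F X N g ?x = 0 \<longleftrightarrow> (\<exists>h\<in>MH X M. \<forall>u\<in>fst X. g u = f (h u))" if g: "g \<in> MH X N" for g
    proof -
      have "Fmap F X N g ?x = 0 \<longleftrightarrow> g \<in> {g \<in> MH X N. \<pi> X g = 0}" using g px[OF X g] by simp
      also have "\<dots> \<longleftrightarrow> g \<in> (\<lambda>h. mc X M N f h) ` MH X M" using ker X by simp
      finally show ?thesis using factor_iff[OF X M g] by simp
    qed
  qed
  then show "\<exists>M N f x. fpd F M N f x" by blast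
next
  assume "\<exists>M N f x. fpd F M N f x"
  then obtain M N f x where fp: "fpd F M N f x" by blast
  then have M: "M \<in> MO" "N \<in> MO" "f \<in> MH M N" "x \<in> Fob F N" by (auto simp: fpd_def)
  let ?p = "\<lambda>X g. Fmap F X N g x"
  show "fin_presented A F" unfolding fin_presented_def
  proof (rule bexI[OF _ M(1)], rule bexI[OF _ M(2)], rule bexI[OF _ M(3)], rule exI[of _ ?p], intro conjI ballI allI)
    fix X g h assume "X \<in> MO" "g \<in> MH X N" "h \<in> MH X N"
    then show "?p X (\<lambda>u\<in>fst X. g u + h u) = ?p X g + ?p X h" using lf_addf[OF F] M by blast
  next
    fix X g c assume "X \<in> MO" "g \<in> MH X N"
    then show "?p X (\<lambda>u\<in>fst X. scale c (g u)) = scale c (?p X g)" using lf_scalef[OF F] M by blast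
  next
    fix X Y h g assume "X \<in> MO" "Y \<in> MO" "h \<in> MH X Y" "g \<in> MH Y N"
    then show "?p X (mc X Y N g h) = Fmap F X Y h (?p Y g)" using lf_comp[OF F] M by blast
  next
    fix X assume X: "X \<in> MO"
    show "?p X ` MH X N = Fob F X" using fp X lf_map[OF F X M(2)] M unfolding fpd_def by (auto simp: image_iff)
    show "{g \<in> MH X N. ?p X g = 0} = (\<lambda>h. mc X M N f h) ` MH X M"
    proof (intro subset_antisym subsetI)
      fix g assume "g \<in> {g \<in> MH X N. ?p X g = 0}"
      then show "g \<in> (\<lambda>h. mc X M N f h) ` MH X M" using fp X factor_iff[OF X M(1-3), of g] unfolding fpd_def by blast
    next
      fix g assume g: "g \<in> (\<lambda>h. mc X M N f h) ` MH X M"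
      then have "g \<in> MH X N" using MH_comp[OF _ M(3) X] by blast
      then show "g \<in> {g \<in> MH X N. ?p X g = 0}" using g fp X factor_iff[OF X M(1-3), of g] unfolding fpd_def by blast
    qed
  qed
qed

section \<open>The category of finitely presented functors\<close>

abbreviation "FC \<equiv> fp_functor_cat A"

lemma FO_iff: "F \<in> Ob FC \<longleftrightarrow> linear_functor A F \<and> (\<exists>M N f x. fpd F M N f x)"
  unfolding fp_functor_cat_def using fin_presented_iff[of F] by (simp del: split_paired_Ex) blast

lemma FO_lf: "F \<in> Ob FC \<Longrightarrow> linear_functor A F" by (simp add: FO_iff)

lemma FH_iff: "\<eta> \<in> Hom FC F G \<longleftrightarrow> \<eta> \<in> extensional MO \<and> (\<forall>M\<in>MO. \<eta> M \<in> linear_maps (Fob F M) (Fob G M)) \<and>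
   (\<forall>M\<in>MO. \<forall>N\<in>MO. \<forall>f\<in>MH M N. \<forall>x\<in>Fob F N. \<eta> M (Fmap F M N f x) = Fmap G M N f (\<eta> N x))"
  by (auto simp: fp_functor_cat_def PiE_iff)

lemma FH_D:
  assumes "\<eta> \<in> Hom FC F G"
  shows FH_mem: "M \<in> MO \<Longrightarrow> x \<in> Fob F M \<Longrightarrow> \<eta> M x \<in> Fob G M"
    and FH_add: "M \<in> MO \<Longrightarrow> x \<in> Fob F M \<Longrightarrow> y \<in> Fob F M \<Longrightarrow> \<eta> M (x + y) = \<eta> M x + \<eta> M y"
    and FH_scale: "M \<in> MO \<Longrightarrow> x \<in> Fob F M \<Longrightarrow> \<eta> M (scale c x) = scale c (\<eta> M x)"
    and FH_nat: "M \<in> MO \<Longrightarrow> N \<in> MO \<Longrightarrow> f \<in> MH M N \<Longrightarrow> y \<in> Fob F N \<Longrightarrow> \<eta> M (Fmap F M N f y) = Fmap G M N f (\<eta> N y)"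
  using assms unfolding FH_iff linear_maps_iff by auto

lemma FH_I:
  assumes F: "F \<in> Ob FC"
    and "\<And>M x. M \<in> MO \<Longrightarrow> x \<in> Fob F M \<Longrightarrow> h M x \<in> Fob G M"
    and "\<And>M x y. M \<in> MO \<Longrightarrow> x \<in> Fob F M \<Longrightarrow> y \<in> Fob F M \<Longrightarrow> h M (x + y) = h M x + h M y"
    and "\<And>M c x. M \<in> MO \<Longrightarrow> x \<in> Fob F M \<Longrightarrow> h M (scale c x) = scale c (h M x)"
    and "\<And>M N f y. M \<in> MO \<Longrightarrow> N \<in> MO \<Longrightarrow> f \<in> MH M N \<Longrightarrow> y \<in> Fob F N \<Longrightarrow> h M (Fmap F M N f y) = Fmap G M N f (h N y)"
  shows "(\<lambda>M\<in>MO. \<lambda>x\<in>Fob F M. h M x) \<in> Hom FC F G"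
proof -
  have s: "kvs.subspace (Fob F M)" if "M \<in> MO" for M using lf_sub F that FO_lf by blast
  show ?thesis unfolding FH_iff linear_maps_iff
    using assms kvs.subspace_add[OF s] kvs.subspace_scale[OF s] lf_map[OF FO_lf[OF F]] by auto
qed

lemma FH_zero: "\<eta> \<in> Hom FC F G \<Longrightarrow> F \<in> Ob FC \<Longrightarrow> M \<in> MO \<Longrightarrow> \<eta> M 0 = 0"
  using FH_scale[of \<eta> F G M 0 0] kvs.subspace_0[OF lf_sub[OF FO_lf]] by simp

lemma FH_diff: "\<eta> \<in> Hom FC F G \<Longrightarrow> F \<in> Ob FC \<Longrightarrow> M \<in> MO \<Longrightarrow> x \<in> Fob F M \<Longrightarrow> y \<in> Fob F M \<Longrightarrow> \<eta> M (x - y) = \<eta> M x - \<eta> M y"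
  unfolding FH_iff using linear_maps_diff lf_sub FO_lf by blast

text \<open>The subfunctor of elements killed by \<eta> is clear; the point is its presentation.
  Generators and relations of the kernel are two successive fibre products of modules, which exist
  because module categories have kernels and products.\<close>

lemma functor_kernel:
  assumes F: "F \<in> Ob FC" and G: "G \<in> Ob FC" and \<eta>: "\<eta> \<in> Hom FC F G"
  defines "K \<equiv> \<lparr>Fob = (\<lambda>M. {x \<in> Fob F M. \<eta> M x = 0}), Fmap = (\<lambda>M N f. \<lambda>x\<in>{x \<in> Fob F N. \<eta> N x = 0}. Fmap F M N f x)\<rparr>"
  shows "\<exists>K\<in>Ob FC. \<exists>k\<in>Hom FC K F. \<forall>M\<in>MO. inj_on (k M) (Fob K M) \<and> k M ` Fob K M = {x \<in> Fob F M. \<eta> M x = 0}"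
proof -
  note lF = FO_lf[OF F] and lG = FO_lf[OF G]
  have sub: "kvs.subspace (Fob K M)" if M: "M \<in> MO" for M
    using lf_sub[OF lF M] FH_add[OF \<eta> M] FH_scale[OF \<eta> M] FH_zero[OF \<eta> F M]
    by (auto simp: K_def kvs.subspace_def)
  have K: "x \<in> Fob K M \<longleftrightarrow> x \<in> Fob F M \<and> \<eta> M x = 0" for x M by (simp add: K_def)
  have Km: "x \<in> Fob K N \<Longrightarrow> Fmap K M N f x = Fmap F M N f x" for M N f x by (simp add: K_def)
  have Kc: "M \<in> MO \<Longrightarrow> N \<in> MO \<Longrightarrow> f \<in> MH M N \<Longrightarrow> y \<in> Fob K N \<Longrightarrow> Fmap F M N f y \<in> Fob K M" for M N f y
    unfolding K using lf_map[OF lF] FH_nat[OF \<eta>] lf_zero[OF lG] by simp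
  have lK: "linear_functor A K"
  proof (rule linear_functorI)
    fix M assume M: "M \<in> MO"
    show "fd_space (Fob K M)" by (rule fd_space_sub[OF lf_fd[OF lF M] sub[OF M]]) (auto simp: K)
    show "Fmap K M M (Id (mod_cat A) M) y = y" if "y \<in> Fob K M" for y
      using that lf_id[OF lF M] by (simp add: Km K)
    fix N f assume N: "N \<in> MO" and f: "f \<in> MH M N"
    show "Fmap K M N f \<in> extensional (Fob K N)" by (simp add: K_def)
    show "y \<in> Fob K N \<Longrightarrow> Fmap K M N f y \<in> Fob K M" for y using Kc[OF M N f] by (simp add: Km)
    show "x \<in> Fob K N \<Longrightarrow> y \<in> Fob K N \<Longrightarrow> Fmap K M N f (x + y) = Fmap K M N f x + Fmap K M N f y" for x y
      using kvs.subspace_add[OF sub[OF N]] lf_add[OF lF M N f] by (simp add: Km K)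
    show "y \<in> Fob K N \<Longrightarrow> Fmap K M N f (scale c y) = scale c (Fmap K M N f y)" for c y
      using kvs.subspace_scale[OF sub[OF N]] lf_scale[OF lF M N f] by (simp add: Km K)
    show "g \<in> MH M N \<Longrightarrow> y \<in> Fob K N \<Longrightarrow> Fmap K M N (\<lambda>u\<in>fst M. f u + g u) y = Fmap K M N f y + Fmap K M N g y" for g y
      using lf_addf[OF lF M N f] by (simp add: Km K)
    show "y \<in> Fob K N \<Longrightarrow> Fmap K M N (\<lambda>u\<in>fst M. scale c (f u)) y = scale c (Fmap K M N f y)" for c y
      using lf_scalef[OF lF M N f] by (simp add: Km K)
    fix L g y assume L: "L \<in> MO" "g \<in> MH N L" "y \<in> Fob K L"
    show "Fmap K M L (mc M N L g f) y = Fmap K M N f (Fmap K N L g y)"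
      using lf_comp[OF lF M N L(1) f L(2)] Kc[OF N L] L(3) by (simp add: Km K)
  qed
  obtain M N f x where fpF: "fpd F M N f x" using F FO_iff by blast
  obtain M' N' f' x' where fpG: "fpd G M' N' f' x'" using G FO_iff by blast
  have M: "M \<in> MO" "N \<in> MO" "f \<in> MH M N" "x \<in> Fob F N"
    and gF: "\<And>X y. X \<in> MO \<Longrightarrow> y \<in> Fob F X \<Longrightarrow> \<exists>g\<in>MH X N. y = Fmap F X N g x"
    and rF: "\<And>X g. X \<in> MO \<Longrightarrow> g \<in> MH X N \<Longrightarrow> Fmap F X N g x = 0 \<longleftrightarrow> (\<exists>h\<in>MH X M. \<forall>u\<in>fst X. g u = f (h u))"
    using fpF by (auto simp: fpd_def)
  have M': "M' \<in> MO" "N' \<in> MO" "f' \<in> MH M' N'" "x' \<in> Fob G N'"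
    and gG: "\<And>X y. X \<in> MO \<Longrightarrow> y \<in> Fob G X \<Longrightarrow> \<exists>g\<in>MH X N'. y = Fmap G X N' g x'"
    and rG: "\<And>X g. X \<in> MO \<Longrightarrow> g \<in> MH X N' \<Longrightarrow> Fmap G X N' g x' = 0 \<longleftrightarrow> (\<exists>h\<in>MH X M'. \<forall>u\<in>fst X. g u = f' (h u))"
    using fpG by (auto simp: fpd_def)
  \<comment> \<open>\<open>h\<close> lifts \<eta> to the generating modules.\<close>
  obtain h where h: "h \<in> MH N N'" "\<eta> N x = Fmap G N N' h x'" using gG[OF M(2) FH_mem[OF \<eta> M(2,4)]] by blast
  have \<eta>g: "\<eta> X (Fmap F X N g x) = 0 \<longleftrightarrow> (\<exists>k\<in>MH X M'. \<forall>u\<in>fst X. h (g u) = f' (k u))"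
    if X: "X \<in> MO" and g: "g \<in> MH X N" for X g
  proof -
    have "\<eta> X (Fmap F X N g x) = Fmap G X N' (mc X N N' h g) x'"
      using FH_nat[OF \<eta> X M(2) g M(4)] h(2) lf_comp[OF lG X M(2) M'(2) g h(1) M'(4)] by simp
    then show ?thesis using rG[OF X MH_comp[OF g h(1) X]] by simp
  qed
  \<comment> \<open>A morphism g into \<open>N\<close> gives an element of the kernel iff h g
    factors through \<open>f'\<close>, that is, iff g factors through \<open>P\<close>.\<close>
  obtain P p q where P: "P \<in> MO" "p \<in> MH P N" "q \<in> MH P M'" "\<forall>v\<in>fst P. h (p v) = f' (q v)"
    and Pu: "\<forall>X\<in>MO. \<forall>g\<in>MH X N. \<forall>k\<in>MH X M'. (\<forall>x\<in>fst X. h (g x) = f' (k x)) \<longrightarrow>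
      (\<exists>l\<in>MH X P. \<forall>x\<in>fst X. p (l x) = g x \<and> q (l x) = k x)"
    using pullback_mod[OF M(2) M'(2,1) h(1) M'(3)] .
  \<comment> \<open>A morphism into \<open>P\<close> gives the zero element iff its composite with
    \<open>p\<close> factors through \<open>f\<close>, that is, iff it factors through
    \<open>R\<close>.\<close>
  obtain R a b where R: "R \<in> MO" "a \<in> MH R P" "b \<in> MH R M" "\<forall>v\<in>fst R. p (a v) = f (b v)"
    and Ru: "\<forall>X\<in>MO. \<forall>g\<in>MH X P. \<forall>k\<in>MH X M. (\<forall>x\<in>fst X. p (g x) = f (k x)) \<longrightarrow>
      (\<exists>l\<in>MH X R. \<forall>x\<in>fst X. a (l x) = g x \<and> b (l x) = k x)"
    using pullback_mod[OF P(1) M(2,1) P(2) M(3)] .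
  let ?k = "Fmap F P N p x"
  have k: "?k \<in> Fob K P" unfolding K using lf_map[OF lF P(1) M(2) P(2) M(4)] \<eta>g[OF P(1,2)] P(3,4) by blast
  have kg: "Fmap K X P g ?k = Fmap F X N (mc X P N p g) x" if X: "X \<in> MO" and g: "g \<in> MH X P" for X g
    using lf_comp[OF lF X P(1) M(2) g P(2) M(4)] k by (simp add: Km)
  have "fpd K R P a ?k" unfolding fpd_def
  proof (intro conjI ballI R(1,2) P(1) k)
    fix X assume X: "X \<in> MO"
    { fix y assume y: "y \<in> Fob K X"
      then obtain g where g: "g \<in> MH X N" "y = Fmap F X N g x" using gF[OF X] K by blast
      then obtain k where "k \<in> MH X M'" "\<forall>u\<in>fst X. h (g u) = f' (k u)" using \<eta>g[OF X g(1)] y K by blast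
      then obtain l where l: "l \<in> MH X P" "\<forall>x\<in>fst X. p (l x) = g x" using Pu X g(1) by blast
      have "mc X P N p l = g" by (rule MH_eqI[OF MH_comp[OF l(1) P(2) X] g(1)]) (simp add: l)
      then show "\<exists>g\<in>MH X P. y = Fmap K X P g ?k" using l(1) g(2) kg[OF X l(1)] by metis }
    fix g assume g: "g \<in> MH X P"
    show "Fmap K X P g ?k = 0 \<longleftrightarrow> (\<exists>h\<in>MH X R. \<forall>u\<in>fst X. g u = a (h u))"
    proof -
      have "Fmap K X P g ?k = 0 \<longleftrightarrow> (\<exists>h\<in>MH X M. \<forall>u\<in>fst X. p (g u) = f (h u))"
        using kg[OF X g] rF[OF X MH_comp[OF g P(2) X]] by simp
      also have "\<dots> \<longleftrightarrow> (\<exists>h\<in>MH X R. \<forall>u\<in>fst X. g u = a (h u))"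
      proof
        assume "\<exists>h\<in>MH X M. \<forall>u\<in>fst X. p (g u) = f (h u)"
        then obtain l where "l \<in> MH X R" "\<forall>x\<in>fst X. a (l x) = g x" using Ru X g by blast
        then show "\<exists>h\<in>MH X R. \<forall>u\<in>fst X. g u = a (h u)" by force
      next
        assume "\<exists>h\<in>MH X R. \<forall>u\<in>fst X. g u = a (h u)"
        then obtain l where l: "l \<in> MH X R" "\<forall>u\<in>fst X. g u = a (l u)" by blast
        have "p (g u) = f (mc X R M b l u)" if "u \<in> fst X" for u
          using that l R(4) MH_mem[OF l(1)] by simp
        then show "\<exists>h\<in>MH X M. \<forall>u\<in>fst X. p (g u) = f (h u)" using MH_comp[OF l(1) R(3) X] by blast
      qed
      finally show ?thesis .
    qed
  qed
  then have KO: "K \<in> Ob FC" using lK FO_iff by blast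
  have kh: "(\<lambda>M\<in>MO. \<lambda>x\<in>Fob K M. x) \<in> Hom FC K F"
    by (rule FH_I[OF KO]) (auto simp: K Km)
  show ?thesis
    by (rule bexI[OF _ KO], rule bexI[OF _ kh]) (auto simp: K inj_on_def)
qed

text \<open>The generating module of \<open>G\<close> still generates, and the relations are those
  of \<open>G\<close> together with the image of a lift \<open>h\<close> of \<eta>: the presenting
  map is (h, f') on the product of \<open>N\<close> and \<open>M'\<close>.\<close>

lemma functor_cokernel:
  assumes F: "F \<in> Ob FC" and G: "G \<in> Ob FC" and \<eta>: "\<eta> \<in> Hom FC F G"
  obtains Q c where "Q \<in> Ob FC" "c \<in> Hom FC G Q"
    "\<And>M. M \<in> MO \<Longrightarrow> c M ` Fob G M = Fob Q M \<and> {y \<in> Fob G M. c M y = 0} = \<eta> M ` Fob F M"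
proof -
  note lF = FO_lf[OF F] and lG = FO_lf[OF G]
  have im: "kvs.subspace (\<eta> M ` Fob F M)" if M: "M \<in> MO" for M
  proof (rule fd_space_subspace, rule fd_space_image)
    show "fd_space (Fob F M)" using lf_fd[OF lF M] .
  qed (use FH_add[OF \<eta> M] FH_scale[OF \<eta> M] in auto)
  have "\<forall>M\<in>MO. \<exists>c :: 'k vec \<Rightarrow> 'k vec. (\<forall>x y. c (x + y) = c x + c y) \<and> (\<forall>r x. c (scale r x) = scale r (c x)) \<and> (\<forall>x. c x = 0 \<longleftrightarrow> x \<in> \<eta> M ` Fob F M)"
  proof
    fix M assume M: "M \<in> MO"
    show "\<exists>c :: 'k vec \<Rightarrow> 'k vec. (\<forall>x y. c (x + y) = c x + c y) \<and> (\<forall>r x. c (scale r x) = scale r (c x)) \<and> (\<forall>x. c x = 0 \<longleftrightarrow> x \<in> \<eta> M ` Fob F M)"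
      by (rule linear_with_kernel[OF im[OF M]])
  qed
  from bchoice[OF this] obtain c :: "('k, 'a) rmod \<Rightarrow> 'k vec \<Rightarrow> 'k vec" where
    c': "\<forall>M\<in>MO. (\<forall>x y. c M (x + y) = c M x + c M y) \<and> (\<forall>r x. c M (scale r x) = scale r (c M x)) \<and> (\<forall>x. c M x = 0 \<longleftrightarrow> x \<in> \<eta> M ` Fob F M)"
    by blast
  have c: "\<And>M x y. M \<in> MO \<Longrightarrow> c M (x + y) = c M x + c M y"
    "\<And>M r x. M \<in> MO \<Longrightarrow> c M (scale r x) = scale r (c M x)" "\<And>M x. M \<in> MO \<Longrightarrow> c M x = 0 \<longleftrightarrow> x \<in> \<eta> M ` Fob F M"
    using c' by blast+
  have cd: "c M (x - y) = c M x - c M y" if M: "M \<in> MO" for M x y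
    using c(1)[OF M, of "x - y" y] by (simp add: algebra_simps)
  define Q where "Q = \<lparr>Fob = (\<lambda>M. c M ` Fob G M), Fmap = (\<lambda>M N f. \<lambda>z\<in>c N ` Fob G N. c M (Fmap G M N f (SOME y. y \<in> Fob G N \<and> c N y = z)))\<rparr>"
  have Q: "Fob Q M = c M ` Fob G M" for M by (simp add: Q_def)
  \<comment> \<open>The chosen preimage is immaterial: two preimages differ by a value of \<eta>,
    which naturality sends to a value of \<eta> again.\<close>
  have Qm: "Fmap Q M N f (c N y) = c M (Fmap G M N f y)"
    if M: "M \<in> MO" and N: "N \<in> MO" and f: "f \<in> MH M N" and y: "y \<in> Fob G N" for M N f y
  proof -
    let ?z = "SOME y'. y' \<in> Fob G N \<and> c N y' = c N y"
    have z: "?z \<in> Fob G N \<and> c N ?z = c N y" by (rule someI[of _ y]) (simp add: y)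
    then have "c N (?z - y) = 0" using cd[OF N] by simp
    then obtain w where w: "w \<in> Fob F N" "?z - y = \<eta> N w" using c(3)[OF N] by auto
    have "Fmap G M N f (\<eta> N w + y) = Fmap G M N f (\<eta> N w) + Fmap G M N f y"
      using lf_add[OF lG M N f FH_mem[OF \<eta> N w(1)] y] .
    moreover have "Fmap G M N f (\<eta> N w) = \<eta> M (Fmap F M N f w)" using FH_nat[OF \<eta> M N f w(1)] by simp
    moreover have "c M (\<eta> M (Fmap F M N f w)) = 0" using c(3)[OF M] lf_map[OF lF M N f w(1)] by blast
    moreover have "?z = \<eta> N w + y" using w(2) unfolding diff_eq_eq .
    ultimately have "c M (Fmap G M N f ?z) = c M (Fmap G M N f y)" using c(1)[OF M] by simp
    then show ?thesis using y by (simp add: Q_def)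
  qed
  have lQ: "linear_functor A Q"
  proof (rule linear_functorI)
    fix M assume M: "M \<in> MO"
    show "fd_space (Fob Q M)" unfolding Q by (rule fd_space_image[OF lf_fd[OF lG M]]) (auto simp: c M)
    show "Fmap Q M M (Id (mod_cat A) M) y = y" if "y \<in> Fob Q M" for y
      using that lf_id[OF lG M] Qm[OF M M MH_id[OF M]] by (auto simp: Q)
    fix N f assume N: "N \<in> MO" and f: "f \<in> MH M N"
    show "Fmap Q M N f \<in> extensional (Fob Q N)" by (simp add: Q_def)
    show "y \<in> Fob Q N \<Longrightarrow> Fmap Q M N f y \<in> Fob Q M" for y
      using Qm[OF M N f] lf_map[OF lG M N f] by (auto simp: Q)
    show "Fmap Q M N f (x + y) = Fmap Q M N f x + Fmap Q M N f y" if x: "x \<in> Fob Q N" and y: "y \<in> Fob Q N" for x y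
    proof -
      obtain x' y' where xy: "x = c N x'" "y = c N y'" "x' \<in> Fob G N" "y' \<in> Fob G N" using x y by (auto simp: Q)
      have "Fmap Q M N f (c N (x' + y')) = c M (Fmap G M N f (x' + y'))"
        using Qm[OF M N f] kvs.subspace_add[OF lf_sub[OF lG N] xy(3,4)] by blast
      then show ?thesis using xy Qm[OF M N f] lf_add[OF lG M N f xy(3,4)] c(1)[OF M] c(1)[OF N] by simp
    qed
    show "Fmap Q M N f (scale r y) = scale r (Fmap Q M N f y)" if y: "y \<in> Fob Q N" for r y
    proof -
      obtain y' where xy: "y = c N y'" "y' \<in> Fob G N" using y by (auto simp: Q)
      have "Fmap Q M N f (c N (scale r y')) = c M (Fmap G M N f (scale r y'))"
        using Qm[OF M N f] kvs.subspace_scale[OF lf_sub[OF lG N] xy(2)] by blast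
      then show ?thesis using xy Qm[OF M N f] lf_scale[OF lG M N f xy(2)] c(2)[OF M] c(2)[OF N] by simp
    qed
    show "g \<in> MH M N \<Longrightarrow> y \<in> Fob Q N \<Longrightarrow> Fmap Q M N (\<lambda>u\<in>fst M. f u + g u) y = Fmap Q M N f y + Fmap Q M N g y" for g y
      using Qm[OF M N f] Qm[OF M N MH_add[OF f _ M N]] Qm[OF M N, of g] lf_addf[OF lG M N f] c(1)[OF M] by (auto simp: Q)
    show "y \<in> Fob Q N \<Longrightarrow> Fmap Q M N (\<lambda>u\<in>fst M. scale r (f u)) y = scale r (Fmap Q M N f y)" for r y
      using Qm[OF M N f] Qm[OF M N MH_scale[OF f M N]] lf_scalef[OF lG M N f] c(2)[OF M] by (auto simp: Q)
    fix L g y assume L: "L \<in> MO" "g \<in> MH N L" "y \<in> Fob Q L"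
    then obtain y' where y': "y = c L y'" "y' \<in> Fob G L" by (auto simp: Q)
    show "Fmap Q M L (mc M N L g f) y = Fmap Q M N f (Fmap Q N L g y)"
      using Qm[OF M L(1) MH_comp[OF f L(2) M] y'(2)] lf_comp[OF lG M N L(1) f L(2) y'(2)] Qm[OF N L(1,2) y'(2)]
        Qm[OF M N f lf_map[OF lG N L(1,2) y'(2)]] y' by simp
  qed
  obtain M N f x where fpF: "fpd F M N f x" using F FO_iff by blast
  obtain M' N' f' x' where fpG: "fpd G M' N' f' x'" using G FO_iff by blast
  have M: "M \<in> MO" "N \<in> MO" "f \<in> MH M N" "x \<in> Fob F N"
    and gF: "\<And>X y. X \<in> MO \<Longrightarrow> y \<in> Fob F X \<Longrightarrow> \<exists>g\<in>MH X N. y = Fmap F X N g x"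
    using fpF by (auto simp: fpd_def)
  have M': "M' \<in> MO" "N' \<in> MO" "f' \<in> MH M' N'" "x' \<in> Fob G N'"
    and gG: "\<And>X y. X \<in> MO \<Longrightarrow> y \<in> Fob G X \<Longrightarrow> \<exists>g\<in>MH X N'. y = Fmap G X N' g x'"
    and rG: "\<And>X g. X \<in> MO \<Longrightarrow> g \<in> MH X N' \<Longrightarrow> Fmap G X N' g x' = 0 \<longleftrightarrow> (\<exists>h\<in>MH X M'. \<forall>u\<in>fst X. g u = f' (h u))"
    using fpG by (auto simp: fpd_def)
  obtain h where h: "h \<in> MH N N'" "\<eta> N x = Fmap G N N' h x'" using gG[OF M(2) FH_mem[OF \<eta> M(2,4)]] by blast
  have \<eta>g: "\<eta> X (Fmap F X N g x) = Fmap G X N' (mc X N N' h g) x'"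
    if X: "X \<in> MO" and g: "g \<in> MH X N" for X g
    using FH_nat[OF \<eta> X M(2) g M(4)] h(2) lf_comp[OF lG X M(2) M'(2) g h(1) M'(4)] by simp
  obtain R a b where R: "R \<in> MO" "a \<in> MH R N" "b \<in> MH R M'"
    and Ru: "\<forall>X\<in>MO. \<forall>g\<in>MH X N. \<forall>k\<in>MH X M'. \<exists>l\<in>MH X R. \<forall>x\<in>fst X. a (l x) = g x \<and> b (l x) = k x"
    by (rule product_mod[OF M(2) M'(1)]) (rule that)
  let ?\<phi> = "\<lambda>u\<in>fst R. mc R N N' h a u + mc R M' N' f' b u"
  have \<phi>: "?\<phi> \<in> MH R N'" by (rule MH_add[OF MH_comp[OF R(2) h(1) R(1)] MH_comp[OF R(3) M'(3) R(1)] R(1) M'(2)])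
  have "fpd Q R N' ?\<phi> (c N' x')" unfolding fpd_def
  proof (intro conjI ballI R(1) M'(2) \<phi>)
    show "c N' x' \<in> Fob Q N'" using M' by (simp add: Q)
    fix X assume X: "X \<in> MO"
    { fix y assume "y \<in> Fob Q X"
      then obtain y' where y': "y = c X y'" "y' \<in> Fob G X" by (auto simp: Q)
      then obtain g where "g \<in> MH X N'" "y' = Fmap G X N' g x'" using gG[OF X] by blast
      then show "\<exists>g\<in>MH X N'. y = Fmap Q X N' g (c N' x')" using y' Qm[OF X M'(2) _ M'(4)] by auto }
    fix g assume g: "g \<in> MH X N'"
    have Qg: "Fmap Q X N' g (c N' x') = c X (Fmap G X N' g x')" using Qm[OF X M'(2) g M'(4)] .
    show "Fmap Q X N' g (c N' x') = 0 \<longleftrightarrow> (\<exists>l\<in>MH X R. \<forall>u\<in>fst X. g u = ?\<phi> (l u))"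
    proof
      assume "Fmap Q X N' g (c N' x') = 0"
      then obtain w where w: "w \<in> Fob F X" "Fmap G X N' g x' = \<eta> X w" using Qg c(3)[OF X] by auto
      obtain k where k: "k \<in> MH X N" "w = Fmap F X N k x" using gF[OF X w(1)] by blast
      let ?hk = "mc X N N' h k"
      have hk: "?hk \<in> MH X N'" by (rule MH_comp[OF k(1) h(1) X])
      \<comment> \<open>Linearity of functors is given for sums and multiples, so the difference g -
        h k is written with the scalar -1.\<close>
      let ?mhk = "\<lambda>u\<in>fst X. scale (-1) (?hk u)"
      let ?d = "\<lambda>u\<in>fst X. g u + ?mhk u"
      have mhk: "?mhk \<in> MH X N'" by (rule MH_scale[OF hk X M'(2)])
      have d: "?d \<in> MH X N'" by (rule MH_add[OF g mhk X M'(2)])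
      have "Fmap G X N' ?d x' = Fmap G X N' g x' + scale (-1) (Fmap G X N' ?hk x')"
        using lf_addf[OF lG X M'(2) g mhk M'(4)] lf_scalef[OF lG X M'(2) hk M'(4), of "-1"] by simp
      also have "\<dots> = 0" using w(2) k(2) \<eta>g[OF X k(1)] by (simp add: kvs.scale_minus_left)
      finally obtain m where m: "m \<in> MH X M'" "\<forall>u\<in>fst X. ?d u = f' (m u)" using rG[OF X d] by blast
      obtain l where l: "l \<in> MH X R" "\<forall>x\<in>fst X. a (l x) = k x \<and> b (l x) = m x" using Ru X k(1) m(1) by blast
      have "g u = ?\<phi> (l u)" if u: "u \<in> fst X" for u
      proof -
        have "g u + scale (-1) (h (k u)) = f' (m u)" using m(2) u by simp
        then have "g u = h (k u) + f' (m u)" by (simp add: kvs.scale_minus_left algebra_simps)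
        then show ?thesis using l(2) u MH_mem[OF l(1) u] by simp
      qed
      then show "\<exists>l\<in>MH X R. \<forall>u\<in>fst X. g u = ?\<phi> (l u)" using l(1) by blast
    next
      assume "\<exists>l\<in>MH X R. \<forall>u\<in>fst X. g u = ?\<phi> (l u)"
      then obtain l where l: "l \<in> MH X R" "\<forall>u\<in>fst X. g u = ?\<phi> (l u)" by blast
      let ?al = "mc X R N a l" and ?bl = "mc X R M' b l"
      have al: "?al \<in> MH X N" "?bl \<in> MH X M'" using MH_comp[OF l(1) R(2) X] MH_comp[OF l(1) R(3) X] .
      have hal: "mc X N N' h ?al \<in> MH X N'" "mc X M' N' f' ?bl \<in> MH X N'"
        using MH_comp[OF al(1) h(1) X] MH_comp[OF al(2) M'(3) X] .
      have "g = (\<lambda>u\<in>fst X. mc X N N' h ?al u + mc X M' N' f' ?bl u)"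
        by (rule MH_eqI[OF g MH_add[OF hal X M'(2)]]) (use l(2) MH_mem[OF l(1)] in simp)
      then have "Fmap G X N' g x' = Fmap G X N' (mc X N N' h ?al) x' + Fmap G X N' (mc X M' N' f' ?bl) x'"
        using lf_addf[OF lG X M'(2) hal M'(4)] by simp
      also have "Fmap G X N' (mc X M' N' f' ?bl) x' = 0"
        by (rule iffD2[OF rG[OF X hal(2)]], rule bexI[OF _ al(2)]) simp
      also have "Fmap G X N' (mc X N N' h ?al) x' = \<eta> X (Fmap F X N ?al x)" using \<eta>g[OF X al(1)] by simp
      finally show "Fmap Q X N' g (c N' x') = 0"
        unfolding Qg using c(3)[OF X] lf_map[OF lF X M(2) al(1) M(4)] by simp
    qed
  qed
  then have QO: "Q \<in> Ob FC" using lQ FO_iff by blast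
  show ?thesis
  proof (rule that[OF QO])
    show "(\<lambda>M\<in>MO. \<lambda>x\<in>Fob G M. c M x) \<in> Hom FC G Q"
      by (rule FH_I[OF G]) (auto simp: Q c Qm)
    fix M assume M: "M \<in> MO"
    have "\<eta> M ` Fob F M \<subseteq> Fob G M" using FH_mem[OF \<eta> M] by blast
    then show "(\<lambda>M\<in>MO. \<lambda>x\<in>Fob G M. c M x) M ` Fob G M = Fob Q M \<and>
        {y \<in> Fob G M. (\<lambda>M\<in>MO. \<lambda>x\<in>Fob G M. c M x) M y = 0} = \<eta> M ` Fob F M"
      using M c(3)[OF M] by (auto simp: Q)
  qed
qed

text \<open>Presented by the product of the two presenting maps; \<open>R\<close> has jointly
  injective projections, so that factoring can be tested in both coordinates.\<close>

lemma functor_product: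
  assumes F: "F \<in> Ob FC" and G: "G \<in> Ob FC"
  defines "P \<equiv> \<lparr>Fob = (\<lambda>M. prodset (Fob F M) (Fob G M)),
     Fmap = (\<lambda>M N f. \<lambda>z\<in>prodset (Fob F N) (Fob G N). pr (Fmap F M N f (pr1 z)) (Fmap G M N f (pr2 z)))\<rparr>"
  shows "\<exists>P\<in>Ob FC. \<exists>p\<in>Hom FC P F. \<exists>q\<in>Hom FC P G. \<forall>M\<in>MO. bij_betw (\<lambda>z. (p M z, q M z)) (Fob P M) (Fob F M \<times> Fob G M)"
proof -
  note lF = FO_lf[OF F] and lG = FO_lf[OF G]
  have P: "z \<in> Fob P M \<longleftrightarrow> pr1 z \<in> Fob F M \<and> pr2 z \<in> Fob G M" for z M by (simp add: P_def prodset_iff)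
  have Pm: "z \<in> Fob P N \<Longrightarrow> Fmap P M N f z = pr (Fmap F M N f (pr1 z)) (Fmap G M N f (pr2 z))" for M N f z
    by (simp add: P_def)
  have fd: "fd_space (Fob P M)" if "M \<in> MO" for M
    using fd_space_prodset lf_fd[OF lF that] lf_fd[OF lG that] by (auto simp: P_def)
  have Pc: "M \<in> MO \<Longrightarrow> N \<in> MO \<Longrightarrow> f \<in> MH M N \<Longrightarrow> y \<in> Fob P N \<Longrightarrow> Fmap P M N f y \<in> Fob P M" for M N f y
    using lf_map[OF lF] lf_map[OF lG] by (simp add: P Pm)
  have lP: "linear_functor A P"
  proof (rule linear_functorI)
    fix M assume M: "M \<in> MO"
    show "fd_space (Fob P M)" using fd[OF M] .
    show "Fmap P M M (Id (mod_cat A) M) y = y" if "y \<in> Fob P M" for y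
      using that lf_id[OF lF M] lf_id[OF lG M] by (simp add: Pm P)
    fix N f assume N: "N \<in> MO" and f: "f \<in> MH M N"
    show "Fmap P M N f \<in> extensional (Fob P N)" by (simp add: P_def)
    show "y \<in> Fob P N \<Longrightarrow> Fmap P M N f y \<in> Fob P M" for y using Pc[OF M N f] .
    show "x \<in> Fob P N \<Longrightarrow> y \<in> Fob P N \<Longrightarrow> Fmap P M N f (x + y) = Fmap P M N f x + Fmap P M N f y" for x y
      using kvs.subspace_add[OF fd_space_subspace[OF fd[OF N]], of x y] lf_add[OF lF M N f] lf_add[OF lG M N f]
      by (simp add: Pm P pr12_add pr_add)
    show "y \<in> Fob P N \<Longrightarrow> Fmap P M N f (scale c y) = scale c (Fmap P M N f y)" for c y
      using kvs.subspace_scale[OF fd_space_subspace[OF fd[OF N]], of y c] lf_scale[OF lF M N f] lf_scale[OF lG M N f]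
      by (simp add: Pm P pr12_scale pr_scale)
    show "g \<in> MH M N \<Longrightarrow> y \<in> Fob P N \<Longrightarrow> Fmap P M N (\<lambda>u\<in>fst M. f u + g u) y = Fmap P M N f y + Fmap P M N g y" for g y
      using lf_addf[OF lF M N f] lf_addf[OF lG M N f] by (simp add: Pm P pr_add)
    show "y \<in> Fob P N \<Longrightarrow> Fmap P M N (\<lambda>u\<in>fst M. scale c (f u)) y = scale c (Fmap P M N f y)" for c y
      using lf_scalef[OF lF M N f] lf_scalef[OF lG M N f] by (simp add: Pm P pr_scale)
    fix L g y assume L: "L \<in> MO" "g \<in> MH N L" "y \<in> Fob P L"
    show "Fmap P M L (mc M N L g f) y = Fmap P M N f (Fmap P N L g y)"
      using lf_comp[OF lF M N L(1) f L(2)] lf_comp[OF lG M N L(1) f L(2)] Pc[OF N L] L(3) by (simp add: Pm P)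
  qed
  obtain M N f x where fpF: "fpd F M N f x" using F FO_iff by blast
  obtain M' N' f' x' where fpG: "fpd G M' N' f' x'" using G FO_iff by blast
  have M: "M \<in> MO" "N \<in> MO" "f \<in> MH M N" "x \<in> Fob F N"
    and gF: "\<And>X y. X \<in> MO \<Longrightarrow> y \<in> Fob F X \<Longrightarrow> \<exists>g\<in>MH X N. y = Fmap F X N g x"
    and rF: "\<And>X g. X \<in> MO \<Longrightarrow> g \<in> MH X N \<Longrightarrow> Fmap F X N g x = 0 \<longleftrightarrow> (\<exists>h\<in>MH X M. \<forall>u\<in>fst X. g u = f (h u))"
    using fpF by (auto simp: fpd_def)
  have M': "M' \<in> MO" "N' \<in> MO" "f' \<in> MH M' N'" "x' \<in> Fob G N'"
    and gG: "\<And>X y. X \<in> MO \<Longrightarrow> y \<in> Fob G X \<Longrightarrow> \<exists>g\<in>MH X N'. y = Fmap G X N' g x'"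
    and rG: "\<And>X g. X \<in> MO \<Longrightarrow> g \<in> MH X N' \<Longrightarrow> Fmap G X N' g x' = 0 \<longleftrightarrow> (\<exists>h\<in>MH X M'. \<forall>u\<in>fst X. g u = f' (h u))"
    using fpG by (auto simp: fpd_def)
  obtain R a b where R: "R \<in> MO" "a \<in> MH R N" "b \<in> MH R N'"
    and Ru: "\<forall>X\<in>MO. \<forall>g\<in>MH X N. \<forall>k\<in>MH X N'. \<exists>l\<in>MH X R. \<forall>x\<in>fst X. a (l x) = g x \<and> b (l x) = k x"
    and Ri: "\<forall>x\<in>fst R. \<forall>y\<in>fst R. a x = a y \<longrightarrow> b x = b y \<longrightarrow> x = y"
    using product_mod[OF M(2) M'(2)] .
  obtain T a' b' where T: "T \<in> MO" "a' \<in> MH T M" "b' \<in> MH T M'"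
    and Tu: "\<forall>X\<in>MO. \<forall>g\<in>MH X M. \<forall>k\<in>MH X M'. \<exists>l\<in>MH X T. \<forall>x\<in>fst X. a' (l x) = g x \<and> b' (l x) = k x"
    by (rule product_mod[OF M(1) M'(1)]) (rule that)
  obtain \<phi> where \<phi>: "\<phi> \<in> MH T R" and \<phi>': "\<forall>x\<in>fst T. a (\<phi> x) = f (a' x) \<and> b (\<phi> x) = f' (b' x)"
  proof -
    obtain l where "l \<in> MH T R" "\<forall>x\<in>fst T. a (l x) = mc T M N f a' x \<and> b (l x) = mc T M' N' f' b' x"
      using Ru T(1) MH_comp[OF T(2) M(3) T(1)] MH_comp[OF T(3) M'(3) T(1)] by blast
    then show ?thesis using that by simp
  qed
  let ?x = "pr (Fmap F R N a x) (Fmap G R N' b x')"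
  have x0: "?x \<in> Fob P R" using lf_map[OF lF R(1) M(2) R(2) M(4)] lf_map[OF lG R(1) M'(2) R(3) M'(4)] by (simp add: P)
  have gx: "Fmap P X R g ?x = pr (Fmap F X N (mc X R N a g) x) (Fmap G X N' (mc X R N' b g) x')"
    if X: "X \<in> MO" and g: "g \<in> MH X R" for X g
    using lf_comp[OF lF X R(1) M(2) g R(2) M(4)] lf_comp[OF lG X R(1) M'(2) g R(3) M'(4)] x0 by (simp add: Pm)
  have "fpd P T R \<phi> ?x" unfolding fpd_def
  proof (intro conjI ballI R(1) T(1) \<phi> x0)
    fix X assume X: "X \<in> MO"
    { fix y assume "y \<in> Fob P X"
      then have "pr1 y \<in> Fob F X" "pr2 y \<in> Fob G X" by (auto simp: P)
      then obtain g1 g2 where g: "g1 \<in> MH X N" "pr1 y = Fmap F X N g1 x" "g2 \<in> MH X N'" "pr2 y = Fmap G X N' g2 x'"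
        using gF[OF X] gG[OF X] by metis
      obtain l where l: "l \<in> MH X R" "\<forall>x\<in>fst X. a (l x) = g1 x \<and> b (l x) = g2 x" using Ru X g by blast
      have "mc X R N a l = g1" by (rule MH_eqI[OF MH_comp[OF l(1) R(2) X] g(1)]) (simp add: l)
      moreover have "mc X R N' b l = g2" by (rule MH_eqI[OF MH_comp[OF l(1) R(3) X] g(3)]) (simp add: l)
      ultimately have "y = Fmap P X R l ?x" using gx[OF X l(1)] g by (metis pr_simps(3))
      then show "\<exists>g\<in>MH X R. y = Fmap P X R g ?x" using l(1) by blast }
    fix g assume g: "g \<in> MH X R"
    have "Fmap P X R g ?x = 0 \<longleftrightarrow> (\<exists>h\<in>MH X M. \<forall>u\<in>fst X. a (g u) = f (h u)) \<and> (\<exists>h\<in>MH X M'. \<forall>u\<in>fst X. b (g u) = f' (h u))"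
      using gx[OF X g] rF[OF X MH_comp[OF g R(2) X]] rG[OF X MH_comp[OF g R(3) X]] by (simp add: pr_eq_0_iff)
    also have "\<dots> \<longleftrightarrow> (\<exists>l\<in>MH X T. \<forall>u\<in>fst X. g u = \<phi> (l u))"
    proof
      assume "(\<exists>h\<in>MH X M. \<forall>u\<in>fst X. a (g u) = f (h u)) \<and> (\<exists>h\<in>MH X M'. \<forall>u\<in>fst X. b (g u) = f' (h u))"
      then obtain h1 h2 where h: "h1 \<in> MH X M" "\<forall>u\<in>fst X. a (g u) = f (h1 u)" "h2 \<in> MH X M'" "\<forall>u\<in>fst X. b (g u) = f' (h2 u)"
        by blast
      obtain l where l: "l \<in> MH X T" "\<forall>x\<in>fst X. a' (l x) = h1 x \<and> b' (l x) = h2 x" using Tu X h by blast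
      have "g u = \<phi> (l u)" if u: "u \<in> fst X" for u
      proof -
        have "l u \<in> fst T" using MH_mem[OF l(1) u] .
        moreover from this have "\<phi> (l u) \<in> fst R" using MH_mem[OF \<phi>] by blast
        ultimately show ?thesis using Ri MH_mem[OF g u] \<phi>' l(2) h u by simp
      qed
      then show "\<exists>l\<in>MH X T. \<forall>u\<in>fst X. g u = \<phi> (l u)" using l(1) by blast
    next
      assume "\<exists>l\<in>MH X T. \<forall>u\<in>fst X. g u = \<phi> (l u)"
      then obtain l where l: "l \<in> MH X T" "\<forall>u\<in>fst X. g u = \<phi> (l u)" by blast
      have "\<forall>u\<in>fst X. a (g u) = f (mc X T M a' l u)" "\<forall>u\<in>fst X. b (g u) = f' (mc X T M' b' l u)"
        using l \<phi>' MH_mem[OF l(1)] by auto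
      then show "(\<exists>h\<in>MH X M. \<forall>u\<in>fst X. a (g u) = f (h u)) \<and> (\<exists>h\<in>MH X M'. \<forall>u\<in>fst X. b (g u) = f' (h u))"
        using MH_comp[OF l(1) T(2) X] MH_comp[OF l(1) T(3) X] by blast
    qed
    finally show "Fmap P X R g ?x = 0 \<longleftrightarrow> (\<exists>l\<in>MH X T. \<forall>u\<in>fst X. g u = \<phi> (l u))" .
  qed
  then have PO: "P \<in> Ob FC" using lP FO_iff by blast
  have ph: "(\<lambda>M\<in>MO. \<lambda>x\<in>Fob P M. pr1 x) \<in> Hom FC P F" "(\<lambda>M\<in>MO. \<lambda>x\<in>Fob P M. pr2 x) \<in> Hom FC P G"
    by (rule FH_I[OF PO]; auto simp: P Pm pr12_add pr12_scale)+
  show ?thesis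
  proof (rule bexI[OF _ PO], rule bexI[OF _ ph(1)], rule bexI[OF _ ph(2)], intro ballI)
    fix M assume "M \<in> MO"
    then show "bij_betw (\<lambda>z. ((\<lambda>M\<in>MO. \<lambda>x\<in>Fob P M. pr1 x) M z, (\<lambda>M\<in>MO. \<lambda>x\<in>Fob P M. pr2 x) M z)) (Fob P M) (Fob F M \<times> Fob G M)"
      by (intro bij_betwI[where g = "\<lambda>(x, y). pr x y"]) (auto simp: P)
  qed
qed

lemma functor_zero:
  defines "Z \<equiv> \<lparr>Fob = (\<lambda>M. {0}), Fmap = (\<lambda>M N f. \<lambda>z\<in>{0}. 0)\<rparr> :: ('k, 'a) mod_functor"
  shows "Z \<in> Ob FC"
proof -
  let ?O = "({0}, \<lambda>_ _. 0) :: ('k, 'a) rmod"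
  have "linear_functor A Z"
    by (rule linear_functorI) (auto simp: Z_def fd_space_zero)
  moreover have "fpd Z ?O ?O (\<lambda>u\<in>fst ?O. 0) 0" unfolding fpd_def
    using zero_mod zero_MH[OF zero_mod zero_mod] zero_MH[OF _ zero_mod]
    by (auto simp: Z_def MH_iff linear_maps_iff)
  ultimately show ?thesis using FO_iff by blast
qed

text \<open>Exactness of functors is tested at each module. Lifts and descents are formed pointwise;
  they are linear and natural because injectivity, respectively surjectivity, determines their
  values.\<close>

lemma concrete_abelian_functors: "concrete_abelian FC MO Fob"
proof
  fix F :: "('k, 'a) mod_functor" and M assume F: "F \<in> Ob FC" and M: "M \<in> MO"
  have s: "kvs.subspace (Fob F M)" using lf_sub[OF FO_lf[OF F] M] .
  show "0 \<in> Fob F M" using kvs.subspace_0[OF s] .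
  show "x - y \<in> Fob F M" if "x \<in> Fob F M" "y \<in> Fob F M" for x y using kvs.subspace_diff[OF s that] .
next
  fix F G :: "('k, 'a) mod_functor" and \<eta> assume F: "F \<in> Ob FC" and G: "G \<in> Ob FC" and \<eta>: "\<eta> \<in> Hom FC F G"
  show "\<eta> M x \<in> Fob G M" if "M \<in> MO" "x \<in> Fob F M" for M x using FH_mem[OF \<eta> that] .
  show "\<eta> M (x - y) = \<eta> M x - \<eta> M y" if "M \<in> MO" "x \<in> Fob F M" "y \<in> Fob F M" for M x y
    using FH_diff[OF \<eta> F that] .
  show "\<exists>N\<in>Ob FC. \<exists>k\<in>Hom FC N F. \<forall>M\<in>MO. inj_on (k M) (Fob N M) \<and> k M ` Fob N M = {x \<in> Fob F M. \<eta> M x = 0}"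
    by (rule functor_kernel[OF F G \<eta>])
  show "\<exists>N\<in>Ob FC. \<exists>c\<in>Hom FC G N. \<forall>M\<in>MO. c M ` Fob G M = Fob N M \<and> {y \<in> Fob G M. c M y = 0} = \<eta> M ` Fob F M"
    by (rule functor_cokernel[OF F G \<eta>]) blast
  fix \<theta> assume \<theta>: "\<theta> \<in> Hom FC F G"
  show "\<eta> = \<theta>" if e: "\<And>M x. M \<in> MO \<Longrightarrow> x \<in> Fob F M \<Longrightarrow> \<eta> M x = \<theta> M x"
  proof (rule extensionalityI[of _ MO])
    show "\<eta> \<in> extensional MO" "\<theta> \<in> extensional MO" using \<eta> \<theta> by (auto simp: FH_iff)
    fix M assume M: "M \<in> MO"
    show "\<eta> M = \<theta> M"
      by (rule extensionalityI[of _ "Fob F M"]) (use \<eta> \<theta> M e in \<open>auto simp: FH_iff linear_maps_iff\<close>)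
  qed
  have "(\<lambda>M\<in>MO. \<lambda>x\<in>Fob F M. \<eta> M x - \<theta> M x) \<in> Hom FC F G"
  proof (rule FH_I[OF F])
    fix M x assume M: "M \<in> MO" and x: "x \<in> Fob F M"
    show "\<eta> M x - \<theta> M x \<in> Fob G M"
      using kvs.subspace_diff[OF lf_sub[OF FO_lf[OF G] M]] FH_mem[OF \<eta> M x] FH_mem[OF \<theta> M x] by blast
    show "\<eta> M (x + y) - \<theta> M (x + y) = \<eta> M x - \<theta> M x + (\<eta> M y - \<theta> M y)" if "y \<in> Fob F M" for y
      using FH_add[OF \<eta> M x that] FH_add[OF \<theta> M x that] by simp
    show "\<eta> M (scale c x) - \<theta> M (scale c x) = scale c (\<eta> M x - \<theta> M x)" for c
      using FH_scale[OF \<eta> M x] FH_scale[OF \<theta> M x] by (simp add: scale_diff)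
  next
    fix M N f y assume *: "M \<in> MO" "N \<in> MO" "f \<in> MH M N" and y: "y \<in> Fob F N"
    have "Fmap G M N f (\<eta> N y - \<theta> N y) = Fmap G M N f (\<eta> N y) - Fmap G M N f (\<theta> N y)"
    proof (rule linear_maps_diff[of _ "Fob G N" "Fob G M"])
      show "Fmap G M N f \<in> linear_maps (Fob G N) (Fob G M)" using FO_lf[OF G] * unfolding linear_functor_def by blast
    qed (use lf_sub[OF FO_lf[OF G] *(2)] FH_mem[OF \<eta> *(2) y] FH_mem[OF \<theta> *(2) y] in auto)
    then show "\<eta> M (Fmap F M N f y) - \<theta> M (Fmap F M N f y) = Fmap G M N f (\<eta> N y - \<theta> N y)"
      using FH_nat[OF \<eta> * y] FH_nat[OF \<theta> * y] by simp
  qed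
  then show "\<exists>h\<in>Hom FC F G. \<forall>M\<in>MO. \<forall>x\<in>Fob F M. h M x = \<eta> M x - \<theta> M x"
    by (rule bexI[rotated]) auto
next
  fix X Y Z :: "('k, 'a) mod_functor" and f g assume *: "X \<in> Ob FC" "Y \<in> Ob FC" "Z \<in> Ob FC" "f \<in> Hom FC X Y" "g \<in> Hom FC Y Z"
  have "Comp FC X Y Z g f = (\<lambda>M\<in>MO. \<lambda>x\<in>Fob X M. g M (f M x))"
    by (auto simp: fp_functor_cat_def compose_def fun_eq_iff restrict_def)
  also have "\<dots> \<in> Hom FC X Z"
    by (rule FH_I[OF *(1)]) (auto simp: FH_mem[OF *(4)] FH_mem[OF *(5)] FH_add[OF *(4)] FH_add[OF *(5)]
       FH_scale[OF *(4)] FH_scale[OF *(5)] FH_nat[OF *(4)] FH_nat[OF *(5)])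
  finally show "Comp FC X Y Z g f \<in> Hom FC X Z" .
next
  fix M x and X Y Z :: "('k, 'a) mod_functor" and f g assume "M \<in> MO" "x \<in> Fob X M"
  then show "Comp FC X Y Z g f M x = g M (f M x)" by (simp add: fp_functor_cat_def compose_def)
next
  fix X :: "('k, 'a) mod_functor" assume X: "X \<in> Ob FC"
  have "Id FC X = (\<lambda>M\<in>MO. \<lambda>x\<in>Fob X M. x)" by (simp add: fp_functor_cat_def)
  also have "\<dots> \<in> Hom FC X X" by (rule FH_I[OF X]) auto
  finally show "Id FC X \<in> Hom FC X X" .
next
  fix X :: "('k, 'a) mod_functor" and M x assume "M \<in> MO" "x \<in> Fob X M"
  then show "Id FC X M x = x" by (simp add: fp_functor_cat_def)
next
  show "\<exists>Z\<in>Ob FC. \<forall>M\<in>MO. Fob Z M = {0}" by (rule bexI[OF _ functor_zero]) simp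
next
  fix X Y :: "('k, 'a) mod_functor" assume X: "X \<in> Ob FC" and Y: "Y \<in> Ob FC"
  have "(\<lambda>M\<in>MO. \<lambda>x\<in>Fob X M. 0) \<in> Hom FC X Y"
    by (rule FH_I[OF X]) (auto simp: kvs.subspace_0[OF lf_sub[OF FO_lf[OF Y]]] lf_zero[OF FO_lf[OF Y]])
  then show "\<exists>f\<in>Hom FC X Y. \<forall>M\<in>MO. \<forall>x\<in>Fob X M. f M x = 0" by (rule bexI[rotated]) auto
  show "\<exists>P\<in>Ob FC. \<exists>p\<in>Hom FC P X. \<exists>q\<in>Hom FC P Y. \<forall>i\<in>MO. bij_betw (\<lambda>z. (p i z, q i z)) (Fob P i) (Fob X i \<times> Fob Y i)"
    by (rule functor_product[OF X Y])
next
  fix N X T :: "('k, 'a) mod_functor" and k t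
  assume *: "N \<in> Ob FC" "X \<in> Ob FC" "T \<in> Ob FC" and k: "k \<in> Hom FC N X" and t: "t \<in> Hom FC T X"
    and i: "\<And>M. M \<in> MO \<Longrightarrow> inj_on (k M) (Fob N M) \<and> t M ` Fob T M \<subseteq> k M ` Fob N M"
  define u where "u = (\<lambda>M x. inv_into (Fob N M) (k M) (t M x))"
  have u: "u M x \<in> Fob N M" "k M (u M x) = t M x" if "M \<in> MO" "x \<in> Fob T M" for M x
    using i[OF that(1)] that by (auto simp: u_def inv_into_into f_inv_into_f image_subset_iff)
  have ui: "u M x = y" if "M \<in> MO" "x \<in> Fob T M" "y \<in> Fob N M" "k M y = t M x" for M x y
    using i[OF that(1)] u[OF that(1,2)] that by (metis inj_onD)
  note lT = FO_lf[OF *(3)] and lN = FO_lf[OF *(1)]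
  have "(\<lambda>M\<in>MO. \<lambda>x\<in>Fob T M. u M x) \<in> Hom FC T N"
  proof (rule FH_I[OF *(3)])
    fix M x assume M: "M \<in> MO" and x: "x \<in> Fob T M"
    show "u M x \<in> Fob N M" using u M x by blast
    show "u M (x + y) = u M x + u M y" if y: "y \<in> Fob T M" for y
      using kvs.subspace_add[OF lf_sub[OF lT M] x y] kvs.subspace_add[OF lf_sub[OF lN M] u(1)[OF M x] u(1)[OF M y]]
      by (intro ui[OF M]) (auto simp: FH_add[OF k M] FH_add[OF t M] u M x y)
    show "u M (scale c x) = scale c (u M x)" for c
      using kvs.subspace_scale[OF lf_sub[OF lT M] x] kvs.subspace_scale[OF lf_sub[OF lN M] u(1)[OF M x]]
      by (intro ui[OF M]) (auto simp: FH_scale[OF k M] FH_scale[OF t M] u M x)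
  next
    fix M L f y assume M: "M \<in> MO" "L \<in> MO" "f \<in> MH M L" "y \<in> Fob T L"
    show "u M (Fmap T M L f y) = Fmap N M L f (u L y)"
      using lf_map[OF lT M] lf_map[OF lN M(1-3) u(1)[OF M(2,4)]]
      by (intro ui[OF M(1)]) (auto simp: FH_nat[OF k M(1-3)] FH_nat[OF t M(1-3)] u M)
  qed
  then show "\<exists>u\<in>Hom FC T N. \<forall>M\<in>MO. \<forall>x\<in>Fob T M. k M (u M x) = t M x"
    by (rule bexI[rotated]) (auto simp: u)
next
  fix N Y T :: "('k, 'a) mod_functor" and c t
  assume *: "N \<in> Ob FC" "Y \<in> Ob FC" "T \<in> Ob FC" and c: "c \<in> Hom FC Y N" and t: "t \<in> Hom FC Y T"
    and cs: "\<And>M. M \<in> MO \<Longrightarrow> c M ` Fob Y M = Fob N M"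
    and z: "\<And>M y. M \<in> MO \<Longrightarrow> y \<in> Fob Y M \<Longrightarrow> c M y = 0 \<Longrightarrow> t M y = 0"
  define u where "u = (\<lambda>M z. t M (SOME y. y \<in> Fob Y M \<and> c M y = z))"
  note lY = FO_lf[OF *(2)]
  have u: "u M (c M y) = t M y" if M: "M \<in> MO" and y: "y \<in> Fob Y M" for M y
  proof -
    let ?s = "SOME y'. y' \<in> Fob Y M \<and> c M y' = c M y"
    have s: "?s \<in> Fob Y M \<and> c M ?s = c M y" by (rule someI[of _ y]) (simp add: y)
    then have "c M (?s - y) = 0" using FH_diff[OF c *(2) M] y by simp
    then have "t M (?s - y) = 0" using z[OF M] kvs.subspace_diff[OF lf_sub[OF lY M]] s y by blast
    then show ?thesis using FH_diff[OF t *(2) M] s y by (simp add: u_def)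
  qed
  have ex: "\<exists>y\<in>Fob Y M. x = c M y" if "M \<in> MO" "x \<in> Fob N M" for M x using cs[OF that(1)] that by blast
  have "(\<lambda>M\<in>MO. \<lambda>x\<in>Fob N M. u M x) \<in> Hom FC N T"
  proof (rule FH_I[OF *(1)])
    fix M x assume M: "M \<in> MO" and x: "x \<in> Fob N M"
    obtain x' where x': "x' \<in> Fob Y M" "x = c M x'" using ex[OF M x] by blast
    show "u M x \<in> Fob T M" using x' u M FH_mem[OF t M] by simp
    show "u M (x + y) = u M x + u M y" if y: "y \<in> Fob N M" for y
    proof -
      obtain y' where y': "y' \<in> Fob Y M" "y = c M y'" using ex[OF M y] by blast
      show ?thesis using u[OF M kvs.subspace_add[OF lf_sub[OF lY M] x'(1) y'(1)]] x' y' u[OF M] FH_add[OF t M] FH_add[OF c M] by simp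
    qed
    show "u M (scale r x) = scale r (u M x)" for r
      using u[OF M kvs.subspace_scale[OF lf_sub[OF lY M] x'(1)]] x' u[OF M] FH_scale[OF t M] FH_scale[OF c M] by simp
  next
    fix M L f y assume M: "M \<in> MO" "L \<in> MO" "f \<in> MH M L" "y \<in> Fob N L"
    obtain y' where y': "y' \<in> Fob Y L" "y = c L y'" using ex[OF M(2,4)] by blast
    show "u M (Fmap N M L f y) = Fmap T M L f (u L y)"
      using u[OF M(1) lf_map[OF lY M(1-3) y'(1)]] u[OF M(2) y'(1)] y' FH_nat[OF c M(1-3)] FH_nat[OF t M(1-3)] by simp
  qed
  then show "\<exists>u\<in>Hom FC N T. \<forall>M\<in>MO. \<forall>y\<in>Fob Y M. u M (c M y) = t M y"
    by (rule bexI[rotated]) (auto simp: u FH_mem[OF c])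
qed

end

section \<open>Functors between module categories\<close>

text \<open>A right adjoint is only needed through its couniversal arrows: they make precomposition
  with the functor preserve finite presentation.\<close>

locale module_functor = A: fd_modules A + B: fd_modules B
  for A :: "('k::field, 'a) module" and B :: "('k, 'b) module" +
  fixes Fo :: "('k, 'a) rmod \<Rightarrow> ('k, 'b) rmod"
    and Fm :: "('k, 'a) rmod \<Rightarrow> ('k, 'a) rmod \<Rightarrow> ('k vec \<Rightarrow> 'k vec) \<Rightarrow> 'k vec \<Rightarrow> 'k vec"
  assumes Fo_mem: "M \<in> A.MO \<Longrightarrow> Fo M \<in> B.MO"
    and Fm_mem: "M \<in> A.MO \<Longrightarrow> N \<in> A.MO \<Longrightarrow> f \<in> A.MH M N \<Longrightarrow> Fm M N f \<in> B.MH (Fo M) (Fo N)"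
    and Fm_id: "M \<in> A.MO \<Longrightarrow> u \<in> fst (Fo M) \<Longrightarrow> Fm M M (Id (mod_cat A) M) u = u"
    and Fm_comp: "L \<in> A.MO \<Longrightarrow> M \<in> A.MO \<Longrightarrow> N \<in> A.MO \<Longrightarrow> f \<in> A.MH L M \<Longrightarrow> g \<in> A.MH M N \<Longrightarrow> u \<in> fst (Fo L) \<Longrightarrow>
      Fm L N (A.mc L M N g f) u = Fm M N g (Fm L M f u)"
    and Fm_add: "M \<in> A.MO \<Longrightarrow> N \<in> A.MO \<Longrightarrow> f \<in> A.MH M N \<Longrightarrow> g \<in> A.MH M N \<Longrightarrow> u \<in> fst (Fo M) \<Longrightarrow>
      Fm M N (\<lambda>u\<in>fst M. f u + g u) u = Fm M N f u + Fm M N g u"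
    and Fm_scale: "M \<in> A.MO \<Longrightarrow> N \<in> A.MO \<Longrightarrow> f \<in> A.MH M N \<Longrightarrow> u \<in> fst (Fo M) \<Longrightarrow>
      Fm M N (\<lambda>u\<in>fst M. scale c (f u)) u = scale c (Fm M N f u)"
    and couniversal: "W \<in> B.MO \<Longrightarrow> \<exists>H\<in>A.MO. \<exists>e\<in>B.MH (Fo H) W. \<forall>X\<in>A.MO. \<forall>g\<in>B.MH (Fo X) W.
      \<exists>!g'. g' \<in> A.MH X H \<and> (\<forall>u\<in>fst (Fo X). g u = e (Fm X H g' u))"
    and summand: "W \<in> B.MO \<Longrightarrow> \<exists>M\<in>A.MO. \<exists>i\<in>B.MH W (Fo M). \<exists>p\<in>B.MH (Fo M) W. \<forall>u\<in>fst W. p (i u) = u"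
begin

definition pre :: "('k, 'b) mod_functor \<Rightarrow> ('k, 'a) mod_functor" where
  "pre X = \<lparr>Fob = (\<lambda>M. Fob X (Fo M)), Fmap = (\<lambda>M N f. Fmap X (Fo M) (Fo N) (Fm M N f))\<rparr>"

lemma pre_simps [simp]: "Fob (pre X) M = Fob X (Fo M)" "Fmap (pre X) M N f = Fmap X (Fo M) (Fo N) (Fm M N f)"
  by (simp_all add: pre_def)

lemma Fm_id': "M \<in> A.MO \<Longrightarrow> Fm M M (Id (mod_cat A) M) = Id (mod_cat B) (Fo M)"
  by (rule B.MH_eqI[OF Fm_mem B.MH_id]) (auto simp: A.MH_id Fo_mem Fm_id)

lemma Fm_comp': "L \<in> A.MO \<Longrightarrow> M \<in> A.MO \<Longrightarrow> N \<in> A.MO \<Longrightarrow> f \<in> A.MH L M \<Longrightarrow> g \<in> A.MH M N \<Longrightarrow>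
    Fm L N (A.mc L M N g f) = B.mc (Fo L) (Fo M) (Fo N) (Fm M N g) (Fm L M f)"
  by (rule B.MH_eqI[OF Fm_mem B.MH_comp]) (auto intro: A.MH_comp Fm_mem Fo_mem simp: Fm_comp)

lemma Fm_add': "M \<in> A.MO \<Longrightarrow> N \<in> A.MO \<Longrightarrow> f \<in> A.MH M N \<Longrightarrow> g \<in> A.MH M N \<Longrightarrow>
    Fm M N (\<lambda>u\<in>fst M. f u + g u) = (\<lambda>u\<in>fst (Fo M). Fm M N f u + Fm M N g u)"
  by (rule B.MH_eqI[OF Fm_mem B.MH_add]) (auto intro: A.MH_add Fm_mem Fo_mem simp: Fm_add)

lemma Fm_scale': "M \<in> A.MO \<Longrightarrow> N \<in> A.MO \<Longrightarrow> f \<in> A.MH M N \<Longrightarrow>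
    Fm M N (\<lambda>u\<in>fst M. scale c (f u)) = (\<lambda>u\<in>fst (Fo M). scale c (Fm M N f u))"
  by (rule B.MH_eqI[OF Fm_mem B.MH_scale]) (auto intro: A.MH_scale Fm_mem Fo_mem simp: Fm_scale)

lemma pre_linear:
  assumes X: "linear_functor B X" shows "linear_functor A (pre X)"
proof (rule A.linear_functorI)
  fix M assume M: "M \<in> A.MO"
  show "fd_space (Fob (pre X) M)" using B.lf_fd[OF X Fo_mem[OF M]] by simp
  show "Fmap (pre X) M M (Id (mod_cat A) M) y = y" if "y \<in> Fob (pre X) M" for y
    using that B.lf_id[OF X Fo_mem[OF M]] by (simp add: Fm_id'[OF M])
  fix N f assume N: "N \<in> A.MO" and f: "f \<in> A.MH M N"
  note m = Fo_mem[OF M] Fo_mem[OF N] Fm_mem[OF M N f]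
  show "Fmap (pre X) M N f \<in> extensional (Fob (pre X) N)"
    using X m unfolding linear_functor_def linear_maps_iff by simp
  show "y \<in> Fob (pre X) N \<Longrightarrow> Fmap (pre X) M N f y \<in> Fob (pre X) M" for y using B.lf_map[OF X m] by simp
  show "x \<in> Fob (pre X) N \<Longrightarrow> y \<in> Fob (pre X) N \<Longrightarrow> Fmap (pre X) M N f (x + y) = Fmap (pre X) M N f x + Fmap (pre X) M N f y" for x y
    using B.lf_add[OF X m] by simp
  show "y \<in> Fob (pre X) N \<Longrightarrow> Fmap (pre X) M N f (scale c y) = scale c (Fmap (pre X) M N f y)" for c y
    using B.lf_scale[OF X m] by simp
  show "g \<in> A.MH M N \<Longrightarrow> y \<in> Fob (pre X) N \<Longrightarrow> Fmap (pre X) M N (\<lambda>u\<in>fst M. f u + g u) y = Fmap (pre X) M N f y + Fmap (pre X) M N g y" for g y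
    using B.lf_addf[OF X m Fm_mem[OF M N]] by (simp add: Fm_add'[OF M N f])
  show "y \<in> Fob (pre X) N \<Longrightarrow> Fmap (pre X) M N (\<lambda>u\<in>fst M. scale c (f u)) y = scale c (Fmap (pre X) M N f y)" for c y
    using B.lf_scalef[OF X m] by (simp add: Fm_scale'[OF M N f])
  fix L g y assume L: "L \<in> A.MO" "g \<in> A.MH N L" "y \<in> Fob (pre X) L"
  show "Fmap (pre X) M L (A.mc M N L g f) y = Fmap (pre X) M N f (Fmap (pre X) N L g y)"
    using B.lf_comp[OF X m(1,2) Fo_mem[OF L(1)] m(3) Fm_mem[OF N L(1,2)]] L(3) by (simp add: Fm_comp'[OF M N L(1) f L(2)])
qed

text \<open>Morphisms Fo Y -> N correspond to morphisms Y -> H, so precomposition turns the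
  representable functor of \<open>N\<close> into that of \<open>H\<close>. Hence the presenting map
  \<open>f\<close> is replaced by the map \<open>k\<close> that the right adjoint makes of
  it.\<close>

lemma pre_fpd:
  assumes X: "linear_functor B X" and fp: "B.fpd X M N f x"
  shows "\<exists>M' N' f' x'. A.fpd (pre X) M' N' f' x'"
proof -
  have M: "M \<in> B.MO" "N \<in> B.MO" "f \<in> B.MH M N" "x \<in> Fob X N"
    and gX: "\<And>Y y. Y \<in> B.MO \<Longrightarrow> y \<in> Fob X Y \<Longrightarrow> \<exists>g\<in>B.MH Y N. y = Fmap X Y N g x"
    and rX: "\<And>Y g. Y \<in> B.MO \<Longrightarrow> g \<in> B.MH Y N \<Longrightarrow> Fmap X Y N g x = 0 \<longleftrightarrow> (\<exists>h\<in>B.MH Y M. \<forall>u\<in>fst Y. g u = f (h u))"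
    using fp by (auto simp: B.fpd_def)
  obtain H e where H: "H \<in> A.MO" "e \<in> B.MH (Fo H) N"
    and Hu: "\<forall>X\<in>A.MO. \<forall>g\<in>B.MH (Fo X) N. \<exists>!g'. g' \<in> A.MH X H \<and> (\<forall>u\<in>fst (Fo X). g u = e (Fm X H g' u))"
    using couniversal[OF M(2)] by blast
  obtain H' e' where H': "H' \<in> A.MO" "e' \<in> B.MH (Fo H') M"
    and Hu': "\<forall>X\<in>A.MO. \<forall>g\<in>B.MH (Fo X) M. \<exists>!g'. g' \<in> A.MH X H' \<and> (\<forall>u\<in>fst (Fo X). g u = e' (Fm X H' g' u))"
    using couniversal[OF M(1)] by blast
  have fe: "B.mc (Fo H') M N f e' \<in> B.MH (Fo H') N" by (rule B.MH_comp[OF H'(2) M(3) Fo_mem[OF H'(1)]])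
  \<comment> \<open>The transpose of f e', that is, the right adjoint applied to
    \<open>f\<close>.\<close>
  obtain k where k: "k \<in> A.MH H' H" "\<forall>u\<in>fst (Fo H'). B.mc (Fo H') M N f e' u = e (Fm H' H k u)"
    using Hu H'(1) fe by blast
  let ?x = "Fmap X (Fo H) N e x"
  have x: "?x \<in> Fob (pre X) H" using B.lf_map[OF X Fo_mem[OF H(1)] M(2) H(2) M(4)] by simp
  have gx: "Fmap (pre X) Y H g ?x = Fmap X (Fo Y) N (B.mc (Fo Y) (Fo H) N e (Fm Y H g)) x"
    if Y: "Y \<in> A.MO" and g: "g \<in> A.MH Y H" for Y g
    using B.lf_comp[OF X Fo_mem[OF Y] Fo_mem[OF H(1)] M(2) Fm_mem[OF Y H(1) g] H(2) M(4)] by simp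
  have eg: "B.mc (Fo Y) (Fo H) N e (Fm Y H g) \<in> B.MH (Fo Y) N" if Y: "Y \<in> A.MO" and g: "g \<in> A.MH Y H" for Y g
    by (rule B.MH_comp[OF Fm_mem[OF Y H(1) g] H(2) Fo_mem[OF Y]])
  have "A.fpd (pre X) H' H k ?x" unfolding A.fpd_def
  proof (intro conjI ballI H(1) H'(1) k(1) x)
    fix Y assume Y: "Y \<in> A.MO"
    { fix y assume "y \<in> Fob (pre X) Y"
      then obtain g where g: "g \<in> B.MH (Fo Y) N" "y = Fmap X (Fo Y) N g x" using gX[OF Fo_mem[OF Y]] by auto
      obtain g' where g': "g' \<in> A.MH Y H" "\<forall>u\<in>fst (Fo Y). g u = e (Fm Y H g' u)" using Hu Y g(1) by blast
      have "g = B.mc (Fo Y) (Fo H) N e (Fm Y H g')"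
        by (rule B.MH_eqI[OF g(1) eg[OF Y g'(1)]]) (simp add: g'(2))
      then show "\<exists>g\<in>A.MH Y H. y = Fmap (pre X) Y H g ?x" using gx[OF Y g'(1)] g(2) g'(1) by metis }
    fix g assume g: "g \<in> A.MH Y H"
    have "Fmap (pre X) Y H g ?x = 0 \<longleftrightarrow> (\<exists>h\<in>B.MH (Fo Y) M. \<forall>u\<in>fst (Fo Y). e (Fm Y H g u) = f (h u))"
      using gx[OF Y g] rX[OF Fo_mem[OF Y] eg[OF Y g]] by simp
    also have "\<dots> \<longleftrightarrow> (\<exists>h\<in>A.MH Y H'. \<forall>u\<in>fst Y. g u = k (h u))"
    proof
      assume "\<exists>h\<in>B.MH (Fo Y) M. \<forall>u\<in>fst (Fo Y). e (Fm Y H g u) = f (h u)"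
      then obtain h where h: "h \<in> B.MH (Fo Y) M" "\<forall>u\<in>fst (Fo Y). e (Fm Y H g u) = f (h u)" by blast
      obtain h' where h': "h' \<in> A.MH Y H'" "\<forall>u\<in>fst (Fo Y). h u = e' (Fm Y H' h' u)" using Hu' Y h(1) by blast
      have kh: "A.mc Y H' H k h' \<in> A.MH Y H" by (rule A.MH_comp[OF h'(1) k(1) Y])
      have "e (Fm Y H g u) = e (Fm Y H (A.mc Y H' H k h') u)" if u: "u \<in> fst (Fo Y)" for u
      proof -
        have fu: "Fm Y H' h' u \<in> fst (Fo H')" using B.MH_mem[OF Fm_mem[OF Y H'(1) h'(1)] u] .
        have "e (Fm Y H g u) = f (e' (Fm Y H' h' u))" using h(2) h'(2) u by simp
        also have "\<dots> = e (Fm H' H k (Fm Y H' h' u))" using k(2) fu by simp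
        finally show ?thesis using Fm_comp[OF Y H'(1) H(1) h'(1) k(1) u] by simp
      qed
      \<comment> \<open>The uniqueness clause at the transpose of e after Fm g: both
        \<open>g\<close> and k h' satisfy it.\<close>
      moreover define P where "P g' \<longleftrightarrow> g' \<in> A.MH Y H \<and> (\<forall>u\<in>fst (Fo Y). e (Fm Y H g u) = e (Fm Y H g' u))" for g'
      ultimately have "P g" "P (A.mc Y H' H k h')" using g kh by auto
      moreover have "\<exists>!g'. P g'" using Hu[rule_format, OF Y eg[OF Y g]] by (simp add: P_def)
      ultimately have "g = A.mc Y H' H k h'" by blast
      then have "\<forall>u\<in>fst Y. g u = k (h' u)" by simp
      then show "\<exists>h\<in>A.MH Y H'. \<forall>u\<in>fst Y. g u = k (h u)" using h'(1) by blast
    next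
      assume "\<exists>h\<in>A.MH Y H'. \<forall>u\<in>fst Y. g u = k (h u)"
      then obtain h where h: "h \<in> A.MH Y H'" "\<forall>u\<in>fst Y. g u = k (h u)" by blast
      have geq: "g = A.mc Y H' H k h" by (rule A.MH_eqI[OF g A.MH_comp[OF h(1) k(1) Y]]) (simp add: h(2))
      have "e (Fm Y H g u) = f (B.mc (Fo Y) (Fo H') M e' (Fm Y H' h) u)" if u: "u \<in> fst (Fo Y)" for u
      proof -
        have fu: "Fm Y H' h u \<in> fst (Fo H')" using B.MH_mem[OF Fm_mem[OF Y H'(1) h(1)] u] .
        have "e (Fm Y H g u) = e (Fm H' H k (Fm Y H' h u))"
          using Fm_comp[OF Y H'(1) H(1) h(1) k(1) u] geq by simp
        also have "\<dots> = f (e' (Fm Y H' h u))" using k(2) fu by simp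
        finally show ?thesis using u by simp
      qed
      then show "\<exists>h\<in>B.MH (Fo Y) M. \<forall>u\<in>fst (Fo Y). e (Fm Y H g u) = f (h u)"
        using B.MH_comp[OF Fm_mem[OF Y H'(1) h(1)] H'(2) Fo_mem[OF Y]] by blast
    qed
    finally show "Fmap (pre X) Y H g ?x = 0 \<longleftrightarrow> (\<exists>h\<in>A.MH Y H'. \<forall>u\<in>fst Y. g u = k (h u))" .
  qed
  then show ?thesis by blast
qed

lemma pre_Ob: "X \<in> Ob B.FC \<Longrightarrow> pre X \<in> Ob A.FC"
  using A.FO_iff B.FO_iff pre_linear pre_fpd by metis

text \<open>The identity of \<open>N\<close> factors through some \<open>Fo M\<close>, so the
  identity of \<open>Fob X N\<close> factors through a zero space.\<close>

lemma pre_faithful: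
  assumes X: "X \<in> Ob B.FC" and z: "\<And>M. M \<in> A.MO \<Longrightarrow> Fob X (Fo M) = {0}" and N: "N \<in> B.MO"
  shows "Fob X N = {0}"
proof -
  note lX = B.FO_lf[OF X]
  obtain M i p where M: "M \<in> A.MO" "i \<in> B.MH N (Fo M)" "p \<in> B.MH (Fo M) N" "\<forall>u\<in>fst N. p (i u) = u"
    using summand[OF N] by blast
  have FM: "Fo M \<in> B.MO" using Fo_mem M(1) .
  have "B.mc N (Fo M) N p i = Id (mod_cat B) N"
    by (rule B.MH_eqI[OF B.MH_comp[OF M(2,3) N] B.MH_id[OF N]]) (simp add: M(4))
  then have "y = Fmap X N (Fo M) i (Fmap X (Fo M) N p y)" if "y \<in> Fob X N" for y
    using B.lf_comp[OF lX N FM N M(2,3) that] B.lf_id[OF lX N that] by simp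
  moreover have "Fmap X (Fo M) N p y = 0" if "y \<in> Fob X N" for y
    using B.lf_map[OF lX FM N M(3) that] z[OF M(1)] by simp
  ultimately have "y = 0" if "y \<in> Fob X N" for y using B.lf_zero[OF lX N FM M(2)] that by metis
  then show ?thesis using kvs.subspace_0[OF B.lf_sub[OF lX N]] by blast
qed

lemma KG_filtration_pre:
  fixes \<alpha> :: "'w::wellorder"
  assumes "KG_filtration A.FC \<alpha> = Ob A.FC" shows "KG_filtration B.FC \<alpha> = Ob B.FC"
proof -
  interpret CA: concrete_abelian A.FC A.MO Fob by (rule A.concrete_abelian_functors)
  interpret CB: concrete_abelian B.FC B.MO Fob by (rule B.concrete_abelian_functors)
  interpret R: reindexing_functor A.FC A.MO Fob B.FC B.MO Fob pre "\<lambda>X Y \<eta>. \<lambda>M\<in>A.MO. \<eta> (Fo M)" Fo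
  proof
    fix X Y :: "('k, 'b) mod_functor" and f assume *: "X \<in> Ob B.FC" "Y \<in> Ob B.FC" "f \<in> Hom B.FC X Y"
    show "(\<lambda>M\<in>A.MO. f (Fo M)) \<in> Hom A.FC (pre X) (pre Y)"
      using *(3) Fo_mem Fm_mem unfolding A.FH_iff B.FH_iff by simp
  qed (use pre_faithful in \<open>auto simp: pre_Ob Fo_mem\<close>)
  show ?thesis by (rule R.KG_filtration_all[OF assms])
qed

end

text \<open>Each functor gives one implication, so the same indices exhaust both filtrations; then
  the least such index, or its absence, is the same.\<close>

lemma KG_eqI:
  fixes A :: "('k::field, 'a) module" and B :: "('k, 'b) module"
  assumes "module_functor A B F Fm" and "module_functor B A G Gm"
  shows "(KG A :: 'w ordinal extended) = KG B"
proof -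
  have "KG_filtration (fp_functor_cat A) \<alpha> = Ob (fp_functor_cat A) \<longleftrightarrow>
      KG_filtration (fp_functor_cat B) \<alpha> = Ob (fp_functor_cat B)" for \<alpha> :: "'w ordinal"
    using module_functor.KG_filtration_pre[OF assms(1)] module_functor.KG_filtration_pre[OF assms(2)] by blast
  then show ?thesis by (simp add: KG_def KG_dim_category_def)
qed

section \<open>Path algebras and representations\<close>

text \<open>Induction that keeps every intermediate element supported in \<open>K\<close>, hence
  inside the path algebra when \<open>K\<close> is the set of paths.\<close>

lemma poly_mapping_add_induct [consumes 1, case_names zero add]:
  assumes "Poly_Mapping.keys x \<subseteq> K" and "P 0"
    and "\<And>p c y. p \<in> K \<Longrightarrow> Poly_Mapping.keys y \<subseteq> K \<Longrightarrow> P y \<Longrightarrow> P (Poly_Mapping.single p c + y)"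
  shows "P (x :: 'p \<Rightarrow>\<^sub>0 'k::ab_group_add)"
proof -
  have "finite A \<Longrightarrow> Poly_Mapping.keys x \<subseteq> A \<Longrightarrow> A \<subseteq> K \<Longrightarrow> P x" for A x
  proof (induction A arbitrary: x rule: finite_induct)
    case empty then show ?case using assms(2) by simp
  next
    case (insert p A)
    let ?c = "Poly_Mapping.lookup x p"
    let ?y = "x - Poly_Mapping.single p ?c"
    have "Poly_Mapping.keys ?y \<subseteq> A"
    proof
      fix q assume "q \<in> Poly_Mapping.keys ?y"
      then have "Poly_Mapping.lookup ?y q \<noteq> 0" by (simp add: in_keys_iff)
      then have "q \<noteq> p" "Poly_Mapping.lookup x q \<noteq> 0" by (auto simp: lookup_minus lookup_single when_def split: if_splits)
      then show "q \<in> A" using insert.prems(1) by (auto simp: in_keys_iff)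
    qed
    then have "P ?y" "Poly_Mapping.keys ?y \<subseteq> K" using insert by auto
    then have "P (Poly_Mapping.single p ?c + ?y)" using assms(3) insert.prems(2) by blast
    then show ?case by simp
  qed
  then show ?thesis using assms(1) finite_keys by blast
qed

lemma keys_scale: "Poly_Mapping.keys (scale c x) \<subseteq> Poly_Mapping.keys x"
  by (auto simp: in_keys_iff)

lemma scale_single: "scale c (Poly_Mapping.single p a) = Poly_Mapping.single p (c * a)"
  by (rule poly_mapping_eqI) (simp add: lookup_single when_def)

lemma keys_diff_subset: "Poly_Mapping.keys (x - y) \<subseteq> Poly_Mapping.keys x \<union> Poly_Mapping.keys (y :: 'p \<Rightarrow>\<^sub>0 'k::ab_group_add)"
  by (auto simp: in_keys_iff lookup_minus)

locale quiver = fin_digraph Q for Q :: "('v, 'a) pre_digraph"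
begin

abbreviation tgt :: "'v \<times> 'a list \<Rightarrow> 'v" where
  "tgt p \<equiv> last (awalk_verts (fst p) (snd p))"

abbreviation "QP \<equiv> quiver_paths Q"

lemma awalk_verts_ne: "awalk_verts v p \<noteq> []" by (cases p) auto

lemma tgt_Cons: "tgt (v, a # p) = tgt (head Q a, p)"
  using awalk_verts_ne by simp

lemma tgt_append: "tgt (v, p @ q) = tgt (tgt (v, p), q)"
  by (induction p arbitrary: v) (auto simp: awalk_verts_ne)

lemma QP_Nil: "(v, []) \<in> QP \<longleftrightarrow> v \<in> verts Q"
  by (auto simp: quiver_paths_def awalk_def)

lemma QP_Cons: "(v, a # p) \<in> QP \<longleftrightarrow> a \<in> arcs Q \<and> tail Q a = v \<and> (head Q a, p) \<in> QP"
  by (auto simp: quiver_paths_def awalk_def)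

lemma QP_append: "(v, p @ q) \<in> QP \<longleftrightarrow> (v, p) \<in> QP \<and> (tgt (v, p), q) \<in> QP"
proof (induction p arbitrary: v)
  case Nil
  then show ?case by (auto simp: QP_Nil) (auto simp: quiver_paths_def awalk_def)
next
  case (Cons a p)
  then show ?case using tgt_Cons by (auto simp: QP_Cons)
qed

lemma QP_fst: "(v, p) \<in> QP \<Longrightarrow> v \<in> verts Q"
  by (auto simp: quiver_paths_def awalk_def)

lemma QP_tgt: "p \<in> QP \<Longrightarrow> tgt p \<in> verts Q"
proof -
  have "(v, q) \<in> QP \<Longrightarrow> tgt (v, q) \<in> verts Q" for v q
    by (induction q arbitrary: v) (auto simp: QP_Nil QP_Cons awalk_verts_ne)
  then show "p \<in> QP \<Longrightarrow> tgt p \<in> verts Q" by (cases p) simp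
qed

lemma finite_short_paths: "finite {p \<in> QP. length (snd p) \<le> n}"
proof -
  have "{p \<in> QP. length (snd p) \<le> n} \<subseteq> verts Q \<times> {p. set p \<subseteq> arcs Q \<and> length p \<le> n}"
    by (auto simp: quiver_paths_def awalk_def)
  then show ?thesis by (rule finite_subset) (simp add: finite_lists_length_le)
qed

definition pmul :: "('v \<times> 'a list \<Rightarrow>\<^sub>0 'k::field) \<Rightarrow> ('v \<times> 'a list \<Rightarrow>\<^sub>0 'k) \<Rightarrow> ('v \<times> 'a list \<Rightarrow>\<^sub>0 'k)" where
  "pmul x y = (\<Sum>p\<in>Poly_Mapping.keys x. \<Sum>q\<in>Poly_Mapping.keys y.
     if tgt p = fst q then Poly_Mapping.single (fst p, snd p @ snd q) (Poly_Mapping.lookup x p * Poly_Mapping.lookup y q) else 0)"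

text \<open>The sums defining the product run over supports, which shrink under cancellation. Over a
  common finite index set bilinearity holds term by term.\<close>

lemma pmul_finite:
  assumes "finite K" "finite L" "Poly_Mapping.keys x \<subseteq> K" "Poly_Mapping.keys y \<subseteq> L"
  shows "pmul x y = (\<Sum>p\<in>K. \<Sum>q\<in>L.
     if tgt p = fst q then Poly_Mapping.single (fst p, snd p @ snd q) (Poly_Mapping.lookup x p * Poly_Mapping.lookup y q) else 0)"
proof -
  have "pmul x y = (\<Sum>p\<in>Poly_Mapping.keys x. \<Sum>q\<in>L.
     if tgt p = fst q then Poly_Mapping.single (fst p, snd p @ snd q) (Poly_Mapping.lookup x p * Poly_Mapping.lookup y q) else 0)"
    unfolding pmul_def using assms by (intro sum.cong refl sum.mono_neutral_left) (auto simp: in_keys_iff)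
  also have "\<dots> = (\<Sum>p\<in>K. \<Sum>q\<in>L.
     if tgt p = fst q then Poly_Mapping.single (fst p, snd p @ snd q) (Poly_Mapping.lookup x p * Poly_Mapping.lookup y q) else 0)"
    using assms by (intro sum.mono_neutral_left) (auto simp: in_keys_iff intro!: sum.neutral)
  finally show ?thesis .
qed

lemma pmul_add_left: "pmul (x + x') y = pmul x y + pmul x' y"
proof -
  let ?K = "Poly_Mapping.keys x \<union> Poly_Mapping.keys x'"
  have "finite ?K" "finite (Poly_Mapping.keys y)" "Poly_Mapping.keys (x + x') \<subseteq> ?K" using keys_add[of x x'] by auto
  then show ?thesis
    using pmul_finite[of ?K "Poly_Mapping.keys y" x y] pmul_finite[of ?K "Poly_Mapping.keys y" x' y]
      pmul_finite[of ?K "Poly_Mapping.keys y" "x + x'" y]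
    by (simp add: lookup_add algebra_simps single_add flip: sum.distrib)
       (intro sum.cong refl, simp add: single_add lookup_add algebra_simps)
qed

lemma pmul_add_right: "pmul y (x + x') = pmul y x + pmul y x'"
proof -
  let ?K = "Poly_Mapping.keys x \<union> Poly_Mapping.keys x'"
  have "finite ?K" "finite (Poly_Mapping.keys y)" "Poly_Mapping.keys (x + x') \<subseteq> ?K" using keys_add[of x x'] by auto
  then show ?thesis
    using pmul_finite[of "Poly_Mapping.keys y" ?K y x] pmul_finite[of "Poly_Mapping.keys y" ?K y x']
      pmul_finite[of "Poly_Mapping.keys y" ?K y "x + x'"]
    by (simp add: lookup_add algebra_simps single_add flip: sum.distrib)
       (intro sum.cong refl, simp add: single_add lookup_add algebra_simps)
qed

lemma pmul_zero [simp]: "pmul 0 y = 0" "pmul y 0 = 0"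
  by (simp_all add: pmul_def)

lemma pmul_single: "pmul (Poly_Mapping.single p a) (Poly_Mapping.single q b) =
    (if tgt p = fst q then Poly_Mapping.single (fst p, snd p @ snd q) (a * b) else 0)"
  by (subst pmul_finite[of "{p}" "{q}"]) auto

lemma pmul_scale: "pmul (scale c x) y = scale c (pmul x y)" "pmul y (scale c x) = scale c (pmul y x)"
proof -
  have s0: "scale c (0 :: 'v \<times> 'a list \<Rightarrow>\<^sub>0 'b) = 0" by (rule poly_mapping_eqI) simp
  have sa: "scale c (u + w) = scale c u + scale c w" for u w :: "'v \<times> 'a list \<Rightarrow>\<^sub>0 'b"
    by (rule poly_mapping_eqI) (simp add: lookup_add algebra_simps)
  have ss: "scale c (sum f K) = (\<Sum>k\<in>K. scale c (f k))" for f :: "'z \<Rightarrow> 'v \<times> 'a list \<Rightarrow>\<^sub>0 'b" and K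
    by (induction K rule: infinite_finite_induct) (auto simp: s0 sa)
  have ss': "scale c (sum f K) = (\<Sum>k\<in>K. scale c (f k))" for f :: "'v \<times> 'a list \<Rightarrow> 'v \<times> 'a list \<Rightarrow>\<^sub>0 'b" and K
    by (induction K rule: infinite_finite_induct) (auto simp: s0 sa)
  have f: "finite (Poly_Mapping.keys x)" "finite (Poly_Mapping.keys y)" by auto
  show "pmul (scale c x) y = scale c (pmul x y)"
    by (subst pmul_finite[OF f keys_scale subset_refl])
      (simp add: pmul_def ss' scale_single s0 mult_ac if_distrib[of "scale c"] cong: if_cong)
  show "pmul y (scale c x) = scale c (pmul y x)"
    by (subst pmul_finite[OF f(2,1) subset_refl keys_scale])
      (simp add: pmul_def ss' scale_single s0 mult_ac if_distrib[of "scale c"] cong: if_cong)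
qed

lemma keys_pmul: "Poly_Mapping.keys (pmul x y) \<subseteq> {(fst p, snd p @ snd q) | p q. p \<in> Poly_Mapping.keys x \<and> q \<in> Poly_Mapping.keys y \<and> tgt p = fst q}"
proof
  fix r assume r: "r \<in> Poly_Mapping.keys (pmul x y)"
  then obtain p where p: "p \<in> Poly_Mapping.keys x" "r \<in> Poly_Mapping.keys (\<Sum>q\<in>Poly_Mapping.keys y.
     if tgt p = fst q then Poly_Mapping.single (fst p, snd p @ snd q) (Poly_Mapping.lookup x p * Poly_Mapping.lookup y q) else 0)"
    unfolding pmul_def using subsetD[OF keys_sum r[unfolded pmul_def]] by blast
  then obtain q where q: "q \<in> Poly_Mapping.keys y" "r \<in> Poly_Mapping.keys (
     if tgt p = fst q then Poly_Mapping.single (fst p, snd p @ snd q) (Poly_Mapping.lookup x p * Poly_Mapping.lookup y q) else 0)"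
    using subsetD[OF keys_sum p(2)] by blast
  then have "tgt p = fst q" "r = (fst p, snd p @ snd q)" by (auto split: if_splits)
  then show "r \<in> {(fst p, snd p @ snd q) | p q. p \<in> Poly_Mapping.keys x \<and> q \<in> Poly_Mapping.keys y \<and> tgt p = fst q}"
    using p(1) q(1) by blast
qed

abbreviation PA :: "('k::field, 'v \<times> 'a list \<Rightarrow>\<^sub>0 'k) module" where "PA \<equiv> path_algebra Q"

lemma PA_simps: "carrier PA = {x. Poly_Mapping.keys x \<subseteq> QP}" "x \<otimes>\<^bsub>PA\<^esub> y = pmul x y"
  "\<one>\<^bsub>PA\<^esub> = (\<Sum>v\<in>verts Q. Poly_Mapping.single (v, []) 1)" "\<zero>\<^bsub>PA\<^esub> = 0" "x \<oplus>\<^bsub>PA\<^esub> y = x + y" "c \<odot>\<^bsub>PA\<^esub> x = scale c x"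
  by (simp_all add: path_algebra_def pmul_def case_prod_beta cong: if_cong)

lemma pmul_carrier: "x \<in> carrier PA \<Longrightarrow> y \<in> carrier PA \<Longrightarrow> pmul x y \<in> carrier PA"
proof -
  assume xy: "x \<in> carrier PA" "y \<in> carrier PA"
  have "r \<in> QP" if "r \<in> Poly_Mapping.keys (pmul x y)" for r
  proof -
    obtain p q where r: "r = (fst p, snd p @ snd q)" "p \<in> Poly_Mapping.keys x" "q \<in> Poly_Mapping.keys y" "tgt p = fst q"
      using subsetD[OF keys_pmul \<open>r \<in> _\<close>] by blast
    then have "p \<in> QP" "q \<in> QP" using xy by (auto simp: PA_simps)
    then show ?thesis using r QP_append[of "fst p" "snd p" "snd q"] by simp
  qed
  then show "pmul x y \<in> carrier PA" by (auto simp: PA_simps)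
qed

lemma pmul_assoc: "pmul (pmul x y) z = pmul x (pmul y z)"
using subset_UNIV[of "Poly_Mapping.keys x"]
 proof (induction x rule: poly_mapping_add_induct)
  case (add p a x)
  have "pmul (pmul (Poly_Mapping.single p a) y) z = pmul (Poly_Mapping.single p a) (pmul y z)"
  using subset_UNIV[of "Poly_Mapping.keys y"]
 proof (induction y rule: poly_mapping_add_induct)
    case (add q b y)
    have "pmul (pmul (Poly_Mapping.single p a) (Poly_Mapping.single q b)) z = pmul (Poly_Mapping.single p a) (pmul (Poly_Mapping.single q b) z)"
    using subset_UNIV[of "Poly_Mapping.keys z"]
 proof (induction z rule: poly_mapping_add_induct)
      case (add r c z)
      have "pmul (pmul (Poly_Mapping.single p a) (Poly_Mapping.single q b)) (Poly_Mapping.single r c) =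
          pmul (Poly_Mapping.single p a) (pmul (Poly_Mapping.single q b) (Poly_Mapping.single r c))"
        using tgt_append[of "fst p" "snd p" "snd q"] by (auto simp: pmul_single mult.assoc)
      then show ?case using add by (simp add: pmul_add_right)
    qed auto
    then show ?case using add by (simp add: pmul_add_right pmul_add_left)
  qed auto
  then show ?case using add by (simp add: pmul_add_left)
qed auto

lemma pmul_sum_left: "pmul (sum f K) y = (\<Sum>k\<in>K. pmul (f k) y)"
  by (induction K rule: infinite_finite_induct) (auto simp: pmul_add_left)

lemma pmul_sum_right: "pmul y (sum f K) = (\<Sum>k\<in>K. pmul y (f k))"
  by (induction K rule: infinite_finite_induct) (auto simp: pmul_add_right)

lemma pmul_one:
  assumes "x \<in> carrier PA" shows "pmul \<one>\<^bsub>PA\<^esub> x = x" "pmul x \<one>\<^bsub>PA\<^esub> = x"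
proof -
  have "Poly_Mapping.keys x \<subseteq> QP" using assms by (simp add: PA_simps)
  then show "pmul \<one>\<^bsub>PA\<^esub> x = x"
  proof (induction x rule: poly_mapping_add_induct)
    case (add p a x)
    have "(\<Sum>v\<in>verts Q. pmul (Poly_Mapping.single (v, []) 1) (Poly_Mapping.single p a)) = (\<Sum>v\<in>verts Q. if v = fst p then Poly_Mapping.single p a else 0)"
      by (rule sum.cong) (auto simp: pmul_single)
    also have "\<dots> = Poly_Mapping.single p a" using QP_fst[of "fst p" "snd p"] add(1) by simp
    finally have "pmul \<one>\<^bsub>PA\<^esub> (Poly_Mapping.single p a) = Poly_Mapping.single p a" by (simp add: PA_simps pmul_sum_left)
    then show ?case using add by (simp add: pmul_add_right)
  qed simp
  have "Poly_Mapping.keys x \<subseteq> QP" using assms by (simp add: PA_simps)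
  then show "pmul x \<one>\<^bsub>PA\<^esub> = x"
  proof (induction x rule: poly_mapping_add_induct)
    case (add p a x)
    have "(\<Sum>v\<in>verts Q. pmul (Poly_Mapping.single p a) (Poly_Mapping.single (v, []) 1)) = (\<Sum>v\<in>verts Q. if v = tgt p then Poly_Mapping.single p a else 0)"
      by (rule sum.cong) (auto simp: pmul_single)
    also have "\<dots> = Poly_Mapping.single p a" using QP_tgt[of p] add(1) by simp
    finally have "pmul (Poly_Mapping.single p a) \<one>\<^bsub>PA\<^esub> = Poly_Mapping.single p a" by (simp add: PA_simps pmul_sum_right)
    then show ?case using add by (simp add: pmul_add_left)
  qed simp
qed

lemma PA_add_closed: "x \<in> carrier PA \<Longrightarrow> y \<in> carrier PA \<Longrightarrow> x + y \<in> carrier PA"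
  using keys_add[of x y] by (auto simp: PA_simps)

lemma PA_diff_closed: "x \<in> carrier PA \<Longrightarrow> y \<in> carrier PA \<Longrightarrow> x - y \<in> carrier PA"
  using keys_diff_subset[of x y] by (auto simp: PA_simps)

lemma PA_scale_closed: "x \<in> carrier PA \<Longrightarrow> scale c x \<in> carrier PA"
  using keys_scale[of c x] by (auto simp: PA_simps)

lemma PA_one_closed: "\<one>\<^bsub>PA\<^esub> \<in> carrier PA"
proof -
  have "Poly_Mapping.keys (\<Sum>v\<in>verts Q. Poly_Mapping.single (v, []) 1) \<subseteq> QP"
    using keys_sum[of "\<lambda>v. Poly_Mapping.single (v, []) 1" "verts Q"] by (auto simp: QP_Nil)
  then show ?thesis by (simp add: PA_simps)
qed

lemma PA_single: "Poly_Mapping.single p c \<in> carrier PA \<longleftrightarrow> p \<in> QP \<or> c = 0"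
  by (auto simp: PA_simps)

lemma ring_PA: "ring (PA :: ('k::field, _) module)"
proof (rule ringI)
  show "abelian_group (PA :: ('k::field, _) module)"
  proof (rule abelian_groupI)
    fix x :: "'v \<times> 'a list \<Rightarrow>\<^sub>0 'k" assume x: "x \<in> carrier PA"
    then have "- x \<in> carrier PA" by (auto simp: PA_simps)
    then show "\<exists>y\<in>carrier PA. y \<oplus>\<^bsub>PA\<^esub> x = \<zero>\<^bsub>PA\<^esub>" by (rule bexI[rotated]) (simp add: PA_simps)
  qed (auto simp: PA_simps(4,5) PA_add_closed add_ac, simp add: PA_simps)
  show "monoid (PA :: ('k::field, _) module)"
    by (rule monoidI) (auto simp: PA_simps(2) pmul_carrier PA_one_closed pmul_assoc pmul_one)
qed (simp_all add: PA_simps(2,5) pmul_add_left pmul_add_right)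

end

section \<open>Quotients of the path algebra\<close>

locale quiver_quotient = quiver Q for Q :: "('v, 'a) pre_digraph" +
  fixes R :: "('v \<times> 'a list \<Rightarrow>\<^sub>0 'k::field) set"
  assumes R_carrier: "R \<subseteq> carrier (path_algebra Q)"
begin

abbreviation "J \<equiv> genideal (path_algebra Q) R"
abbreviation "QA \<equiv> quotient_algebra (path_algebra Q) J"

lemma ideal_J: "ideal J PA" by (rule ring.genideal_ideal[OF ring_PA R_carrier])

lemma R_J: "R \<subseteq> J" by (rule ring.genideal_self[OF ring_PA R_carrier])

lemma J_carrier: "J \<subseteq> carrier PA" using ideal.Icarr[OF ideal_J] by blast

lemma J_zero: "0 \<in> J"
  using additive_subgroup.zero_closed[OF ideal.axioms(1)[OF ideal_J]] by (simp add: PA_simps)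

lemma J_add: "x \<in> J \<Longrightarrow> y \<in> J \<Longrightarrow> x + y \<in> J"
  using additive_subgroup.a_closed[OF ideal.axioms(1)[OF ideal_J]] by (simp add: PA_simps)

lemma J_mult: "x \<in> J \<Longrightarrow> y \<in> carrier PA \<Longrightarrow> pmul x y \<in> J" "x \<in> J \<Longrightarrow> y \<in> carrier PA \<Longrightarrow> pmul y x \<in> J"
  using ideal.I_l_closed[OF ideal_J] ideal.I_r_closed[OF ideal_J] by (auto simp: PA_simps(2))

text \<open>Ideals are ring ideals here, with no scalars in their definition; scaling is
  multiplication by a multiple of the unit.\<close>

lemma J_scale: "x \<in> J \<Longrightarrow> scale c x \<in> J"
proof -
  assume x: "x \<in> J"
  have "pmul (scale c \<one>\<^bsub>PA\<^esub>) x \<in> J" by (rule J_mult(2)[OF x PA_scale_closed[OF PA_one_closed]])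
  then show ?thesis using pmul_one(1)[OF subsetD[OF J_carrier x]] by (simp add: pmul_scale)
qed

lemma J_diff: "x \<in> J \<Longrightarrow> y \<in> J \<Longrightarrow> x - y \<in> J"
proof -
  assume x: "x \<in> J" and y: "y \<in> J"
  have "scale (-1) y = - y" by (rule poly_mapping_eqI) simp
  then have "- y \<in> J" using J_scale[OF y, of "-1"] by simp
  then show ?thesis using J_add[OF x] by fastforce
qed

definition cst :: "('v \<times> 'a list \<Rightarrow>\<^sub>0 'k) \<Rightarrow> ('v \<times> 'a list \<Rightarrow>\<^sub>0 'k) set" where
  "cst x = J +>\<^bsub>PA\<^esub> x"

lemma cst_mem: "y \<in> cst x \<longleftrightarrow> y - x \<in> J"
  unfolding cst_def a_r_coset_def r_coset_def by (auto simp: PA_simps(5)) (metis diff_add_cancel)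

lemma cst_eq_iff: "cst x = cst y \<longleftrightarrow> x - y \<in> J"
proof
  assume "cst x = cst y"
  moreover have "x \<in> cst x" using J_zero by (simp add: cst_mem)
  ultimately show "x - y \<in> J" by (simp add: cst_mem)
next
  assume xy: "x - y \<in> J"
  have "z - x \<in> J \<longleftrightarrow> z - y \<in> J" for z
    using J_add[OF _ xy, of "z - x"] J_diff[OF _ xy, of "z - y"] by auto
  then show "cst x = cst y" by (auto simp: cst_mem)
qed

lemma QA_carrier: "carrier QA = cst ` carrier PA"
  by (auto simp: quotient_algebra_def FactRing_def A_RCOSETS_def RCOSETS_def a_r_coset_def cst_def)

lemma QA_add: "cst x \<oplus>\<^bsub>QA\<^esub> cst y = cst (x + y)"
proof -
  have "cst x \<oplus>\<^bsub>QA\<^esub> cst y = {a + b | a b. a \<in> cst x \<and> b \<in> cst y}"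
    by (auto simp: quotient_algebra_def FactRing_def set_add_def set_mult_def PA_simps(5))
  also have "\<dots> = cst (x + y)"
  proof (intro subset_antisym subsetI)
    fix z assume "z \<in> {a + b | a b. a \<in> cst x \<and> b \<in> cst y}"
    then obtain a b where "z = a + b" "a - x \<in> J" "b - y \<in> J" by (auto simp: cst_mem)
    then show "z \<in> cst (x + y)" using J_add[of "a - x" "b - y"] by (simp add: cst_mem algebra_simps)
  next
    fix z assume "z \<in> cst (x + y)"
    then have "z - y \<in> cst x" "y \<in> cst y" using J_zero by (auto simp: cst_mem algebra_simps)
    then show "z \<in> {a + b | a b. a \<in> cst x \<and> b \<in> cst y}" by force
  qed
  finally show ?thesis .
qed

lemma QA_mult: "x \<in> carrier PA \<Longrightarrow> y \<in> carrier PA \<Longrightarrow> cst x \<otimes>\<^bsub>QA\<^esub> cst y = cst (pmul x y)"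
  using ideal.rcoset_mult_add[OF ideal_J, of x y]
  by (simp add: quotient_algebra_def FactRing_def cst_def PA_simps(2))

lemma QA_one: "\<one>\<^bsub>QA\<^esub> = cst \<one>\<^bsub>PA\<^esub>"
  by (simp add: quotient_algebra_def FactRing_def cst_def)

lemma QA_zero: "\<zero>\<^bsub>QA\<^esub> = cst 0"
proof -
  have "cst 0 = J" by (auto simp: cst_mem)
  then show ?thesis by (simp add: quotient_algebra_def FactRing_def)
qed

lemma QA_smult: "c \<odot>\<^bsub>QA\<^esub> cst x = cst (scale c x)"
proof -
  have "cst (scale c y) = cst (scale c x)" if "y \<in> cst x" for y
  proof -
    have "scale c (y - x) = scale c y - scale c x" by (rule poly_mapping_eqI) (simp add: lookup_minus algebra_simps)
    then show ?thesis using J_scale[of "y - x" c] that by (simp add: cst_eq_iff cst_mem)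
  qed
  moreover have "x \<in> cst x" using J_zero by (simp add: cst_mem)
  ultimately have "(\<Union>y\<in>cst x. cst (scale c y)) = cst (scale c x)" by blast
  then show ?thesis by (simp add: quotient_algebra_def PA_simps(6) cst_def)
qed

end

text \<open>No extensionality, in contrast to \<open>linear_maps\<close>: module actions are
  functions on all vectors whose values outside the module are arbitrary.\<close>

definition lin_on :: "'k::field vec set \<Rightarrow> ('k vec \<Rightarrow> 'k vec) \<Rightarrow> bool" where
  "lin_on U f \<longleftrightarrow> (\<forall>u\<in>U. f u \<in> U) \<and> (\<forall>u\<in>U. \<forall>w\<in>U. f (u + w) = f u + f w) \<and> (\<forall>u\<in>U. \<forall>c. f (scale c u) = scale c (f u))"

lemma lin_onD:
  assumes "lin_on U f"
  shows lin_on_mem: "u \<in> U \<Longrightarrow> f u \<in> U"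
    and lin_on_add: "u \<in> U \<Longrightarrow> w \<in> U \<Longrightarrow> f (u + w) = f u + f w"
    and lin_on_scale: "u \<in> U \<Longrightarrow> f (scale c u) = scale c (f u)"
  using assms by (auto simp: lin_on_def)

lemma lin_on_zero: "lin_on U f \<Longrightarrow> kvs.subspace U \<Longrightarrow> f 0 = 0"
  using lin_on_scale[of U f 0 0] kvs.subspace_0[of U] by simp

lemma lin_on_sum:
  assumes "lin_on U f" "kvs.subspace U" "\<And>k. k \<in> K \<Longrightarrow> g k \<in> U"
  shows "f (sum g K) = (\<Sum>k\<in>K. f (g k))"
  using assms(3)
proof (induction K rule: infinite_finite_induct)
  case (insert k K)
  have "sum g K \<in> U" using kvs.subspace_sum[OF assms(2)] insert by blast
  then show ?case using lin_on_add[OF assms(1)] insert by simp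
qed (use lin_on_zero[OF assms(1,2)] in auto)

lemma lin_on_diff: "lin_on U f \<Longrightarrow> kvs.subspace U \<Longrightarrow> u \<in> U \<Longrightarrow> w \<in> U \<Longrightarrow> f (u - w) = f u - f w"
proof -
  assume f: "lin_on U f" and U: "kvs.subspace U" and u: "u \<in> U" and w: "w \<in> U"
  have "f (u - w + w) = f (u - w) + f w" by (rule lin_on_add[OF f kvs.subspace_diff[OF U u w] w])
  then show ?thesis by simp
qed

lemma lin_on_comp: "lin_on U f \<Longrightarrow> lin_on U g \<Longrightarrow> lin_on U (\<lambda>u. g (f u))"
  by (auto simp: lin_on_def)

section \<open>Representations and the action of paths\<close>

context quiver
begin

text \<open>A representation given on its total space: \<open>e v\<close> is the projection onto the
  space at \<open>v\<close>, and \<open>t a\<close> is the map of the arrow extended by zero.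
  Relating such data to modules avoids a direct sum over the vertices.\<close>

definition qrep :: "'k::field vec set \<Rightarrow> ('v \<Rightarrow> 'k vec \<Rightarrow> 'k vec) \<Rightarrow> ('a \<Rightarrow> 'k vec \<Rightarrow> 'k vec) \<Rightarrow> bool" where
  "qrep U e t \<longleftrightarrow> kvs.subspace U \<and> (\<forall>v\<in>verts Q. lin_on U (e v)) \<and> (\<forall>a\<in>arcs Q. lin_on U (t a)) \<and>
     (\<forall>v\<in>verts Q. \<forall>w\<in>verts Q. \<forall>u\<in>U. e w (e v u) = (if w = v then e v u else 0)) \<and>
     (\<forall>u\<in>U. (\<Sum>v\<in>verts Q. e v u) = u) \<and>
     (\<forall>a\<in>arcs Q. \<forall>w\<in>verts Q. \<forall>u\<in>U. t a (e w u) = (if w = tail Q a then t a u else 0)) \<and>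
     (\<forall>a\<in>arcs Q. \<forall>w\<in>verts Q. \<forall>u\<in>U. e w (t a u) = (if w = head Q a then t a u else 0))"

lemma qrepD:
  assumes "qrep U e t"
  shows qrep_sub: "kvs.subspace U"
    and qrep_e: "v \<in> verts Q \<Longrightarrow> lin_on U (e v)"
    and qrep_t: "a \<in> arcs Q \<Longrightarrow> lin_on U (t a)"
    and qrep_ee: "v \<in> verts Q \<Longrightarrow> w \<in> verts Q \<Longrightarrow> u \<in> U \<Longrightarrow> e w (e v u) = (if w = v then e v u else 0)"
    and qrep_one: "u \<in> U \<Longrightarrow> (\<Sum>v\<in>verts Q. e v u) = u"
    and qrep_te: "a \<in> arcs Q \<Longrightarrow> w \<in> verts Q \<Longrightarrow> u \<in> U \<Longrightarrow> t a (e w u) = (if w = tail Q a then t a u else 0)"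
    and qrep_et: "a \<in> arcs Q \<Longrightarrow> w \<in> verts Q \<Longrightarrow> u \<in> U \<Longrightarrow> e w (t a u) = (if w = head Q a then t a u else 0)"
  using assms unfolding qrep_def by blast+

text \<open>The leftmost arrow acts first, as befits right modules with the product of paths read
  from left to right.\<close>

definition pact :: "('v \<Rightarrow> 'k::field vec \<Rightarrow> 'k vec) \<Rightarrow> ('a \<Rightarrow> 'k vec \<Rightarrow> 'k vec) \<Rightarrow> 'v \<times> 'a list \<Rightarrow> 'k vec \<Rightarrow> 'k vec" where
  "pact e t p u = fold t (snd p) (e (fst p) u)"

definition xact :: "('v \<Rightarrow> 'k::field vec \<Rightarrow> 'k vec) \<Rightarrow> ('a \<Rightarrow> 'k vec \<Rightarrow> 'k vec) \<Rightarrow> ('v \<times> 'a list \<Rightarrow>\<^sub>0 'k) \<Rightarrow> 'k vec \<Rightarrow> 'k vec" where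
  "xact e t x u = (\<Sum>p\<in>Poly_Mapping.keys x. scale (Poly_Mapping.lookup x p) (pact e t p u))"

lemma xact_finite: "finite K \<Longrightarrow> Poly_Mapping.keys x \<subseteq> K \<Longrightarrow> xact e t x u = (\<Sum>p\<in>K. scale (Poly_Mapping.lookup x p) (pact e t p u))"
  unfolding xact_def by (intro sum.mono_neutral_left) (auto simp: in_keys_iff)

lemma xact_add: "xact e t (x + y) u = xact e t x u + xact e t y u"
proof -
  let ?K = "Poly_Mapping.keys x \<union> Poly_Mapping.keys y"
  have "finite ?K" "Poly_Mapping.keys (x + y) \<subseteq> ?K" using keys_add[of x y] by auto
  then show ?thesis using xact_finite[of ?K x e t u] xact_finite[of ?K y e t u] xact_finite[of ?K "x + y" e t u]
    by (simp add: lookup_add kvs.scale_left_distrib sum.distrib)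
qed

lemma xact_zero [simp]: "xact e t 0 u = 0" by (simp add: xact_def)

lemma xact_single [simp]: "xact e t (Poly_Mapping.single p c) u = scale c (pact e t p u)"
  by (subst xact_finite[of "{p}"]) auto

lemma xact_scale: "xact e t (scale c x) u = scale c (xact e t x u)"
  by (subst xact_finite[OF _ keys_scale]) (auto simp: xact_def kvs.scale_sum_right)

lemma xact_diff: "xact e t (x - y) u = xact e t x u - xact e t y u"
  using xact_add[of e t "x - y" y u] by simp

lemma xact_sum: "xact e t (sum f K) u = (\<Sum>k\<in>K. xact e t (f k) u)"
  by (induction K rule: infinite_finite_induct) (auto simp: xact_add)

context
  fixes U :: "'k::field vec set" and e t
  assumes rep: "qrep U e t"
begin

lemma fold_lin: "set p \<subseteq> arcs Q \<Longrightarrow> lin_on U (fold t p)"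
proof (induction p)
  case (Cons a p)
  then show ?case using lin_on_comp[OF qrep_t[OF rep, of a], of "fold t p"] by (simp add: comp_def)
qed (simp add: lin_on_def)

lemma pact_lin: "p \<in> QP \<Longrightarrow> lin_on U (pact e t p)"
proof -
  assume p: "p \<in> QP"
  then have "set (snd p) \<subseteq> arcs Q" "fst p \<in> verts Q" by (auto simp: quiver_paths_def awalk_def)
  then show ?thesis using lin_on_comp[OF qrep_e[OF rep] fold_lin] by (simp add: pact_def[abs_def])
qed

lemma xact_lin: "x \<in> carrier PA \<Longrightarrow> lin_on U (xact e t x)"
proof -
  assume "x \<in> carrier PA"
  then have "Poly_Mapping.keys x \<subseteq> QP" by (simp add: PA_simps)
  then show ?thesis
  proof (induction x rule: poly_mapping_add_induct)
    case zero then show ?case using kvs.subspace_0[OF qrep_sub[OF rep]] by (simp add: lin_on_def)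
  next
    case (add p c y)
    then show ?case using pact_lin[OF add(1)] kvs.subspace_add[OF qrep_sub[OF rep]] kvs.subspace_scale[OF qrep_sub[OF rep]]
      unfolding lin_on_def xact_add xact_single by (simp add: scale_add mult.commute)
  qed
qed

lemma e_pact: "p \<in> QP \<Longrightarrow> w \<in> verts Q \<Longrightarrow> u \<in> U \<Longrightarrow> e w (pact e t p u) = (if w = tgt p then pact e t p u else 0)"
proof (cases "snd p" rule: rev_cases)
  case Nil
  then obtain v where "p = (v, [])" by (cases p) auto
  then show "p \<in> QP \<Longrightarrow> w \<in> verts Q \<Longrightarrow> u \<in> U \<Longrightarrow> e w (pact e t p u) = (if w = tgt p then pact e t p u else 0)"
    using qrep_ee[OF rep, of v w u] by (simp add: pact_def QP_Nil)
next
  case (snoc q a)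
  assume p: "p \<in> QP" and w: "w \<in> verts Q" and u: "u \<in> U"
  obtain v where v: "p = (v, q @ [a])" using snoc by (cases p) auto
  then have q: "(v, q) \<in> QP" "a \<in> arcs Q" "tgt p = head Q a"
    using p tgt_append[of v q "[a]"] by (auto simp: QP_append QP_Cons)
  have "pact e t p u = t a (pact e t (v, q) u)" by (simp add: v pact_def)
  then show ?thesis using qrep_et[OF rep q(2) w lin_on_mem[OF pact_lin[OF q(1)] u]] q(3) by simp
qed

lemma pact_append:
  assumes p: "p \<in> QP" and q: "q \<in> QP" and u: "u \<in> U"
  shows "pact e t q (pact e t p u) = (if tgt p = fst q then pact e t (fst p, snd p @ snd q) u else 0)"
proof -
  have q': "fst q \<in> verts Q" "set (snd q) \<subseteq> arcs Q" using q by (auto simp: quiver_paths_def awalk_def)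
  have "pact e t q (pact e t p u) = fold t (snd q) (e (fst q) (pact e t p u))" by (simp add: pact_def)
  also have "e (fst q) (pact e t p u) = (if fst q = tgt p then pact e t p u else 0)" by (rule e_pact[OF p q'(1) u])
  finally show ?thesis using lin_on_zero[OF fold_lin[OF q'(2)] qrep_sub[OF rep]] by (auto simp: pact_def)
qed

lemma xact_pmul:
  assumes x: "x \<in> carrier PA" and y: "y \<in> carrier PA" and u: "u \<in> U"
  shows "xact e t (pmul x y) u = xact e t y (xact e t x u)"
proof -
  have "Poly_Mapping.keys x \<subseteq> QP" using x by (simp add: PA_simps)
  then show ?thesis
  proof (induction x rule: poly_mapping_add_induct)
    case zero then show ?case using lin_on_zero[OF xact_lin[OF y] qrep_sub[OF rep]] by simp
  next
    case (add p c x)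
    have xc: "x \<in> carrier PA" using add by (simp add: PA_simps)
    have pu: "pact e t p u \<in> U" using pact_lin[OF add(1)] u lin_on_mem by blast
    have "Poly_Mapping.keys y \<subseteq> QP" using y by (simp add: PA_simps)
    then have "xact e t (pmul (Poly_Mapping.single p c) y) u = xact e t y (scale c (pact e t p u))"
    proof (induction y rule: poly_mapping_add_induct)
      case (add q d y)
      have "pact e t q (scale c (pact e t p u)) = scale c (pact e t q (pact e t p u))"
        using lin_on_scale[OF pact_lin[OF add(1)] pu] .
      then have "xact e t (pmul (Poly_Mapping.single p c) (Poly_Mapping.single q d)) u = scale d (pact e t q (scale c (pact e t p u)))"
        using pact_append[OF \<open>p \<in> QP\<close> add(1) u] by (simp add: pmul_single mult.commute)
      then show ?case using add by (simp add: pmul_add_right xact_add)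
    qed simp
    moreover have "xact e t x u \<in> U" using xact_lin[OF xc] u lin_on_mem by blast
    ultimately show ?case
      using add lin_on_add[OF xact_lin[OF y]] kvs.subspace_scale[OF qrep_sub[OF rep] pu]
      by (simp add: pmul_add_left xact_add)
  qed
qed

lemma xact_one: "u \<in> U \<Longrightarrow> xact e t \<one>\<^bsub>PA\<^esub> u = u"
  using qrep_one[OF rep] by (simp add: PA_simps xact_sum pact_def)

text \<open>For the passage to quotients: as the annihilator is an ideal, it suffices that the
  generating relations act as zero.\<close>

lemma annihilator_ideal: "ideal {x \<in> carrier PA. \<forall>u\<in>U. xact e t x u = 0} PA"
proof (rule idealI[OF ring_PA])
  interpret ring "PA :: ('k, 'v \<times> 'a list \<Rightarrow>\<^sub>0 'k) module" by (rule ring_PA)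
  show "subgroup {x \<in> carrier PA. \<forall>u\<in>U. xact e t x u = 0} (add_monoid PA)"
  proof (rule add.subgroupI)
    show "{x \<in> carrier PA. \<forall>u\<in>U. xact e t x u = 0} \<noteq> {}" by (auto simp: PA_simps intro!: exI[of _ 0])
  next
    fix x assume x: "x \<in> {x \<in> carrier PA. \<forall>u\<in>U. xact e t x u = 0}"
    then have "\<ominus>\<^bsub>PA\<^esub> x = - x"
      by (intro minus_equality) (auto simp: PA_simps)
    then show "\<ominus>\<^bsub>PA\<^esub> x \<in> {x \<in> carrier PA. \<forall>u\<in>U. xact e t x u = 0}"
      using x xact_diff[of e t 0 x] by (auto simp: PA_simps)
  next
    fix x y assume "x \<in> {x \<in> carrier PA. \<forall>u\<in>U. xact e t x u = 0}" "y \<in> {x \<in> carrier PA. \<forall>u\<in>U. xact e t x u = 0}"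
    then show "x \<oplus>\<^bsub>PA\<^esub> y \<in> {x \<in> carrier PA. \<forall>u\<in>U. xact e t x u = 0}"
      using PA_add_closed[of x y] by (auto simp: PA_simps(5) xact_add)
  qed auto
next
  fix a x :: "'v \<times> 'a list \<Rightarrow>\<^sub>0 'k" assume a: "a \<in> {x \<in> carrier PA. \<forall>u\<in>U. xact e t x u = 0}" and x: "x \<in> carrier PA"
  show "x \<otimes>\<^bsub>PA\<^esub> a \<in> {x \<in> carrier PA. \<forall>u\<in>U. xact e t x u = 0}"
    using a x pmul_carrier xact_pmul lin_on_mem[OF xact_lin[OF x]] by (auto simp: PA_simps(2))
  show "a \<otimes>\<^bsub>PA\<^esub> x \<in> {x \<in> carrier PA. \<forall>u\<in>U. xact e t x u = 0}"
    using a x pmul_carrier xact_pmul lin_on_zero[OF xact_lin[OF x] qrep_sub[OF rep]] by (auto simp: PA_simps(2))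
qed

end

lemma path2_elem_carrier: "r \<in> paths2 Q \<Longrightarrow> path2_elem Q r \<in> carrier PA"
  by (cases r) (auto simp: path2_elem_def paths2_def PA_simps QP_Cons QP_Nil)

lemma arrow_elem_carrier: "a \<in> arcs Q \<Longrightarrow> arrow_elem Q a \<in> carrier PA"
  by (auto simp: arrow_elem_def PA_simps QP_Cons QP_Nil)

lemma xact_arrow: "qrep U e t \<Longrightarrow> u \<in> U \<Longrightarrow> a \<in> arcs Q \<Longrightarrow> xact e t (arrow_elem Q a) u = t a u"
  using qrep_te[of U e t a "tail Q a" u] by (simp add: arrow_elem_def pact_def)

lemma xact_path2: "qrep U e t \<Longrightarrow> u \<in> U \<Longrightarrow> (a, b) \<in> paths2 Q \<Longrightarrow> xact e t (path2_elem Q (a, b)) u = t b (t a u)"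
  using qrep_te[of U e t a "tail Q a" u] by (simp add: path2_elem_def pact_def paths2_def)

end

section \<open>Modules over the quotient as representations with relations\<close>

context quiver_quotient
begin

text \<open>A coset acts through an arbitrary representative; when the relations act as zero,
  \<open>qmod_act\<close> shows that the choice does not matter. \<open>me\<close> and
  \<open>mt\<close> recover the representation from a module.\<close>

definition qmod :: "'k vec set \<Rightarrow> ('v \<Rightarrow> 'k vec \<Rightarrow> 'k vec) \<Rightarrow> ('a \<Rightarrow> 'k vec \<Rightarrow> 'k vec) \<Rightarrow> ('k, ('v \<times> 'a list \<Rightarrow>\<^sub>0 'k) set) rmod" where
  "qmod U e t = (U, \<lambda>u X. xact e t (SOME x. x \<in> X) u)"

definition me :: "('k, ('v \<times> 'a list \<Rightarrow>\<^sub>0 'k) set) rmod \<Rightarrow> 'v \<Rightarrow> 'k vec \<Rightarrow> 'k vec" where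
  "me M v u = snd M u (cst (Poly_Mapping.single (v, []) 1))"

definition mt :: "('k, ('v \<times> 'a list \<Rightarrow>\<^sub>0 'k) set) rmod \<Rightarrow> 'a \<Rightarrow> 'k vec \<Rightarrow> 'k vec" where
  "mt M a u = snd M u (cst (Poly_Mapping.single (tail Q a, [a]) 1))"

lemma fst_qmod [simp]: "fst (qmod U e t) = U" by (simp add: qmod_def)

lemma J_annihilates:
  assumes "qrep U e t" "\<And>r u. r \<in> R \<Longrightarrow> u \<in> U \<Longrightarrow> xact e t r u = 0" "x \<in> J" "u \<in> U"
  shows "xact e t x u = 0"
proof -
  have "R \<subseteq> {x \<in> carrier PA. \<forall>u\<in>U. xact e t x u = 0}" using assms(2) R_carrier by auto
  then have "J \<subseteq> {x \<in> carrier PA. \<forall>u\<in>U. xact e t x u = 0}"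
    by (rule ring.genideal_minimal[OF ring_PA annihilator_ideal[OF assms(1)]])
  then show ?thesis using assms by blast
qed

lemma qmod_act:
  assumes "qrep U e t" "\<And>r u. r \<in> R \<Longrightarrow> u \<in> U \<Longrightarrow> xact e t r u = 0" "u \<in> U"
  shows "snd (qmod U e t) u (cst x) = xact e t x u"
proof -
  let ?y = "SOME y. y \<in> cst x"
  have "x \<in> cst x" using J_zero by (simp add: cst_mem)
  then have "?y \<in> cst x" by (rule someI)
  then have "xact e t (?y - x) u = 0" using J_annihilates[OF assms(1,2)] assms(3) by (simp add: cst_mem)
  then show ?thesis by (simp add: qmod_def xact_diff)
qed

lemma qmod_right_module:
  assumes rep: "qrep U e t" and rel: "\<And>r u. r \<in> R \<Longrightarrow> u \<in> U \<Longrightarrow> xact e t r u = 0"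
  shows "right_module QA (qmod U e t)"
  unfolding right_module_iff fst_qmod QA_carrier
proof (intro conjI ballI allI)
  have act: "snd (qmod U e t) u (cst x) = xact e t x u" if "u \<in> U" for u x
    by (rule qmod_act[OF rep rel that])
  show "kvs.subspace U" by (rule qrep_sub[OF rep])
  show "snd (qmod U e t) u \<one>\<^bsub>QA\<^esub> = u" if "u \<in> U" for u
    using act[OF that] xact_one[OF rep that] by (simp add: QA_one)
  fix u X assume u: "u \<in> U" and "X \<in> cst ` carrier PA"
  then obtain x where x: "X = cst x" "x \<in> carrier PA" by blast
  note l = xact_lin[OF rep x(2)]
  show "snd (qmod U e t) u X \<in> U" using act[OF u] lin_on_mem[OF l u] x by simp
  show "snd (qmod U e t) (scale c u) X = scale c (snd (qmod U e t) u X)" for c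
    using act[OF u] act[OF kvs.subspace_scale[OF qrep_sub[OF rep] u]] lin_on_scale[OF l u] x by simp
  show "snd (qmod U e t) u (c \<odot>\<^bsub>QA\<^esub> X) = scale c (snd (qmod U e t) u X)" for c
    using act[OF u] x by (simp add: QA_smult xact_scale)
  show "snd (qmod U e t) (u + w) X = snd (qmod U e t) u X + snd (qmod U e t) w X" if w: "w \<in> U" for w
    using act[OF u] act[OF w] act[OF kvs.subspace_add[OF qrep_sub[OF rep] u w]] lin_on_add[OF l u w] x by simp
  fix Y assume "Y \<in> cst ` carrier PA"
  then obtain y where y: "Y = cst y" "y \<in> carrier PA" by blast
  show "snd (qmod U e t) u (X \<oplus>\<^bsub>QA\<^esub> Y) = snd (qmod U e t) u X + snd (qmod U e t) u Y"
    using act[OF u] x y by (simp add: QA_add xact_add)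
  show "snd (qmod U e t) u (X \<otimes>\<^bsub>QA\<^esub> Y) = snd (qmod U e t) (snd (qmod U e t) u X) Y"
    using act[OF u] act[OF lin_on_mem[OF l u]] x y by (simp add: QA_mult xact_pmul[OF rep x(2) y(2) u])
qed

lemma qmod_me:
  assumes rep: "qrep U e t" and rel: "\<And>r u. r \<in> R \<Longrightarrow> u \<in> U \<Longrightarrow> xact e t r u = 0" and u: "u \<in> U"
  shows "me (qmod U e t) v u = e v u" "a \<in> arcs Q \<Longrightarrow> mt (qmod U e t) a u = t a u"
  using qmod_act[OF rep rel u] xact_arrow[OF rep u, of a]
  by (simp_all add: me_def mt_def pact_def arrow_elem_def)

context
  fixes M assumes M: "right_module QA M"
begin

lemma act_lin: "x \<in> carrier PA \<Longrightarrow> lin_on (fst M) (\<lambda>u. snd M u (cst x))"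
  using M unfolding right_module_iff lin_on_def QA_carrier by blast

lemma act_mult: "x \<in> carrier PA \<Longrightarrow> y \<in> carrier PA \<Longrightarrow> u \<in> fst M \<Longrightarrow> snd M (snd M u (cst x)) (cst y) = snd M u (cst (pmul x y))"
proof -
  assume x: "x \<in> carrier PA" and y: "y \<in> carrier PA" and u: "u \<in> fst M"
  then have "snd M u (cst x \<otimes>\<^bsub>QA\<^esub> cst y) = snd M (snd M u (cst x)) (cst y)"
    using M unfolding right_module_iff QA_carrier by blast
  then show ?thesis using QA_mult[OF x y] by simp
qed

lemma act_add: "x \<in> carrier PA \<Longrightarrow> y \<in> carrier PA \<Longrightarrow> u \<in> fst M \<Longrightarrow> snd M u (cst (x + y)) = snd M u (cst x) + snd M u (cst y)"
proof -
  assume x: "x \<in> carrier PA" and y: "y \<in> carrier PA" and u: "u \<in> fst M"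
  then have "snd M u (cst x \<oplus>\<^bsub>QA\<^esub> cst y) = snd M u (cst x) + snd M u (cst y)"
    using M unfolding right_module_iff QA_carrier by blast
  then show ?thesis using QA_add by simp
qed

lemma act_scale: "x \<in> carrier PA \<Longrightarrow> u \<in> fst M \<Longrightarrow> snd M u (cst (scale c x)) = scale c (snd M u (cst x))"
proof -
  assume x: "x \<in> carrier PA" and u: "u \<in> fst M"
  then have "snd M u (c \<odot>\<^bsub>QA\<^esub> cst x) = scale c (snd M u (cst x))"
    using M unfolding right_module_iff QA_carrier by blast
  then show ?thesis using QA_smult by simp
qed

lemma act_one: "u \<in> fst M \<Longrightarrow> snd M u (cst \<one>\<^bsub>PA\<^esub>) = u"
  using M unfolding right_module_iff QA_one by blast

lemma act_0: "u \<in> fst M \<Longrightarrow> snd M u (cst 0) = 0"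
proof -
  have "scale 0 (0 :: 'v \<times> 'a list \<Rightarrow>\<^sub>0 'k) = 0" by (rule poly_mapping_eqI) simp
  then show "u \<in> fst M \<Longrightarrow> snd M u (cst 0) = 0" using act_scale[of 0 u 0] by (simp add: PA_simps)
qed

lemma act_sum: "u \<in> fst M \<Longrightarrow> (\<And>k. k \<in> K \<Longrightarrow> f k \<in> carrier PA) \<Longrightarrow> snd M u (cst (sum f K)) = (\<Sum>k\<in>K. snd M u (cst (f k)))"
proof (induction K rule: infinite_finite_induct)
  case (insert k K)
  have "sum f K \<in> carrier PA"
    using insert(2,5) keys_sum[of f K] by (fastforce simp: PA_simps)
  then show ?case using insert act_add by simp
qed (auto simp: act_0)

lemma qrep_me: "qrep (fst M) (me M) (mt M)"
  unfolding qrep_def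
proof (intro conjI ballI)
  show "kvs.subspace (fst M)" using M right_module_iff by blast
  have ve: "Poly_Mapping.single (v, []) (1::'k) \<in> carrier PA" if "v \<in> verts Q" for v using that by (simp add: PA_single QP_Nil)
  have at: "Poly_Mapping.single (tail Q a, [a]) (1::'k) \<in> carrier PA" if "a \<in> arcs Q" for a
    using that by (simp add: PA_single QP_Nil QP_Cons)
  show "lin_on (fst M) (me M v)" if "v \<in> verts Q" for v using act_lin[OF ve[OF that]] by (simp add: me_def[abs_def])
  show "lin_on (fst M) (mt M a)" if "a \<in> arcs Q" for a using act_lin[OF at[OF that]] by (simp add: mt_def[abs_def])
  fix u assume u: "u \<in> fst M"
  show "(\<Sum>v\<in>verts Q. me M v u) = u"
    using act_sum[OF u, of "verts Q" "\<lambda>v. Poly_Mapping.single (v, []) 1"] ve act_one[OF u] by (simp add: PA_simps(3) me_def)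
  show "me M w (me M v u) = (if w = v then me M v u else 0)" if "v \<in> verts Q" "w \<in> verts Q" for v w
    using act_mult[OF ve[OF that(1)] ve[OF that(2)] u] act_0[OF u] by (simp add: me_def pmul_single)
  show "mt M a (me M w u) = (if w = tail Q a then mt M a u else 0)" if "a \<in> arcs Q" "w \<in> verts Q" for a w
    using act_mult[OF ve[OF that(2)] at[OF that(1)] u] act_0[OF u] by (simp add: me_def mt_def pmul_single)
  show "me M w (mt M a u) = (if w = head Q a then mt M a u else 0)" if "a \<in> arcs Q" "w \<in> verts Q" for a w
    using act_mult[OF at[OF that(1)] ve[OF that(2)] u] act_0[OF u] by (simp add: me_def mt_def pmul_single)
qed

lemma act_path:
  assumes u: "u \<in> fst M" and p: "p \<in> QP"
  shows "snd M u (cst (Poly_Mapping.single p 1)) = pact (me M) (mt M) p u"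
proof -
  have "(v, q) \<in> QP \<Longrightarrow> snd M u (cst (Poly_Mapping.single (v, q) 1)) = pact (me M) (mt M) (v, q) u" for v q
  proof (induction q rule: rev_induct)
    case Nil then show ?case by (simp add: pact_def me_def)
  next
    case (snoc a q)
    then have q: "(v, q) \<in> QP" "a \<in> arcs Q" "tail Q a = tgt (v, q)" by (auto simp: QP_append QP_Cons)
    have "pmul (Poly_Mapping.single (v, q) 1) (Poly_Mapping.single (tail Q a, [a]) (1::'k)) = Poly_Mapping.single (v, q @ [a]) 1"
      using q(3) by (simp add: pmul_single)
    moreover have "Poly_Mapping.single (v, q) (1::'k) \<in> carrier PA" "Poly_Mapping.single (tail Q a, [a]) (1::'k) \<in> carrier PA"
      using q by (auto simp: PA_single QP_Cons QP_Nil)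
    ultimately have "snd M u (cst (Poly_Mapping.single (v, q @ [a]) 1)) = mt M a (snd M u (cst (Poly_Mapping.single (v, q) 1)))"
      using act_mult[of "Poly_Mapping.single (v, q) 1" "Poly_Mapping.single (tail Q a, [a]) 1" u] u by (simp add: mt_def)
    then show ?case using snoc.IH[OF q(1)] by (simp add: pact_def)
  qed
  then show ?thesis using p by (cases p) simp
qed

lemma act_xact:
  assumes u: "u \<in> fst M" and x: "x \<in> carrier PA"
  shows "snd M u (cst x) = xact (me M) (mt M) x u"
proof -
  have "Poly_Mapping.keys x \<subseteq> QP" using x by (simp add: PA_simps)
  then show ?thesis
  proof (induction x rule: poly_mapping_add_induct)
    case zero then show ?case using act_0[OF u] by simp
  next
    case (add p c x)
    have xc: "x \<in> carrier PA" "Poly_Mapping.single p c \<in> carrier PA" "Poly_Mapping.single p 1 \<in> carrier PA"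
      using add by (auto simp: PA_simps)
    have "snd M u (cst (Poly_Mapping.single p c)) = scale c (pact (me M) (mt M) p u)"
      using act_scale[OF xc(3) u, of c] act_path[OF u add(1)] by (simp add: scale_single)
    then show ?case using act_add[OF xc(2,1) u] add by (simp add: xact_add)
  qed
qed

lemma relation_act: "r \<in> R \<Longrightarrow> u \<in> fst M \<Longrightarrow> xact (me M) (mt M) r u = 0"
proof -
  assume r: "r \<in> R" and u: "u \<in> fst M"
  have "cst r = cst 0" using r R_J by (auto simp: cst_eq_iff)
  then show ?thesis using act_xact[OF u subsetD[OF R_carrier r]] act_0[OF u] by simp
qed

end

text \<open>Vertices and arrows generate the algebra, so commuting with their actions extends first
  to paths and then to linear combinations.\<close>

lemma hom_criterion:
  assumes M: "right_module QA M" and N: "right_module QA N"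
    and f: "\<And>u. u \<in> fst M \<Longrightarrow> f u \<in> fst N" "\<And>u w. u \<in> fst M \<Longrightarrow> w \<in> fst M \<Longrightarrow> f (u + w) = f u + f w"
      "\<And>c u. u \<in> fst M \<Longrightarrow> f (scale c u) = scale c (f u)"
    and fe: "\<And>v u. v \<in> verts Q \<Longrightarrow> u \<in> fst M \<Longrightarrow> f (me M v u) = me N v (f u)"
    and ft: "\<And>a u. a \<in> arcs Q \<Longrightarrow> u \<in> fst M \<Longrightarrow> f (mt M a u) = mt N a (f u)"
    and u: "u \<in> fst M" and X: "X \<in> carrier QA"
  shows "f (snd M u X) = snd N (f u) X"
proof -
  note rM = qrep_me[OF M] and rN = qrep_me[OF N]
  have sM: "kvs.subspace (fst M)" using qrep_sub[OF rM] .
  have f0: "f 0 = 0" using f(3)[OF kvs.subspace_0[OF sM], of 0] by simp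
  have fold: "f (fold (mt M) q w) = fold (mt N) q (f w)" if "set q \<subseteq> arcs Q" "w \<in> fst M" for q w
    using that
  proof (induction q arbitrary: w)
    case (Cons a q)
    then show ?case using ft[of a w] lin_on_mem[OF qrep_t[OF rM, of a], of w] by simp
  qed simp
  have path: "f (pact (me M) (mt M) p u) = pact (me N) (mt N) p (f u)" if p: "p \<in> QP" for p
  proof -
    have p': "set (snd p) \<subseteq> arcs Q" "fst p \<in> verts Q" using p by (auto simp: quiver_paths_def awalk_def)
    then show ?thesis using fold[OF p'(1) lin_on_mem[OF qrep_e[OF rM p'(2)] u]] fe[OF p'(2) u] by (simp add: pact_def)
  qed
  obtain x where x: "X = cst x" "x \<in> carrier PA" using X QA_carrier by blast
  have "Poly_Mapping.keys x \<subseteq> QP" using x by (simp add: PA_simps)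
  then have "f (xact (me M) (mt M) x u) = xact (me N) (mt N) x (f u)"
  proof (induction x rule: poly_mapping_add_induct)
    case (add p c x)
    have "x \<in> carrier PA" using add by (simp add: PA_simps)
    then have "xact (me M) (mt M) x u \<in> fst M" "pact (me M) (mt M) p u \<in> fst M"
      using lin_on_mem[OF xact_lin[OF rM] u] lin_on_mem[OF pact_lin[OF rM add(1)] u] by auto
    then show ?case using add f path[OF add(1)] kvs.subspace_scale[OF sM] by (simp add: xact_add)
  qed (simp add: f0)
  then show ?thesis using act_xact[OF M u x(2)] act_xact[OF N f(1)[OF u] x(2)] x(1) by simp
qed

lemma hom_me:
  assumes "\<And>u X. u \<in> fst M \<Longrightarrow> X \<in> carrier QA \<Longrightarrow> f (snd M u X) = snd N (f u) X" "u \<in> fst M"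
  shows "v \<in> verts Q \<Longrightarrow> f (me M v u) = me N v (f u)" "a \<in> arcs Q \<Longrightarrow> f (mt M a u) = mt N a (f u)"
  using assms by (auto simp: me_def mt_def QA_carrier PA_single QP_Nil QP_Cons)

text \<open>If finitely many paths span the quotient, their translates of finitely many generators
  span the module. Conversely a finite spanning set generates it, with scalar multiples of the unit
  as coefficients.\<close>

lemma fd_modules_QA:
  assumes K: "finite K" and span: "\<And>p. p \<in> QP \<Longrightarrow> \<exists>y. Poly_Mapping.keys y \<subseteq> K \<and> y \<in> carrier PA \<and> Poly_Mapping.single p 1 - y \<in> J"
  shows "fd_modules QA"
proof
  fix M assume M: "right_module QA M"
  have sub: "kvs.subspace (fst M)" using M right_module_iff by blast
  have red: "\<exists>y. Poly_Mapping.keys y \<subseteq> K \<and> y \<in> carrier PA \<and> x - y \<in> J" if "x \<in> carrier PA" for x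
  proof -
    have "Poly_Mapping.keys x \<subseteq> QP" using that by (simp add: PA_simps)
    then show ?thesis
    proof (induction x rule: poly_mapping_add_induct)
      case zero then show ?case using J_zero by (intro exI[of _ 0]) (simp add: PA_simps)
    next
      case (add p c x)
      obtain y where y: "Poly_Mapping.keys y \<subseteq> K" "y \<in> carrier PA" "x - y \<in> J" using add by blast
      obtain z where z: "Poly_Mapping.keys z \<subseteq> K" "z \<in> carrier PA" "Poly_Mapping.single p 1 - z \<in> J" using span[OF add(1)] by blast
      have "Poly_Mapping.single p c + x - (scale c z + y) = scale c (Poly_Mapping.single p 1 - z) + (x - y)"
        by (rule poly_mapping_eqI) (simp add: lookup_minus lookup_add lookup_single when_def algebra_simps)
      then have "Poly_Mapping.single p c + x - (scale c z + y) \<in> J" using J_add[OF J_scale[OF z(3)] y(3)] by metis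
      moreover have "Poly_Mapping.keys (scale c z + y) \<subseteq> K" using keys_add[of "scale c z" y] keys_scale[of c z] y z by blast
      ultimately show ?case using PA_add_closed[OF PA_scale_closed[OF z(2)] y(2)] by blast
    qed
  qed
  show "fin_gen QA M = fd_space (fst M)"
  proof
    assume "fin_gen QA M"
    then obtain B where B: "finite B" "B \<subseteq> fst M"
      and gen: "\<forall>u\<in>fst M. \<exists>a. (\<forall>b\<in>B. a b \<in> carrier QA) \<and> u = (\<Sum>b\<in>B. snd M b (a b))"
      by (cases M) (auto simp: fin_gen_def)
    let ?G = "(\<lambda>(p, b). pact (me M) (mt M) p b) ` (K \<times> B)"
    have "snd M b X \<in> kvs.span ?G" if b: "b \<in> B" and X: "X \<in> carrier QA" for b X
    proof -
      obtain x where x: "X = cst x" "x \<in> carrier PA" using X QA_carrier by blast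
      obtain y where y: "Poly_Mapping.keys y \<subseteq> K" "y \<in> carrier PA" "x - y \<in> J" using red[OF x(2)] by blast
      have "snd M b X = xact (me M) (mt M) y b"
        using act_xact[OF M _ y(2)] B b x(1) y(3) cst_eq_iff[of x y] by auto
      also have "\<dots> \<in> kvs.span ?G" unfolding xact_def
        using y(1) b by (intro kvs.span_sum kvs.span_scale kvs.span_base) auto
      finally show ?thesis .
    qed
    then have *: "(\<Sum>b\<in>B. snd M b (a b)) \<in> kvs.span ?G" if "\<forall>b\<in>B. a b \<in> carrier QA" for a
      using that by (intro kvs.span_sum) blast
    have "fst M \<subseteq> kvs.span ?G"
    proof
      fix u assume "u \<in> fst M"
      then obtain a where "\<forall>b\<in>B. a b \<in> carrier QA" "u = (\<Sum>b\<in>B. snd M b (a b))" using gen by meson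
      then show "u \<in> kvs.span ?G" using * by blast
    qed
    moreover have "fd_space (kvs.span ?G)" unfolding fd_space_def by (intro exI[of _ ?G]) (use K B in auto)
    ultimately show "fd_space (fst M)" using fd_space_sub sub by blast
  next
    assume "fd_space (fst M)"
    then obtain B where B: "finite B" "fst M = kvs.span B" by (auto simp: fd_space_def)
    then have BM: "B \<subseteq> fst M" using kvs.span_superset by blast
    have "\<exists>a. (\<forall>b\<in>B. a b \<in> carrier QA) \<and> u = (\<Sum>b\<in>B. snd M b (a b))" if "u \<in> fst M" for u
    proof -
      obtain c where c: "u = (\<Sum>b\<in>B. scale (c b) b)" using \<open>u \<in> fst M\<close> unfolding B(2) kvs.span_finite[OF B(1)] by blast
      have "snd M b (cst (scale (c b) \<one>\<^bsub>PA\<^esub>)) = scale (c b) b" if "b \<in> B" for b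
        using act_scale[OF M PA_one_closed, of b "c b"] act_one[OF M, of b] BM that by auto
      then have "u = (\<Sum>b\<in>B. snd M b (cst (scale (c b) \<one>\<^bsub>PA\<^esub>)))" using c by simp
      then show ?thesis using PA_scale_closed[OF PA_one_closed] QA_carrier by (intro exI[of _ "\<lambda>b. cst (scale (c b) \<one>\<^bsub>PA\<^esub>)"]) auto
    qed
    then show "fin_gen QA M" using B BM by (cases M) (auto simp: fin_gen_def)
  qed
qed

end

section \<open>Gentle and skew-gentle algebras\<close>

lemma successively_split:
  "\<not> successively P p \<longleftrightarrow> (\<exists>q a b r. p = q @ [a, b] @ r \<and> \<not> P a b)"
proof
  show "\<not> successively P p \<Longrightarrow> \<exists>q a b r. p = q @ [a, b] @ r \<and> \<not> P a b"
  proof (induction P p rule: successively.induct)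
    case (3 P x y xs)
    show ?case
    proof (cases "P x y")
      case True
      then obtain q a b r where "y # xs = q @ [a, b] @ r" "\<not> P a b" using 3 by auto
      then show ?thesis by (intro exI[of _ "x # q"]) auto
    next
      case False
      then show ?thesis by (intro exI[of _ "[]"]) auto
    qed
  qed auto
next
  assume "\<exists>q a b r. p = q @ [a, b] @ r \<and> \<not> P a b"
  then show "\<not> successively P p" by (auto simp: successively_append_iff)
qed

section \<open>Spanning paths of a finite-dimensional quotient\<close>

context quiver_quotient
begin

lemma abelian_group_QA: "abelian_group QA"
proof (rule abelian_groupI)
  have z: "cst 0 \<in> carrier QA" by (auto simp: QA_carrier PA_simps)
  show "\<zero>\<^bsub>QA\<^esub> \<in> carrier QA" using z QA_zero by simp
  fix X assume "X \<in> carrier QA"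
  then obtain x where x: "X = cst x" "x \<in> carrier PA" by (auto simp: QA_carrier)
  then have m: "- x \<in> carrier PA" by (simp add: PA_simps)
  show "\<zero>\<^bsub>QA\<^esub> \<oplus>\<^bsub>QA\<^esub> X = X" using x QA_add QA_zero by simp
  show "\<exists>Y\<in>carrier QA. Y \<oplus>\<^bsub>QA\<^esub> X = \<zero>\<^bsub>QA\<^esub>"
    by (rule bexI[of _ "cst (- x)"]) (use m in \<open>auto simp: x QA_add QA_zero QA_carrier\<close>)
  fix Y assume "Y \<in> carrier QA"
  then obtain y where y: "Y = cst y" "y \<in> carrier PA" by (auto simp: QA_carrier)
  show "X \<oplus>\<^bsub>QA\<^esub> Y \<in> carrier QA" "X \<oplus>\<^bsub>QA\<^esub> Y = Y \<oplus>\<^bsub>QA\<^esub> X"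
    using x y PA_add_closed by (auto simp: QA_add QA_carrier add.commute)
  fix Z assume "Z \<in> carrier QA"
  then obtain z where "Z = cst z" "z \<in> carrier PA" by (auto simp: QA_carrier)
  then show "X \<oplus>\<^bsub>QA\<^esub> Y \<oplus>\<^bsub>QA\<^esub> Z = X \<oplus>\<^bsub>QA\<^esub> (Y \<oplus>\<^bsub>QA\<^esub> Z)"
    using x y by (simp add: QA_add add.assoc)
qed

text \<open>The finitely many elements spanning the quotient have representatives with finite
  supports; \<open>K\<close> is the union of these.\<close>

lemma fd_algebra_support:
  assumes "fd_algebra QA"
  obtains K where "finite K" "\<And>x :: 'v \<times> 'a list \<Rightarrow>\<^sub>0 'k. x \<in> carrier PA \<Longrightarrow> \<exists>y. Poly_Mapping.keys y \<subseteq> K \<and> x - y \<in> J"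
proof -
  interpret abelian_group QA by (rule abelian_group_QA)
  obtain B where B: "finite B" "B \<subseteq> carrier QA" "carrier QA = {\<Oplus>\<^bsub>QA\<^esub>b\<in>B. c b \<odot>\<^bsub>QA\<^esub> b | c. True}"
    using assms unfolding fd_algebra_def by blast
  have "\<forall>b\<in>B. \<exists>x. x \<in> carrier PA \<and> b = cst x" using B(2) by (auto simp: QA_carrier)
  then obtain r where r: "\<forall>b\<in>B. r b \<in> carrier PA \<and> b = cst (r b)" by metis
  let ?K = "\<Union>b\<in>B. Poly_Mapping.keys (r b)"
  have c: "c b \<odot>\<^bsub>QA\<^esub> b = cst (scale (c b) (r b))" if "b \<in> B" for c b
    using r that QA_smult by metis
  have cc: "c b \<odot>\<^bsub>QA\<^esub> b \<in> carrier QA" if "b \<in> B" for c b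
    unfolding QA_carrier c[OF that] using r that PA_scale_closed by blast
  have fs: "\<exists>y. Poly_Mapping.keys y \<subseteq> ?K \<and> (\<Oplus>\<^bsub>QA\<^esub>b\<in>F. c b \<odot>\<^bsub>QA\<^esub> b) = cst y" if "finite F" "F \<subseteq> B" for F c
    using that
  proof (induction F rule: finite_induct)
    case empty then show ?case by (intro exI[of _ 0]) (simp add: QA_zero)
  next
    case (insert b F)
    then obtain y where y: "Poly_Mapping.keys y \<subseteq> ?K" "(\<Oplus>\<^bsub>QA\<^esub>b\<in>F. c b \<odot>\<^bsub>QA\<^esub> b) = cst y" by auto
    have "(\<Oplus>\<^bsub>QA\<^esub>b\<in>insert b F. c b \<odot>\<^bsub>QA\<^esub> b) = c b \<odot>\<^bsub>QA\<^esub> b \<oplus>\<^bsub>QA\<^esub> (\<Oplus>\<^bsub>QA\<^esub>b\<in>F. c b \<odot>\<^bsub>QA\<^esub> b)"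
      using insert cc by (intro finsum_insert) auto
    also have "\<dots> = cst (scale (c b) (r b) + y)" using y c[of b c] insert.prems QA_add by simp
    finally have "(\<Oplus>\<^bsub>QA\<^esub>b\<in>insert b F. c b \<odot>\<^bsub>QA\<^esub> b) = cst (scale (c b) (r b) + y)" .
    moreover have "Poly_Mapping.keys (scale (c b) (r b) + y) \<subseteq> ?K"
      using keys_add[of "scale (c b) (r b)" y] keys_scale[of "c b" "r b"] y(1) insert.prems by blast
    ultimately show ?case by blast
  qed
  show ?thesis
  proof (rule that[of ?K])
    show "finite ?K" using B(1) by simp
    fix x :: "'v \<times> 'a list \<Rightarrow>\<^sub>0 'k" assume "x \<in> carrier PA"
    then have "cst x \<in> carrier QA" by (simp add: QA_carrier)
    then obtain c where "cst x = (\<Oplus>\<^bsub>QA\<^esub>b\<in>B. c b \<odot>\<^bsub>QA\<^esub> b)" unfolding B(3) by blast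
    then obtain y where "Poly_Mapping.keys y \<subseteq> ?K" "cst x = cst y" using fs[OF B(1) subset_refl, of c] by auto
    then show "\<exists>y. Poly_Mapping.keys y \<subseteq> ?K \<and> x - y \<in> J" by (auto simp: cst_eq_iff)
  qed
qed

lemma path_factor_in_J:
  assumes p: "(v, q @ [a, b] @ r) \<in> QP" and x: "x \<in> J"
  shows "pmul (pmul (Poly_Mapping.single (v, q) 1) x) (Poly_Mapping.single (head Q b, r) 1) \<in> J"
proof -
  have "Poly_Mapping.single (v, q) (1::'k) \<in> carrier PA" "Poly_Mapping.single (head Q b, r) (1::'k) \<in> carrier PA"
    using p by (auto simp: PA_single QP_append QP_Cons)
  then show ?thesis using J_mult x by blast
qed

lemma path_factor:
  assumes p: "(v, q @ [a, b] @ r) \<in> QP"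
  shows "pmul (pmul (Poly_Mapping.single (v, q) 1) (path2_elem Q (a, b))) (Poly_Mapping.single (head Q b, r) 1) =
    (Poly_Mapping.single (v, q @ [a, b] @ r) 1 :: _ \<Rightarrow>\<^sub>0 'k)"
  using p tgt_append[of v q "[a, b]"] awalk_verts_ne
  by (auto simp: path2_elem_def pmul_single QP_append QP_Cons)

lemma paths_with_relation_in_J:
  assumes "path2_elem Q (a, b) \<in> J" "(v, q @ [a, b] @ r) \<in> QP"
  shows "(Poly_Mapping.single (v, q @ [a, b] @ r) 1 :: _ \<Rightarrow>\<^sub>0 'k) \<in> J"
  using path_factor_in_J[OF assms(2,1)] path_factor[OF assms(2)] by simp

end

context quiver
begin

text \<open>The ideal is monomial: combinations of paths containing a relation form an ideal around
  it. Hence a relation-free path cannot be reduced modulo the ideal to a combination of other paths,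
  and must belong to the finite support \<open>K\<close>.\<close>

lemma finite_good_paths:
  fixes ty :: "'k::field itself"
  assumes rel: "rel \<subseteq> paths2 Q"
    and fd: "fd_algebra (quotient_algebra (path_algebra Q) (genideal (path_algebra Q) (path2_elem Q ` rel)) :: ('k, ('v \<times> 'a list \<Rightarrow>\<^sub>0 'k) set) module)"
  shows "finite {p \<in> QP. successively (\<lambda>a b. (a, b) \<notin> rel) (snd p)}"
proof -
  let ?R = "path2_elem Q ` rel :: ('v \<times> 'a list \<Rightarrow>\<^sub>0 'k) set"
  interpret quiver_quotient Q ?R
    by unfold_locales (use rel path2_elem_carrier in blast)
  let ?good = "\<lambda>p :: 'a list. successively (\<lambda>a b. (a, b) \<notin> rel) p"
  let ?I = "{x \<in> carrier PA. \<forall>p\<in>Poly_Mapping.keys x. \<not> ?good (snd p)} :: ('v \<times> 'a list \<Rightarrow>\<^sub>0 'k) set"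
  have "ideal ?I PA"
  proof (rule idealI[OF ring_PA])
    interpret ring "PA :: ('k, 'v \<times> 'a list \<Rightarrow>\<^sub>0 'k) module" by (rule ring_PA)
    show "subgroup ?I (add_monoid PA)"
    proof (rule add.subgroupI)
      show "?I \<noteq> {}" by (auto simp: PA_simps intro!: exI[of _ 0])
    next
      fix x assume x: "x \<in> ?I"
      then have "\<ominus>\<^bsub>PA\<^esub> x = - x" by (intro minus_equality) (auto simp: PA_simps)
      then show "\<ominus>\<^bsub>PA\<^esub> x \<in> ?I" using x by (auto simp: PA_simps)
    next
      fix x y assume "x \<in> ?I" "y \<in> ?I"
      then show "x \<oplus>\<^bsub>PA\<^esub> y \<in> ?I" using PA_add_closed[of x y] keys_add[of x y] by (auto simp: PA_simps(5))
    qed auto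
  next
    fix a x :: "'v \<times> 'a list \<Rightarrow>\<^sub>0 'k" assume a: "a \<in> ?I" and x: "x \<in> carrier PA"
    have "\<not> ?good (snd p)" if "p \<in> Poly_Mapping.keys (pmul x a)" for p
      using subsetD[OF keys_pmul that] a by (auto simp: successively_append_iff)
    then show "x \<otimes>\<^bsub>PA\<^esub> a \<in> ?I" using a x pmul_carrier by (auto simp: PA_simps(2))
    have "\<not> ?good (snd p)" if "p \<in> Poly_Mapping.keys (pmul a x)" for p
      using subsetD[OF keys_pmul that] a by (auto simp: successively_append_iff)
    then show "a \<otimes>\<^bsub>PA\<^esub> x \<in> ?I" using a x pmul_carrier by (auto simp: PA_simps(2))
  qed
  moreover have "?R \<subseteq> ?I" using rel path2_elem_carrier by (auto simp: path2_elem_def split: if_splits)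
  ultimately have JI: "J \<subseteq> ?I" by (rule ring.genideal_minimal[OF ring_PA])
  obtain K where K: "finite K" "\<And>x :: 'v \<times> 'a list \<Rightarrow>\<^sub>0 'k. x \<in> carrier PA \<Longrightarrow> \<exists>y. Poly_Mapping.keys y \<subseteq> K \<and> x - y \<in> J"
    using fd_algebra_support[OF fd] by metis
  have "p \<in> K" if p: "p \<in> QP" "?good (snd p)" for p
  proof (rule ccontr)
    assume pK: "p \<notin> K"
    obtain y where y: "Poly_Mapping.keys y \<subseteq> K" "Poly_Mapping.single p 1 - y \<in> J" using K(2)[of "Poly_Mapping.single p 1"] p by (auto simp: PA_single)
    have "Poly_Mapping.lookup y p = 0" using y(1) pK by (auto simp: in_keys_iff)
    \<comment> \<open>As \<open>p\<close> is not in \<open>K\<close>, its coefficient in the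
      difference is 1.\<close>
    then have "p \<in> Poly_Mapping.keys (Poly_Mapping.single p 1 - y)" by (simp add: in_keys_iff lookup_minus)
    then show False using y(2) JI p(2) by blast
  qed
  then have "{p \<in> QP. ?good (snd p)} \<subseteq> K" by blast
  then show ?thesis using K(1) by (rule finite_subset)
qed

end

section \<open>The two algebras and their spanning paths\<close>

locale skew_gentle =
  fixes Q :: "('v, 'a) pre_digraph" and I :: "('a \<times> 'a) set" and Sp :: "'v set" and ty :: "'k::field itself"
  assumes triple: "skew_gentle_triple TYPE('k) Q I Sp" and two: "(2::'k) \<noteq> 0"
begin

abbreviation "QB \<equiv> add_loops Q Sp"
abbreviation "QG \<equiv> signed_quiver Q Sp"
abbreviation "sv \<equiv> sign_vertex Sp"

definition RB :: "('v \<times> ('a + 'v) list \<Rightarrow>\<^sub>0 'k) set" where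
  "RB = path2_elem QB ` (\<lambda>(a, b). (Inl a, Inl b)) ` I \<union>
          (\<lambda>i. path2_elem QB (Inr i, Inr i) - arrow_elem QB (Inr i)) ` Sp"

definition RG :: "('v signed_vertex \<times> ('a \<times> sign) list \<Rightarrow>\<^sub>0 'k) set" where
  "RG = path2_elem QG ` {((a, s), (b, s)) | a b s. (a, b) \<in> I}"

lemma QB_simps [simp]: "verts QB = verts Q" "arcs QB = Inl ` arcs Q \<union> Inr ` Sp"
  "tail QB (Inl a) = tail Q a" "tail QB (Inr i) = i" "head QB (Inl a) = head Q a" "head QB (Inr i) = i"
  by (auto simp: add_loops_def)

lemma QG_simps [simp]: "verts QG = {sv i s | i s. i \<in> verts Q}" "arcs QG = arcs Q \<times> UNIV"
  "tail QG (a, s) = sv (tail Q a) s" "head QG (a, s) = sv (head Q a) s"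
  by (auto simp: signed_quiver_def)

lemma Q_fin: "fin_digraph Q" and I_paths: "I \<subseteq> paths2 Q" and Sp_verts: "Sp \<subseteq> verts Q"
  using triple by (auto simp: skew_gentle_triple_def)

lemma finite_signs: "finite (UNIV :: sign set)"
proof -
  have "UNIV = {Plus, Minus}" using sign.exhaust by auto
  then show ?thesis by (metis finite.emptyI finite_insert)
qed

sublocale Q0: fin_digraph Q by (rule Q_fin)

lemma finite_Sp: "finite Sp" using Sp_verts Q0.finite_verts finite_subset by blast

lemma sv_eq_iff: "sv i s = sv j s' \<longleftrightarrow> i = j \<and> (s = s' \<or> i \<in> Sp)"
  by (auto simp: sign_vertex_def)

lemma quiver_QB: "quiver QB"
  by unfold_locales (use Sp_verts finite_Sp in auto)

lemma quiver_QG: "quiver QG"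
proof unfold_locales
  have "verts QG = (\<lambda>(i, s). sv i s) ` (verts Q \<times> UNIV)" by auto
  then show "finite (verts QG)" using finite_signs by simp
  show "finite (arcs QG)" using finite_signs by simp
  fix e assume "e \<in> arcs QG"
  then show "tail QG e \<in> verts QG" "head QG e \<in> verts QG"
    using Q0.tail_in_verts Q0.head_in_verts by (cases e; auto)+
qed

lemma I_D: "(a, b) \<in> I \<Longrightarrow> a \<in> arcs Q \<and> b \<in> arcs Q \<and> head Q a = tail Q b"
  using I_paths by (auto simp: paths2_def)

sublocale B: quiver_quotient QB RB
proof -
  interpret quiver QB by (rule quiver_QB)
  show "quiver_quotient QB RB"
  proof
    have "path2_elem QB (Inl a, Inl b) \<in> carrier (path_algebra QB)" if "(a, b) \<in> I" for a b
      by (rule path2_elem_carrier) (use I_D[OF that] in \<open>auto simp: paths2_def\<close>)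
    moreover have "path2_elem QB (Inr i, Inr i) - arrow_elem QB (Inr i) \<in> carrier (path_algebra QB)" if "i \<in> Sp" for i
      by (rule PA_diff_closed[OF path2_elem_carrier arrow_elem_carrier]) (use that in \<open>auto simp: paths2_def\<close>)
    ultimately show "RB \<subseteq> carrier (path_algebra QB)" unfolding RB_def by auto
  qed
qed

sublocale G: quiver_quotient QG RG
proof -
  interpret quiver QG by (rule quiver_QG)
  show "quiver_quotient QG RG"
  proof
    have "path2_elem QG ((a, s), (b, s)) \<in> carrier (path_algebra QG)" if "(a, b) \<in> I" for a b s
      by (rule path2_elem_carrier) (use I_D[OF that] in \<open>auto simp: paths2_def\<close>)
    then show "RG \<subseteq> carrier (path_algebra QG)" unfolding RG_def by blast
  qed
qed

lemma algebras: "skew_gentle_algebra Q I Sp = B.QA" "associated_gentle_algebra Q I Sp = G.QA"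
  by (simp_all add: skew_gentle_algebra_def associated_gentle_algebra_def RB_def RG_def)

text \<open>The monomial relations of the gentle algebra on the quiver with loops. They are also the
  leading terms of the skew-gentle relations, in which \<epsilon>\<epsilon> = 0 is replaced by
  \<epsilon>\<epsilon> = \<epsilon>, so the same relation-free paths span both.\<close>

definition rel :: "(('a + 'v) \<times> ('a + 'v)) set" where
  "rel = (\<lambda>(a, b). (Inl a, Inl b)) ` I \<union> (\<lambda>i. (Inr i, Inr i)) ` Sp"

abbreviation "good \<equiv> successively (\<lambda>a b. (a, b) \<notin> rel)"

lemma rel_iff [simp]: "(Inl a, Inl b) \<in> rel \<longleftrightarrow> (a, b) \<in> I" "(Inr i, Inr j) \<in> rel \<longleftrightarrow> i = j \<and> i \<in> Sp"
  "(Inl a, Inr i) \<notin> rel" "(Inr i, Inl a) \<notin> rel"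
  by (auto simp: rel_def)

lemma finite_good: "finite {p \<in> B.QP. good (snd p)}"
proof (rule B.finite_good_paths)
  show "rel \<subseteq> paths2 QB" using I_D by (auto simp: rel_def paths2_def)
  show "fd_algebra (quotient_algebra (path_algebra QB) (genideal (path_algebra QB) (path2_elem QB ` rel)) :: ('k, ('v \<times> ('a + 'v) list \<Rightarrow>\<^sub>0 'k) set) module)"
    using triple unfolding skew_gentle_triple_def gentle_def rel_def by (elim conjE)
qed

text \<open>Rewriting: a factor from \<open>I\<close> makes a path zero, and a repeated loop can be
  shortened, so induction on the length reaches relation-free paths. Only spanning is needed
  here.\<close>

lemma fd_B: "fd_modules B.QA"
proof (rule B.fd_modules_QA[OF finite_good])
  have "(v, q) \<in> B.QP \<Longrightarrow> \<exists>y. Poly_Mapping.keys y \<subseteq> {p \<in> B.QP. good (snd p)} \<and> y \<in> carrier B.PA \<and> (Poly_Mapping.single (v, q) 1 :: _ \<Rightarrow>\<^sub>0 'k) - y \<in> B.J" for v q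
  proof (induction "length q" arbitrary: q rule: less_induct)
    case less
    show ?case
    proof (cases "good q")
      case True
      then show ?thesis using less.prems B.J_zero by (intro exI[of _ "Poly_Mapping.single (v, q) 1"]) (auto simp: B.PA_simps)
    next
      case False
      then have "\<exists>q1 a b q2. q = q1 @ [a, b] @ q2 \<and> \<not> (a, b) \<notin> rel" unfolding successively_split .
      then obtain q1 a b q2 where q: "q = q1 @ [a, b] @ q2" "(a, b) \<in> rel" by (elim exE conjE) simp
      consider a' b' where "a = Inl a'" "b = Inl b'" "(a', b') \<in> I" | i where "a = Inr i" "b = Inr i" "i \<in> Sp"
        using q(2) by (auto simp: rel_def)
      then show ?thesis
      proof cases
        case 1
        then have "path2_elem QB (a, b) \<in> RB" by (auto simp: RB_def)
        then have "path2_elem QB (a, b) \<in> B.J" using B.R_J by blast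
        then have "(Poly_Mapping.single (v, q) 1 :: _ \<Rightarrow>\<^sub>0 'k) \<in> B.J" using B.paths_with_relation_in_J less.prems unfolding q(1) by blast
        then show ?thesis by (intro exI[of _ 0]) (simp add: B.PA_simps)
      next
        case 2
        have p: "(v, q1 @ [a, b] @ q2) \<in> B.QP" using less.prems q by simp
        have p': "(v, q1 @ [a] @ q2) \<in> B.QP" using p 2 by (auto simp: B.QP_append B.QP_Cons)
        have t: "last (pre_digraph.awalk_verts QB v q1) = i" using p 2 by (auto simp: B.QP_append B.QP_Cons)
        obtain y where y: "Poly_Mapping.keys y \<subseteq> {p \<in> B.QP. good (snd p)}" "y \<in> carrier B.PA"
            "(Poly_Mapping.single (v, q1 @ [a] @ q2) 1 :: _ \<Rightarrow>\<^sub>0 'k) - y \<in> B.J"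
          using less.hyps[OF _ p'] q(1) by auto
        \<comment> \<open>Multiplied by the rest of the path on both sides, this says that the path
          equals a shorter one modulo the ideal.\<close>
        have "path2_elem QB (a, b) - arrow_elem QB a \<in> B.J" using 2 B.R_J by (auto simp: RB_def)
        then have j: "B.pmul (B.pmul (Poly_Mapping.single (v, q1) 1) (path2_elem QB (a, b) - arrow_elem QB a)) (Poly_Mapping.single (head QB b, q2) (1::'k)) \<in> B.J"
          using B.path_factor_in_J[OF p] by blast
        have d: "B.pmul (B.pmul x (r - s)) z = B.pmul (B.pmul x r) z - B.pmul (B.pmul x s) z" for x r s z :: "'v \<times> ('a + 'v) list \<Rightarrow>\<^sub>0 'k"
          using B.pmul_add_right[of x "r - s" s] B.pmul_add_left[of "B.pmul x (r - s)" "B.pmul x s" z] by simp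
        have "B.pmul (B.pmul (Poly_Mapping.single (v, q1) 1) (arrow_elem QB a)) (Poly_Mapping.single (head QB b, q2) 1) =
            (Poly_Mapping.single (v, q1 @ [a] @ q2) 1 :: _ \<Rightarrow>\<^sub>0 'k)"
          using t 2 B.tgt_append[of v q1 "[a]"] by (simp add: arrow_elem_def B.pmul_single)
        then have "(Poly_Mapping.single (v, q) 1 :: _ \<Rightarrow>\<^sub>0 'k) - Poly_Mapping.single (v, q1 @ [a] @ q2) 1 \<in> B.J"
          using j B.path_factor[OF p] q(1) unfolding d by simp
        then have "(Poly_Mapping.single (v, q) 1 :: _ \<Rightarrow>\<^sub>0 'k) - y \<in> B.J" using B.J_add[OF _ y(3)] by fastforce
        then show ?thesis using y by blast
      qed
    qed
  qed
  then show "\<exists>y. Poly_Mapping.keys y \<subseteq> {p \<in> B.QP. good (snd p)} \<and> y \<in> carrier B.PA \<and> (Poly_Mapping.single p 1 :: _ \<Rightarrow>\<^sub>0 'k) - y \<in> B.J" if "p \<in> B.QP" for p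
    using that by (cases p) blast
qed

text \<open>A path of the signed quiver is turned into a path through the special loops: a loop
  records each change of sign.\<close>

fun unsign :: "('a \<times> sign) list \<Rightarrow> ('a + 'v) list" where
  "unsign [] = []"
| "unsign [(a, s)] = [Inl a]"
| "unsign ((a, s) # (b, s') # p) = (if s = s' then [Inl a] else [Inl a, Inr (head Q a)]) @ unsign ((b, s') # p)"

definition grel :: "(('a \<times> sign) \<times> ('a \<times> sign)) set" where
  "grel = {((a, s), (b, s)) | a b s. (a, b) \<in> I}"

lemma length_unsign: "length p \<le> length (unsign p)"
  by (induction p rule: unsign.induct) auto

lemma unsign_hd: "unsign ((a, s) # p) = Inl a # tl (unsign ((a, s) # p))"
  by (cases p) auto

text \<open>The sign can change only at a special vertex, where a loop is available, and no relation
  involves both an arrow and a loop. Consecutive arrows of the image therefore have equal signs in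
  the source, where \<open>I\<close> is avoided.\<close>

lemma unsign_path:
  "(w, (a, s) # p) \<in> G.QP \<Longrightarrow> successively (\<lambda>a b. (a, b) \<notin> grel) ((a, s) # p) \<Longrightarrow>
    (tail Q a, unsign ((a, s) # p)) \<in> B.QP \<and> good (unsign ((a, s) # p))"
proof (induction p arbitrary: w a s)
  case Nil
  then show ?case by (auto simp: G.QP_Cons B.QP_Cons B.QP_Nil)
next
  case (Cons b' p)
  obtain b s' where b: "b' = (b, s')" by (cases b')
  have a: "a \<in> arcs Q" and w: "(sv (head Q a) s, (b, s') # p) \<in> G.QP" using Cons.prems(1) by (auto simp: G.QP_Cons b)
  have h: "sv (tail Q b) s' = sv (head Q a) s" using w by (auto simp: G.QP_Cons)
  then have hb: "tail Q b = head Q a" "s = s' \<or> head Q a \<in> Sp" by (auto simp: sv_eq_iff)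
  have ih: "(tail Q b, unsign ((b, s') # p)) \<in> B.QP" "good (unsign ((b, s') # p))"
    using Cons.IH[OF w] Cons.prems(2) b by auto
  have I: "s = s' \<Longrightarrow> (a, b) \<notin> I" using Cons.prems(2) by (auto simp: b grel_def)
  obtain r where r: "unsign ((b, s') # p) = Inl b # r" using unsign_hd by blast
  show ?case using ih a hb I unfolding b unsign.simps r by (auto simp: B.QP_Cons)
qed

text \<open>Through \<open>unsign\<close> the lengths of relation-free signed paths are bounded by
  those of the finitely many relation-free paths with loops; a finite quiver has finitely many paths
  of bounded length.\<close>

lemma fd_G: "fd_modules G.QA"
proof -
  let ?gd = "\<lambda>p. successively (\<lambda>a b. (a, b) \<notin> grel) p"
  obtain n where n: "\<And>p. p \<in> B.QP \<Longrightarrow> good (snd p) \<Longrightarrow> length (snd p) \<le> n"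
  proof -
    have "finite ((length \<circ> snd) ` {p \<in> B.QP. good (snd p)})" using finite_good by blast
    then obtain n where "\<forall>k\<in>(length \<circ> snd) ` {p \<in> B.QP. good (snd p)}. k \<le> n" using finite_nat_set_iff_bounded_le by blast
    then have "\<And>p. p \<in> B.QP \<Longrightarrow> good (snd p) \<Longrightarrow> length (snd p) \<le> n" by auto
    then show ?thesis by (rule that)
  qed
  have "{p \<in> G.QP. ?gd (snd p)} \<subseteq> {p \<in> G.QP. length (snd p) \<le> n}"
  proof
    fix p assume p: "p \<in> {p \<in> G.QP. ?gd (snd p)}"
    obtain v q where vq: "p = (v, q)" by (cases p)
    have "length q \<le> n"
    proof (cases q)
      case (Cons x r)
      obtain a s where x: "x = (a, s)" by (cases x)
      have "length (unsign q) \<le> n"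
        using unsign_path[of v a s r] p n[of "(tail Q a, unsign q)"] by (simp add: vq Cons x)
      then show ?thesis using length_unsign[of q] by linarith
    qed simp
    then show "p \<in> {p \<in> G.QP. length (snd p) \<le> n}" using p vq by simp
  qed
  then have fin: "finite {p \<in> G.QP. ?gd (snd p)}" using G.finite_short_paths finite_subset by blast
  show ?thesis
  proof (rule G.fd_modules_QA[OF fin])
    fix p assume p: "p \<in> G.QP"
    show "\<exists>y. Poly_Mapping.keys y \<subseteq> {p \<in> G.QP. ?gd (snd p)} \<and> y \<in> carrier G.PA \<and> (Poly_Mapping.single p 1 :: _ \<Rightarrow>\<^sub>0 'k) - y \<in> G.J"
    proof (cases "?gd (snd p)")
      case True
      then show ?thesis using p G.J_zero by (intro exI[of _ "Poly_Mapping.single p 1"]) (auto simp: G.PA_simps)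
    next
      case False
      then have "\<exists>q a b r. snd p = q @ [a, b] @ r \<and> \<not> (a, b) \<notin> grel" unfolding successively_split .
      then obtain q a b r where q: "snd p = q @ [a, b] @ r" "(a, b) \<in> grel" by (elim exE conjE) simp
      have "path2_elem QG (a, b) \<in> RG" using q(2) unfolding RG_def grel_def by (rule imageI)
      then have "path2_elem QG (a, b) \<in> G.J" using G.R_J by blast
      then have "(Poly_Mapping.single p 1 :: _ \<Rightarrow>\<^sub>0 'k) \<in> G.J"
        using G.paths_with_relation_in_J[of a b "fst p" q r] p unfolding q(1)[symmetric] by simp
      then show ?thesis by (intro exI[of _ 0]) (simp add: G.PA_simps)
    qed
  qed
qed

end

section \<open>Passing between the two algebras\<close>

lemma half_double: "(2::'k::field) \<noteq> 0 \<Longrightarrow> scale (1/2) (x + x) = (x :: 'k vec)"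
proof -
  assume "(2::'k) \<noteq> 0"
  then have "(1/2 + 1/2 :: 'k) = 1" by simp
  then have "scale (1/2 + 1/2) x = x" by simp
  then show ?thesis by (simp only: kvs.scale_left_distrib kvs.scale_right_distrib)
qed

type_synonym ('k, 'v, 'a) gentle_mod = "('k, ('v signed_vertex \<times> ('a \<times> sign) list \<Rightarrow>\<^sub>0 'k) set) rmod"
type_synonym ('k, 'v, 'a) skew_mod = "('k, ('v \<times> ('a + 'v) list \<Rightarrow>\<^sub>0 'k) set) rmod"

text \<open>A vector \<open>z\<close> also encodes the pair \<open>(sp Plus z, sp Minus z)\<close>.\<close>

definition sg :: "(sign \<Rightarrow> 'k::field vec) \<Rightarrow> 'k vec" where
  "sg f = pr (f Plus) (f Minus)"

definition sp :: "sign \<Rightarrow> 'k::field vec \<Rightarrow> 'k vec" where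
  "sp s z = (case s of Plus \<Rightarrow> pr1 z | Minus \<Rightarrow> pr2 z)"

fun opp :: "sign \<Rightarrow> sign" where
  "opp Plus = Minus" | "opp Minus = Plus"

lemma opp_simps [simp]: "opp (opp s) = s" "opp s \<noteq> s" "s \<noteq> opp s"
  by (cases s; simp)+

lemma not_eq_opp: "s' \<noteq> s \<longleftrightarrow> s' = opp s" by (cases s; cases s'; simp)

lemma sp_sg [simp]: "sp s (sg f) = f s"
  by (cases s) (simp_all add: sp_def sg_def)

lemma sg_eqI: "(\<And>s. sp s z = sp s z') \<Longrightarrow> z = z'"
  using pr_simps(3)[of z] pr_simps(3)[of z'] by (metis sign.simps(3,4) sp_def)

lemma sp_lin: "sp s (x + y) = sp s x + sp s y" "sp s (scale c x) = scale c (sp s x)" "sp s 0 = 0"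
  by (cases s; simp add: sp_def pr12_add pr12_scale)+

lemma sp_diff: "sp s (x - y) = sp s x - sp s y"
  using sp_lin(1)[of s "x - y" y] by simp

lemma sp_sum: "sp s (sum f K) = (\<Sum>k\<in>K. sp s (f k))"
  by (induction K rule: infinite_finite_induct) (auto simp: sp_lin)

lemma fd_signed:
  assumes "fd_space U" "kvs.subspace V" "\<And>z s. z \<in> V \<Longrightarrow> sp s z \<in> U"
  shows "fd_space V"
  by (rule fd_space_sub[OF fd_space_prodset[OF assms(1,1)] assms(2)])
    (use assms(3)[of _ Plus] assms(3)[of _ Minus] in \<open>auto simp: prodset_iff sp_def\<close>)

definition dbl :: "('k::field vec \<Rightarrow> 'k vec) \<Rightarrow> 'k vec \<Rightarrow> 'k vec" where
  "dbl f z = sg (\<lambda>s. f (sp s z))"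

lemma sp_dbl [simp]: "sp s (dbl f z) = f (sp s z)" by (simp add: dbl_def)

lemma lin_on_sum_fun:
  assumes "kvs.subspace U" "\<And>k. k \<in> K \<Longrightarrow> lin_on U (f k)" shows "lin_on U (\<lambda>u. \<Sum>k\<in>K. f k u)"
  using assms(2) unfolding lin_on_def
  by (auto intro!: kvs.subspace_sum[OF assms(1)] sum.cong simp: sum.distrib[symmetric] kvs.scale_sum_right)

lemma lin_on_diff_fun:
  assumes "kvs.subspace U" "lin_on U f" "lin_on U g" shows "lin_on U (\<lambda>u. f u - scale c (g u))"
  using assms kvs.subspace_diff[OF assms(1)] kvs.subspace_scale[OF assms(1)]
  unfolding lin_on_def by (auto simp: scale_add scale_diff mult.commute)

section \<open>Vertex components of modules over the two algebras\<close>

context skew_gentle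
begin

lemma SpV: "i \<in> Sp \<Longrightarrow> i \<in> verts Q" using Sp_verts by blast

sublocale FB: fd_modules B.QA by (rule fd_B)
sublocale FG: fd_modules G.QA by (rule fd_G)

lemma MO_right: "N \<in> FB.MO \<Longrightarrow> right_module B.QA N" "M \<in> FG.MO \<Longrightarrow> right_module G.QA M"
  by (simp_all add: FB.MO_iff FG.MO_iff)

lemma B_homI:
  assumes N: "N \<in> FB.MO" "N' \<in> FB.MO"
    and f: "\<And>u. u \<in> fst N \<Longrightarrow> f u \<in> fst N'" "\<And>u w. u \<in> fst N \<Longrightarrow> w \<in> fst N \<Longrightarrow> f (u + w) = f u + f w"
      "\<And>c u. u \<in> fst N \<Longrightarrow> f (scale c u) = scale c (f u)"
    and e: "\<And>i u. i \<in> verts Q \<Longrightarrow> u \<in> fst N \<Longrightarrow> f (B.me N i u) = B.me N' i (f u)"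
    and t: "\<And>a u. a \<in> arcs Q \<Longrightarrow> u \<in> fst N \<Longrightarrow> f (B.mt N (Inl a) u) = B.mt N' (Inl a) (f u)"
    and ep: "\<And>i u. i \<in> Sp \<Longrightarrow> u \<in> fst N \<Longrightarrow> f (B.mt N (Inr i) u) = B.mt N' (Inr i) (f u)"
  shows "(\<lambda>u\<in>fst N. f u) \<in> FB.MH N N'"
proof (rule FB.MH_restrict[OF f _ N(1)])
  fix x X assume x: "x \<in> fst N" and X: "X \<in> carrier B.QA"
  show "f (snd N x X) = snd N' (f x) X"
    by (rule B.hom_criterion[OF MO_right(1)[OF N(1)] MO_right(1)[OF N(2)] f _ _ x X]) (use e t ep in auto)
qed

lemma G_homI:
  assumes N: "N \<in> FG.MO" "N' \<in> FG.MO"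
    and f: "\<And>u. u \<in> fst N \<Longrightarrow> f u \<in> fst N'" "\<And>u w. u \<in> fst N \<Longrightarrow> w \<in> fst N \<Longrightarrow> f (u + w) = f u + f w"
      "\<And>c u. u \<in> fst N \<Longrightarrow> f (scale c u) = scale c (f u)"
    and e: "\<And>i s u. i \<in> verts Q \<Longrightarrow> u \<in> fst N \<Longrightarrow> f (G.me N (sv i s) u) = G.me N' (sv i s) (f u)"
    and t: "\<And>a s u. a \<in> arcs Q \<Longrightarrow> u \<in> fst N \<Longrightarrow> f (G.mt N (a, s) u) = G.mt N' (a, s) (f u)"
  shows "(\<lambda>u\<in>fst N. f u) \<in> FG.MH N N'"
proof (rule FG.MH_restrict[OF f _ N(1)])
  fix x X assume x: "x \<in> fst N" and X: "X \<in> carrier G.QA"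
  show "f (snd N x X) = snd N' (f x) X"
    by (rule G.hom_criterion[OF MO_right(2)[OF N(1)] MO_right(2)[OF N(2)] f _ _ x X]) (use e t in auto)
qed

lemma B_homD:
  assumes "f \<in> FB.MH N N'" "u \<in> fst N"
  shows "i \<in> verts Q \<Longrightarrow> f (B.me N i u) = B.me N' i (f u)"
    "a \<in> arcs Q \<Longrightarrow> f (B.mt N (Inl a) u) = B.mt N' (Inl a) (f u)"
    "i \<in> Sp \<Longrightarrow> f (B.mt N (Inr i) u) = B.mt N' (Inr i) (f u)"
proof -
  have "\<And>u X. u \<in> fst N \<Longrightarrow> X \<in> carrier B.QA \<Longrightarrow> f (snd N u X) = snd N' (f u) X" using assms(1) by (simp add: FB.MH_iff)
  note h = B.hom_me[of N f N', OF this assms(2)]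
  show "i \<in> verts Q \<Longrightarrow> f (B.me N i u) = B.me N' i (f u)"
    "a \<in> arcs Q \<Longrightarrow> f (B.mt N (Inl a) u) = B.mt N' (Inl a) (f u)"
    "i \<in> Sp \<Longrightarrow> f (B.mt N (Inr i) u) = B.mt N' (Inr i) (f u)"
    using h by auto
qed

lemma G_homD:
  assumes "f \<in> FG.MH N N'" "u \<in> fst N"
  shows "i \<in> verts Q \<Longrightarrow> f (G.me N (sv i s) u) = G.me N' (sv i s) (f u)"
    "a \<in> arcs Q \<Longrightarrow> f (G.mt N (a, s) u) = G.mt N' (a, s) (f u)"
proof -
  have "\<And>u X. u \<in> fst N \<Longrightarrow> X \<in> carrier G.QA \<Longrightarrow> f (snd N u X) = snd N' (f u) X" using assms(1) by (simp add: FG.MH_iff)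
  note h = G.hom_me[of N f N', OF this assms(2)]
  show "i \<in> verts Q \<Longrightarrow> f (G.me N (sv i s) u) = G.me N' (sv i s) (f u)"
    "a \<in> arcs Q \<Longrightarrow> f (G.mt N (a, s) u) = G.mt N' (a, s) (f u)"
    using h by auto
qed

text \<open>\<open>PB\<close> projects onto the sum of the vertex spaces at special vertices; there \<open>tau\<close> is the
  involution \<open>1 - 2\<epsilon>\<close>, whose \<open>-1\<close>-eigenspace is the image of the idempotent loop.\<close>

definition tau :: "('k, 'v, 'a) skew_mod \<Rightarrow> 'k vec \<Rightarrow> 'k vec" where
  "tau N u = (\<Sum>i\<in>Sp. B.me N i u - scale 2 (B.mt N (Inr i) u))"

definition PB :: "('k, 'v, 'a) skew_mod \<Rightarrow> 'k vec \<Rightarrow> 'k vec" where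
  "PB N u = (\<Sum>i\<in>Sp. B.me N i u)"

context
  fixes N assumes N: "right_module B.QA N"
begin

lemma B_rep: "B.qrep (fst N) (B.me N) (B.mt N)" by (rule B.qrep_me[OF N])

lemma B_sub: "kvs.subspace (fst N)" by (rule B.qrep_sub[OF B_rep])

lemma B_e: "i \<in> verts Q \<Longrightarrow> lin_on (fst N) (B.me N i)" using B.qrep_e[OF B_rep] by simp

lemma B_t: "a \<in> arcs Q \<Longrightarrow> lin_on (fst N) (B.mt N (Inl a))" "i \<in> Sp \<Longrightarrow> lin_on (fst N) (B.mt N (Inr i))"
  using B.qrep_t[OF B_rep] by auto

lemma B_ee: "i \<in> verts Q \<Longrightarrow> j \<in> verts Q \<Longrightarrow> u \<in> fst N \<Longrightarrow> B.me N j (B.me N i u) = (if j = i then B.me N i u else 0)"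
  using B.qrep_ee[OF B_rep] by simp

lemma B_one: "u \<in> fst N \<Longrightarrow> (\<Sum>i\<in>verts Q. B.me N i u) = u"
  using B.qrep_one[OF B_rep] by simp

lemma B_te: "a \<in> arcs Q \<Longrightarrow> j \<in> verts Q \<Longrightarrow> u \<in> fst N \<Longrightarrow> B.mt N (Inl a) (B.me N j u) = (if j = tail Q a then B.mt N (Inl a) u else 0)"
  "i \<in> Sp \<Longrightarrow> j \<in> verts Q \<Longrightarrow> u \<in> fst N \<Longrightarrow> B.mt N (Inr i) (B.me N j u) = (if j = i then B.mt N (Inr i) u else 0)"
  using B.qrep_te[OF B_rep, of "Inl a" j u] B.qrep_te[OF B_rep, of "Inr i" j u] by auto

lemma B_et: "a \<in> arcs Q \<Longrightarrow> j \<in> verts Q \<Longrightarrow> u \<in> fst N \<Longrightarrow> B.me N j (B.mt N (Inl a) u) = (if j = head Q a then B.mt N (Inl a) u else 0)"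
  "i \<in> Sp \<Longrightarrow> j \<in> verts Q \<Longrightarrow> u \<in> fst N \<Longrightarrow> B.me N j (B.mt N (Inr i) u) = (if j = i then B.mt N (Inr i) u else 0)"
  using B.qrep_et[OF B_rep, of "Inl a" j u] B.qrep_et[OF B_rep, of "Inr i" j u] by auto

lemma B_rel: "(a, b) \<in> I \<Longrightarrow> u \<in> fst N \<Longrightarrow> B.mt N (Inl b) (B.mt N (Inl a) u) = 0"
proof -
  assume ab: "(a, b) \<in> I" and u: "u \<in> fst N"
  have "path2_elem QB (Inl a, Inl b) \<in> RB" using ab by (auto simp: RB_def)
  then show ?thesis using B.relation_act[OF N _ u] B.xact_path2[OF B_rep u, of "Inl a" "Inl b"] I_D[OF ab] by (auto simp: paths2_def)
qed

lemma B_idem: "i \<in> Sp \<Longrightarrow> u \<in> fst N \<Longrightarrow> B.mt N (Inr i) (B.mt N (Inr i) u) = B.mt N (Inr i) u"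
proof -
  assume i: "i \<in> Sp" and u: "u \<in> fst N"
  have "path2_elem QB (Inr i, Inr i) - arrow_elem QB (Inr i) \<in> RB" using i by (auto simp: RB_def)
  then have "B.xact (B.me N) (B.mt N) (path2_elem QB (Inr i, Inr i) - arrow_elem QB (Inr i)) u = 0"
    by (rule B.relation_act[OF N _ u])
  then show ?thesis
    using B.xact_path2[OF B_rep u, of "Inr i" "Inr i"] B.xact_arrow[OF B_rep u, of "Inr i"] i
    by (auto simp: paths2_def B.xact_diff)
qed

lemma B_mem: "i \<in> verts Q \<Longrightarrow> u \<in> fst N \<Longrightarrow> B.me N i u \<in> fst N" "a \<in> arcs Q \<Longrightarrow> u \<in> fst N \<Longrightarrow> B.mt N (Inl a) u \<in> fst N"
  "i \<in> Sp \<Longrightarrow> u \<in> fst N \<Longrightarrow> B.mt N (Inr i) u \<in> fst N"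
  using lin_on_mem[OF B_e] lin_on_mem[OF B_t(1)] lin_on_mem[OF B_t(2)] by auto

lemma tau_lin: "lin_on (fst N) (tau N)"
  unfolding tau_def[abs_def]
  by (intro lin_on_sum_fun[OF B_sub] lin_on_diff_fun[OF B_sub] B_e B_t(2) SpV)

lemma PB_lin: "lin_on (fst N) (PB N)"
  unfolding PB_def[abs_def] by (intro lin_on_sum_fun[OF B_sub] B_e SpV)

lemma tau_mem: "u \<in> fst N \<Longrightarrow> tau N u \<in> fst N" using lin_on_mem[OF tau_lin] .

lemma tau_e: "w \<in> verts Q \<Longrightarrow> u \<in> fst N \<Longrightarrow> tau N (B.me N w u) = (if w \<in> Sp then B.me N w u - scale 2 (B.mt N (Inr w) u) else 0)"
proof -
  assume w: "w \<in> verts Q" and u: "u \<in> fst N"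
  have "tau N (B.me N w u) = (\<Sum>i\<in>Sp. if i = w then B.me N w u - scale 2 (B.mt N (Inr w) u) else 0)"
    unfolding tau_def using w u by (intro sum.cong refl) (auto simp: B_ee B_te SpV)
  then show ?thesis using finite_Sp by simp
qed

lemma e_tau: "w \<in> verts Q \<Longrightarrow> u \<in> fst N \<Longrightarrow> B.me N w (tau N u) = tau N (B.me N w u)"
proof -
  assume w: "w \<in> verts Q" and u: "u \<in> fst N"
  have m: "B.me N i u - scale 2 (B.mt N (Inr i) u) \<in> fst N" if "i \<in> Sp" for i
    using that u by (intro kvs.subspace_diff[OF B_sub] kvs.subspace_scale[OF B_sub] B_mem) (auto simp: SpV)
  have "B.me N w (tau N u) = (\<Sum>i\<in>Sp. B.me N w (B.me N i u - scale 2 (B.mt N (Inr i) u)))"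
    unfolding tau_def by (rule lin_on_sum[OF B_e[OF w] B_sub m])
  also have "\<dots> = (\<Sum>i\<in>Sp. if i = w then B.me N w u - scale 2 (B.mt N (Inr w) u) else 0)"
  proof (intro sum.cong refl)
    fix i assume i: "i \<in> Sp"
    have "B.me N w (B.me N i u - scale 2 (B.mt N (Inr i) u)) = B.me N w (B.me N i u) - scale 2 (B.me N w (B.mt N (Inr i) u))"
      using lin_on_diff[OF B_e[OF w] B_sub] lin_on_scale[OF B_e[OF w]] B_mem SpV[OF i] i u kvs.subspace_scale[OF B_sub] by simp
    then show "B.me N w (B.me N i u - scale 2 (B.mt N (Inr i) u)) = (if i = w then B.me N w u - scale 2 (B.mt N (Inr w) u) else 0)"
      using w u i SpV[OF i] by (auto simp: B_ee B_et)
  qed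
  finally show ?thesis using tau_e[OF w u] finite_Sp by simp
qed

lemma PB_e: "w \<in> verts Q \<Longrightarrow> u \<in> fst N \<Longrightarrow> PB N (B.me N w u) = (if w \<in> Sp then B.me N w u else 0)"
proof -
  assume w: "w \<in> verts Q" and u: "u \<in> fst N"
  have "PB N (B.me N w u) = (\<Sum>i\<in>Sp. if i = w then B.me N w u else 0)"
    unfolding PB_def using w u by (intro sum.cong refl) (auto simp: B_ee SpV)
  then show ?thesis using finite_Sp by simp
qed

lemma e_PB: "w \<in> verts Q \<Longrightarrow> u \<in> fst N \<Longrightarrow> B.me N w (PB N u) = (if w \<in> Sp then B.me N w u else 0)"
proof -
  assume w: "w \<in> verts Q" and u: "u \<in> fst N"
  have "B.me N w (PB N u) = (\<Sum>i\<in>Sp. B.me N w (B.me N i u))"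
    unfolding PB_def by (rule lin_on_sum[OF B_e[OF w] B_sub]) (use B_mem u SpV in auto)
  also have "\<dots> = (\<Sum>i\<in>Sp. if i = w then B.me N w u else 0)"
    using w u by (intro sum.cong refl) (auto simp: B_ee SpV)
  finally show ?thesis using finite_Sp by simp
qed

lemma B_ext:
  assumes "u \<in> fst N" "u' \<in> fst N" "\<And>w. w \<in> verts Q \<Longrightarrow> B.me N w u = B.me N w u'" shows "u = u'"
  using B_one[OF assms(1)] B_one[OF assms(2)] assms(3) by (metis (no_types, lifting) sum.cong)

text \<open>At a special vertex (1 - 2\<epsilon>)^2 = 1 because \<epsilon> is idempotent; elsewhere
  \<open>tau\<close> is zero. It suffices to compare the components at all vertices.\<close>

lemma tau_tau: "u \<in> fst N \<Longrightarrow> tau N (tau N u) = PB N u"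
proof (rule B_ext)
  assume u: "u \<in> fst N"
  show "tau N (tau N u) \<in> fst N" "PB N u \<in> fst N" using u tau_mem lin_on_mem[OF PB_lin] by auto
  fix w assume w: "w \<in> verts Q"
  let ?e = "B.me N w u" and ?p = "B.mt N (Inr w) u"
  show "B.me N w (tau N (tau N u)) = B.me N w (PB N u)"
  proof (cases "w \<in> Sp")
    case True
    have m: "?e \<in> fst N" "?p \<in> fst N" using B_mem w True u by auto
    have "tau N ?p = tau N (B.me N w ?p)" using B_et(2)[OF True w u] by simp
    also have "\<dots> = ?p - scale 2 ?p" using tau_e[OF w m(2)] True B_et(2)[OF True w u] B_idem[OF True u] by simp
    finally have tp: "tau N ?p = ?p - scale 2 ?p" .
    have "tau N (?e - scale 2 ?p) = tau N ?e - scale 2 (tau N ?p)"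
      using lin_on_diff[OF tau_lin B_sub m(1) kvs.subspace_scale[OF B_sub m(2)]] lin_on_scale[OF tau_lin m(2)] by simp
    also have "\<dots> = ?e"
    proof -
      \<comment> \<open>\<open>tau\<close> is -1 on the image of \<epsilon>.\<close>
      have "?p - scale 2 ?p = - ?p" by (rule poly_mapping_eqI) (simp add: lookup_minus)
      then have "tau N ?p = - ?p" using tp by (rule trans[rotated])
      then show ?thesis using tau_e[OF w u] True by (simp add: kvs.scale_minus_right)
    qed
    finally show ?thesis using e_tau[OF w tau_mem[OF u]] e_tau[OF w u] tau_e[OF w u] e_PB[OF w u] True by simp
  next
    case False
    then show ?thesis using e_tau[OF w tau_mem[OF u]] e_tau[OF w u] tau_e[OF w u] e_PB[OF w u] lin_on_zero[OF tau_lin B_sub] by simp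
  qed
qed

lemma PB_tau: "u \<in> fst N \<Longrightarrow> PB N (tau N u) = tau N u"
proof (rule B_ext)
  assume u: "u \<in> fst N"
  show "PB N (tau N u) \<in> fst N" "tau N u \<in> fst N" using u tau_mem lin_on_mem[OF PB_lin] by auto
  show "B.me N w (PB N (tau N u)) = B.me N w (tau N u)" if w: "w \<in> verts Q" for w
    using e_PB[OF w tau_mem[OF u]] e_tau[OF w u] tau_e[OF w u] by simp
qed

text \<open>The loop is recovered from the involution as \<epsilon> = (1 - tau)/2, so morphisms and
  actions may be checked against \<open>tau\<close> instead.\<close>

lemma eps_tau: "i \<in> Sp \<Longrightarrow> u \<in> fst N \<Longrightarrow> scale (1/2) (B.me N i u - tau N (B.me N i u)) = B.mt N (Inr i) u"
proof -
  assume i: "i \<in> Sp" and u: "u \<in> fst N"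
  have "B.me N i u - tau N (B.me N i u) = scale 2 (B.mt N (Inr i) u)" using tau_e[OF SpV[OF i] u] i by simp
  then show ?thesis using two by simp
qed

end

text \<open>\<open>pG M s\<close> projects onto the sum of the vertex spaces of sign \<open>s\<close>, where special
  vertices carry both signs.\<close>

definition pG :: "('k, 'v, 'a) gentle_mod \<Rightarrow> sign \<Rightarrow> 'k vec \<Rightarrow> 'k vec" where
  "pG M s u = (\<Sum>i\<in>verts Q. G.me M (sv i s) u)"

definition PG :: "('k, 'v, 'a) gentle_mod \<Rightarrow> 'k vec \<Rightarrow> 'k vec" where
  "PG M u = (\<Sum>i\<in>Sp. G.me M (Special i) u)"

lemma sv_Sp: "i \<in> Sp \<Longrightarrow> sv i s = Special i" by (simp add: sign_vertex_def)

text \<open>Relative to a fixed sign the vertices are all those of that sign, which include the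
  special ones, and the non-special ones of the other sign.\<close>

lemma sum_QG:
  "(\<Sum>v\<in>verts QG. g v) = (\<Sum>i\<in>verts Q. g (sv i s)) + (\<Sum>i\<in>verts Q - Sp. g (sv i (opp s)))" for g :: "_ \<Rightarrow> 'k vec"
proof -
  have "sv i s' \<in> (\<lambda>i. sv i s) ` verts Q \<union> (\<lambda>i. sv i (opp s)) ` (verts Q - Sp)" if "i \<in> verts Q" for i s'
  proof (cases "s' = s \<or> i \<in> Sp")
    case True
    then have "sv i s' = sv i s" by (auto simp: sv_eq_iff)
    then show ?thesis using that by blast
  next
    case False
    then show ?thesis using that not_eq_opp by auto
  qed
  then have "verts QG = (\<lambda>i. sv i s) ` verts Q \<union> (\<lambda>i. sv i (opp s)) ` (verts Q - Sp)" by auto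
  moreover have "(\<Sum>v\<in>(\<lambda>i. sv i s) ` verts Q \<union> (\<lambda>i. sv i (opp s)) ` (verts Q - Sp). g v) =
      (\<Sum>v\<in>(\<lambda>i. sv i s) ` verts Q. g v) + (\<Sum>v\<in>(\<lambda>i. sv i (opp s)) ` (verts Q - Sp). g v)"
    by (rule sum.union_disjoint) (auto simp: sv_eq_iff)
  moreover have "(\<Sum>v\<in>(\<lambda>i. sv i s) ` verts Q. g v) = (\<Sum>i\<in>verts Q. g (sv i s))"
    by (rule sum.reindex_cong[OF _ refl refl]) (auto simp: inj_on_def sv_eq_iff)
  moreover have "(\<Sum>v\<in>(\<lambda>i. sv i (opp s)) ` (verts Q - Sp). g v) = (\<Sum>i\<in>verts Q - Sp. g (sv i (opp s)))"
    by (rule sum.reindex_cong[OF _ refl refl]) (auto simp: inj_on_def sv_eq_iff)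
  ultimately show ?thesis by simp
qed

context
  fixes M assumes M: "right_module G.QA M"
begin

lemma G_rep: "G.qrep (fst M) (G.me M) (G.mt M)" by (rule G.qrep_me[OF M])

lemma G_sub: "kvs.subspace (fst M)" by (rule G.qrep_sub[OF G_rep])

lemma G_e: "i \<in> verts Q \<Longrightarrow> lin_on (fst M) (G.me M (sv i s))" using G.qrep_e[OF G_rep, of "sv i s"] by auto

lemma G_t: "a \<in> arcs Q \<Longrightarrow> lin_on (fst M) (G.mt M (a, s))" using G.qrep_t[OF G_rep, of "(a, s)"] by auto

lemma G_mem: "i \<in> verts Q \<Longrightarrow> u \<in> fst M \<Longrightarrow> G.me M (sv i s) u \<in> fst M" "a \<in> arcs Q \<Longrightarrow> u \<in> fst M \<Longrightarrow> G.mt M (a, s) u \<in> fst M"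
  using lin_on_mem[OF G_e] lin_on_mem[OF G_t] by auto

lemma G_ee: "i \<in> verts Q \<Longrightarrow> j \<in> verts Q \<Longrightarrow> u \<in> fst M \<Longrightarrow>
    G.me M (sv j s') (G.me M (sv i s) u) = (if i = j \<and> (s = s' \<or> i \<in> Sp) then G.me M (sv i s) u else 0)"
  using G.qrep_ee[OF G_rep, of "sv i s" "sv j s'" u] by (auto simp: sv_eq_iff)

lemma G_te: "a \<in> arcs Q \<Longrightarrow> j \<in> verts Q \<Longrightarrow> u \<in> fst M \<Longrightarrow>
    G.mt M (a, s) (G.me M (sv j s') u) = (if j = tail Q a \<and> (s = s' \<or> j \<in> Sp) then G.mt M (a, s) u else 0)"
  using G.qrep_te[OF G_rep, of "(a, s)" "sv j s'" u] by (auto simp: sv_eq_iff)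

lemma G_et: "a \<in> arcs Q \<Longrightarrow> j \<in> verts Q \<Longrightarrow> u \<in> fst M \<Longrightarrow>
    G.me M (sv j s') (G.mt M (a, s) u) = (if j = head Q a \<and> (s = s' \<or> j \<in> Sp) then G.mt M (a, s) u else 0)"
  using G.qrep_et[OF G_rep, of "(a, s)" "sv j s'" u] by (auto simp: sv_eq_iff)

lemma G_rel: "(a, b) \<in> I \<Longrightarrow> u \<in> fst M \<Longrightarrow> G.mt M (b, s) (G.mt M (a, s) u) = 0"
proof -
  assume ab: "(a, b) \<in> I" and u: "u \<in> fst M"
  have "path2_elem QG ((a, s), (b, s)) \<in> RG" using ab by (auto simp: RG_def)
  then show ?thesis using G.relation_act[OF M _ u] G.xact_path2[OF G_rep u, of "(a, s)" "(b, s)"] I_D[OF ab] by (auto simp: paths2_def)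
qed

lemma pG_lin: "lin_on (fst M) (pG M s)"
  unfolding pG_def[abs_def] by (intro lin_on_sum_fun[OF G_sub] G_e)

lemma G_eS: "i \<in> Sp \<Longrightarrow> lin_on (fst M) (G.me M (Special i))"
  using G_e[of i Plus] sv_Sp Sp_verts by auto

lemma PG_lin: "lin_on (fst M) (PG M)"
  unfolding PG_def[abs_def] by (intro lin_on_sum_fun[OF G_sub] G_eS)

lemma pG_mem: "u \<in> fst M \<Longrightarrow> pG M s u \<in> fst M" using lin_on_mem[OF pG_lin] .

lemma PG_mem: "u \<in> fst M \<Longrightarrow> PG M u \<in> fst M" using lin_on_mem[OF PG_lin] .

lemma pG_e: "i \<in> verts Q \<Longrightarrow> u \<in> fst M \<Longrightarrow> pG M s' (G.me M (sv i s) u) = (if s = s' \<or> i \<in> Sp then G.me M (sv i s) u else 0)"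
proof -
  assume i: "i \<in> verts Q" and u: "u \<in> fst M"
  have "pG M s' (G.me M (sv i s) u) = (\<Sum>j\<in>verts Q. if j = i then (if s = s' \<or> i \<in> Sp then G.me M (sv i s) u else 0) else 0)"
    unfolding pG_def using i u by (intro sum.cong refl) (auto simp: G_ee)
  then show ?thesis using i by simp
qed

lemma e_pG: "i \<in> verts Q \<Longrightarrow> u \<in> fst M \<Longrightarrow> G.me M (sv i s) (pG M s' u) = (if s = s' \<or> i \<in> Sp then G.me M (sv i s) u else 0)"
proof -
  assume i: "i \<in> verts Q" and u: "u \<in> fst M"
  have "G.me M (sv i s) (pG M s' u) = (\<Sum>j\<in>verts Q. G.me M (sv i s) (G.me M (sv j s') u))"
    unfolding pG_def by (rule lin_on_sum[OF G_e[OF i] G_sub]) (use G_mem u in auto)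
  also have "\<dots> = (\<Sum>j\<in>verts Q. if j = i then (if s = s' \<or> i \<in> Sp then G.me M (sv i s) u else 0) else 0)"
  proof (intro sum.cong refl)
    fix j assume j: "j \<in> verts Q"
    have "sv i s' = sv i s" if "s = s' \<or> i \<in> Sp" using that by (auto simp: sv_eq_iff)
    then show "G.me M (sv i s) (G.me M (sv j s') u) = (if j = i then (if s = s' \<or> i \<in> Sp then G.me M (sv i s) u else 0) else 0)"
      unfolding G_ee[OF j i u] by (cases "j = i"; cases "s = s' \<or> i \<in> Sp") (simp_all, auto)
  qed
  finally show ?thesis using i by simp
qed

lemma e_PG: "i \<in> verts Q \<Longrightarrow> u \<in> fst M \<Longrightarrow> G.me M (sv i s) (PG M u) = (if i \<in> Sp then G.me M (sv i s) u else 0)"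
proof -
  assume i: "i \<in> verts Q" and u: "u \<in> fst M"
  have "G.me M (sv i s) (PG M u) = (\<Sum>j\<in>Sp. G.me M (sv i s) (G.me M (Special j) u))"
    unfolding PG_def by (rule lin_on_sum[OF G_e[OF i] G_sub]) (use lin_on_mem[OF G_eS] u in auto)
  also have "\<dots> = (\<Sum>j\<in>Sp. if j = i then G.me M (sv i s) u else 0)"
  proof (intro sum.cong refl)
    fix j assume j: "j \<in> Sp"
    then show "G.me M (sv i s) (G.me M (Special j) u) = (if j = i then G.me M (sv i s) u else 0)"
      using G_ee[of j i u s s] i u sv_Sp[OF j, of s] Sp_verts by auto
  qed
  finally show ?thesis using finite_Sp by simp
qed

lemma G_ext:
  assumes "u \<in> fst M" "u' \<in> fst M" "\<And>i s. i \<in> verts Q \<Longrightarrow> G.me M (sv i s) u = G.me M (sv i s) u'" shows "u = u'"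
proof -
  have "(\<Sum>v\<in>verts QG. G.me M v u) = (\<Sum>v\<in>verts QG. G.me M v u')"
    by (rule sum.cong) (use assms(3) in auto)
  then show ?thesis using G.qrep_one[OF G_rep assms(1)] G.qrep_one[OF G_rep assms(2)] by simp
qed

lemma pG_ext:
  assumes "u \<in> fst M" "u' \<in> fst M" "\<And>s. pG M s u = pG M s u'" shows "u = u'"
proof (rule G_ext[OF assms(1,2)])
  fix i s assume i: "i \<in> verts Q"
  show "G.me M (sv i s) u = G.me M (sv i s) u'"
    using e_pG[OF i assms(1), of s s] e_pG[OF i assms(2), of s s] assms(3)[of s] by simp
qed

text \<open>The two ranges overlap exactly in the special part, so applying both projections leaves
  \<open>PG\<close>.\<close>

lemma pG_pG: "u \<in> fst M \<Longrightarrow> pG M s' (pG M s u) = (if s = s' then pG M s u else PG M u)"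
proof (rule G_ext)
  assume u: "u \<in> fst M"
  show "pG M s' (pG M s u) \<in> fst M" "(if s = s' then pG M s u else PG M u) \<in> fst M" using u pG_mem PG_mem by auto
  fix i r assume i: "i \<in> verts Q"
  show "G.me M (sv i r) (pG M s' (pG M s u)) = G.me M (sv i r) (if s = s' then pG M s u else PG M u)"
    using e_pG[OF i pG_mem[OF u], of r s' s] e_pG[OF i u, of r s] e_PG[OF i u, of r] by (cases r; cases s; cases s') auto
qed

lemma pG_PG: "u \<in> fst M \<Longrightarrow> pG M s (PG M u) = PG M u"
proof (rule G_ext)
  assume u: "u \<in> fst M"
  show "pG M s (PG M u) \<in> fst M" "PG M u \<in> fst M" using u pG_mem PG_mem by auto
  fix i r assume i: "i \<in> verts Q"
  show "G.me M (sv i r) (pG M s (PG M u)) = G.me M (sv i r) (PG M u)"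
    using e_pG[OF i PG_mem[OF u], of r s] e_PG[OF i u, of r] by auto
qed

lemma pG_t: "a \<in> arcs Q \<Longrightarrow> u \<in> fst M \<Longrightarrow> pG M s (G.mt M (a, s) u) = G.mt M (a, s) u"
proof (rule G_ext)
  assume a: "a \<in> arcs Q" and u: "u \<in> fst M"
  show "pG M s (G.mt M (a, s) u) \<in> fst M" "G.mt M (a, s) u \<in> fst M" using a u pG_mem G_mem by auto
  fix i r assume i: "i \<in> verts Q"
  show "G.me M (sv i r) (pG M s (G.mt M (a, s) u)) = G.me M (sv i r) (G.mt M (a, s) u)"
    using e_pG[OF i G_mem(2)[OF a u], of r s s] G_et[OF a i u, of r s] by auto
qed

lemma t_pG: "a \<in> arcs Q \<Longrightarrow> u \<in> fst M \<Longrightarrow> G.mt M (a, s) (pG M s u) = G.mt M (a, s) u"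
proof -
  assume a: "a \<in> arcs Q" and u: "u \<in> fst M"
  have ta: "tail Q a \<in> verts Q" using a by simp
  have "G.mt M (a, s) (pG M s u) = G.mt M (a, s) (G.me M (sv (tail Q a) s) (pG M s u))"
    using G_te[OF a ta pG_mem[OF u], of s s] by simp
  then show ?thesis using e_pG[OF ta u, of s s] G_te[OF a ta u, of s s] by simp
qed

lemma pG_PG_swap: "u \<in> fst M \<Longrightarrow> PG M (pG M s u) = PG M u"
proof (rule G_ext)
  assume u: "u \<in> fst M"
  show "PG M (pG M s u) \<in> fst M" "PG M u \<in> fst M" using u pG_mem PG_mem by auto
  fix i r assume i: "i \<in> verts Q"
  show "G.me M (sv i r) (PG M (pG M s u)) = G.me M (sv i r) (PG M u)"
    using e_PG[OF i pG_mem[OF u], of r s] e_PG[OF i u, of r] e_pG[OF i u, of r s] by auto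
qed

text \<open>The module is the sum of the two ranges amalgamated along the special part: vectors of
  either sign with a common special part glue, if that part is counted once.\<close>

lemma pG_glue:
  assumes "\<And>s. c s \<in> fst M" "\<And>s. pG M s (c s) = c s" "PG M (c Plus) = PG M (c Minus)"
  shows "c Plus + (c Minus - PG M (c Minus)) \<in> fst M" "pG M s (c Plus + (c Minus - PG M (c Minus))) = c s"
proof -
  have d: "c Minus - PG M (c Minus) \<in> fst M" using assms(1) PG_mem kvs.subspace_diff[OF G_sub] by blast
  show "c Plus + (c Minus - PG M (c Minus)) \<in> fst M" using kvs.subspace_add[OF G_sub assms(1) d] .
  have op: "pG M s (c s') = PG M (c s')" if "s' \<noteq> s" for s s'
    using pG_pG[OF assms(1), of s s' s'] assms(2)[of s'] that by simp
  have "pG M s (c Plus + (c Minus - PG M (c Minus))) = pG M s (c Plus) + (pG M s (c Minus) - PG M (c Minus))"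
    using lin_on_add[OF pG_lin assms(1) d] lin_on_diff[OF pG_lin G_sub assms(1) PG_mem[OF assms(1)]] pG_PG[OF assms(1)] by simp
  then show "pG M s (c Plus + (c Minus - PG M (c Minus))) = c s"
    using op[of Plus Minus] op[of Minus Plus] assms(2,3) by (cases s) simp_all
qed

end

text \<open>\<open>F\<close> forgets the signs: the space of \<open>F M\<close> is the direct sum of the two ranges of
  \<open>pG M\<close>, in which the space at a special vertex occurs twice, and the loop projects onto
  its antidiagonal along the diagonal.\<close>

definition FU :: "('k, 'v, 'a) gentle_mod \<Rightarrow> 'k vec set" where
  "FU M = {z. \<forall>s. sp s z \<in> fst M \<and> pG M s (sp s z) = sp s z}"

definition Fe :: "('k, 'v, 'a) gentle_mod \<Rightarrow> 'v \<Rightarrow> 'k vec \<Rightarrow> 'k vec" where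
  "Fe M i z = sg (\<lambda>s. G.me M (sv i s) (sp s z))"

definition Ft :: "('k, 'v, 'a) gentle_mod \<Rightarrow> 'a + 'v \<Rightarrow> 'k vec \<Rightarrow> 'k vec" where
  "Ft M x z = (case x of Inl a \<Rightarrow> sg (\<lambda>s. G.mt M (a, s) (sp s z))
     | Inr i \<Rightarrow> sg (\<lambda>s. scale (1/2) (G.me M (sv i s) (sp s z) - G.me M (sv i s) (sp (opp s) z))))"

definition F :: "('k, 'v, 'a) gentle_mod \<Rightarrow> ('k, 'v, 'a) skew_mod" where
  "F M = B.qmod (FU M) (Fe M) (Ft M)"

lemma fst_F [simp]: "fst (F M) = FU M" by (simp add: F_def)

lemma sp_Fe [simp]: "sp s (Fe M i z) = G.me M (sv i s) (sp s z)" by (simp add: Fe_def)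

lemma sp_Ft [simp]: "sp s (Ft M (Inl a) z) = G.mt M (a, s) (sp s z)"
  "sp s (Ft M (Inr i) z) = scale (1/2) (G.me M (sv i s) (sp s z) - G.me M (sv i s) (sp (opp s) z))"
  by (simp_all add: Ft_def)

lemma FU_D: "z \<in> FU M \<Longrightarrow> sp s z \<in> fst M" "z \<in> FU M \<Longrightarrow> pG M s (sp s z) = sp s z"
  by (simp_all add: FU_def)

lemma FU_I: "(\<And>s. sp s z \<in> fst M) \<Longrightarrow> (\<And>s. pG M s (sp s z) = sp s z) \<Longrightarrow> z \<in> FU M"
  by (simp add: FU_def)

context
  fixes M assumes M: "right_module G.QA M"
begin

lemma FU_sub: "kvs.subspace (FU M)"
  by (rule kvs.subspaceI)
    (auto intro!: FU_I kvs.subspace_add[OF G_sub[OF M]] kvs.subspace_scale[OF G_sub[OF M]] kvs.subspace_0[OF G_sub[OF M]]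
      simp: FU_D sp_lin lin_on_add[OF pG_lin[OF M]] lin_on_scale[OF pG_lin[OF M]] lin_on_zero[OF pG_lin[OF M] G_sub[OF M]])

lemma pG_zero: "pG M s 0 = 0" "PG M 0 = 0"
  using lin_on_zero[OF pG_lin[OF M] G_sub[OF M]] lin_on_zero[OF PG_lin[OF M] G_sub[OF M]] by auto

lemma G_zero: "i \<in> verts Q \<Longrightarrow> G.me M (sv i s) 0 = 0" "a \<in> arcs Q \<Longrightarrow> G.mt M (a, s) 0 = 0"
  using lin_on_zero[OF G_e[OF M] G_sub[OF M]] lin_on_zero[OF G_t[OF M] G_sub[OF M]] by auto

lemma FU_lin:
  assumes f: "\<And>s. lin_on (fst M) (f s)" and p: "\<And>s u. u \<in> fst M \<Longrightarrow> pG M s (f s u) = f s u"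
  shows "lin_on (FU M) (\<lambda>z. sg (\<lambda>s. f s (sp s z)))"
  unfolding lin_on_def
proof (intro conjI ballI allI)
  show "sg (\<lambda>s. f s (sp s z)) \<in> FU M" if "z \<in> FU M" for z
    by (rule FU_I) (use lin_on_mem[OF f FU_D(1)[OF that]] p[OF FU_D(1)[OF that]] in simp_all)
  show "sg (\<lambda>s. f s (sp s (z + z'))) = sg (\<lambda>s. f s (sp s z)) + sg (\<lambda>s. f s (sp s z'))" if "z \<in> FU M" "z' \<in> FU M" for z z'
    by (rule sg_eqI) (simp add: sp_lin lin_on_add[OF f] FU_D(1)[OF that(1)] FU_D(1)[OF that(2)])
  show "sg (\<lambda>s. f s (sp s (scale c z))) = scale c (sg (\<lambda>s. f s (sp s z)))" if "z \<in> FU M" for z c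
    by (rule sg_eqI) (simp add: sp_lin lin_on_scale[OF f] FU_D(1)[OF that])
qed

lemma Fe_lin: "i \<in> verts Q \<Longrightarrow> lin_on (FU M) (Fe M i)"
  unfolding Fe_def[abs_def] by (rule FU_lin) (auto simp: G_e[OF M] pG_e[OF M])

lemma Ft_lin1: "a \<in> arcs Q \<Longrightarrow> lin_on (FU M) (Ft M (Inl a))"
  unfolding Ft_def[abs_def] sum.case by (rule FU_lin) (simp_all add: G_t[OF M] pG_t[OF M])

text \<open>The loop mixes the two coordinates, so \<open>FU_lin\<close> does not apply. Its
  coordinate at \<open>s\<close> lies in the image of the vertex projection at \<open>sv i s\<close>
  and hence has sign \<open>s\<close>.\<close>

lemma Ft_lin2: "i \<in> Sp \<Longrightarrow> lin_on (FU M) (Ft M (Inr i))"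
proof -
  assume i: "i \<in> Sp"
  note V = SpV[OF i]
  have e: "G.me M (sv i s) (sp s' z) \<in> fst M" if "z \<in> FU M" for s s' z using G_mem(1)[OF M V] FU_D(1)[OF that] by blast
  have d: "G.me M (sv i s) (sp s' z) - G.me M (sv i s) (sp s'' z) \<in> fst M" if "z \<in> FU M" for s s' s'' z
    using kvs.subspace_diff[OF G_sub[OF M] e[OF that] e[OF that]] .
  show ?thesis
    unfolding lin_on_def
  proof (intro conjI ballI allI)
    show "Ft M (Inr i) z \<in> FU M" if z: "z \<in> FU M" for z
    proof (rule FU_I)
      fix s
      show "sp s (Ft M (Inr i) z) \<in> fst M" using kvs.subspace_scale[OF G_sub[OF M] d[OF z]] by simp
      show "pG M s (sp s (Ft M (Inr i) z)) = sp s (Ft M (Inr i) z)"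
        using lin_on_scale[OF pG_lin[OF M] d[OF z]] lin_on_diff[OF pG_lin[OF M] G_sub[OF M] e[OF z] e[OF z]]
          pG_e[OF M V] FU_D(1)[OF z] by simp
    qed
    show "Ft M (Inr i) (z + z') = Ft M (Inr i) z + Ft M (Inr i) z'" if "z \<in> FU M" "z' \<in> FU M" for z z'
      by (rule sg_eqI) (simp add: sp_lin lin_on_add[OF G_e[OF M V]] FU_D that kvs.scale_right_diff_distrib kvs.scale_right_distrib)
    show "Ft M (Inr i) (scale c z) = scale c (Ft M (Inr i) z)" if "z \<in> FU M" for z c
      by (rule sg_eqI) (simp add: sp_lin lin_on_scale[OF G_e[OF M V]] FU_D that kvs.scale_right_diff_distrib mult.commute)
  qed
qed

lemma F_rep: "B.qrep (FU M) (Fe M) (Ft M)"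
  unfolding B.qrep_def QB_simps
proof (intro conjI ballI)
  show "kvs.subspace (FU M)" by (rule FU_sub)
  show "lin_on (FU M) (Fe M v)" if "v \<in> verts Q" for v by (rule Fe_lin[OF that])
  show "lin_on (FU M) (Ft M a)" if "a \<in> Inl ` arcs Q \<union> Inr ` Sp" for a using that Ft_lin1 Ft_lin2 by auto
  show "Fe M w (Fe M v u) = (if w = v then Fe M v u else 0)" if "v \<in> verts Q" "w \<in> verts Q" "u \<in> FU M" for v w u
    by (rule sg_eqI) (simp add: G_ee[OF M that(1,2) FU_D(1)[OF that(3)]] sp_lin)
  show "(\<Sum>v\<in>verts Q. Fe M v u) = u" if "u \<in> FU M" for u
    by (rule sg_eqI) (use FU_D(2)[OF that] in \<open>simp add: sp_sum pG_def\<close>)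
  show "Ft M a (Fe M w u) = (if w = tail QB a then Ft M a u else 0)"
    if a: "a \<in> Inl ` arcs Q \<union> Inr ` Sp" and w: "w \<in> verts Q" and u: "u \<in> FU M" for a w u
  proof (cases a)
    case (Inl b)
    then have b: "b \<in> arcs Q" using a by auto
    show ?thesis unfolding Inl by (rule sg_eqI) (simp add: G_te[OF M b w FU_D(1)[OF u]] sp_lin)
  next
    case (Inr i)
    then have i: "i \<in> Sp" using a by auto
    have "G.me M (sv i s) (G.me M (sv w s') (sp s'' u)) = (if w = i then G.me M (sv i s) (sp s'' u) else 0)" for s s' s''
    proof -
      have "w = i \<Longrightarrow> sv w s' = sv i s" using i by (simp add: sv_eq_iff)
      then show ?thesis using G_ee[OF M w SpV[OF i] FU_D(1)[OF u], of s s' s''] i by (cases "w = i") simp_all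
    qed
    note h = this
    show ?thesis unfolding Inr by (rule sg_eqI) (simp add: sp_lin h)
  qed
  show "Fe M w (Ft M a u) = (if w = head QB a then Ft M a u else 0)"
    if a: "a \<in> Inl ` arcs Q \<union> Inr ` Sp" and w: "w \<in> verts Q" and u: "u \<in> FU M" for a w u
  proof (cases a)
    case (Inl b)
    then have b: "b \<in> arcs Q" using a by auto
    show ?thesis unfolding Inl by (rule sg_eqI) (simp add: G_et[OF M b w FU_D(1)[OF u]] sp_lin)
  next
    case (Inr i)
    then have i: "i \<in> Sp" using a by auto
    note V = SpV[OF i]
    have e: "G.me M (sv i s) (sp s' u) \<in> fst M" for s s' using G_mem(1)[OF M V] FU_D(1)[OF u] by blast
    have "G.me M (sv w s) (sp s (Ft M (Inr i) u)) = (if w = i then sp s (Ft M (Inr i) u) else 0)" for s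
      using lin_on_scale[OF G_e[OF M w] kvs.subspace_diff[OF G_sub[OF M] e e]]
        lin_on_diff[OF G_e[OF M w] G_sub[OF M] e e] G_ee[OF M V w FU_D(1)[OF u]] by simp
    note h = this[unfolded sp_Ft]
    show ?thesis unfolding Inr by (rule sg_eqI) (simp add: sp_lin h)
  qed
qed

lemma F_rel: "r \<in> RB \<Longrightarrow> z \<in> FU M \<Longrightarrow> B.xact (Fe M) (Ft M) r z = 0"
proof -
  assume r: "r \<in> RB" and z: "z \<in> FU M"
  consider a b where "(a, b) \<in> I" "r = path2_elem QB (Inl a, Inl b)"
    | i where "i \<in> Sp" "r = path2_elem QB (Inr i, Inr i) - arrow_elem QB (Inr i)"
    using r by (auto simp: RB_def)
  then show ?thesis
  proof cases
    case (1 a b)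
    have "Ft M (Inl b) (Ft M (Inl a) z) = 0"
      by (rule sg_eqI) (simp add: G_rel[OF M 1(1)] FU_D z sp_lin)
    then show ?thesis using B.xact_path2[OF F_rep z, of "Inl a" "Inl b"] I_D[OF 1(1)] 1(2) by (auto simp: paths2_def)
  next
    case (2 i)
    note V = SpV[OF 2(1)]
    have e: "G.me M (sv i s) (sp s' z) \<in> fst M" for s s' using G_mem(1)[OF M V] FU_D(1)[OF z] by blast
    have h: "G.me M (sv i r) (sp s (Ft M (Inr i) z)) = scale (1/2) (G.me M (sv i r) (sp s z) - G.me M (sv i r) (sp (opp s) z))" for r s
    proof -
      have "sv i s = sv i r" using 2(1) by (simp add: sv_eq_iff)
      then show ?thesis
        using lin_on_scale[OF G_e[OF M V] kvs.subspace_diff[OF G_sub[OF M] e e]]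
          lin_on_diff[OF G_e[OF M V] G_sub[OF M] e e] G_ee[OF M V V FU_D(1)[OF z]] 2(1) by simp
    qed
    have "Ft M (Inr i) (Ft M (Inr i) z) = Ft M (Inr i) z"
    proof (rule sg_eqI)
      fix s
      let ?d = "G.me M (sv i s) (sp s z) - G.me M (sv i s) (sp (opp s) z)"
      \<comment> \<open>After one application the two coordinates are opposite, so the second takes
        half of twice the value.\<close>
      have "scale (1/2) ?d - scale (1/2) (- ?d) = scale (1/2 + 1/2) ?d"
        by (simp only: kvs.scale_left_distrib kvs.scale_minus_right diff_minus_eq_add)
      moreover have "(1/2 + 1/2 :: 'k) = 1" using two by simp
      ultimately show "sp s (Ft M (Inr i) (Ft M (Inr i) z)) = sp s (Ft M (Inr i) z)"
        unfolding sp_Ft(2)[of s M i "Ft M (Inr i) z"] h by simp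
    qed
    then show ?thesis using B.xact_path2[OF F_rep z, of "Inr i" "Inr i"] B.xact_arrow[OF F_rep z, of "Inr i"] 2
      by (auto simp: paths2_def B.xact_diff)
  qed
qed

lemma F_right: "right_module B.QA (F M)"
  unfolding F_def by (rule B.qmod_right_module[OF F_rep F_rel])

lemma F_me: "z \<in> FU M \<Longrightarrow> B.me (F M) i z = Fe M i z"
  unfolding F_def by (rule B.qmod_me(1)[OF F_rep F_rel])

lemma F_mt: "z \<in> FU M \<Longrightarrow> a \<in> arcs Q \<Longrightarrow> B.mt (F M) (Inl a) z = Ft M (Inl a) z"
  "z \<in> FU M \<Longrightarrow> i \<in> Sp \<Longrightarrow> B.mt (F M) (Inr i) z = Ft M (Inr i) z"
  unfolding F_def by (rule B.qmod_me(2)[OF F_rep F_rel]; simp)+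

text \<open>On F M the loop is half of (1 - swap) at a special vertex, so 1 - 2\<epsilon> is the
  swap of the two copies of the special part.\<close>

lemma sp_tau_F: "z \<in> FU M \<Longrightarrow> sp s (tau (F M) z) = PG M (sp (opp s) z)"
  unfolding tau_def PG_def sp_sum
proof (intro sum.cong refl)
  fix i assume z: "z \<in> FU M" and i: "i \<in> Sp"
  then show "sp s (B.me (F M) i z - scale 2 (B.mt (F M) (Inr i) z)) = G.me M (Special i) (sp (opp s) z)"
    using two by (simp add: F_me F_mt sp_diff sp_lin sv_Sp)
qed

lemma sp_PB_F: "z \<in> FU M \<Longrightarrow> sp s (PB (F M) z) = PG M (sp s z)"
  unfolding PB_def PG_def sp_sum by (intro sum.cong refl) (simp add: F_me sv_Sp)

end

lemma F_MO: "M \<in> FG.MO \<Longrightarrow> F M \<in> FB.MO"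
  using fd_signed[of "fst M" "FU M"] F_right FU_sub FU_D(1) by (auto simp: FB.MO_iff FG.MO_iff)

text \<open>\<open>H\<close> doubles a module: the space of \<open>H N\<close> consists of the pairs in \<open>N \<times> N\<close> whose
  components at special vertices are exchanged by \<open>tau\<close>, so that special vertices are not
  doubled; \<open>io N s\<close> maps onto the half of sign \<open>s\<close>.\<close>

definition io :: "('k, 'v, 'a) skew_mod \<Rightarrow> sign \<Rightarrow> 'k vec \<Rightarrow> 'k vec" where
  "io N s y = sg (\<lambda>s'. if s' = s then y else tau N y)"

definition HU :: "('k, 'v, 'a) skew_mod \<Rightarrow> 'k vec set" where
  "HU N = {z. \<forall>s. sp s z \<in> fst N \<and> PB N (sp s z) = tau N (sp (opp s) z)}"

definition He :: "('k, 'v, 'a) skew_mod \<Rightarrow> 'v signed_vertex \<Rightarrow> 'k vec \<Rightarrow> 'k vec" where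
  "He N v z = (case v of Special i \<Rightarrow> io N Plus (B.me N i (sp Plus z)) | Signed i s \<Rightarrow> io N s (B.me N i (sp s z)))"

definition Ht :: "('k, 'v, 'a) skew_mod \<Rightarrow> 'a \<times> sign \<Rightarrow> 'k vec \<Rightarrow> 'k vec" where
  "Ht N x z = io N (snd x) (B.mt N (Inl (fst x)) (sp (snd x) z))"

definition H :: "('k, 'v, 'a) skew_mod \<Rightarrow> ('k, 'v, 'a) gentle_mod" where
  "H N = G.qmod (HU N) (He N) (Ht N)"

lemma fst_H [simp]: "fst (H N) = HU N" by (simp add: H_def)

lemma sp_io: "sp s' (io N s y) = (if s' = s then y else tau N y)" by (simp add: io_def)

lemma sp_io_simps [simp]: "sp s (io N s y) = y" "sp (opp s) (io N s y) = tau N y" "sp s (io N (opp s) y) = tau N y"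
  by (simp_all add: sp_io)

lemma HU_D: "z \<in> HU N \<Longrightarrow> sp s z \<in> fst N" "z \<in> HU N \<Longrightarrow> PB N (sp s z) = tau N (sp (opp s) z)"
  by (simp_all add: HU_def)

lemma HU_I: "(\<And>s. sp s z \<in> fst N) \<Longrightarrow> (\<And>s. PB N (sp s z) = tau N (sp (opp s) z)) \<Longrightarrow> z \<in> HU N"
  by (simp add: HU_def)

context
  fixes N assumes N: "right_module B.QA N"
begin

lemma tau_zero: "tau N 0 = 0" "PB N 0 = 0" "i \<in> verts Q \<Longrightarrow> B.me N i 0 = 0" "a \<in> arcs Q \<Longrightarrow> B.mt N (Inl a) 0 = 0"
  using lin_on_zero[OF tau_lin[OF N] B_sub[OF N]] lin_on_zero[OF PB_lin[OF N] B_sub[OF N]]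
    lin_on_zero[OF B_e[OF N] B_sub[OF N]] lin_on_zero[OF B_t(1)[OF N] B_sub[OF N]] by auto

lemma HU_sub: "kvs.subspace (HU N)"
  by (rule kvs.subspaceI)
    (auto intro!: HU_I kvs.subspace_add[OF B_sub[OF N]] kvs.subspace_scale[OF B_sub[OF N]] kvs.subspace_0[OF B_sub[OF N]]
      simp: HU_D sp_lin lin_on_add[OF tau_lin[OF N]] lin_on_scale[OF tau_lin[OF N]] lin_on_add[OF PB_lin[OF N]] lin_on_scale[OF PB_lin[OF N]] tau_zero)

text \<open>Both coordinate conditions of \<open>HU\<close> reduce to tau tau = PB and PB tau =
  tau.\<close>

lemma io_mem: "y \<in> fst N \<Longrightarrow> io N s y \<in> HU N"
proof (rule HU_I)
  assume y: "y \<in> fst N"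
  fix s'
  show "sp s' (io N s y) \<in> fst N" using y tau_mem[OF N] by (simp add: sp_io)
  show "PB N (sp s' (io N s y)) = tau N (sp (opp s') (io N s y))"
    using y tau_tau[OF N y] PB_tau[OF N y] by (cases s; cases s') (simp_all add: sp_io)
qed

lemma io_lin: "x \<in> fst N \<Longrightarrow> y \<in> fst N \<Longrightarrow> io N s (x + y) = io N s x + io N s y"
  "x \<in> fst N \<Longrightarrow> io N s (scale c x) = scale c (io N s x)" "io N s 0 = 0"
  by (rule sg_eqI; simp add: sp_io sp_lin lin_on_add[OF tau_lin[OF N]] lin_on_scale[OF tau_lin[OF N]] tau_zero)+

text \<open>At special vertices the two embeddings agree up to \<open>tau\<close>; this is the
  identification of the two copies of a special vertex.\<close>

lemma io_tau: "y \<in> fst N \<Longrightarrow> PB N y = y \<Longrightarrow> io N (opp s) (tau N y) = io N s y"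
  by (rule sg_eqI) (auto simp: sp_io tau_tau[OF N] not_eq_opp)

text \<open>\<open>He\<close> uses the sign Plus at a special vertex. The coordinates there are
  exchanged by \<open>tau\<close>, so the sign Minus gives the same map and one formula covers all
  signed vertices.\<close>

lemma He_sv: "z \<in> HU N \<Longrightarrow> i \<in> verts Q \<Longrightarrow> He N (sv i s) z = io N s (B.me N i (sp s z))"
proof (cases "i \<in> Sp \<and> s = Minus")
  case True
  assume z: "z \<in> HU N" and i: "i \<in> verts Q"
  let ?y = "B.me N i (sp Plus z)"
  have y: "?y \<in> fst N" using B_mem(1)[OF N i HU_D(1)[OF z]] .
  have "B.me N i (sp Minus z) = B.me N i (PB N (sp Minus z))" using e_PB[OF N i HU_D(1)[OF z]] True by simp
  also have "\<dots> = tau N ?y" using HU_D(2)[OF z, of Minus] e_tau[OF N i HU_D(1)[OF z]] by simp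
  finally have "io N Minus (B.me N i (sp Minus z)) = io N Plus ?y"
    using io_tau[OF y, of Plus] PB_e[OF N i HU_D(1)[OF z], of Plus] True by simp
  then show ?thesis using True by (simp add: He_def sign_vertex_def)
qed (cases s; auto simp: He_def sign_vertex_def)

lemma tau_e0: "i \<in> verts Q \<Longrightarrow> i \<notin> Sp \<Longrightarrow> u \<in> fst N \<Longrightarrow> tau N (B.me N i u) = 0"
  using tau_e[OF N] by simp

lemma He_lin: "i \<in> verts Q \<Longrightarrow> lin_on (HU N) (He N (sv i s))"
  unfolding lin_on_def
  using kvs.subspace_add[OF HU_sub] kvs.subspace_scale[OF HU_sub]
  by (auto simp: He_sv sp_lin HU_D io_mem io_lin B_mem[OF N] lin_on_add[OF B_e[OF N]] lin_on_scale[OF B_e[OF N]])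

lemma Ht_lin: "a \<in> arcs Q \<Longrightarrow> lin_on (HU N) (Ht N (a, s))"
  unfolding lin_on_def
  by (auto simp: Ht_def sp_lin HU_D io_mem io_lin B_mem[OF N] lin_on_add[OF B_t(1)[OF N]] lin_on_scale[OF B_t(1)[OF N]])

lemma H_rep: "G.qrep (HU N) (He N) (Ht N)"
  unfolding G.qrep_def
proof (intro conjI ballI)
  show "kvs.subspace (HU N)" by (rule HU_sub)
  show "lin_on (HU N) (He N v)" if "v \<in> verts QG" for v using that He_lin by auto
  show "lin_on (HU N) (Ht N a)" if "a \<in> arcs QG" for a using that Ht_lin by auto
  show "He N w (He N v u) = (if w = v then He N v u else 0)" if vw: "v \<in> verts QG" "w \<in> verts QG" and u: "u \<in> HU N" for v w u
  proof -
    obtain i s j s' where v: "v = sv i s" "i \<in> verts Q" and w: "w = sv j s'" "j \<in> verts Q" using vw by auto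
    have m: "He N v u \<in> HU N" using lin_on_mem[OF He_lin u] v by simp
    have e: "B.me N i (sp s u) \<in> fst N" using B_mem(1)[OF N v(2) HU_D(1)[OF u]] .
    show ?thesis
    proof (cases "s' = s \<or> j \<in> Sp")
      case True
      then have w': "w = sv j s" using w by (auto simp: sv_eq_iff)
      have "He N w (He N v u) = io N s (B.me N j (B.me N i (sp s u)))"
        using He_sv[OF m w(2)] He_sv[OF u v(2)] v w' by simp
      also have "\<dots> = (if j = i then He N v u else 0)"
        using B_ee[OF N v(2) w(2) HU_D(1)[OF u]] He_sv[OF u v(2)] v io_lin(3) by simp
      finally show ?thesis using w' v by (simp add: sv_eq_iff)
    next
      case False
      then have "s' = opp s" using not_eq_opp by blast
      then have "He N w (He N v u) = io N s' (B.me N j (tau N (B.me N i (sp s u))))"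
        using He_sv[OF m w(2)] He_sv[OF u v(2)] v w by simp
      \<comment> \<open>The opposite coordinate of a vector in the image of \<open>io\<close> lies
        in the special part, so it has no component at a non-special vertex.\<close>
      also have "\<dots> = 0" using e_tau[OF N w(2) e] tau_e0[OF w(2) _ e] False io_lin(3) by simp
      finally show ?thesis using v w False by (auto simp: sv_eq_iff)
    qed
  qed
  show "(\<Sum>v\<in>verts QG. He N v u) = u" if u: "u \<in> HU N" for u
  proof (rule sg_eqI)
    fix s
    \<comment> \<open>In coordinate \<open>s\<close> the vertices of sign \<open>s\<close> already
      give everything; the remaining ones are non-special and appear there only through
      \<open>tau\<close>, which kills them.\<close>
    have "(\<Sum>v\<in>verts QG. sp s (He N v u)) = (\<Sum>i\<in>verts Q. sp s (He N (sv i s) u)) + (\<Sum>i\<in>verts Q - Sp. sp s (He N (sv i (opp s)) u))"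
      by (rule sum_QG)
    also have "(\<Sum>i\<in>verts Q. sp s (He N (sv i s) u)) = sp s u"
      using B_one[OF N HU_D(1)[OF u]] He_sv[OF u] by simp
    also have "(\<Sum>i\<in>verts Q - Sp. sp s (He N (sv i (opp s)) u)) = 0"
      by (intro sum.neutral ballI) (use He_sv[OF u] tau_e0 HU_D(1)[OF u] in auto)
    finally show "sp s (\<Sum>v\<in>verts QG. He N v u) = sp s u" by (simp add: sp_sum)
  qed
  show "Ht N a (He N w u) = (if w = tail QG a then Ht N a u else 0)" if aw: "a \<in> arcs QG" "w \<in> verts QG" and u: "u \<in> HU N" for a w u
  proof -
    obtain b s i s' where a: "a = (b, s)" "b \<in> arcs Q" and w: "w = sv i s'" "i \<in> verts Q" using aw by auto
    have e: "B.me N i (sp s u) \<in> fst N" for s using B_mem(1)[OF N w(2) HU_D(1)[OF u]] .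
    show ?thesis
    proof (cases "s' = s \<or> i \<in> Sp")
      case True
      then have w': "w = sv i s" using w by (auto simp: sv_eq_iff)
      have "Ht N a (He N w u) = io N s (B.mt N (Inl b) (B.me N i (sp s u)))"
        using He_sv[OF u w(2)] a w' by (simp add: Ht_def)
      then show ?thesis using B_te(1)[OF N a(2) w(2) HU_D(1)[OF u]] w' a io_lin(3) by (auto simp: Ht_def sv_eq_iff)
    next
      case False
      then have "s' = opp s" using not_eq_opp by blast
      then have "Ht N a (He N w u) = io N s (B.mt N (Inl b) (tau N (B.me N i (sp s' u))))"
        using He_sv[OF u w(2)] a w by (simp add: Ht_def)
      also have "\<dots> = 0" using tau_e0[OF w(2) _ HU_D(1)[OF u]] False io_lin(3) tau_zero(4)[OF a(2)] by simp
      finally show ?thesis using a w False by (auto simp: sv_eq_iff)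
    qed
  qed
  show "He N w (Ht N a u) = (if w = head QG a then Ht N a u else 0)" if aw: "a \<in> arcs QG" "w \<in> verts QG" and u: "u \<in> HU N" for a w u
  proof -
    obtain b s i s' where a: "a = (b, s)" "b \<in> arcs Q" and w: "w = sv i s'" "i \<in> verts Q" using aw by auto
    have m: "Ht N a u \<in> HU N" using lin_on_mem[OF Ht_lin u] a by simp
    have t: "B.mt N (Inl b) (sp s u) \<in> fst N" using B_mem(2)[OF N a(2) HU_D(1)[OF u]] .
    show ?thesis
    proof (cases "s' = s \<or> i \<in> Sp")
      case True
      then have w': "w = sv i s" using w by (auto simp: sv_eq_iff)
      have "He N w (Ht N a u) = io N s (B.me N i (B.mt N (Inl b) (sp s u)))"
        using He_sv[OF m w(2)] a w' by (simp add: Ht_def)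
      then show ?thesis using B_et(1)[OF N a(2) w(2) HU_D(1)[OF u]] w' a io_lin(3) by (auto simp: Ht_def sv_eq_iff)
    next
      case False
      then have "s' = opp s" using not_eq_opp by blast
      then have "He N w (Ht N a u) = io N s' (B.me N i (tau N (B.mt N (Inl b) (sp s u))))"
        using He_sv[OF m w(2)] a w by (simp add: Ht_def)
      also have "\<dots> = 0" using e_tau[OF N w(2) t] tau_e0[OF w(2) _ t] False io_lin(3) by simp
      finally show ?thesis using a w False by (auto simp: sv_eq_iff)
    qed
  qed
qed

lemma H_rel: "r \<in> RG \<Longrightarrow> z \<in> HU N \<Longrightarrow> G.xact (He N) (Ht N) r z = 0"
proof -
  assume r: "r \<in> RG" and z: "z \<in> HU N"
  then obtain a b s where ab: "(a, b) \<in> I" "r = path2_elem QG ((a, s), (b, s))" by (auto simp: RG_def)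
  have "Ht N (b, s) (Ht N (a, s) z) = 0"
    using B_rel[OF N ab(1) HU_D(1)[OF z]] io_lin(3) by (simp add: Ht_def)
  then show ?thesis using G.xact_path2[OF H_rep z, of "(a, s)" "(b, s)"] I_D[OF ab(1)] ab(2) by (auto simp: paths2_def)
qed

lemma H_right: "right_module G.QA (H N)"
  unfolding H_def by (rule G.qmod_right_module[OF H_rep H_rel])

lemma H_me: "z \<in> HU N \<Longrightarrow> i \<in> verts Q \<Longrightarrow> G.me (H N) (sv i s) z = io N s (B.me N i (sp s z))"
  unfolding H_def using B.qmod_me(1) G.qmod_me(1)[OF H_rep H_rel] He_sv by simp

lemma H_mt: "z \<in> HU N \<Longrightarrow> a \<in> arcs Q \<Longrightarrow> G.mt (H N) (a, s) z = io N s (B.mt N (Inl a) (sp s z))"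
  unfolding H_def using G.qmod_me(2)[OF H_rep H_rel, of z "(a, s)"] by (simp add: Ht_def)

text \<open>The projection to sign \<open>s\<close> keeps coordinate \<open>s\<close>; of the other
  coordinate the special part survives, which is \<open>tau\<close> of the kept one.\<close>

lemma pG_H: "z \<in> HU N \<Longrightarrow> pG (H N) s z = io N s (sp s z)"
proof (rule sg_eqI)
  fix s' assume z: "z \<in> HU N"
  have "tau N (sp s z) = (\<Sum>i\<in>verts Q. tau N (B.me N i (sp s z)))"
    using lin_on_sum[OF tau_lin[OF N] B_sub[OF N], of "verts Q" "\<lambda>i. B.me N i (sp s z)"]
      B_one[OF N HU_D(1)[OF z]] B_mem(1)[OF N _ HU_D(1)[OF z]] by simp
  then show "sp s' (pG (H N) s z) = sp s' (io N s (sp s z))"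
    using z B_one[OF N HU_D(1)[OF z]] by (simp add: pG_def sp_sum H_me sp_io)
qed

end

lemma H_MO: "N \<in> FB.MO \<Longrightarrow> H N \<in> FG.MO"
  using fd_signed[of "fst N" "HU N"] H_right HU_sub HU_D(1) by (auto simp: FB.MO_iff FG.MO_iff)

section \<open>The functors on morphisms\<close>

lemma hom_pG:
  assumes f: "f \<in> FG.MH M M'" and M: "M \<in> FG.MO" and u: "u \<in> fst M"
  shows "f (pG M s u) = pG M' s (f u)" "f (PG M u) = PG M' (f u)"
proof -
  note R = MO_right(2)[OF M]
  have sum: "f (sum g K) = (\<Sum>k\<in>K. f (g k))" if "\<And>k. k \<in> K \<Longrightarrow> g k \<in> fst M" for g and K :: "'v set"
    using that
  proof (induction K rule: infinite_finite_induct)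
    case (insert k K)
    then have "sum g K \<in> fst M" using kvs.subspace_sum[OF G_sub[OF R]] by blast
    then show ?case using insert FG.MH_lin(1)[OF f] by simp
  qed (use FG.MH_diff[OF f M kvs.subspace_0[OF G_sub[OF R]] kvs.subspace_0[OF G_sub[OF R]]] in simp_all)
  show "f (pG M s u) = pG M' s (f u)"
    unfolding pG_def using G_mem(1)[OF R] u G_homD(1)[OF f u] by (subst sum) auto
  show "f (PG M u) = PG M' (f u)"
    unfolding PG_def using lin_on_mem[OF G_eS[OF R]] u G_homD(1)[OF f u SpV, of _ Plus] sv_Sp by (subst sum) auto
qed

lemma hom_tau:
  assumes f: "f \<in> FB.MH N N'" and N: "N \<in> FB.MO" and u: "u \<in> fst N"
  shows "f (tau N u) = tau N' (f u)" "f (PB N u) = PB N' (f u)"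
proof -
  note R = MO_right(1)[OF N]
  have sum: "f (sum g K) = (\<Sum>k\<in>K. f (g k))" if "\<And>k. k \<in> K \<Longrightarrow> g k \<in> fst N" for g and K :: "'v set"
    using that
  proof (induction K rule: infinite_finite_induct)
    case (insert k K)
    then have "sum g K \<in> fst N" using kvs.subspace_sum[OF B_sub[OF R]] by blast
    then show ?case using insert FB.MH_lin(1)[OF f] by simp
  qed (use FB.MH_diff[OF f N kvs.subspace_0[OF B_sub[OF R]] kvs.subspace_0[OF B_sub[OF R]]] in simp_all)
  have e: "B.me N i u \<in> fst N" "B.mt N (Inr i) u \<in> fst N" "scale 2 (B.mt N (Inr i) u) \<in> fst N" if "i \<in> Sp" for i
    using B_mem[OF R _ u] SpV[OF that] that kvs.subspace_scale[OF B_sub[OF R]] by auto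
  show "f (tau N u) = tau N' (f u)"
    unfolding tau_def using kvs.subspace_diff[OF B_sub[OF R] e(1,3)]
    by (subst sum) (auto intro!: sum.cong simp: FB.MH_diff[OF f N e(1,3)] FB.MH_lin(2)[OF f e(2)] B_homD[OF f u] SpV)
  show "f (PB N u) = PB N' (f u)"
    unfolding PB_def using e by (subst sum) (auto intro!: sum.cong simp: B_homD[OF f u] SpV)
qed

lemma MH_zero: "f \<in> FG.MH M M' \<Longrightarrow> M \<in> FG.MO \<Longrightarrow> f 0 = 0" "g \<in> FB.MH N N' \<Longrightarrow> N \<in> FB.MO \<Longrightarrow> g 0 = 0"
  using FG.MH_lin(2)[of f M M' 0 0] kvs.subspace_0[OF FG.MO_subspace] FB.MH_lin(2)[of g N N' 0 0] kvs.subspace_0[OF FB.MO_subspace]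
  by auto

definition Fm :: "('k, 'v, 'a) gentle_mod \<Rightarrow> ('k, 'v, 'a) gentle_mod \<Rightarrow> ('k vec \<Rightarrow> 'k vec) \<Rightarrow> 'k vec \<Rightarrow> 'k vec" where
  "Fm M M' f = (\<lambda>z\<in>FU M. dbl f z)"

definition Hm :: "('k, 'v, 'a) skew_mod \<Rightarrow> ('k, 'v, 'a) skew_mod \<Rightarrow> ('k vec \<Rightarrow> 'k vec) \<Rightarrow> 'k vec \<Rightarrow> 'k vec" where
  "Hm N N' f = (\<lambda>z\<in>HU N. dbl f z)"

lemma Fm_MH:
  assumes M: "M \<in> FG.MO" "M' \<in> FG.MO" and f: "f \<in> FG.MH M M'" shows "Fm M M' f \<in> FB.MH (F M) (F M')"
proof -
  note R = MO_right(2)[OF M(1)] and R' = MO_right(2)[OF M(2)]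
  have m: "dbl f z \<in> FU M'" if "z \<in> FU M" for z
    by (rule FU_I) (use FG.MH_mem[OF f FU_D(1)[OF that]] FU_D(2)[OF that] in \<open>simp_all flip: hom_pG(1)[OF f M(1) FU_D(1)[OF that]]\<close>)
  have "(\<lambda>z\<in>fst (F M). dbl f z) \<in> FB.MH (F M) (F M')"
  proof (rule B_homI[OF F_MO[OF M(1)] F_MO[OF M(2)]]; unfold fst_F)
    fix u w c i a assume u: "u \<in> FU M"
    note u' = FU_D(1)[OF u]
    show "dbl f u \<in> FU M'" by (rule m[OF u])
    show "dbl f (u + w) = dbl f u + dbl f w" if w: "w \<in> FU M"
      by (rule sg_eqI) (simp add: sp_lin FG.MH_lin[OF f] u' FU_D(1)[OF w])
    show "dbl f (scale c u) = scale c (dbl f u)"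
      by (rule sg_eqI) (simp add: sp_lin FG.MH_lin[OF f] u')
    show "dbl f (B.me (F M) i u) = B.me (F M') i (dbl f u)" if "i \<in> verts Q"
      unfolding F_me[OF R u] F_me[OF R' m[OF u]] by (rule sg_eqI) (simp add: G_homD[OF f u'] that)
    show "dbl f (B.mt (F M) (Inl a) u) = B.mt (F M') (Inl a) (dbl f u)" if "a \<in> arcs Q"
      unfolding F_mt(1)[OF R u that] F_mt(1)[OF R' m[OF u] that] by (rule sg_eqI) (simp add: G_homD[OF f u'] that)
    show "dbl f (B.mt (F M) (Inr i) u) = B.mt (F M') (Inr i) (dbl f u)" if i: "i \<in> Sp"
    proof -
      note V = SpV[OF i]
      have e: "G.me M (sv i s) (sp s' u) \<in> fst M" for s s' using G_mem(1)[OF R V u'] .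
      show ?thesis
        unfolding F_mt(2)[OF R u i] F_mt(2)[OF R' m[OF u] i]
        by (rule sg_eqI) (simp add: G_homD[OF f u'] V FG.MH_lin(2)[OF f kvs.subspace_diff[OF G_sub[OF R] e e]] FG.MH_diff[OF f M(1) e e])
    qed
  qed
  then show ?thesis by (simp add: Fm_def)
qed

lemma dbl_io:
  assumes f: "f \<in> FB.MH N N'" and N: "N \<in> FB.MO" and y: "y \<in> fst N"
  shows "dbl f (io N s y) = io N' s (f y)"
  by (rule sg_eqI) (simp add: sp_io hom_tau[OF f N y])

lemma Hm_MH:
  assumes N: "N \<in> FB.MO" "N' \<in> FB.MO" and f: "f \<in> FB.MH N N'" shows "Hm N N' f \<in> FG.MH (H N) (H N')"
proof -
  note R = MO_right(1)[OF N(1)] and R' = MO_right(1)[OF N(2)]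
  have m: "dbl f z \<in> HU N'" if "z \<in> HU N" for z
    by (rule HU_I) (use FB.MH_mem[OF f HU_D(1)[OF that]] hom_tau[OF f N(1) HU_D(1)[OF that]] HU_D(2)[OF that] in \<open>simp_all flip: hom_tau[OF f N(1) HU_D(1)[OF that]]\<close>)
  have "(\<lambda>z\<in>fst (H N). dbl f z) \<in> FG.MH (H N) (H N')"
  proof (rule G_homI[OF H_MO[OF N(1)] H_MO[OF N(2)]]; unfold fst_H)
    fix u w c i a s assume u: "u \<in> HU N"
    note u' = HU_D(1)[OF u]
    show "dbl f u \<in> HU N'" by (rule m[OF u])
    show "dbl f (u + w) = dbl f u + dbl f w" if w: "w \<in> HU N"
      by (rule sg_eqI) (simp add: sp_lin FB.MH_lin[OF f] u' HU_D(1)[OF w])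
    show "dbl f (scale c u) = scale c (dbl f u)"
      by (rule sg_eqI) (simp add: sp_lin FB.MH_lin[OF f] u')
    show "dbl f (G.me (H N) (sv i s) u) = G.me (H N') (sv i s) (dbl f u)" if i: "i \<in> verts Q"
      unfolding H_me[OF R u i] H_me[OF R' m[OF u] i] by (simp add: dbl_io[OF f N(1) B_mem(1)[OF R i u']] B_homD[OF f u'] i)
    show "dbl f (G.mt (H N) (a, s) u) = G.mt (H N') (a, s) (dbl f u)" if a: "a \<in> arcs Q"
      unfolding H_mt[OF R u a] H_mt[OF R' m[OF u] a] by (simp add: dbl_io[OF f N(1) B_mem(2)[OF R a u']] B_homD[OF f u'] a)
  qed
  then show ?thesis by (simp add: Hm_def)
qed

section \<open>The adjunctions between the two functors\<close>

definition ks :: "('k, 'v, 'a) gentle_mod \<Rightarrow> sign \<Rightarrow> 'k vec \<Rightarrow> 'k vec" where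
  "ks M s m = sg (\<lambda>s'. if s' = s then pG M s m else 0)"

lemma sp_ks: "sp s' (ks M s m) = (if s' = s then pG M s m else 0)" by (simp add: ks_def)

context
  fixes M assumes M: "right_module G.QA M"
begin

lemma ks_mem: "m \<in> fst M \<Longrightarrow> ks M s m \<in> FU M"
  by (rule FU_I) (simp_all add: sp_ks pG_mem[OF M] pG_pG[OF M] pG_zero[OF M] kvs.subspace_0[OF G_sub[OF M]])

lemma ks_lin: "m \<in> fst M \<Longrightarrow> m' \<in> fst M \<Longrightarrow> ks M s (m + m') = ks M s m + ks M s m'"
  "m \<in> fst M \<Longrightarrow> ks M s (scale c m) = scale c (ks M s m)" "ks M s 0 = 0"
  by (rule sg_eqI; simp add: sp_ks sp_lin lin_on_add[OF pG_lin[OF M]] lin_on_scale[OF pG_lin[OF M]] pG_zero[OF M])+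

lemma ks_sum: "z \<in> FU M \<Longrightarrow> ks M Plus (sp Plus z) + ks M Minus (sp Minus z) = z"
proof (rule sg_eqI)
  fix s assume "z \<in> FU M"
  then show "sp s (ks M Plus (sp Plus z) + ks M Minus (sp Minus z)) = sp s z"
    by (cases s) (simp_all add: sp_lin sp_ks FU_D)
qed

lemma PG_pG: "m \<in> fst M \<Longrightarrow> pG M (opp s) (pG M s m) = PG M m" "m \<in> fst M \<Longrightarrow> pG M s (pG M (opp s) m) = PG M m"
  using pG_pG[OF M] by simp_all

text \<open>\<open>tau\<close> moves the special part to the other coordinate, and that part is what
  the second sign projection inside \<open>ks\<close> leaves.\<close>

lemma tau_ks: "m \<in> fst M \<Longrightarrow> tau (F M) (ks M s m) = ks M (opp s) (pG M s m)"
proof (rule sg_eqI)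
  fix s' assume m: "m \<in> fst M"
  show "sp s' (tau (F M) (ks M s m)) = sp s' (ks M (opp s) (pG M s m))"
    unfolding sp_tau_F[OF M ks_mem[OF m]]
    by (cases s; cases s') (simp_all add: sp_ks pG_zero[OF M] pG_PG_swap[OF M m] PG_pG[OF m, of Plus, simplified] PG_pG[OF m, of Minus, simplified])
qed

lemma PB_ks: "m \<in> fst M \<Longrightarrow> PB (F M) (ks M s m) = tau (F M) (ks M (opp s) m)"
proof (rule sg_eqI)
  fix s' assume m: "m \<in> fst M"
  show "sp s' (PB (F M) (ks M s m)) = sp s' (tau (F M) (ks M (opp s) m))"
    unfolding sp_tau_F[OF M ks_mem[OF m]] sp_PB_F[OF M ks_mem[OF m]]
    by (cases s; cases s') (simp_all add: sp_ks pG_zero[OF M] pG_PG_swap[OF M m])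
qed

lemma ks_e: "i \<in> verts Q \<Longrightarrow> m \<in> fst M \<Longrightarrow> ks M s (G.me M (sv i s) m) = B.me (F M) i (ks M s m)"
  unfolding F_me[OF M ks_mem]
  by (rule sg_eqI) (simp add: sp_ks pG_e[OF M] e_pG[OF M] G_zero[OF M])

lemma ks_t: "a \<in> arcs Q \<Longrightarrow> m \<in> fst M \<Longrightarrow> ks M s (G.mt M (a, s) m) = B.mt (F M) (Inl a) (ks M s m)"
  unfolding F_mt(1)[OF M ks_mem]
  by (rule sg_eqI) (simp add: sp_ks pG_t[OF M] t_pG[OF M] G_zero[OF M])

end

text \<open>\<open>ks\<close> places the sign-\<open>s\<close> part of a vector in coordinate
  \<open>s\<close> of F X; applying \<open>g\<close> to both placements gives the adjoint morphism.
  Its values satisfy the condition of \<open>HU\<close> because \<open>PB\<close> of one placement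
  is \<open>tau\<close> of the other and \<open>g\<close> commutes with both maps.\<close>

lemma F_transpose:
  assumes X: "X \<in> FG.MO" and N: "N \<in> FB.MO" and g: "g \<in> FB.MH (F X) N"
  shows "(\<lambda>m\<in>fst X. sg (\<lambda>s. g (ks X s m))) \<in> FG.MH X (H N)"
proof -
  note R = MO_right(2)[OF X] and R' = MO_right(1)[OF N]
  note FX = F_MO[OF X]
  have k: "ks X s m \<in> fst (F X)" if "m \<in> fst X" for s m using ks_mem[OF R that] by simp
  have mem: "sg (\<lambda>s. g (ks X s m)) \<in> HU N" if m: "m \<in> fst X" for m
    by (rule HU_I) (use FB.MH_mem[OF g k[OF m]] PB_ks[OF R m] in \<open>simp_all flip: hom_tau[OF g FX k[OF m]]\<close>)
  \<comment> \<open>On a vector of sign \<open>s\<close> the transpose takes values in the image of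
    \<open>io N s\<close>, which is where the vertices and arrows of H N act.\<close>
  have fixed: "sg (\<lambda>s'. g (ks X s' m)) = io N s (g (ks X s m))" if m: "m \<in> fst X" "pG X s m = m" for s m
  proof (rule sg_eqI)
    fix s'
    have "tau N (g (ks X s m)) = g (ks X (opp s) m)"
      using hom_tau(1)[OF g FX k[OF m(1)], of s] tau_ks[OF R m(1), of s] m(2) by simp
    then show "sp s' (sg (\<lambda>s'. g (ks X s' m))) = sp s' (io N s (g (ks X s m)))"
      using not_eq_opp[of s' s] by (auto simp: sp_io)
  qed
  show ?thesis
  proof (rule G_homI[OF X H_MO[OF N]]; (unfold fst_H)?)
    fix u w c i a s assume u: "u \<in> fst X"
    show "sg (\<lambda>s. g (ks X s u)) \<in> HU N" by (rule mem[OF u])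
    show "sg (\<lambda>s. g (ks X s (u + w))) = sg (\<lambda>s. g (ks X s u)) + sg (\<lambda>s. g (ks X s w))" if w: "w \<in> fst X"
      by (rule sg_eqI) (simp add: sp_lin ks_lin[OF R] u w FB.MH_lin(1)[OF g k[OF u] k[OF w]])
    show "sg (\<lambda>s. g (ks X s (scale c u))) = scale c (sg (\<lambda>s. g (ks X s u)))"
      by (rule sg_eqI) (simp add: sp_lin ks_lin[OF R] u FB.MH_lin(2)[OF g k[OF u]])
    show "sg (\<lambda>s'. g (ks X s' (G.me X (sv i s) u))) = G.me (H N) (sv i s) (sg (\<lambda>s. g (ks X s u)))" if i: "i \<in> verts Q"
      unfolding H_me[OF R' mem[OF u] i] using fixed[OF G_mem(1)[OF R i u] , of s s] pG_e[OF R i u, of s s] ks_e[OF R i u, of s] B_homD(1)[OF g k[OF u] i, of s]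
      by simp
    show "sg (\<lambda>s'. g (ks X s' (G.mt X (a, s) u))) = G.mt (H N) (a, s) (sg (\<lambda>s. g (ks X s u)))" if a: "a \<in> arcs Q"
      unfolding H_mt[OF R' mem[OF u] a] using fixed[OF G_mem(2)[OF R a u] , of s s] pG_t[OF R a u, of s] ks_t[OF R a u, of s] B_homD(2)[OF g k[OF u] a, of s]
      by simp
  qed
qed

text \<open>Here \<open>io\<close> plays the part of \<open>ks\<close>: both placements of a vector
  in H Y are sent through \<open>g\<close>. Vertices and arrows are compatible by construction; the
  loop needs the identification of the placements at special vertices.\<close>

lemma H_transpose:
  assumes Y: "Y \<in> FB.MO" and M: "M \<in> FG.MO" and g: "g \<in> FG.MH (H Y) M"
  shows "(\<lambda>n\<in>fst Y. sg (\<lambda>s. g (io Y s n))) \<in> FB.MH Y (F M)"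
proof -
  note R = MO_right(1)[OF Y] and R' = MO_right(2)[OF M] and HY = H_MO[OF Y]
  have k: "io Y s n \<in> fst (H Y)" if "n \<in> fst Y" for s n using io_mem[OF R that] by simp
  have mem: "sg (\<lambda>s. g (io Y s n)) \<in> FU M" if n: "n \<in> fst Y" for n
    by (rule FU_I) (use FG.MH_mem[OF g k[OF n]] pG_H[OF R io_mem[OF R n]] in \<open>simp_all flip: hom_pG[OF g HY k[OF n]]\<close>)
  show ?thesis
  proof (rule B_homI[OF Y F_MO[OF M]]; (unfold fst_F)?)
    fix u w c i a assume u: "u \<in> fst Y"
    show "sg (\<lambda>s. g (io Y s u)) \<in> FU M" by (rule mem[OF u])
    show "sg (\<lambda>s. g (io Y s (u + w))) = sg (\<lambda>s. g (io Y s u)) + sg (\<lambda>s. g (io Y s w))" if w: "w \<in> fst Y"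
      by (rule sg_eqI) (simp add: sp_lin io_lin[OF R] u w FG.MH_lin(1)[OF g k[OF u] k[OF w]])
    show "sg (\<lambda>s. g (io Y s (scale c u))) = scale c (sg (\<lambda>s. g (io Y s u)))"
      by (rule sg_eqI) (simp add: sp_lin io_lin[OF R] u FG.MH_lin(2)[OF g k[OF u]])
    have e: "g (io Y s (B.me Y i n)) = G.me M (sv i s) (g (io Y s n))" if "i \<in> verts Q" "n \<in> fst Y" for i s n
      using G_homD(1)[OF g k[OF that(2)] that(1), of s s] H_me[OF R io_mem[OF R that(2)] that(1)] by simp
    show "sg (\<lambda>s. g (io Y s (B.me Y i u))) = B.me (F M) i (sg (\<lambda>s. g (io Y s u)))" if i: "i \<in> verts Q"
      unfolding F_me[OF R' mem[OF u]] by (rule sg_eqI) (simp add: e[OF i u])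
    show "sg (\<lambda>s. g (io Y s (B.mt Y (Inl a) u))) = B.mt (F M) (Inl a) (sg (\<lambda>s. g (io Y s u)))" if a: "a \<in> arcs Q"
      unfolding F_mt(1)[OF R' mem[OF u] a]
    proof (rule sg_eqI)
      show "sp s (sg (\<lambda>s. g (io Y s (B.mt Y (Inl a) u)))) = sp s (Ft M (Inl a) (sg (\<lambda>s. g (io Y s u))))" for s
        using G_homD(2)[OF g k[OF u] a, of s s] H_mt[OF R io_mem[OF R u] a, of s s] by simp
    qed
    show "sg (\<lambda>s. g (io Y s (B.mt Y (Inr i) u))) = B.mt (F M) (Inr i) (sg (\<lambda>s. g (io Y s u)))" if i: "i \<in> Sp"
      unfolding F_mt(2)[OF R' mem[OF u] i]
    proof (rule sg_eqI)
      fix s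
      note V = SpV[OF i]
      have me: "B.me Y i u \<in> fst Y" using B_mem(1)[OF R V u] .
      have te: "tau Y (B.me Y i u) \<in> fst Y" using tau_mem[OF R me] .
      \<comment> \<open>The opposite placement of a special component is the placement at
        \<open>s\<close> of its image under \<open>tau\<close>, so the half difference in F M
        becomes (1 - tau)/2, which is the loop.\<close>
      have "G.me M (sv i s) (g (io Y (opp s) u)) = g (io Y (opp s) (B.me Y i u))"
        using e[OF V u, of "opp s"] i by (simp add: sv_Sp)
      also have "io Y (opp s) (B.me Y i u) = io Y s (tau Y (B.me Y i u))"
        using io_tau[OF R me, of "opp s"] PB_e[OF R V u] i by simp
      finally have o: "G.me M (sv i s) (g (io Y (opp s) u)) = g (io Y s (tau Y (B.me Y i u)))" .
      have "io Y s (B.mt Y (Inr i) u) = io Y s (scale (1/2) (B.me Y i u - tau Y (B.me Y i u)))" using eps_tau[OF R i u] by simp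
      also have "\<dots> = scale (1/2) (io Y s (B.me Y i u) - io Y s (tau Y (B.me Y i u)))"
        using io_lin(2)[OF R kvs.subspace_diff[OF B_sub[OF R] me te]] io_lin(1)[OF R kvs.subspace_diff[OF B_sub[OF R] me te] te] by simp
      finally show "sp s (sg (\<lambda>s. g (io Y s (B.mt Y (Inr i) u)))) = sp s (Ft M (Inr i) (sg (\<lambda>s. g (io Y s u))))"
        using FG.MH_lin(2)[OF g kvs.subspace_diff[OF FG.MO_subspace[OF HY] k[OF me] k[OF te]]] FG.MH_diff[OF g HY k[OF me] k[OF te]] o e[OF V u, of s]
        by simp
    qed
  qed
qed

text \<open>Counit F (H N) -> N. The inner \<open>sp\<close> selects the coordinate of F, the outer
  one that of H; only equal signs contribute.\<close>

definition eF :: "'k vec \<Rightarrow> 'k vec" where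
  "eF z = sp Plus (sp Plus z) + sp Minus (sp Minus z)"

text \<open>Counit H (F M) -> M, the glueing formula of \<open>pG_glue\<close>. The two diagonal
  coordinates share their special part, which a plain sum would count twice.\<close>

definition eH :: "('k, 'v, 'a) gentle_mod \<Rightarrow> 'k vec \<Rightarrow> 'k vec" where
  "eH M w = sp Plus (sp Plus w) + (sp Minus (sp Minus w) - PG M (sp Minus (sp Minus w)))"

lemma eF_hom:
  assumes N: "N \<in> FB.MO" shows "(\<lambda>z\<in>FU (H N). eF z) \<in> FB.MH (F (H N)) N"
proof -
  note R = MO_right(1)[OF N]
  note R' = H_right[OF R]
  have d: "sp s (sp s z) \<in> fst N" if "z \<in> FU (H N)" for s z using HU_D(1)[OF FU_D(1)[OF that, unfolded fst_H]] .
  have "(\<lambda>z\<in>fst (F (H N)). eF z) \<in> FB.MH (F (H N)) N"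
  proof (rule B_homI[OF F_MO[OF H_MO[OF N]] N]; unfold fst_F)
    fix u w c i a assume u: "u \<in> FU (H N)"
    have uh: "sp s u \<in> HU N" for s using FU_D(1)[OF u] by simp
    show "eF u \<in> fst N" unfolding eF_def by (intro kvs.subspace_add[OF B_sub[OF R]] d u)
    show "eF (u + w) = eF u + eF w" by (simp add: eF_def sp_lin)
    show "eF (scale c u) = scale c (eF u)" by (simp add: eF_def sp_lin kvs.scale_right_distrib)
    show "eF (B.me (F (H N)) i u) = B.me N i (eF u)" if i: "i \<in> verts Q"
      unfolding F_me[OF R' u] eF_def by (simp add: H_me[OF R uh i] lin_on_add[OF B_e[OF R i] d[OF u] d[OF u]])
    show "eF (B.mt (F (H N)) (Inl a) u) = B.mt N (Inl a) (eF u)" if a: "a \<in> arcs Q"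
      unfolding F_mt(1)[OF R' u a] eF_def by (simp add: H_mt[OF R uh a] lin_on_add[OF B_t(1)[OF R a] d[OF u] d[OF u]])
    show "eF (B.mt (F (H N)) (Inr i) u) = B.mt N (Inr i) (eF u)" if i: "i \<in> Sp"
    proof -
      note V = SpV[OF i]
      have m: "B.me N i (sp s (sp s u)) \<in> fst N" for s using B_mem(1)[OF R V d[OF u]] .
      have h: "G.me (H N) (sv i s) (sp s' u) = io N s' (B.me N i (sp s' (sp s' u)))" for s s'
        using H_me[OF R uh V, of s' s'] i by (simp add: sv_Sp)
      \<comment> \<open>Each half difference in F (H N) compares a diagonal coordinate with
        \<open>tau\<close> of the other one; their sum is (1 - tau)/2 applied to the counit.\<close>
      have "eF (B.mt (F (H N)) (Inr i) u) = scale (1/2) (B.me N i (sp Plus (sp Plus u)) - tau N (B.me N i (sp Minus (sp Minus u))))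
          + scale (1/2) (B.me N i (sp Minus (sp Minus u)) - tau N (B.me N i (sp Plus (sp Plus u))))"
        unfolding F_mt(2)[OF R' u i] eF_def by (simp add: h sp_lin sp_diff sp_io)
      also have "\<dots> = scale (1/2) (B.me N i (eF u) - tau N (B.me N i (eF u)))"
        by (simp add: eF_def lin_on_add[OF B_e[OF R V] d[OF u] d[OF u]] lin_on_add[OF tau_lin[OF R] m m] flip: kvs.scale_right_distrib)
      also have "\<dots> = B.mt N (Inr i) (eF u)"
        by (rule eps_tau[OF R i]) (unfold eF_def, intro kvs.subspace_add[OF B_sub[OF R]] d u)
      finally show ?thesis .
    qed
  qed
  then show ?thesis by simp
qed

lemma eH_pG:
  assumes M: "M \<in> FG.MO" and w: "w \<in> HU (F M)"
  shows "eH M w \<in> fst M" "pG M s (eH M w) = sp s (sp s w)"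
proof -
  note R = MO_right(2)[OF M]
  have wf: "sp s w \<in> FU M" for s using HU_D(1)[OF w] by simp
  have "PG M (sp Plus (sp Plus w)) = PG M (sp Minus (sp Minus w))"
    using arg_cong[OF HU_D(2)[OF w, of Plus], of "sp Plus"] sp_PB_F[OF R wf, of Plus Plus] sp_tau_F[OF R wf, of Plus Minus] by simp
  note h = pG_glue[OF R, of "\<lambda>s. sp s (sp s w)", OF FU_D(1)[OF wf] FU_D(2)[OF wf] this]
  show "eH M w \<in> fst M" "pG M s (eH M w) = sp s (sp s w)" using h by (simp_all add: eH_def)
qed

text \<open>Shows that the counit recovers each coordinate from its placement; it yields both
  compatibility with the action and uniqueness of transposes. Equality is tested on the two sign
  projections.\<close>

lemma eH_io:
  assumes M: "M \<in> FG.MO" and y: "y \<in> FU M" shows "eH M (io (F M) s y) = sp s y"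
proof -
  note R = MO_right(2)[OF M]
  have io: "io (F M) s y \<in> HU (F M)" using io_mem[OF F_right[OF R]] y by simp
  show ?thesis
  proof (rule pG_ext[OF R eH_pG(1)[OF M io] FU_D(1)[OF y]])
    fix r
    show "pG M r (eH M (io (F M) s y)) = pG M r (sp s y)"
      unfolding eH_pG(2)[OF M io] using FU_D(2)[OF y, of s] pG_pG[OF R FU_D(1)[OF y], of r s s] sp_tau_F[OF R y]
      by (cases "r = s") (auto simp: sp_io not_eq_opp)
  qed
qed

lemma eH_hom:
  assumes M: "M \<in> FG.MO" shows "(\<lambda>w\<in>HU (F M). eH M w) \<in> FG.MH (H (F M)) M"
proof -
  note R = MO_right(2)[OF M]
  note R' = F_right[OF R]
  have d: "sp s (sp s z) \<in> fst M" if "z \<in> HU (F M)" for s z using FU_D(1)[OF HU_D(1)[OF that, unfolded fst_F]] .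
  have "(\<lambda>z\<in>fst (H (F M)). eH M z) \<in> FG.MH (H (F M)) M"
  proof (rule G_homI[OF H_MO[OF F_MO[OF M]] M]; unfold fst_H)
    fix u w c i a s assume u: "u \<in> HU (F M)"
    have uf: "sp s u \<in> FU M" for s using HU_D(1)[OF u] by simp
    show "eH M u \<in> fst M" by (rule eH_pG(1)[OF M u])
    show "eH M (u + w) = eH M u + eH M w" if w: "w \<in> HU (F M)"
      by (simp add: eH_def sp_lin lin_on_add[OF PG_lin[OF R] d[OF u] d[OF w]])
    show "eH M (scale c u) = scale c (eH M u)"
      by (simp add: eH_def sp_lin lin_on_scale[OF PG_lin[OF R] d[OF u]] kvs.scale_right_distrib kvs.scale_right_diff_distrib)
    show "eH M (G.me (H (F M)) (sv i s) u) = G.me M (sv i s) (eH M u)" if i: "i \<in> verts Q"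
    proof -
      have "Fe M i (sp s u) \<in> FU M" using lin_on_mem[OF Fe_lin[OF R i] uf] .
      then show ?thesis
        unfolding H_me[OF R' u i] F_me[OF R uf] using eH_io[OF M] e_pG[OF R i eH_pG(1)[OF M u], of s s] eH_pG(2)[OF M u, of s] by simp
    qed
    show "eH M (G.mt (H (F M)) (a, s) u) = G.mt M (a, s) (eH M u)" if a: "a \<in> arcs Q"
    proof -
      have "Ft M (Inl a) (sp s u) \<in> FU M" using lin_on_mem[OF Ft_lin1[OF R a] uf] .
      then show ?thesis
        unfolding H_mt[OF R' u a] F_mt(1)[OF R uf a] using eH_io[OF M] t_pG[OF R a eH_pG(1)[OF M u], of s] eH_pG(2)[OF M u, of s] by simp
    qed
  qed
  then show ?thesis by simp
qed

text \<open>Existence: a vector of F X is the sum of the two placements of its coordinates.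
  Uniqueness: evaluating the condition at a placement isolates one coordinate of the
  transpose.\<close>

lemma F_couniversal:
  assumes N: "N \<in> FB.MO" and X: "X \<in> FG.MO" and g: "g \<in> FB.MH (F X) N"
  shows "\<exists>!g'. g' \<in> FG.MH X (H N) \<and> (\<forall>u\<in>fst (F X). g u = (\<lambda>z\<in>FU (H N). eF z) (Fm X (H N) g' u))"
proof (rule ex1I)
  note R = MO_right(2)[OF X] and R' = MO_right(1)[OF N]
  let ?g = "\<lambda>m\<in>fst X. sg (\<lambda>s. g (ks X s m))"
  have k: "ks X s m \<in> fst (F X)" if "m \<in> fst X" for s m using ks_mem[OF R that] by simp
  have e: "(\<lambda>z\<in>FU (H N). eF z) (Fm X (H N) h u) = eF (dbl h u)" if "h \<in> FG.MH X (H N)" "u \<in> FU X" for h u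
    using FB.MH_mem[OF Fm_MH[OF X H_MO[OF N] that(1)], of u] that(2) by (simp add: Fm_def)
  have t: "?g \<in> FG.MH X (H N)" by (rule F_transpose[OF X N g])
  show "?g \<in> FG.MH X (H N) \<and> (\<forall>u\<in>fst (F X). g u = (\<lambda>z\<in>FU (H N). eF z) (Fm X (H N) ?g u))"
  proof (intro conjI ballI t)
    fix u assume "u \<in> fst (F X)"
    then have u: "u \<in> FU X" by simp
    have "eF (dbl ?g u) = g (ks X Plus (sp Plus u)) + g (ks X Minus (sp Minus u))"
      by (simp add: eF_def FU_D(1)[OF u])
    also have "\<dots> = g u" using FB.MH_lin(1)[OF g k k] FU_D(1)[OF u] ks_sum[OF R u] by metis
    finally show "g u = (\<lambda>z\<in>FU (H N). eF z) (Fm X (H N) ?g u)" using e[OF t u] by simp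
  qed
  fix h assume h: "h \<in> FG.MH X (H N) \<and> (\<forall>u\<in>fst (F X). g u = (\<lambda>z\<in>FU (H N). eF z) (Fm X (H N) h u))"
  then have h': "h \<in> FG.MH X (H N)" by blast
  show "h = ?g"
  proof (rule FG.MH_eqI[OF h' t])
    fix m assume m: "m \<in> fst X"
    have hm: "h m \<in> HU N" using FG.MH_mem[OF h' m] by simp
    show "h m = ?g m"
    proof (rule sg_eqI)
      fix s
      have "g (ks X s m) = eF (dbl h (ks X s m))" using h k[OF m] e[OF h' ks_mem[OF R m]] by simp
      \<comment> \<open>The other coordinate of the placement is zero, so the diagonal sum has one
        summand.\<close>
      also have "\<dots> = sp s (h (pG X s m))"
        by (cases s) (simp_all add: eF_def sp_ks MH_zero(1)[OF h' X] sp_lin)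
      also have "\<dots> = sp s (h m)" using hom_pG(1)[OF h' X m] pG_H[OF R' hm] by simp
      finally show "sp s (h m) = sp s (?g m)" using m by simp
    qed
  qed
qed

text \<open>Existence is tested on sign projections, where the counit returns diagonal coordinates.
  Uniqueness evaluates the condition at \<open>io Y s n\<close> and applies
  \<open>eH_io\<close>.\<close>

lemma H_couniversal:
  assumes M: "M \<in> FG.MO" and Y: "Y \<in> FB.MO" and g: "g \<in> FG.MH (H Y) M"
  shows "\<exists>!g'. g' \<in> FB.MH Y (F M) \<and> (\<forall>u\<in>fst (H Y). g u = (\<lambda>w\<in>HU (F M). eH M w) (Hm Y (F M) g' u))"
proof (rule ex1I)
  note R = MO_right(1)[OF Y] and R' = MO_right(2)[OF M]
  let ?g = "\<lambda>n\<in>fst Y. sg (\<lambda>s. g (io Y s n))"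
  have k: "io Y s n \<in> fst (H Y)" if "n \<in> fst Y" for s n using io_mem[OF R that] by simp
  have m: "dbl h u \<in> HU (F M)" if "h \<in> FB.MH Y (F M)" "u \<in> HU Y" for h u
    using FG.MH_mem[OF Hm_MH[OF Y F_MO[OF M] that(1)], of u] that(2) by (simp add: Hm_def)
  have e: "(\<lambda>w\<in>HU (F M). eH M w) (Hm Y (F M) h u) = eH M (dbl h u)" if "h \<in> FB.MH Y (F M)" "u \<in> HU Y" for h u
    using m[OF that] that(2) by (simp add: Hm_def)
  have t: "?g \<in> FB.MH Y (F M)" by (rule H_transpose[OF Y M g])
  show "?g \<in> FB.MH Y (F M) \<and> (\<forall>u\<in>fst (H Y). g u = (\<lambda>w\<in>HU (F M). eH M w) (Hm Y (F M) ?g u))"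
  proof (intro conjI ballI t)
    fix u assume u0: "u \<in> fst (H Y)"
    then have u: "u \<in> HU Y" by simp
    have "eH M (dbl ?g u) = g u"
    proof (rule pG_ext[OF R' eH_pG(1)[OF M m[OF t u]] FG.MH_mem[OF g u0]])
      fix s
      show "pG M s (eH M (dbl ?g u)) = pG M s (g u)"
        unfolding eH_pG(2)[OF M m[OF t u]] using hom_pG(1)[OF g H_MO[OF Y] u0, of s] pG_H[OF R u] HU_D(1)[OF u] by simp
    qed
    then show "g u = (\<lambda>w\<in>HU (F M). eH M w) (Hm Y (F M) ?g u)" using e[OF t u] by simp
  qed
  fix h assume h: "h \<in> FB.MH Y (F M) \<and> (\<forall>u\<in>fst (H Y). g u = (\<lambda>w\<in>HU (F M). eH M w) (Hm Y (F M) h u))"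
  then have h': "h \<in> FB.MH Y (F M)" by blast
  show "h = ?g"
  proof (rule FB.MH_eqI[OF h' t])
    fix n assume n: "n \<in> fst Y"
    have hn: "h n \<in> FU M" using FB.MH_mem[OF h' n] by simp
    show "h n = ?g n"
    proof (rule sg_eqI)
      fix s
      have "g (io Y s n) = eH M (dbl h (io Y s n))" using h k[OF n] e[OF h' io_mem[OF R n]] by simp
      also have "\<dots> = sp s (h n)" using dbl_io[OF h' Y n] eH_io[OF M hn] by simp
      finally show "sp s (h n) = sp s (?g n)" using n by simp
    qed
  qed
qed

text \<open>With the transpose of the identity of H N as inclusion, the counit returns u + u, one
  copy for each sign; halving it gives the retraction.\<close>

lemma F_summand:
  assumes N: "N \<in> FB.MO" shows "\<exists>M\<in>FG.MO. \<exists>i\<in>FB.MH N (F M). \<exists>p\<in>FB.MH (F M) N. \<forall>u\<in>fst N. p (i u) = u"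
proof (intro bexI ballI)
  note R = MO_right(1)[OF N] and HN = H_MO[OF N]
  let ?i = "\<lambda>n\<in>fst N. sg (\<lambda>s. Id (mod_cat G.QA) (H N) (io N s n))"
  show i: "?i \<in> FB.MH N (F (H N))" by (rule H_transpose[OF N HN FG.MH_id[OF HN]])
  show "(\<lambda>z\<in>fst (F (H N)). scale (1/2) ((\<lambda>z\<in>FU (H N). eF z) z)) \<in> FB.MH (F (H N)) N"
    by (rule FB.MH_scale[OF eF_hom[OF N] F_MO[OF HN] N])
  fix u assume u: "u \<in> fst N"
  have "?i u \<in> FU (H N)" using FB.MH_mem[OF i u] by simp
  moreover have "eF (?i u) = u + u" using u io_mem[OF R u] by (simp add: eF_def)
  ultimately show "(\<lambda>z\<in>fst (F (H N)). scale (1/2) ((\<lambda>z\<in>FU (H N). eF z) z)) (?i u) = u" using half_double[OF two] by simp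
qed (rule H_MO[OF N])

text \<open>The transpose of the identity of F M followed by the counit is the identity already,
  since glueing counts the special part once.\<close>

lemma H_summand:
  assumes M: "M \<in> FG.MO" shows "\<exists>N\<in>FB.MO. \<exists>i\<in>FG.MH M (H N). \<exists>p\<in>FG.MH (H N) M. \<forall>u\<in>fst M. p (i u) = u"
proof (intro bexI ballI)
  note R = MO_right(2)[OF M] and FM = F_MO[OF M]
  let ?i = "\<lambda>m\<in>fst M. sg (\<lambda>s. Id (mod_cat B.QA) (F M) (ks M s m))"
  show i: "?i \<in> FG.MH M (H (F M))" by (rule F_transpose[OF M FM FB.MH_id[OF FM]])
  show "(\<lambda>w\<in>HU (F M). eH M w) \<in> FG.MH (H (F M)) M" by (rule eH_hom[OF M])
  fix u assume u: "u \<in> fst M"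
  have iu: "?i u \<in> HU (F M)" using FG.MH_mem[OF i u] by simp
  have "eH M (?i u) = u"
  proof (rule pG_ext[OF R eH_pG(1)[OF M iu] u])
    show "pG M s (eH M (?i u)) = pG M s u" for s
      unfolding eH_pG(2)[OF M iu] using u ks_mem[OF R u] by (simp add: sp_ks)
  qed
  then show "(\<lambda>w\<in>HU (F M). eH M w) (?i u) = u" using iu by simp
qed (rule F_MO[OF M])

section \<open>Both functors satisfy the axioms of a module functor\<close>

lemma module_functor_F: "module_functor G.QA B.QA F Fm"
proof (intro module_functor.intro module_functor_axioms.intro fd_G fd_B F_MO Fm_MH)
  fix M L N W f g c and u :: "'k vec"
  show "Fm M M (Id (mod_cat G.QA) M) u = u" if u: "u \<in> fst (F M)"
    unfolding Fm_def using u by (auto intro: sg_eqI simp: FU_D)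
  show "Fm L N (FG.mc L M N g f) u = Fm M N g (Fm L M f u)"
    if "L \<in> FG.MO" "M \<in> FG.MO" "f \<in> FG.MH L M" and u: "u \<in> fst (F L)"
  proof -
    have "dbl f u \<in> FU M" using FB.MH_mem[OF Fm_MH[OF that(1,2,3)] u] u by (simp add: Fm_def)
    moreover have "dbl (FG.mc L M N g f) u = dbl g (dbl f u)" by (rule sg_eqI) (use u in \<open>simp add: FU_D\<close>)
    ultimately show ?thesis using u by (simp add: Fm_def)
  qed
  show "Fm M N (\<lambda>u\<in>fst M. f u + g u) u = Fm M N f u + Fm M N g u" if u: "u \<in> fst (F M)"
  proof -
    have "dbl (\<lambda>u\<in>fst M. f u + g u) u = dbl f u + dbl g u" by (rule sg_eqI) (use u in \<open>simp add: FU_D sp_lin\<close>)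
    then show ?thesis using u by (simp add: Fm_def)
  qed
  show "Fm M N (\<lambda>u\<in>fst M. scale c (f u)) u = scale c (Fm M N f u)" if u: "u \<in> fst (F M)"
  proof -
    have "dbl (\<lambda>u\<in>fst M. scale c (f u)) u = scale c (dbl f u)" by (rule sg_eqI) (use u in \<open>simp add: FU_D sp_lin\<close>)
    then show ?thesis using u by (simp add: Fm_def)
  qed
  show "\<exists>H\<in>FG.MO. \<exists>e\<in>FB.MH (F H) W. \<forall>X\<in>FG.MO. \<forall>g\<in>FB.MH (F X) W.
      \<exists>!g'. g' \<in> FG.MH X H \<and> (\<forall>u\<in>fst (F X). g u = e (Fm X H g' u))" if W: "W \<in> FB.MO"
    by (rule bexI[OF _ H_MO[OF W]], rule bexI[OF _ eF_hom[OF W]]) (intro ballI F_couniversal[OF W])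
  show "\<exists>M\<in>FG.MO. \<exists>i\<in>FB.MH W (F M). \<exists>p\<in>FB.MH (F M) W. \<forall>u\<in>fst W. p (i u) = u" if W: "W \<in> FB.MO"
    by (rule F_summand[OF W])
qed

lemma module_functor_H: "module_functor B.QA G.QA H Hm"
proof (intro module_functor.intro module_functor_axioms.intro fd_G fd_B H_MO Hm_MH)
  fix M L N W f g c and u :: "'k vec"
  show "Hm M M (Id (mod_cat B.QA) M) u = u" if u: "u \<in> fst (H M)"
    unfolding Hm_def using u by (auto intro: sg_eqI simp: HU_D)
  show "Hm L N (FB.mc L M N g f) u = Hm M N g (Hm L M f u)"
    if "L \<in> FB.MO" "M \<in> FB.MO" "f \<in> FB.MH L M" and u: "u \<in> fst (H L)"
  proof -
    have "dbl f u \<in> HU M" using FG.MH_mem[OF Hm_MH[OF that(1,2,3)] u] u by (simp add: Hm_def)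
    moreover have "dbl (FB.mc L M N g f) u = dbl g (dbl f u)" by (rule sg_eqI) (use u in \<open>simp add: HU_D\<close>)
    ultimately show ?thesis using u by (simp add: Hm_def)
  qed
  show "Hm M N (\<lambda>u\<in>fst M. f u + g u) u = Hm M N f u + Hm M N g u" if u: "u \<in> fst (H M)"
  proof -
    have "dbl (\<lambda>u\<in>fst M. f u + g u) u = dbl f u + dbl g u" by (rule sg_eqI) (use u in \<open>simp add: HU_D sp_lin\<close>)
    then show ?thesis using u by (simp add: Hm_def)
  qed
  show "Hm M N (\<lambda>u\<in>fst M. scale c (f u)) u = scale c (Hm M N f u)" if u: "u \<in> fst (H M)"
  proof -
    have "dbl (\<lambda>u\<in>fst M. scale c (f u)) u = scale c (dbl f u)" by (rule sg_eqI) (use u in \<open>simp add: HU_D sp_lin\<close>)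
    then show ?thesis using u by (simp add: Hm_def)
  qed
  show "\<exists>F\<in>FB.MO. \<exists>e\<in>FG.MH (H F) W. \<forall>X\<in>FB.MO. \<forall>g\<in>FG.MH (H X) W.
      \<exists>!g'. g' \<in> FB.MH X F \<and> (\<forall>u\<in>fst (H X). g u = e (Hm X F g' u))" if W: "W \<in> FG.MO"
    by (rule bexI[OF _ F_MO[OF W]], rule bexI[OF _ eH_hom[OF W]]) (intro ballI H_couniversal[OF W])
  show "\<exists>N\<in>FB.MO. \<exists>i\<in>FG.MH W (H N). \<exists>p\<in>FG.MH (H N) W. \<forall>u\<in>fst W. p (i u) = u" if W: "W \<in> FG.MO"
    by (rule H_summand[OF W])
qed

end

theorem corollary5p4:
  fixes Q :: "('v, 'a) pre_digraph" and I :: "('a \<times> 'a) set" and Sp :: "'v set"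
  assumes "CHAR('k::alg_closed_field) \<noteq> 2"
    and "skew_gentle_triple TYPE('k) Q I Sp"
  shows "(KG (skew_gentle_algebra Q I Sp :: ('k, ('v \<times> ('a + 'v) list \<Rightarrow>\<^sub>0 'k) set) module)
            :: 'w ordinal extended) =
         KG (associated_gentle_algebra Q I Sp ::
              ('k, ('v signed_vertex \<times> ('a \<times> sign) list \<Rightarrow>\<^sub>0 'k) set) module)"
proof -
  have "(2::'k) \<noteq> 0"
  proof
    assume "(2::'k) = 0"
    then have "CHAR('k) dvd 2" using of_nat_eq_0_iff_char_dvd[of 2, where 'a = 'k] by simp
    \<comment> \<open>A divisor of 2 other than 2 would be 1, which is not the characteristic of a
      field.\<close>
    then have "CHAR('k) \<le> 2" "CHAR('k) \<noteq> 0" by (auto dest: dvd_imp_le intro: Nat.gr0I)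
    then show False using assms(1) CHAR_not_1[where 'a = 'k] by linarith
  qed
  then interpret skew_gentle Q I Sp "TYPE('k)" by unfold_locales (rule assms(2))
  show ?thesis unfolding algebras by (rule KG_eqI[OF module_functor_H module_functor_F])
qed

end
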